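(* Let $K$ be a field of characteristic $0$ and let $A=KQ/I$, where $Q$ is the quiver with vertices $1,\dots,9$ and arrows $$a:1\to 3,\quad b:2\to 3,\quad c:2\to 4,\quad d:3\to 5,\quad e:3\to 7,\quad f:4\to 5,\quad g:5\to 6,\quad h:5\to 9,\quad i:6\to 8,\quad j:7\to 8,$$ and $I=\langle adg,\ fh,\ ae,\ bd-cf,\ ej-dgi\rangle$. Then $A$ is diagonal Auslander regular, but the opposite algebra $A^{\mathrm{op}}$ is not diagonal Auslander regular.
   Context: Paths are composed from left to right (so $adg$ is the path $1\to3\to5\to6$), and modules are finitely generated right modules. A finite dimensional algebra $B$ with minimal injective coresolution $0\to B_B\to I^0\to I^1\to\cdots$ of the right regular module is called diagonal Auslander regular if $\operatorname{gldim} B<\infty$ and, for all $i\ge 0$, every indecomposable direct summand $X$ of $I^i$ has projective dimension exactly $i$. *)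

theory Defs
  imports
    "HOL-Algebra.Embedded_Algebras"
    "HOL-Algebra.QuotRing"
    "HOL-Library.Extended_Nat"
    "Graph_Theory.Arc_Walk"
begin

(* clashes with the function space arrow of HOL-Library.FuncSet *)
no_notation dominates (\<open>_ \<rightarrow>\<index> _\<close> [100,100] 40)

section \<open>Right modules over a ring\<close>

text \<open>
  The record type of HOL-Algebra modules is reused for right modules over a ring that need not be
  commutative: \<open>r \<odot>\<^bsub>M\<^esub> x\<close> stands for the right action \<open>x \<cdot> r\<close>, whence the order of the factors in
  \<open>r_smult_assoc\<close>.
\<close>

locale right_module = R?: ring R + M?: abelian_group M
  for R :: "('a, 'r) ring_scheme" (structure) and M :: "('a, 'm) module" (structure) +
  assumes r_smult_closed: "\<lbrakk>r \<in> carrier R; x \<in> carrier M\<rbrakk> \<Longrightarrow> r \<odot>\<^bsub>M\<^esub> x \<in> carrier M"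
    and r_smult_ring_distr: "\<lbrakk>r \<in> carrier R; s \<in> carrier R; x \<in> carrier M\<rbrakk> \<Longrightarrow>
      (r \<oplus>\<^bsub>R\<^esub> s) \<odot>\<^bsub>M\<^esub> x = r \<odot>\<^bsub>M\<^esub> x \<oplus>\<^bsub>M\<^esub> s \<odot>\<^bsub>M\<^esub> x"
    and r_smult_module_distr: "\<lbrakk>r \<in> carrier R; x \<in> carrier M; y \<in> carrier M\<rbrakk> \<Longrightarrow>
      r \<odot>\<^bsub>M\<^esub> (x \<oplus>\<^bsub>M\<^esub> y) = r \<odot>\<^bsub>M\<^esub> x \<oplus>\<^bsub>M\<^esub> r \<odot>\<^bsub>M\<^esub> y"
    and r_smult_assoc: "\<lbrakk>r \<in> carrier R; s \<in> carrier R; x \<in> carrier M\<rbrakk> \<Longrightarrow>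
      (r \<otimes>\<^bsub>R\<^esub> s) \<odot>\<^bsub>M\<^esub> x = s \<odot>\<^bsub>M\<^esub> (r \<odot>\<^bsub>M\<^esub> x)"
    and r_smult_one: "x \<in> carrier M \<Longrightarrow> \<one>\<^bsub>R\<^esub> \<odot>\<^bsub>M\<^esub> x = x"

text \<open>
  The library's \<^locale>\<open>submodule\<close> imposes only closure conditions and does not depend on the side of
  the action.
\<close>

definition fg_right_module :: "('a, 'r) ring_scheme \<Rightarrow> ('a, 'm) module \<Rightarrow> bool" where
  "fg_right_module R M \<longleftrightarrow> right_module R M \<and>
     (\<exists>S. finite S \<and> S \<subseteq> carrier M \<and> (\<forall>N. submodule N R M \<and> S \<subseteq> N \<longrightarrow> N = carrier M))"

definition rmod_hom ::
  "('a, 'r) ring_scheme \<Rightarrow> ('a, 'm) module \<Rightarrow> ('a, 'n) module \<Rightarrow> ('m \<Rightarrow> 'n) set" where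
  "rmod_hom R M N = {f \<in> carrier M \<rightarrow> carrier N.
     (\<forall>x\<in>carrier M. \<forall>y\<in>carrier M. f (x \<oplus>\<^bsub>M\<^esub> y) = f x \<oplus>\<^bsub>N\<^esub> f y) \<and>
     (\<forall>r\<in>carrier R. \<forall>x\<in>carrier M. f (r \<odot>\<^bsub>M\<^esub> x) = r \<odot>\<^bsub>N\<^esub> f x)}"

definition rmod_ker :: "('a, 'm) module \<Rightarrow> ('a, 'n) module \<Rightarrow> ('m \<Rightarrow> 'n) \<Rightarrow> 'm set" where
  "rmod_ker M N f = {x \<in> carrier M. f x = \<zero>\<^bsub>N\<^esub>}"

definition regular_right_module :: "('a, 'r) ring_scheme \<Rightarrow> ('a, 'a) module" where
  "regular_right_module R =
     \<lparr>carrier = carrier R, monoid.mult = monoid.mult R, monoid.one = monoid.one R,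
      ring.zero = ring.zero R, ring.add = ring.add R,
      smult = (\<lambda>r x. x \<otimes>\<^bsub>R\<^esub> r)\<rparr>"

definition opposite_ring :: "('a, 'r) ring_scheme \<Rightarrow> ('a, 'r) ring_scheme" where
  "opposite_ring R = R\<lparr>monoid.mult := (\<lambda>x y. y \<otimes>\<^bsub>R\<^esub> x)\<rparr>"


text \<open>
  A statement about all finitely generated right modules has to fix a type for their elements.
  Subsets of \<open>nat \<Rightarrow> 'a\<close> suffice, as a finitely generated module is a quotient of some \<open>R\<^sup>n\<close>, whose
  elements are cosets of tuples; see \<open>fg_right_module_isomorphic_copy\<close> below.
\<close>

type_synonym 'a rmod = "('a, (nat \<Rightarrow> 'a) set) module"

definition transport :: "('m \<Rightarrow> 'n) \<Rightarrow> ('a, 'm) module \<Rightarrow> ('a, 'n) module" where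
  "transport f M = (let g = inv_into (carrier M) f in
     \<lparr>carrier = f ` carrier M, monoid.mult = (\<lambda>x y. x), monoid.one = f \<zero>\<^bsub>M\<^esub>, ring.zero = f \<zero>\<^bsub>M\<^esub>,
      ring.add = (\<lambda>x y. f (g x \<oplus>\<^bsub>M\<^esub> g y)), smult = (\<lambda>r x. f (r \<odot>\<^bsub>M\<^esub> g x))\<rparr>)"

lemma transport_simps:
  "carrier (transport f M) = f ` carrier M" "\<zero>\<^bsub>transport f M\<^esub> = f \<zero>\<^bsub>M\<^esub>"
  by (simp_all add: transport_def Let_def)

lemma transport_add:
  assumes "inj_on f (carrier M)" "x \<in> carrier M" "y \<in> carrier M"
  shows "f x \<oplus>\<^bsub>transport f M\<^esub> f y = f (x \<oplus>\<^bsub>M\<^esub> y)"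
  using assms by (simp add: transport_def Let_def)

lemma transport_smult:
  assumes "inj_on f (carrier M)" "x \<in> carrier M"
  shows "r \<odot>\<^bsub>transport f M\<^esub> f x = f (r \<odot>\<^bsub>M\<^esub> x)"
  using assms by (simp add: transport_def Let_def)

lemma transport_right_module:
  assumes "right_module R M" and inj: "inj_on f (carrier M)"
  shows "right_module R (transport f M)"
proof -
  interpret right_module R M by fact
  have ag: "abelian_group (transport f M)"
  proof (rule abelian_groupI)
    fix x assume "x \<in> carrier (transport f M)"
    then obtain u where "u \<in> carrier M" "x = f u" by (auto simp: transport_simps)
    then show "\<exists>y\<in>carrier (transport f M). y \<oplus>\<^bsub>transport f M\<^esub> x = \<zero>\<^bsub>transport f M\<^esub>"
      by (intro bexI[of _ "f (\<ominus>\<^bsub>M\<^esub> u)"])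
        (auto simp: transport_simps transport_add[OF inj] M.l_neg)
  qed (auto simp: transport_simps transport_add[OF inj] M.a_ac)
  show ?thesis
    using ag R.ring_axioms
    by (intro right_module.intro right_module_axioms.intro)
      (auto simp: transport_simps transport_add[OF inj] transport_smult[OF inj] r_smult_closed
        r_smult_ring_distr r_smult_module_distr r_smult_assoc r_smult_one)
qed

lemma transport_hom:
  assumes "inj_on f (carrier M)"
  shows "f \<in> rmod_hom R M (transport f M)"
  using assms by (auto simp: rmod_hom_def transport_simps transport_add transport_smult)

lemma submoduleI':
  assumes "right_module R M" "L \<subseteq> carrier M" "\<zero>\<^bsub>M\<^esub> \<in> L"
    "\<And>x y. x \<in> L \<Longrightarrow> y \<in> L \<Longrightarrow> x \<oplus>\<^bsub>M\<^esub> y \<in> L"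
    "\<And>r x. r \<in> carrier R \<Longrightarrow> x \<in> L \<Longrightarrow> r \<odot>\<^bsub>M\<^esub> x \<in> L"
  shows "submodule L R M"
proof -
  interpret right_module R M by fact
  have neg: "\<ominus>\<^bsub>M\<^esub> x \<in> L" if "x \<in> L" for x
  proof -
    have x: "x \<in> carrier M" using that assms by auto
    have z: "\<zero>\<^bsub>R\<^esub> \<odot>\<^bsub>M\<^esub> x = \<zero>\<^bsub>M\<^esub>"
      using r_smult_ring_distr[of "\<zero>\<^bsub>R\<^esub>" "\<zero>\<^bsub>R\<^esub>" x] x r_smult_closed[of "\<zero>\<^bsub>R\<^esub>" x]
      by (metis M.add.l_cancel_one' R.l_zero R.zero_closed)
    have "(\<ominus>\<^bsub>R\<^esub> \<one>\<^bsub>R\<^esub>) \<odot>\<^bsub>M\<^esub> x \<oplus>\<^bsub>M\<^esub> x = \<zero>\<^bsub>M\<^esub>"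
      using r_smult_ring_distr[of "\<ominus>\<^bsub>R\<^esub> \<one>\<^bsub>R\<^esub>" "\<one>\<^bsub>R\<^esub>" x] x z by (simp add: r_smult_one R.l_neg)
    hence "\<ominus>\<^bsub>M\<^esub> x = (\<ominus>\<^bsub>R\<^esub> \<one>\<^bsub>R\<^esub>) \<odot>\<^bsub>M\<^esub> x"
      by (metis M.minus_equality R.a_inv_closed R.one_closed r_smult_closed x)
    then show ?thesis using assms(5) that by simp
  qed
  show ?thesis
    by (intro submodule.intro submodule_axioms.intro M.add.subgroupI)
      (use assms neg in \<open>auto simp: a_inv_def[symmetric]\<close>)
qed

lemma submoduleD':
  assumes "submodule L R M"
  shows "L \<subseteq> carrier M" "\<zero>\<^bsub>M\<^esub> \<in> L"
    "\<And>x y. x \<in> L \<Longrightarrow> y \<in> L \<Longrightarrow> x \<oplus>\<^bsub>M\<^esub> y \<in> L"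
    "\<And>r x. r \<in> carrier R \<Longrightarrow> x \<in> L \<Longrightarrow> r \<odot>\<^bsub>M\<^esub> x \<in> L"
  using assms by (auto simp: submodule_def submodule_axioms_def subgroup_def)

lemma fg_right_module_transport:
  assumes fg: "fg_right_module R M" and inj: "inj_on f (carrier M)"
  shows "fg_right_module R (transport f M)"
proof -
  from fg have M: "right_module R M" by (simp add: fg_right_module_def)
  interpret right_module R M by fact
  obtain S where S: "finite S" "S \<subseteq> carrier M"
    and gen: "\<And>N. submodule N R M \<Longrightarrow> S \<subseteq> N \<Longrightarrow> N = carrier M"
    using fg by (auto simp: fg_right_module_def)
  have "L = carrier (transport f M)" if L: "submodule L R (transport f M)" "f ` S \<subseteq> L" for L
  proof -
    note D = submoduleD'[OF L(1), unfolded transport_simps]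
    have "submodule {x \<in> carrier M. f x \<in> L} R M"
      using D by (intro submoduleI' M)
        (auto simp: r_smult_closed transport_add[OF inj, symmetric] transport_smult[OF inj, symmetric])
    with gen L(2) S(2) have "{x \<in> carrier M. f x \<in> L} = carrier M" by blast
    with D(1) show ?thesis by (auto simp: transport_simps)
  qed
  with S transport_right_module[OF M inj] show ?thesis
    unfolding fg_right_module_def
    by (intro conjI exI[of _ "f ` S"]) (auto simp: transport_simps)
qed

lemma fg_right_module_inj:
  fixes R :: "('a, 'r) ring_scheme" and M :: "('a, 'm) module"
  assumes fg: "fg_right_module R M"
  shows "\<exists>f :: 'm \<Rightarrow> (nat \<Rightarrow> 'a) set. inj_on f (carrier M)"
proof -
  from fg have M: "right_module R M" by (simp add: fg_right_module_def)
  interpret right_module R M by fact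
  obtain S where S: "finite S" "S \<subseteq> carrier M"
    and gen: "\<And>N. submodule N R M \<Longrightarrow> S \<subseteq> N \<Longrightarrow> N = carrier M"
    using fg by (auto simp: fg_right_module_def)
  obtain h where h: "bij_betw h S {0..<card S}" using S(1) ex_bij_betw_finite_nat by blast
  hence hinj: "inj_on h S" by (simp add: bij_betw_def)
  define comb where "comb c = (\<Oplus>\<^bsub>M\<^esub>s\<in>S. c (h s) \<odot>\<^bsub>M\<^esub> s)" for c :: "nat \<Rightarrow> 'a"
  define C where "C = (UNIV :: nat set) \<rightarrow> carrier R"
  have cl: "c (h s) \<odot>\<^bsub>M\<^esub> s \<in> carrier M" if "c \<in> C" "s \<in> S" for c s
    using that S(2) by (auto simp: C_def intro!: r_smult_closed)
  have zl: "\<zero>\<^bsub>R\<^esub> \<odot>\<^bsub>M\<^esub> x = \<zero>\<^bsub>M\<^esub>" if x: "x \<in> carrier M" for x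
    using r_smult_ring_distr[of "\<zero>\<^bsub>R\<^esub>" "\<zero>\<^bsub>R\<^esub>" x] x r_smult_closed[of "\<zero>\<^bsub>R\<^esub>" x]
    by (metis M.add.l_cancel_one' R.l_zero R.zero_closed)
  have zr: "r \<odot>\<^bsub>M\<^esub> \<zero>\<^bsub>M\<^esub> = \<zero>\<^bsub>M\<^esub>" if r: "r \<in> carrier R" for r
    using r_smult_module_distr[of r "\<zero>\<^bsub>M\<^esub>" "\<zero>\<^bsub>M\<^esub>"] r r_smult_closed[of r "\<zero>\<^bsub>M\<^esub>"]
    by (metis M.add.l_cancel_one' M.l_zero M.zero_closed)
  have smsum: "r \<odot>\<^bsub>M\<^esub> (\<Oplus>\<^bsub>M\<^esub>s\<in>T. g s) = (\<Oplus>\<^bsub>M\<^esub>s\<in>T. r \<odot>\<^bsub>M\<^esub> g s)"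
    if "finite T" "g \<in> T \<rightarrow> carrier M" "r \<in> carrier R" for r T and g :: "'m \<Rightarrow> 'm"
    using that
  proof (induction T)
    case (insert s T)
    then have "g \<in> T \<rightarrow> carrier M" "(\<lambda>s. r \<odot>\<^bsub>M\<^esub> g s) \<in> T \<rightarrow> carrier M" by (auto intro: r_smult_closed)
    with insert show ?case by (simp add: r_smult_module_distr r_smult_closed)
  qed (simp add: zr)
  have sub: "submodule (comb ` C) R M"
  proof (rule submoduleI'[OF M])
    show "comb ` C \<subseteq> carrier M" unfolding comb_def using cl by (auto intro!: M.finsum_closed)
    have "comb (\<lambda>_. \<zero>\<^bsub>R\<^esub>) = (\<Oplus>\<^bsub>M\<^esub>s\<in>S. \<zero>\<^bsub>M\<^esub>)" unfolding comb_def
      by (rule M.finsum_cong') (use S zl in auto)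
    then have "comb (\<lambda>_. \<zero>\<^bsub>R\<^esub>) = \<zero>\<^bsub>M\<^esub>" by simp
    then show "\<zero>\<^bsub>M\<^esub> \<in> comb ` C" unfolding C_def by (metis Pi_I R.zero_closed imageI)
  next
    fix x y assume "x \<in> comb ` C" "y \<in> comb ` C"
    then obtain c d where c: "c \<in> C" "x = comb c" "d \<in> C" "y = comb d" by auto
    have "comb (\<lambda>n. c n \<oplus>\<^bsub>R\<^esub> d n) = (\<Oplus>\<^bsub>M\<^esub>s\<in>S. c (h s) \<odot>\<^bsub>M\<^esub> s \<oplus>\<^bsub>M\<^esub> d (h s) \<odot>\<^bsub>M\<^esub> s)"
      unfolding comb_def
      by (rule M.finsum_cong') (use c S(2) cl in \<open>auto simp: C_def subset_eq intro!: r_smult_ring_distr\<close>)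
    also have "\<dots> = x \<oplus>\<^bsub>M\<^esub> y" unfolding c comb_def
      by (rule M.finsum_addf) (use c cl in auto)
    finally have eq: "x \<oplus>\<^bsub>M\<^esub> y = comb (\<lambda>n. c n \<oplus>\<^bsub>R\<^esub> d n)" by (rule sym)
    show "x \<oplus>\<^bsub>M\<^esub> y \<in> comb ` C"
      unfolding eq by (rule imageI) (use c in \<open>auto simp: C_def\<close>)
  next
    fix r x assume r: "r \<in> carrier R" and "x \<in> comb ` C"
    then obtain c where c: "c \<in> C" "x = comb c" by auto
    have "comb (\<lambda>n. c n \<otimes>\<^bsub>R\<^esub> r) = (\<Oplus>\<^bsub>M\<^esub>s\<in>S. r \<odot>\<^bsub>M\<^esub> (c (h s) \<odot>\<^bsub>M\<^esub> s))"
      unfolding comb_def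
      by (rule M.finsum_cong')
        (use c S(2) cl r in \<open>auto simp: C_def subset_eq intro!: r_smult_assoc r_smult_closed\<close>)
    also have "\<dots> = r \<odot>\<^bsub>M\<^esub> x" unfolding c comb_def
      by (rule smsum[symmetric]) (use c cl r S in auto)
    finally have eq: "r \<odot>\<^bsub>M\<^esub> x = comb (\<lambda>n. c n \<otimes>\<^bsub>R\<^esub> r)" by (rule sym)
    show "r \<odot>\<^bsub>M\<^esub> x \<in> comb ` C"
      unfolding eq by (rule imageI) (use c r in \<open>auto simp: C_def\<close>)
  qed
  have "S \<subseteq> comb ` C"
  proof
    fix t assume t: "t \<in> S"
    let ?c = "\<lambda>n. if n = h t then \<one>\<^bsub>R\<^esub> else \<zero>\<^bsub>R\<^esub>"
    have "comb ?c = (\<Oplus>\<^bsub>M\<^esub>s\<in>S. if t = s then s else \<zero>\<^bsub>M\<^esub>)" unfolding comb_def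
      by (rule M.finsum_cong') (use S t zl hinj in \<open>auto simp: r_smult_one inj_on_def subset_eq\<close>)
    also have "\<dots> = t" using M.finsum_singleton[OF t S(1), of "\<lambda>s. s"] S(2) by auto
    finally have eq: "t = comb ?c" by (rule sym)
    show "t \<in> comb ` C"
      by (subst eq, rule imageI) (auto simp: C_def)
  qed
  with gen[OF sub] have onto: "comb ` C = carrier M" by simp
  have "inj_on (\<lambda>x. {c. comb c = x \<and> c \<in> C}) (carrier M)"
  proof (intro inj_onI)
    fix x y assume "x \<in> carrier M"
      and eq: "{c. comb c = x \<and> c \<in> C} = {c. comb c = y \<and> c \<in> C}"
    with onto obtain c where "c \<in> C" "comb c = x" by (metis imageE)
    then have "c \<in> {c. comb c = y \<and> c \<in> C}" unfolding eq[symmetric] by simp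
    with \<open>comb c = x\<close> show "x = y" by simp
  qed
  then show ?thesis by blast
qed

lemma fg_right_module_isomorphic_copy:
  fixes R :: "('a, 'r) ring_scheme" and M :: "('a, 'm) module"
  assumes "fg_right_module R M"
  shows "\<exists>(N :: 'a rmod) f. fg_right_module R N \<and> f \<in> rmod_hom R M N \<and>
    bij_betw f (carrier M) (carrier N)"
proof -
  obtain f :: "'m \<Rightarrow> (nat \<Rightarrow> 'a) set" where f: "inj_on f (carrier M)"
    using fg_right_module_inj[OF assms] by blast
  then show ?thesis
    using fg_right_module_transport[OF assms f] transport_hom[OF f, of R]
    by (intro exI[of _ "transport f M"] exI[of _ f]) (auto simp: bij_betw_def transport_simps)
qed


section \<open>Homological notions in the category of finitely generated right modules\<close>

definition projective_rmod :: "('a, 'r) ring_scheme \<Rightarrow> ('a, 'm) module \<Rightarrow> bool" where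
  "projective_rmod R P \<longleftrightarrow> fg_right_module R P \<and>
     (\<forall>(X :: 'a rmod) (Y :: 'a rmod) f g.
        fg_right_module R X \<and> fg_right_module R Y \<and>
        f \<in> rmod_hom R X Y \<and> f ` carrier X = carrier Y \<and> g \<in> rmod_hom R P Y \<longrightarrow>
        (\<exists>h\<in>rmod_hom R P X. \<forall>x\<in>carrier P. f (h x) = g x))"

definition injective_rmod :: "('a, 'r) ring_scheme \<Rightarrow> ('a, 'm) module \<Rightarrow> bool" where
  "injective_rmod R E \<longleftrightarrow> fg_right_module R E \<and>
     (\<forall>(X :: 'a rmod) (Y :: 'a rmod) f g.
        fg_right_module R X \<and> fg_right_module R Y \<and>
        f \<in> rmod_hom R X Y \<and> inj_on f (carrier X) \<and> g \<in> rmod_hom R X E \<longrightarrow>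
        (\<exists>h\<in>rmod_hom R Y E. \<forall>x\<in>carrier X. h (f x) = g x))"

text \<open>\<open>\<cdots> \<rightarrow> P 1 \<rightarrow> P 0 \<rightarrow> M \<rightarrow> 0\<close> with differentials \<open>d i : P (i + 1) \<rightarrow> P i\<close> and augmentation \<open>e\<close>.\<close>

definition projective_resolution ::
  "('a, 'r) ring_scheme \<Rightarrow> ('a, 'm) module \<Rightarrow> (nat \<Rightarrow> 'a rmod) \<Rightarrow>
   (nat \<Rightarrow> (nat \<Rightarrow> 'a) set \<Rightarrow> (nat \<Rightarrow> 'a) set) \<Rightarrow> ((nat \<Rightarrow> 'a) set \<Rightarrow> 'm) \<Rightarrow> bool" where
  "projective_resolution R M P d e \<longleftrightarrow>
     (\<forall>i. projective_rmod R (P i)) \<and>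
     e \<in> rmod_hom R (P 0) M \<and> (\<forall>i. d i \<in> rmod_hom R (P (Suc i)) (P i)) \<and>
     e ` carrier (P 0) = carrier M \<and>
     d 0 ` carrier (P 1) = rmod_ker (P 0) M e \<and>
     (\<forall>i. d (Suc i) ` carrier (P (Suc (Suc i))) = rmod_ker (P (Suc i)) (P i) (d i))"

text \<open>Note that \<open>Inf {} = \<infinity>\<close> in \<^typ>\<open>enat\<close>. The zero module gets projective dimension 0.\<close>

definition projdim :: "('a, 'r) ring_scheme \<Rightarrow> ('a, 'm) module \<Rightarrow> enat" where
  "projdim R M = Inf {enat n | n. \<exists>P d e. projective_resolution R M P d e \<and>
     (\<forall>i>n. carrier (P i) = {\<zero>\<^bsub>P i\<^esub>})}"

definition gldim :: "('a, 'r) ring_scheme \<Rightarrow> enat" where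
  "gldim R = Sup {projdim R M | M :: 'a rmod. fg_right_module R M}"

definition essential_in :: "('a, 'r) ring_scheme \<Rightarrow> ('a, 'm) module \<Rightarrow> 'm set \<Rightarrow> bool" where
  "essential_in R M N \<longleftrightarrow> submodule N R M \<and>
     (\<forall>L. submodule L R M \<and> L \<noteq> {\<zero>\<^bsub>M\<^esub>} \<longrightarrow> N \<inter> L \<noteq> {\<zero>\<^bsub>M\<^esub>})"

text \<open>
  \<open>0 \<rightarrow> M \<rightarrow> E 0 \<rightarrow> E 1 \<rightarrow> \<cdots>\<close> with coaugmentation \<open>u\<close> and differentials \<open>d i : E i \<rightarrow> E (i + 1)\<close>.
  Minimality says that each term is an injective envelope of the image of the map into it.
\<close>

definition minimal_injective_coresolution ::
  "('a, 'r) ring_scheme \<Rightarrow> ('a, 'm) module \<Rightarrow> (nat \<Rightarrow> 'a rmod) \<Rightarrow>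
   (nat \<Rightarrow> (nat \<Rightarrow> 'a) set \<Rightarrow> (nat \<Rightarrow> 'a) set) \<Rightarrow> ('m \<Rightarrow> (nat \<Rightarrow> 'a) set) \<Rightarrow> bool" where
  "minimal_injective_coresolution R M E d u \<longleftrightarrow>
     (\<forall>i. injective_rmod R (E i)) \<and>
     u \<in> rmod_hom R M (E 0) \<and> (\<forall>i. d i \<in> rmod_hom R (E i) (E (Suc i))) \<and>
     inj_on u (carrier M) \<and>
     u ` carrier M = rmod_ker (E 0) (E 1) (d 0) \<and>
     (\<forall>i. d i ` carrier (E i) = rmod_ker (E (Suc i)) (E (Suc (Suc i))) (d (Suc i))) \<and>
     essential_in R (E 0) (u ` carrier M) \<and>
     (\<forall>i. essential_in R (E (Suc i)) (d i ` carrier (E i)))"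

definition direct_decomposition ::
  "('a, 'r) ring_scheme \<Rightarrow> ('a, 'm) module \<Rightarrow> 'm set \<Rightarrow> 'm set \<Rightarrow> bool" where
  "direct_decomposition R M X Y \<longleftrightarrow> submodule X R M \<and> submodule Y R M \<and>
     X \<inter> Y = {\<zero>\<^bsub>M\<^esub>} \<and> X <+>\<^bsub>M\<^esub> Y = carrier M"

definition indecomposable :: "('a, 'r) ring_scheme \<Rightarrow> ('a, 'm) module \<Rightarrow> bool" where
  "indecomposable R M \<longleftrightarrow> carrier M \<noteq> {\<zero>\<^bsub>M\<^esub>} \<and>
     (\<forall>X Y. direct_decomposition R M X Y \<longrightarrow> X = {\<zero>\<^bsub>M\<^esub>} \<or> Y = {\<zero>\<^bsub>M\<^esub>})"

definition indecomposable_summand ::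
  "('a, 'r) ring_scheme \<Rightarrow> ('a, 'm) module \<Rightarrow> 'm set \<Rightarrow> bool" where
  "indecomposable_summand R M X \<longleftrightarrow>
     (\<exists>Y. direct_decomposition R M X Y) \<and> indecomposable R (M\<lparr>carrier := X\<rparr>)"


section \<open>Finite dimensional algebras and diagonal Auslander regularity\<close>

text \<open>A \<open>'k\<close>-algebra is a ring \<open>B\<close> with a ring homomorphism \<open>\<eta>\<close> from \<open>'k\<close> to the centre of \<open>B\<close>.\<close>

definition fd_algebra :: "('k::field \<Rightarrow> 'a) \<Rightarrow> ('a, 'r) ring_scheme \<Rightarrow> bool" where
  "fd_algebra \<eta> B \<longleftrightarrow> ring B \<and>
     range \<eta> \<subseteq> carrier B \<and> \<eta> 1 = \<one>\<^bsub>B\<^esub> \<and>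
     (\<forall>c d. \<eta> (c + d) = \<eta> c \<oplus>\<^bsub>B\<^esub> \<eta> d) \<and> (\<forall>c d. \<eta> (c * d) = \<eta> c \<otimes>\<^bsub>B\<^esub> \<eta> d) \<and>
     (\<forall>c. \<forall>x\<in>carrier B. \<eta> c \<otimes>\<^bsub>B\<^esub> x = x \<otimes>\<^bsub>B\<^esub> \<eta> c) \<and>
     ring.finite_dimension B (range \<eta>) (carrier B)"

text \<open>Minimal injective coresolutions are unique up to isomorphism, so it does not matter which one
  is chosen.\<close>

definition diagonal_Auslander_regular :: "('k::field \<Rightarrow> 'a) \<Rightarrow> ('a, 'r) ring_scheme \<Rightarrow> bool" where
  "diagonal_Auslander_regular \<eta> B \<longleftrightarrow> fd_algebra \<eta> B \<and> gldim B < \<infinity> \<and>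
     (\<exists>E d u. minimal_injective_coresolution B (regular_right_module B) E d u \<and>
        (\<forall>i X. indecomposable_summand B (E i) X \<longrightarrow>
           projdim B ((E i)\<lparr>carrier := X\<rparr>) = enat i))"


section \<open>Path algebras\<close>

text \<open>
  A quiver is a \<^typ>\<open>('v, 'e) pre_digraph\<close>, and the path from \<open>u\<close> to \<open>v\<close> traversing the arrows
  \<open>p\<close> from left to right is the triple \<open>(u, p, v)\<close>; the trivial path at \<open>v\<close> is \<open>(v, [], v)\<close>.
\<close>

type_synonym ('v, 'e) path = "'v \<times> 'e list \<times> 'v"

definition paths :: "('v, 'e) pre_digraph \<Rightarrow> ('v, 'e) path set" where
  "paths Q = {(u, p, v). pre_digraph.awalk Q u p v}"

fun path_source :: "('v, 'e) path \<Rightarrow> 'v" where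
  "path_source (u, p, v) = u"

fun path_target :: "('v, 'e) path \<Rightarrow> 'v" where
  "path_target (u, p, v) = v"

fun path_comp :: "('v, 'e) path \<Rightarrow> ('v, 'e) path \<Rightarrow> ('v, 'e) path" where
  "path_comp (u, p, v) (u', q, w) = (u, p @ q, w)"

definition path_scalar :: "('v, 'e) pre_digraph \<Rightarrow> 'k \<Rightarrow> (('v, 'e) path \<Rightarrow> 'k::field)" where
  "path_scalar Q c = (\<lambda>x. if \<exists>v\<in>verts Q. x = (v, [], v) then c else 0)"

text \<open>Elements of \<open>KQ\<close> are given by their coefficients, as finitely supported functions on paths.\<close>

definition path_algebra :: "('v, 'e) pre_digraph \<Rightarrow> (('v, 'e) path \<Rightarrow> 'k::field) ring" where
  "path_algebra Q =
     \<lparr>carrier = {f. finite {x. f x \<noteq> 0} \<and> {x. f x \<noteq> 0} \<subseteq> paths Q},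
      monoid.mult = (\<lambda>f g z. \<Sum>(x, y) \<in> {(x, y). f x \<noteq> 0 \<and> g y \<noteq> 0 \<and>
                path_target x = path_source y \<and> path_comp x y = z}. f x * g y),
      monoid.one = path_scalar Q 1,
      ring.zero = (\<lambda>x. 0),
      ring.add = (\<lambda>f g x. f x + g x)\<rparr>"

text \<open>The element of \<open>KQ\<close> given by a nonempty sequence of consecutive arrows.\<close>

definition arrow_path :: "('v, 'e) pre_digraph \<Rightarrow> 'e list \<Rightarrow> (('v, 'e) path \<Rightarrow> 'k::field)" where
  "arrow_path Q p = (\<lambda>x. if x = (tail Q (hd p), p, head Q (last p)) then 1 else 0)"


section \<open>The algebra of the example\<close>

datatype arrow = arr_a | arr_b | arr_c | arr_d | arr_e | arr_f | arr_g | arr_h | arr_i | arr_j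

fun arrow_ends :: "arrow \<Rightarrow> nat \<times> nat" where
  "arrow_ends arr_a = (1, 3)"
| "arrow_ends arr_b = (2, 3)"
| "arrow_ends arr_c = (2, 4)"
| "arrow_ends arr_d = (3, 5)"
| "arrow_ends arr_e = (3, 7)"
| "arrow_ends arr_f = (4, 5)"
| "arrow_ends arr_g = (5, 6)"
| "arrow_ends arr_h = (5, 9)"
| "arrow_ends arr_i = (6, 8)"
| "arrow_ends arr_j = (7, 8)"

definition ex_quiver :: "(nat, arrow) pre_digraph" where
  "ex_quiver = \<lparr>verts = {1..9}, arcs = UNIV,
     tail = (\<lambda>x. fst (arrow_ends x)), head = (\<lambda>x. snd (arrow_ends x))\<rparr>"

definition ex_path_algebra :: "((nat, arrow) path \<Rightarrow> 'k::field) ring" where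
  "ex_path_algebra = path_algebra ex_quiver"

definition ex_relations :: "((nat, arrow) path \<Rightarrow> 'k::field) set" where
  "ex_relations =
     {arrow_path ex_quiver [arr_a, arr_d, arr_g],
      arrow_path ex_quiver [arr_f, arr_h],
      arrow_path ex_quiver [arr_a, arr_e],
      arrow_path ex_quiver [arr_b, arr_d] \<ominus>\<^bsub>ex_path_algebra\<^esub> arrow_path ex_quiver [arr_c, arr_f],
      arrow_path ex_quiver [arr_e, arr_j]
        \<ominus>\<^bsub>ex_path_algebra\<^esub> arrow_path ex_quiver [arr_d, arr_g, arr_i]}"

definition ex_ideal :: "((nat, arrow) path \<Rightarrow> 'k::field) set" where
  "ex_ideal = Idl\<^bsub>ex_path_algebra\<^esub> ex_relations"

definition ex_algebra :: "((nat, arrow) path \<Rightarrow> 'k::field) set ring" where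
  "ex_algebra = ex_path_algebra Quot ex_ideal"

definition ex_unit_map :: "'k::field \<Rightarrow> ((nat, arrow) path \<Rightarrow> 'k) set" where
  "ex_unit_map c = ex_ideal +>\<^bsub>ex_path_algebra\<^esub> path_scalar ex_quiver c"

end

theory Submission
  imports Defs "HOL-Library.Function_Algebras"
begin

text \<open>
  For vertices \<open>i\<close> and \<open>k\<close> the space \<open>e\<^sub>i A e\<^sub>k\<close> has dimension at most 1, so that \<open>A\<close> is isomorphic to the
  algebra of the matrices supported on the set \<open>S\<close> of the pairs with \<open>e\<^sub>i A e\<^sub>k \<noteq> 0\<close>, where a product is
  cut off outside \<open>S\<close>. Over such an algebra the indecomposable projectives \<open>P(v)\<close> and injectives \<open>I(v)\<close>
  have at most one-dimensional components, maps between their direct sums are scalar matrices, and a complex of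
  such modules is exact if it has linear contracting homotopies at each vertex.

  In the minimal injective coresolution of \<open>A\<close>, the indecomposable summands of the terms \<open>0, 1, 2, 3\<close> are
  \<open>I(8), I(9)\<close>; \<open>I(5), I(6), I(7)\<close>; \<open>I(2), I(3), I(4)\<close>; \<open>I(1)\<close>. Explicit projective resolutions bound
  their projective dimensions from above. If the differential vanishes on a summand
  \<open>I(v)\<close> of the term \<open>m + 1\<close>, the inclusion of this summand does not factor through the term \<open>m\<close>, as there are
  no nonzero maps from \<open>I(v)\<close> to the latter; by dimension shifting its projective dimension exceeds \<open>m\<close>.

  Over the opposite algebra, \<open>I(7)\<close> is a summand of the term 2 of every injective coresolution
  of the regular module, but its projective dimension is at most 1.
\<close>

section \<open>Path algebras\<close>

text \<open>The set \<open>S\<close> of nonzero pairs is not transitive: for A it contains (1,5) and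
  (5,6) but not (1,6), because adg is zero. So the matrices form no incidence algebra, and every
  construction carries a condition saying that the two ways through an intermediate vertex are cut
  off together: \<open>S_assoc\<close> for the algebra, \<open>thin_ok\<close> for modules, the
  premise of \<open>thin_map_hom\<close> for maps. A second obstacle is one of types. The
  homological notions quantify over modules with elements of type
  \<open>(nat \<Rightarrow> 'a) set\<close>, whereas thin modules consist of functions with values
  in the field; lifting, extension and whole resolutions therefore have to be carried along
  isomorphic copies. Exactness is certified by identities of integer matrices, which
  \<open>code_simp\<close> evaluates and \<open>of_int\<close> maps to the field. The lower bounds
  need only one witness per vertex: for each v listed in the term m + 1, some I(v) is the last term
  of the minimal coresolution of a single P(w), which makes Ext nonzero there.\<close>

definition path_delta :: "('v, 'e) path \<Rightarrow> ('v, 'e) path \<Rightarrow> 'k::field" where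
  "path_delta x = (\<lambda>z. if z = x then 1 else 0)"

text \<open>\<open>path_comp\<close> is total and ignores the inner endpoints, so composability is
  recorded separately.\<close>

definition composes_to :: "('v, 'e) path \<Rightarrow> ('v, 'e) path \<Rightarrow> ('v, 'e) path \<Rightarrow> bool" where
  "composes_to x y z \<longleftrightarrow> path_target x = path_source y \<and> path_comp x y = z"

lemma path_comp_ends [simp]:
  "path_source (path_comp x y) = path_source x" "path_target (path_comp x y) = path_target y"
  by (cases x; cases y; simp)+

lemma paths_ends:
  assumes "x \<in> paths Q" and "\<forall>a\<in>arcs Q. head Q a \<in> verts Q"
  shows "path_source x \<in> verts Q" "path_target x \<in> verts Q"
proof -
  obtain u p v where x: "x = (u, p, v)" by (cases x)
  have *: "v \<in> verts Q" if "pre_digraph.cas Q u p v" "u \<in> verts Q" "set p \<subseteq> arcs Q"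
    using that assms(2)
    by (induction p arbitrary: u) (auto simp: pre_digraph.cas.simps)
  show "path_source x \<in> verts Q" "path_target x \<in> verts Q"
    using assms(1) * by (auto simp: paths_def x pre_digraph.awalk_def)
qed

lemma cas_append:
  "pre_digraph.cas Q u p v \<Longrightarrow> pre_digraph.cas Q v q w \<Longrightarrow> pre_digraph.cas Q u (p @ q) w"
  by (induction p arbitrary: u) (auto simp: pre_digraph.cas.simps)

lemma path_comp_paths:
  assumes "x \<in> paths Q" "y \<in> paths Q" "path_target x = path_source y"
  shows "path_comp x y \<in> paths Q"
  using assms
  by (cases x; cases y) (auto simp: paths_def pre_digraph.awalk_def intro: cas_append)

context
  fixes Q :: "('v, 'e) pre_digraph" and R :: "(('v, 'e) path \<Rightarrow> 'k::field) ring"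
  defines R_def: "R \<equiv> path_algebra Q"
begin

lemma path_algebra_carrier:
  "f \<in> carrier R \<longleftrightarrow> finite {x. f x \<noteq> 0} \<and> {x. f x \<noteq> 0} \<subseteq> paths Q"
  by (simp add: R_def path_algebra_def)

lemma path_algebra_add: "f \<oplus>\<^bsub>R\<^esub> g = (\<lambda>x. f x + g x)"
  by (simp add: R_def path_algebra_def)

lemma path_algebra_zero: "\<zero>\<^bsub>R\<^esub> = (\<lambda>x. 0)"
  by (simp add: R_def path_algebra_def)

lemma path_algebra_one: "\<one>\<^bsub>R\<^esub> = path_scalar Q 1"
  by (simp add: R_def path_algebra_def)

text \<open>Arbitrary finite sets containing the supports are allowed, so that one pair
  \<open>F\<close>, \<open>G\<close> serves several functions at once, as in the proof of
  distributivity.\<close>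

lemma path_algebra_mult:
  assumes "finite F" "finite G" "{x. f x \<noteq> 0} \<subseteq> F" "{x. g x \<noteq> 0} \<subseteq> G"
  shows "(f \<otimes>\<^bsub>R\<^esub> g) z = (\<Sum>x\<in>F. \<Sum>y\<in>G. if composes_to x y z then f x * g y else 0)"
proof -
  have "(f \<otimes>\<^bsub>R\<^esub> g) z = (\<Sum>(x, y) \<in> {(x, y). f x \<noteq> 0 \<and> g y \<noteq> 0 \<and> composes_to x y z}. f x * g y)"
    by (simp add: R_def path_algebra_def composes_to_def)
  also have "\<dots> = (\<Sum>(x, y) \<in> F \<times> G. if composes_to x y z then f x * g y else 0)"
    by (rule sum.mono_neutral_cong_left) (use assms in \<open>auto split: if_splits\<close>)
  finally show ?thesis by (simp add: sum.cartesian_product)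
qed

text \<open>Pairing the product with a weight \<open>c\<close> collapses the sum over composites.
  Associativity and \<open>ex_coeff_mult\<close> both come from this identity, for different
  weights.\<close>

lemma path_algebra_mult_delta_sum:
  assumes "finite F" "finite G" "{x. f x \<noteq> 0} \<subseteq> F" "{x. g x \<noteq> 0} \<subseteq> G"
    and "finite Z" "\<And>x y. x \<in> F \<Longrightarrow> y \<in> G \<Longrightarrow> path_comp x y \<in> Z"
  shows "(\<Sum>z\<in>Z. (f \<otimes>\<^bsub>R\<^esub> g) z * c z) =
    (\<Sum>x\<in>F. \<Sum>y\<in>G. if path_target x = path_source y then f x * g y * c (path_comp x y) else 0)"
proof -
  have "(\<Sum>z\<in>Z. (f \<otimes>\<^bsub>R\<^esub> g) z * c z) =
     (\<Sum>z\<in>Z. \<Sum>x\<in>F. \<Sum>y\<in>G. if composes_to x y z then f x * g y * c z else 0)"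
    by (simp add: path_algebra_mult[OF assms(1-4)] sum_distrib_right if_distrib[of "\<lambda>t. t * _"]
        cong: if_cong)
  also have "\<dots> = (\<Sum>x\<in>F. \<Sum>y\<in>G. \<Sum>z\<in>Z. if composes_to x y z then f x * g y * c z else 0)"
    by (rule trans[OF sum.swap], rule sum.cong[OF refl], rule sum.swap)
  also have "\<dots> = (\<Sum>x\<in>F. \<Sum>y\<in>G. if path_target x = path_source y then f x * g y * c (path_comp x y) else 0)"
  proof (intro sum.cong refl)
    fix x y assume xy: "x \<in> F" "y \<in> G"
    have "(\<Sum>z\<in>Z. if composes_to x y z then f x * g y * c z else 0) =
      (\<Sum>z\<in>Z. if path_comp x y = z then (if path_target x = path_source y then f x * g y * c z else 0) else 0)"
      by (intro sum.cong refl) (auto simp: composes_to_def)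
    also have "\<dots> = (if path_target x = path_source y then f x * g y * c (path_comp x y) else 0)"
      using assms(5,6) xy by (subst sum.delta') auto
    finally show "(\<Sum>z\<in>Z. if composes_to x y z then f x * g y * c z else 0) = \<dots>" .
  qed
  finally show ?thesis .
qed

lemma path_algebra_mult_supp:
  assumes "finite F" "finite G" "{x. f x \<noteq> 0} \<subseteq> F" "{x. g x \<noteq> 0} \<subseteq> G"
  shows "{z. (f \<otimes>\<^bsub>R\<^esub> g) z \<noteq> 0} \<subseteq> {path_comp x y | x y. x \<in> F \<and> y \<in> G \<and> path_target x = path_source y}"
proof
  fix z assume "z \<in> {z. (f \<otimes>\<^bsub>R\<^esub> g) z \<noteq> 0}"
  then have "(f \<otimes>\<^bsub>R\<^esub> g) z \<noteq> 0" by simp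
  then have "(\<Sum>x\<in>F. \<Sum>y\<in>G. if composes_to x y z then f x * g y else 0) \<noteq> 0"
    by (simp only: path_algebra_mult[OF assms] not_False_eq_True)
  then obtain x where x: "x \<in> F" "(\<Sum>y\<in>G. if composes_to x y z then f x * g y else 0) \<noteq> 0"
    by (rule sum.not_neutral_contains_not_neutral)
  from x(2) obtain y where "y \<in> G" "(if composes_to x y z then f x * g y else 0) \<noteq> 0"
    by (rule sum.not_neutral_contains_not_neutral)
  then have "composes_to x y z" and "y \<in> G" by (auto split: if_splits)
  with x(1) show "z \<in> {path_comp x y | x y. x \<in> F \<and> y \<in> G \<and> path_target x = path_source y}"
    unfolding composes_to_def by blast
qed

lemma path_comp_set:
  "{path_comp x y | x y. x \<in> F \<and> y \<in> G \<and> P x y} \<subseteq> (\<lambda>(x, y). path_comp x y) ` (F \<times> G)"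
proof
  fix z assume "z \<in> {path_comp x y | x y. x \<in> F \<and> y \<in> G \<and> P x y}"
  then obtain x y where "x \<in> F" "y \<in> G" "z = path_comp x y" by blast
  then show "z \<in> (\<lambda>(x, y). path_comp x y) ` (F \<times> G)" by (intro image_eqI[of _ _ "(x, y)"]) auto
qed

lemma path_algebra_mult_closed:
  assumes "f \<in> carrier R" "g \<in> carrier R"
  shows "f \<otimes>\<^bsub>R\<^esub> g \<in> carrier R"
proof -
  let ?F = "{x. f x \<noteq> 0}" and ?G = "{x. g x \<noteq> 0}"
  have fin: "finite ?F" "finite ?G" using assms by (auto simp: path_algebra_carrier)
  have sub: "{z. (f \<otimes>\<^bsub>R\<^esub> g) z \<noteq> 0} \<subseteq> {path_comp x y | x y. x \<in> ?F \<and> y \<in> ?G \<and> path_target x = path_source y}"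
    by (rule path_algebra_mult_supp[OF fin order_refl order_refl])
  also have sub': "\<dots> \<subseteq> (\<lambda>(x, y). path_comp x y) ` (?F \<times> ?G)" by (rule path_comp_set)
  finally have "finite {z. (f \<otimes>\<^bsub>R\<^esub> g) z \<noteq> 0}"
    using fin by (meson finite_SigmaI finite_imageI finite_subset)
  moreover have "{z. (f \<otimes>\<^bsub>R\<^esub> g) z \<noteq> 0} \<subseteq> paths Q"
  proof
    fix z assume "z \<in> {z. (f \<otimes>\<^bsub>R\<^esub> g) z \<noteq> 0}"
    with sub obtain x y where "x \<in> ?F" "y \<in> ?G" "path_target x = path_source y" "z = path_comp x y"
      by blast
    with assms show "z \<in> paths Q" by (auto simp: path_algebra_carrier intro!: path_comp_paths)
  qed
  ultimately show ?thesis by (simp add: path_algebra_carrier)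
qed

lemma path_algebra_mult_assoc:
  assumes "f \<in> carrier R" "g \<in> carrier R" "h \<in> carrier R"
  shows "(f \<otimes>\<^bsub>R\<^esub> g) \<otimes>\<^bsub>R\<^esub> h = f \<otimes>\<^bsub>R\<^esub> (g \<otimes>\<^bsub>R\<^esub> h)"
proof
  fix w
  let ?F = "{x. f x \<noteq> 0}" and ?G = "{x. g x \<noteq> 0}" and ?H = "{x. h x \<noteq> 0}"
  have fin: "finite ?F" "finite ?G" "finite ?H" using assms by (auto simp: path_algebra_carrier)
  let ?FG = "(\<lambda>(x, y). path_comp x y) ` (?F \<times> ?G)" and ?GH = "(\<lambda>(x, y). path_comp x y) ` (?G \<times> ?H)"
  have fin': "finite ?FG" "finite ?GH" using fin by auto
  have s1: "{z. (f \<otimes>\<^bsub>R\<^esub> g) z \<noteq> 0} \<subseteq> ?FG"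
    using path_algebra_mult_supp[OF fin(1,2) order_refl order_refl] path_comp_set by (rule order_trans)
  have s2: "{z. (g \<otimes>\<^bsub>R\<^esub> h) z \<noteq> 0} \<subseteq> ?GH"
    using path_algebra_mult_supp[OF fin(2,3) order_refl order_refl] path_comp_set by (rule order_trans)
  \<comment> \<open>The common value of both bracketings: the sum over composable triples with
    composite \<open>w\<close>.\<close>
  let ?c = "\<lambda>x y z. if path_target x = path_source y \<and> path_target y = path_source z \<and>
     path_comp x (path_comp y z) = w then f x * g y * h z else 0"
  have "((f \<otimes>\<^bsub>R\<^esub> g) \<otimes>\<^bsub>R\<^esub> h) w = (\<Sum>u\<in>?FG. \<Sum>z\<in>?H. if composes_to u z w then (f \<otimes>\<^bsub>R\<^esub> g) u * h z else 0)"
    by (rule path_algebra_mult[OF fin'(1) fin(3) s1 order_refl])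
  also have "\<dots> = (\<Sum>z\<in>?H. \<Sum>u\<in>?FG. (f \<otimes>\<^bsub>R\<^esub> g) u * (if composes_to u z w then h z else 0))"
    by (subst sum.swap) (intro sum.cong refl, auto)
  also have "\<dots> = (\<Sum>z\<in>?H. \<Sum>x\<in>?F. \<Sum>y\<in>?G. ?c x y z)"
    by (subst path_algebra_mult_delta_sum[OF fin(1,2) order_refl order_refl fin'(1)])
      (auto simp: composes_to_def intro!: sum.cong)
  also have "\<dots> = (\<Sum>x\<in>?F. \<Sum>y\<in>?G. \<Sum>z\<in>?H. ?c x y z)"
    by (rule trans[OF sum.swap], rule sum.cong[OF refl], rule sum.swap)
  also have "\<dots> = (\<Sum>x\<in>?F. \<Sum>u\<in>?GH. (g \<otimes>\<^bsub>R\<^esub> h) u * (if composes_to x u w then f x else 0))"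
    by (subst path_algebra_mult_delta_sum[OF fin(2,3) order_refl order_refl fin'(2)])
      (auto simp: composes_to_def intro!: sum.cong)
  also have "\<dots> = (\<Sum>x\<in>?F. \<Sum>u\<in>?GH. if composes_to x u w then f x * (g \<otimes>\<^bsub>R\<^esub> h) u else 0)"
    by (intro sum.cong refl) auto
  also have "\<dots> = (f \<otimes>\<^bsub>R\<^esub> (g \<otimes>\<^bsub>R\<^esub> h)) w"
    by (rule path_algebra_mult[OF fin(1) fin'(2) order_refl s2, symmetric])
  finally show "((f \<otimes>\<^bsub>R\<^esub> g) \<otimes>\<^bsub>R\<^esub> h) w = (f \<otimes>\<^bsub>R\<^esub> (g \<otimes>\<^bsub>R\<^esub> h)) w" .
qed

lemma trivial_paths: "v \<in> verts Q \<Longrightarrow> (v, [], v) \<in> paths Q"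
  by (simp add: paths_def pre_digraph.awalk_def pre_digraph.cas.simps)

lemma path_scalar_supp: "{x. path_scalar Q c x \<noteq> 0} \<subseteq> (\<lambda>v. (v, [], v)) ` verts Q"
  by (auto simp: path_scalar_def split: if_splits)

lemma path_scalar_closed:
  assumes "finite (verts Q)"
  shows "path_scalar Q c \<in> carrier R"
proof -
  have "finite {x. path_scalar Q c x \<noteq> 0}"
    using path_scalar_supp[of c] assms by (meson finite_imageI finite_subset)
  then show ?thesis
    using path_scalar_supp[of c] trivial_paths by (force simp: path_algebra_carrier)
qed

text \<open>Each path has one source, so exactly one trivial path composes with it from the left.
  Multiplication by \<open>path_scalar Q c\<close> thus serves as scalar multiplication, as in
  \<open>ex_class_sum_cong\<close>.\<close>

lemma path_scalar_mult_left:
  assumes fin: "finite (verts Q)" and f: "f \<in> carrier R"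
  shows "path_scalar Q c \<otimes>\<^bsub>R\<^esub> f = (\<lambda>x. c * f x)"
proof
  fix z
  let ?F = "{x. f x \<noteq> 0}"
  have fF: "finite ?F" and sF: "?F \<subseteq> paths Q" using f by (auto simp: path_algebra_carrier)
  have src: "path_source x \<in> verts Q" if "x \<in> paths Q" for x
    using that by (cases x) (auto simp: paths_def pre_digraph.awalk_def)
  have "(path_scalar Q c \<otimes>\<^bsub>R\<^esub> f) z =
     (\<Sum>x\<in>(\<lambda>v. (v, [], v)) ` verts Q. \<Sum>y\<in>?F. if composes_to x y z then path_scalar Q c x * f y else 0)"
    by (rule path_algebra_mult) (use fin fF path_scalar_supp in auto)
  also have "\<dots> = (\<Sum>v\<in>verts Q. \<Sum>y\<in>?F. if composes_to (v, [], v) y z then c * f y else 0)"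
    by (subst sum.reindex) (auto simp: inj_on_def path_scalar_def intro!: sum.cong)
  also have "\<dots> = (\<Sum>y\<in>?F. \<Sum>v\<in>verts Q. if v = path_source y then (if y = z then c * f y else 0) else 0)"
    by (subst sum.swap, intro sum.cong refl) (auto simp: composes_to_def)
  also have "\<dots> = (\<Sum>y\<in>?F. if y = z then c * f y else 0)"
    using fin sF src by (intro sum.cong refl) (auto simp: sum.delta)
  also have "\<dots> = c * f z" using fF by (auto simp: sum.delta)
  finally show "(path_scalar Q c \<otimes>\<^bsub>R\<^esub> f) z = c * f z" .
qed

lemma path_scalar_mult_right:
  assumes fin: "finite (verts Q)" "\<forall>a\<in>arcs Q. head Q a \<in> verts Q" and f: "f \<in> carrier R"
  shows "f \<otimes>\<^bsub>R\<^esub> path_scalar Q c = (\<lambda>x. c * f x)"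
proof
  fix z
  let ?F = "{x. f x \<noteq> 0}"
  have fF: "finite ?F" and sF: "?F \<subseteq> paths Q" using f by (auto simp: path_algebra_carrier)
  have "(f \<otimes>\<^bsub>R\<^esub> path_scalar Q c) z =
     (\<Sum>y\<in>?F. \<Sum>x\<in>(\<lambda>v. (v, [], v)) ` verts Q. if composes_to y x z then f y * path_scalar Q c x else 0)"
    by (rule path_algebra_mult) (use fin fF path_scalar_supp in auto)
  also have "\<dots> = (\<Sum>y\<in>?F. \<Sum>v\<in>verts Q. if composes_to y (v, [], v) z then c * f y else 0)"
    by (subst sum.reindex) (auto simp: inj_on_def path_scalar_def mult.commute intro!: sum.cong)
  also have "\<dots> = (\<Sum>y\<in>?F. \<Sum>v\<in>verts Q. if v = path_target y then (if y = z then c * f y else 0) else 0)"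
    by (intro sum.cong refl) (auto simp: composes_to_def)
  also have "\<dots> = (\<Sum>y\<in>?F. if y = z then c * f y else 0)"
    using fin sF paths_ends(2)[OF _ fin(2)] by (intro sum.cong refl) (auto simp: sum.delta)
  also have "\<dots> = c * f z" using fF by (auto simp: sum.delta)
  finally show "(f \<otimes>\<^bsub>R\<^esub> path_scalar Q c) z = c * f z" .
qed

lemma path_algebra_add_closed:
  "f \<in> carrier R \<Longrightarrow> g \<in> carrier R \<Longrightarrow> f \<oplus>\<^bsub>R\<^esub> g \<in> carrier R"
proof -
  assume fg: "f \<in> carrier R" "g \<in> carrier R"
  have "{x. f x + g x \<noteq> 0} \<subseteq> {x. f x \<noteq> 0} \<union> {x. g x \<noteq> 0}" by auto
  with fg show ?thesis by (auto simp: path_algebra_carrier path_algebra_add intro: finite_subset)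
qed

text \<open>Finitely many vertices give the unit finite support; heads of arrows in
  \<open>verts Q\<close> make it right neutral.\<close>

lemma ring_path_algebra:
  assumes fin: "finite (verts Q)" and hd: "\<forall>a\<in>arcs Q. head Q a \<in> verts Q"
  shows "ring R"
proof (rule ringI)
  show "abelian_group R"
  proof (rule abelian_groupI)
    fix f assume f: "f \<in> carrier R"
    then have "(\<lambda>x. - f x) \<in> carrier R" by (simp add: path_algebra_carrier)
    then show "\<exists>g\<in>carrier R. g \<oplus>\<^bsub>R\<^esub> f = \<zero>\<^bsub>R\<^esub>"
      by (intro bexI[of _ "\<lambda>x. - f x"]) (auto simp: path_algebra_add path_algebra_zero)
  qed (auto simp: path_algebra_add_closed, auto simp: path_algebra_add path_algebra_zero path_algebra_carrier algebra_simps)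
next
  show "Group.monoid R"
    by (rule monoidI)
      (auto simp: path_algebra_one path_scalar_closed[OF fin] path_algebra_mult_closed
        path_scalar_mult_left[OF fin] path_scalar_mult_right[OF fin hd] path_algebra_mult_assoc)
next
  fix f g h assume fgh: "f \<in> carrier R" "g \<in> carrier R" "h \<in> carrier R"
  let ?F = "{x. f x \<noteq> 0} \<union> {x. g x \<noteq> 0}" and ?H = "{x. h x \<noteq> 0}"
  have fin: "finite ?F" "finite ?H" using fgh by (auto simp: path_algebra_carrier)
  show "(f \<oplus>\<^bsub>R\<^esub> g) \<otimes>\<^bsub>R\<^esub> h = f \<otimes>\<^bsub>R\<^esub> h \<oplus>\<^bsub>R\<^esub> g \<otimes>\<^bsub>R\<^esub> h"
  proof
    fix z
    have s: "{x. (f \<oplus>\<^bsub>R\<^esub> g) x \<noteq> 0} \<subseteq> ?F" by (auto simp: path_algebra_add)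
    have "((f \<oplus>\<^bsub>R\<^esub> g) \<otimes>\<^bsub>R\<^esub> h) z = (f \<otimes>\<^bsub>R\<^esub> h) z + (g \<otimes>\<^bsub>R\<^esub> h) z"
      unfolding path_algebra_mult[OF fin s order_refl] path_algebra_mult[OF fin Un_upper1 order_refl]
        path_algebra_mult[OF fin Un_upper2 order_refl] sum.distrib[symmetric]
      by (intro sum.cong refl) (simp add: path_algebra_add algebra_simps)
    then show "((f \<oplus>\<^bsub>R\<^esub> g) \<otimes>\<^bsub>R\<^esub> h) z = (f \<otimes>\<^bsub>R\<^esub> h \<oplus>\<^bsub>R\<^esub> g \<otimes>\<^bsub>R\<^esub> h) z"
      by (simp add: path_algebra_add)
  qed
  show "h \<otimes>\<^bsub>R\<^esub> (f \<oplus>\<^bsub>R\<^esub> g) = h \<otimes>\<^bsub>R\<^esub> f \<oplus>\<^bsub>R\<^esub> h \<otimes>\<^bsub>R\<^esub> g"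
  proof
    fix z
    have s: "{x. (f \<oplus>\<^bsub>R\<^esub> g) x \<noteq> 0} \<subseteq> ?F" by (auto simp: path_algebra_add)
    have "(h \<otimes>\<^bsub>R\<^esub> (f \<oplus>\<^bsub>R\<^esub> g)) z = (h \<otimes>\<^bsub>R\<^esub> f) z + (h \<otimes>\<^bsub>R\<^esub> g) z"
      unfolding path_algebra_mult[OF fin(2,1) order_refl s] path_algebra_mult[OF fin(2,1) order_refl Un_upper1]
        path_algebra_mult[OF fin(2,1) order_refl Un_upper2] sum.distrib[symmetric]
      by (intro sum.cong refl) (simp add: path_algebra_add algebra_simps)
    then show "(h \<otimes>\<^bsub>R\<^esub> (f \<oplus>\<^bsub>R\<^esub> g)) z = (h \<otimes>\<^bsub>R\<^esub> f \<oplus>\<^bsub>R\<^esub> h \<otimes>\<^bsub>R\<^esub> g) z"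
      by (simp add: path_algebra_add)
  qed
qed

lemma path_delta_closed: "x \<in> paths Q \<Longrightarrow> path_delta x \<in> carrier R"
  by (auto simp: path_algebra_carrier path_delta_def)

lemma path_delta_mult:
  "path_delta x \<otimes>\<^bsub>R\<^esub> path_delta y =
    (if path_target x = path_source y then path_delta (path_comp x y) else (\<lambda>z. 0))"
proof
  fix z
  have "(path_delta x \<otimes>\<^bsub>R\<^esub> path_delta y) z = (\<Sum>u\<in>{x}. \<Sum>v\<in>{y}. if composes_to u v z then path_delta x u * path_delta y v else 0)"
    by (rule path_algebra_mult) (auto simp: path_delta_def)
  then show "(path_delta x \<otimes>\<^bsub>R\<^esub> path_delta y) z =
    (if path_target x = path_source y then path_delta (path_comp x y) else (\<lambda>z. 0)) z"
    by (auto simp: path_delta_def composes_to_def)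
qed

end

section \<open>Coordinates on the example algebra\<close>

definition ex_pairs :: "(nat \<times> nat) set" where
  "ex_pairs = {(1,1),(1,3),(1,5),(1,9),(2,2),(2,3),(2,4),(2,5),(2,6),(2,7),(2,8),
     (3,3),(3,5),(3,6),(3,7),(3,8),(3,9),(4,4),(4,5),(4,6),(4,8),(5,5),(5,6),(5,8),(5,9),
     (6,6),(6,8),(7,7),(7,8),(8,8),(9,9)}"

text \<open>The added pairs are joined only by paths that lie in the ideal: adg, adgi, ae, aej, bdh,
  cfh and fh.\<close>

definition ex_reachable :: "(nat \<times> nat) set" where
  "ex_reachable = ex_pairs \<union> {(1,6),(1,7),(1,8),(2,9),(4,9)}"

lemma ex_quiver_simps [simp]:
  "verts ex_quiver = {1..9}" "arcs ex_quiver = UNIV"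
  "tail ex_quiver x = fst (arrow_ends x)" "head ex_quiver x = snd (arrow_ends x)"
  by (simp_all add: ex_quiver_def)

lemma ex_quiver_head: "\<forall>a\<in>arcs ex_quiver. head ex_quiver a \<in> verts ex_quiver"
proof
  fix a show "head ex_quiver a \<in> verts ex_quiver" by (cases a) auto
qed

lemma ex_vertices: "{1..9::nat} = {1,2,3,4,5,6,7,8,9}"
  by (simp add: atLeastAtMost_insertL[symmetric] numeral_eq_Suc atLeastAtMostSuc_conv insert_commute)

text \<open>The relation contains the diagonal and is closed under putting an arrow in front, which
  is evaluated arrow by arrow.\<close>

lemma ex_cas_reachable:
  assumes "pre_digraph.cas ex_quiver u p v" "u \<in> {1..9}"
  shows "(u, v) \<in> ex_reachable"
  using assms
proof (induction p arbitrary: u)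
  case Nil
  then have "u = v" "v \<in> {1,2,3,4,5,6,7,8,9}"
    by (auto simp: pre_digraph.cas.simps ex_vertices[symmetric])
  then show ?case by (auto simp: ex_reachable_def ex_pairs_def)
next
  case (Cons e p)
  then have e: "fst (arrow_ends e) = u" "(snd (arrow_ends e), v) \<in> ex_reachable"
    using ex_quiver_head by (auto simp: pre_digraph.cas.simps)
  have "\<forall>(w, v)\<in>ex_reachable. snd (arrow_ends e) = w \<longrightarrow> (fst (arrow_ends e), v) \<in> ex_reachable"
    by (cases e; hypsubst; code_simp)
  with e show ?case by fast
qed

lemma ex_paths_reachable:
  assumes "x \<in> paths ex_quiver"
  shows "(path_source x, path_target x) \<in> ex_reachable"
  using assms ex_cas_reachable by (auto simp: paths_def pre_digraph.awalk_def)

text \<open>All paths between a surviving pair represent the same nonzero element, so both factors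
  of a path through \<open>j\<close> are nonzero.\<close>

lemma ex_pairs_convex:
  assumes "(i, k) \<in> ex_pairs" "(i, j) \<in> ex_reachable" "(j, k) \<in> ex_reachable"
  shows "(i, j) \<in> ex_pairs" "(j, k) \<in> ex_pairs"
proof -
  have "(i, j) \<in> ex_pairs \<or> (i, j) \<in> {(1,6),(1,7),(1,8),(2,9),(4,9)}"
    "(j, k) \<in> ex_pairs \<or> (j, k) \<in> {(1,6),(1,7),(1,8),(2,9),(4,9)}"
    using assms(2,3) unfolding ex_reachable_def by blast+
  then consider "(i, j) \<in> ex_pairs" "(j, k) \<in> ex_pairs" | "(i, j) \<in> {(1,6),(1,7),(1,8),(2,9),(4,9)}"
    | "(j, k) \<in> {(1,6),(1,7),(1,8),(2,9),(4,9)}" by blast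
  then have "(i, j) \<in> ex_pairs \<and> (j, k) \<in> ex_pairs"
  proof cases
    assume "(i, j) \<in> ex_pairs" "(j, k) \<in> ex_pairs"
    then show ?thesis ..
  next
    assume "(i, j) \<in> {(1,6),(1,7),(1,8),(2,9),(4,9)}"
    then show ?thesis using assms(1,3) unfolding ex_reachable_def ex_pairs_def by (elim insertE emptyE) auto
  next
    assume "(j, k) \<in> {(1,6),(1,7),(1,8),(2,9),(4,9)}"
    then show ?thesis using assms(1,2) unfolding ex_reachable_def ex_pairs_def by (elim insertE emptyE) auto
  qed
  then show "(i, j) \<in> ex_pairs" "(j, k) \<in> ex_pairs" by auto
qed

text \<open>
  The relations of the algebra identify parallel paths or kill them, so that the paths from \<open>i\<close> to \<open>k\<close>
  are either all killed or all represent the same basis element.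
\<close>

definition ex_coeff :: "((nat, arrow) path \<Rightarrow> 'k::field) \<Rightarrow> nat \<Rightarrow> nat \<Rightarrow> 'k" where
  "ex_coeff f i k = (if (i, k) \<in> ex_pairs
     then \<Sum>x | f x \<noteq> 0 \<and> path_source x = i \<and> path_target x = k. f x else 0)"

lemma ex_coeff_sum:
  assumes "finite F" "{x. f x \<noteq> 0} \<subseteq> F"
  shows "ex_coeff f i k = (if (i, k) \<in> ex_pairs
     then \<Sum>x\<in>F. if path_source x = i \<and> path_target x = k then f x else 0 else 0)"
proof -
  have "(\<Sum>x | f x \<noteq> 0 \<and> path_source x = i \<and> path_target x = k. f x) =
      (\<Sum>x\<in>F. if path_source x = i \<and> path_target x = k then f x else 0)"
    by (rule sum.mono_neutral_cong_left) (use assms in auto)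
  then show ?thesis by (simp add: ex_coeff_def)
qed

lemmas ex_path_algebra_simps =
  path_algebra_carrier[of _ ex_quiver, folded ex_path_algebra_def]
  path_algebra_add[of ex_quiver, folded ex_path_algebra_def]
  path_algebra_zero[of ex_quiver, folded ex_path_algebra_def]
  path_algebra_one[of ex_quiver, folded ex_path_algebra_def]

interpretation KQ: ring "ex_path_algebra :: ((nat, arrow) path \<Rightarrow> 'k::field) ring"
  unfolding ex_path_algebra_def
  by (rule ring_path_algebra) (use ex_quiver_head in auto)

lemma ex_coeff_add:
  assumes "f \<in> carrier ex_path_algebra" "g \<in> carrier ex_path_algebra"
  shows "ex_coeff (f \<oplus>\<^bsub>ex_path_algebra\<^esub> g) i k = ex_coeff f i k + ex_coeff g i k"
proof -
  let ?F = "{x. f x \<noteq> 0} \<union> {x. g x \<noteq> 0}"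
  have fin: "finite ?F" using assms by (auto simp: ex_path_algebra_simps)
  have "{x. (f \<oplus>\<^bsub>ex_path_algebra\<^esub> g) x \<noteq> 0} \<subseteq> ?F" by (auto simp: ex_path_algebra_simps)
  note s = ex_coeff_sum[OF fin this] ex_coeff_sum[OF fin Un_upper1] ex_coeff_sum[OF fin Un_upper2]
  show ?thesis
    unfolding s by (auto simp: ex_path_algebra_simps sum.distrib[symmetric] intro!: sum.cong)
qed

text \<open>The restriction to \<open>ex_pairs\<close> matters: at (1,6) the right-hand side
  contains the product of the entries at (1,5) and (5,6), which the relation adg = 0 removes from
  the algebra.\<close>

lemma ex_coeff_mult:
  fixes f g :: "(nat, arrow) path \<Rightarrow> 'k::field"
  assumes f: "f \<in> carrier ex_path_algebra" and g: "g \<in> carrier ex_path_algebra"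
    and ik: "(i, k) \<in> ex_pairs"
  shows "ex_coeff (f \<otimes>\<^bsub>ex_path_algebra\<^esub> g) i k = (\<Sum>j\<in>{1..9}. ex_coeff f i j * ex_coeff g j k)"
proof -
  let ?F = "{x. f x \<noteq> 0}" and ?G = "{x. g x \<noteq> 0}"
  have fin: "finite ?F" "finite ?G" and sub: "?F \<subseteq> paths ex_quiver" "?G \<subseteq> paths ex_quiver"
    using f g by (auto simp: ex_path_algebra_simps)
  let ?FG = "(\<lambda>(x, y). path_comp x y) ` (?F \<times> ?G)"
  let ?s = "\<lambda>i k x. path_source x = i \<and> path_target x = k"
  let ?t = "\<lambda>x y. if path_target x = path_source y \<and> path_source x = i \<and> path_target y = k then f x * g y else 0"
  have finFG: "finite ?FG" using fin by auto
  have supp: "{z. (f \<otimes>\<^bsub>ex_path_algebra\<^esub> g) z \<noteq> 0} \<subseteq> ?FG"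
    unfolding ex_path_algebra_def
    by (rule order_trans[OF path_algebra_mult_supp[OF fin order_refl order_refl] path_comp_set])
  have "ex_coeff (f \<otimes>\<^bsub>ex_path_algebra\<^esub> g) i k =
      (\<Sum>z\<in>?FG. if ?s i k z then (f \<otimes>\<^bsub>ex_path_algebra\<^esub> g) z else 0)"
    using ik by (simp add: ex_coeff_sum[OF finFG supp])
  also have "\<dots> = (\<Sum>z\<in>?FG. (f \<otimes>\<^bsub>ex_path_algebra\<^esub> g) z * (if ?s i k z then 1 else 0))"
    by (intro sum.cong refl) simp
  also have "\<dots> = (\<Sum>x\<in>?F. \<Sum>y\<in>?G. if path_target x = path_source y
       then f x * g y * (if ?s i k (path_comp x y) then 1 else 0) else 0)"
    unfolding ex_path_algebra_def
    by (rule path_algebra_mult_delta_sum[OF fin order_refl order_refl finFG]) auto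
  also have "\<dots> = (\<Sum>x\<in>?F. \<Sum>y\<in>?G. ?t x y)"
    by (intro sum.cong refl) auto
  \<comment> \<open>Sorting by the middle vertex, unique for each composable pair, prepares the
    double sum for factorization.\<close>
  also have "\<dots> = (\<Sum>x\<in>?F. \<Sum>y\<in>?G. \<Sum>j\<in>{1..9}. if ?s i j x \<and> ?s j k y then f x * g y else 0)"
  proof (intro sum.cong refl)
    fix x y assume "x \<in> ?F" "y \<in> ?G"
    then have "path_source y \<in> {1..9}"
      using sub paths_ends(1)[OF _ ex_quiver_head, of y] by auto
    moreover have "(\<Sum>j\<in>{1..9}. if ?s i j x \<and> ?s j k y then f x * g y else 0) =
      (\<Sum>j\<in>{1..9}. if path_source y = j then ?t x y else 0)"
      by (intro sum.cong refl) auto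
    ultimately show "?t x y = (\<Sum>j\<in>{1..9}. if ?s i j x \<and> ?s j k y then f x * g y else 0)"
      by (simp add: sum.delta')
  qed
  also have "\<dots> = (\<Sum>x\<in>?F. \<Sum>j\<in>{1..9}. \<Sum>y\<in>?G. if ?s i j x \<and> ?s j k y then f x * g y else 0)"
    by (rule sum.cong[OF refl], rule sum.swap)
  also have "\<dots> = (\<Sum>j\<in>{1..9}. \<Sum>x\<in>?F. \<Sum>y\<in>?G. if ?s i j x \<and> ?s j k y then f x * g y else 0)"
    by (rule sum.swap)
  also have "\<dots> = (\<Sum>j\<in>{1..9}. ex_coeff f i j * ex_coeff g j k)"
  proof (intro sum.cong refl)
    fix j
    have "ex_coeff f i j * ex_coeff g j k =
      (\<Sum>x\<in>?F. if ?s i j x then f x else 0) * (\<Sum>y\<in>?G. if ?s j k y then g y else 0)"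
    \<comment> \<open>If both pairs are reachable, convexity shows that \<open>ex_coeff\<close>
      truncates neither factor. Otherwise one of the two sums is over no paths, and the
      corresponding \<open>ex_coeff\<close> is truncated to 0.\<close>
    proof (cases "(i, j) \<in> ex_reachable \<and> (j, k) \<in> ex_reachable")
      case True
      then show ?thesis using ex_pairs_convex[OF ik]
        by (simp add: ex_coeff_sum[OF fin(1) order_refl] ex_coeff_sum[OF fin(2) order_refl])
    next
      case False
      have "(i, j) \<in> ex_reachable" if "x \<in> ?F" "?s i j x" for x
        using that sub(1) ex_paths_reachable[of x] by auto
      moreover have "(j, k) \<in> ex_reachable" if "y \<in> ?G" "?s j k y" for y
        using that sub(2) ex_paths_reachable[of y] by auto
      ultimately have "(\<forall>x\<in>?F. \<not> ?s i j x) \<or> (\<forall>y\<in>?G. \<not> ?s j k y)"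
        using False by meson
      then have "(\<Sum>x\<in>?F. if ?s i j x then f x else 0) * (\<Sum>y\<in>?G. if ?s j k y then g y else 0) = 0"
      proof
        assume "\<forall>x\<in>?F. \<not> ?s i j x"
        then have "(\<Sum>x\<in>?F. if ?s i j x then f x else 0) = 0" by (intro sum.neutral) auto
        then show ?thesis by simp
      next
        assume "\<forall>y\<in>?G. \<not> ?s j k y"
        then have "(\<Sum>y\<in>?G. if ?s j k y then g y else 0) = 0" by (intro sum.neutral) auto
        then show ?thesis by simp
      qed
      moreover have "(i, j) \<notin> ex_pairs \<or> (j, k) \<notin> ex_pairs"
        using False by (auto simp: ex_reachable_def)
      ultimately show ?thesis by (auto simp: ex_coeff_def)
    qed
    also have "\<dots> = (\<Sum>x\<in>?F. \<Sum>y\<in>?G. if ?s i j x \<and> ?s j k y then f x * g y else 0)"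
      unfolding sum_product by (intro sum.cong refl) auto
    finally show "(\<Sum>x\<in>?F. \<Sum>y\<in>?G. if ?s i j x \<and> ?s j k y then f x * g y else 0) = ex_coeff f i j * ex_coeff g j k" ..
  qed
  finally show ?thesis .
qed

lemma ex_coeff_delta:
  "ex_coeff (path_delta x :: _ \<Rightarrow> 'k::field) i k =
    (if (i, k) \<in> ex_pairs \<and> path_source x = i \<and> path_target x = k then 1 else 0)"
  by (subst ex_coeff_sum[of "{x}"]) (auto simp: path_delta_def)

lemma ex_coeff_scalar:
  "ex_coeff (path_scalar ex_quiver c) i k = (if i = k \<and> i \<in> {1..9} then c else 0)"
proof -
  have inj: "inj_on (\<lambda>v. (v, [] :: arrow list, v)) {1..9::nat}" by (simp add: inj_on_def)
  have mem: "(v, v) \<in> ex_pairs \<longleftrightarrow> v \<in> {1..9}" for v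
    unfolding ex_vertices ex_pairs_def by auto
  have "ex_coeff (path_scalar ex_quiver c) i k = (if (i, k) \<in> ex_pairs
     then \<Sum>x\<in>(\<lambda>v. (v, [], v)) ` {1..9}. if path_source x = i \<and> path_target x = k then path_scalar ex_quiver c x else 0 else 0)"
    by (rule ex_coeff_sum) (use path_scalar_supp[of ex_quiver c] in auto)
  also have "(\<Sum>x\<in>(\<lambda>v. (v, [], v)) ` {1..9}. if path_source x = i \<and> path_target x = k then path_scalar ex_quiver c x else 0) =
    (\<Sum>v\<in>{1..9}. if v = i then (if i = k then c else 0) else 0)"
    unfolding sum.reindex[OF inj] o_def
    by (intro sum.cong refl) (auto simp: path_scalar_def)
  finally show ?thesis using mem by (auto simp: sum.delta)
qed

text \<open>Normal forms: of the two sides of the commutativity relations, bd and dgi are kept, and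
  cf and ej are rewritten to them. Trivial paths fall under the default \<open>[]\<close>.\<close>

fun ex_path :: "nat \<Rightarrow> nat \<Rightarrow> arrow list" where
  "ex_path i k = (case map_of [((1,3),[arr_a]),((1,5),[arr_a,arr_d]),((1,9),[arr_a,arr_d,arr_h]),
     ((2,3),[arr_b]),((2,4),[arr_c]),((2,5),[arr_b,arr_d]),((2,6),[arr_b,arr_d,arr_g]),
     ((2,7),[arr_b,arr_e]),((2,8),[arr_b,arr_d,arr_g,arr_i]),
     ((3,5),[arr_d]),((3,6),[arr_d,arr_g]),((3,7),[arr_e]),((3,8),[arr_d,arr_g,arr_i]),((3,9),[arr_d,arr_h]),
     ((4,5),[arr_f]),((4,6),[arr_f,arr_g]),((4,8),[arr_f,arr_g,arr_i]),
     ((5,6),[arr_g]),((5,8),[arr_g,arr_i]),((5,9),[arr_h]),((6,8),[arr_i]),((7,8),[arr_j])] (i, k)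
   of None \<Rightarrow> [] | Some p \<Rightarrow> p)"

declare ex_path.simps [simp del]

text \<open>The value 0 outside \<open>ex_pairs\<close> lets \<open>ex_path_class\<close> treat
  killed and surviving paths alike.\<close>

definition ex_basis :: "nat \<Rightarrow> nat \<Rightarrow> (nat, arrow) path \<Rightarrow> 'k::field" where
  "ex_basis i k = (if (i, k) \<in> ex_pairs then path_delta (i, ex_path i k, k) else (\<lambda>_. 0))"

lemma ex_path_algebra_minus:
  assumes f: "f \<in> carrier ex_path_algebra" and g: "g \<in> carrier ex_path_algebra"
  shows "f \<ominus>\<^bsub>ex_path_algebra\<^esub> g = (\<lambda>z. f z - g z)"
proof -
  have "(\<lambda>z. - g z) \<in> carrier ex_path_algebra" using g by (simp add: ex_path_algebra_simps)
  then have "\<ominus>\<^bsub>ex_path_algebra\<^esub> g = (\<lambda>z. - g z)"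
    by (intro KQ.minus_equality) (use g in \<open>auto simp: ex_path_algebra_simps\<close>)
  then show ?thesis by (simp add: a_minus_def ex_path_algebra_simps)
qed

lemma ex_mult_delta:
  "path_delta x \<otimes>\<^bsub>ex_path_algebra\<^esub> path_delta y =
    (if path_target x = path_source y then path_delta (path_comp x y) else (\<lambda>z. 0))"
  unfolding ex_path_algebra_def by (rule path_delta_mult)

lemmas ex_delta_closed = path_delta_closed[of _ ex_quiver, folded ex_path_algebra_def]

lemma ex_path_in_paths:
  "pre_digraph.cas ex_quiver u p v \<Longrightarrow> u \<in> {1..9} \<Longrightarrow> (u, p, v) \<in> paths ex_quiver"
  by (simp add: paths_def pre_digraph.awalk_def)

lemma ex_basis_path:
  assumes "(i, k) \<in> ex_pairs"
  shows "(i, ex_path i k, k) \<in> paths ex_quiver"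
proof -
  have "\<forall>(i, k)\<in>ex_pairs. 1 \<le> i \<and> i \<le> 9"
    by code_simp
  moreover have "pre_digraph.cas ex_quiver i (ex_path i k) k"
    using assms unfolding ex_pairs_def by (elim insertE) (simp_all add: ex_path.simps pre_digraph.cas.simps)
  ultimately show ?thesis using assms by (intro ex_path_in_paths) auto
qed

lemma ex_basis_closed: "ex_basis i k \<in> carrier ex_path_algebra"
proof (cases "(i, k) \<in> ex_pairs")
  case True
  then show ?thesis using ex_delta_closed[OF ex_basis_path] by (simp add: ex_basis_def)
next
  case False
  then show ?thesis by (simp add: ex_basis_def ex_path_algebra_simps)
qed

lemma ex_relations_eq:
  "ex_relations = {path_delta (1, [arr_a, arr_d, arr_g], 6), path_delta (4, [arr_f, arr_h], 9),
     path_delta (1, [arr_a, arr_e], 7),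
     path_delta (2, [arr_b, arr_d], 5) \<ominus>\<^bsub>ex_path_algebra\<^esub> path_delta (2, [arr_c, arr_f], 5),
     path_delta (3, [arr_e, arr_j], 8) \<ominus>\<^bsub>ex_path_algebra\<^esub> path_delta (3, [arr_d, arr_g, arr_i], 8)}"
  by (simp add: ex_relations_def arrow_path_def path_delta_def)

lemma ex_delta_path_closed:
  "pre_digraph.cas ex_quiver u p v \<Longrightarrow> u \<in> {1..9} \<Longrightarrow> path_delta (u, p, v) \<in> carrier ex_path_algebra"
  by (intro ex_delta_closed ex_path_in_paths)

lemma ex_relations_closed:
  "ex_relations \<subseteq> carrier (ex_path_algebra :: ((nat, arrow) path \<Rightarrow> 'k::field) ring)"
  by (simp add: ex_relations_eq ex_delta_path_closed pre_digraph.cas.simps)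

section \<open>Residue classes of paths\<close>

lemma ex_ideal: "ideal ex_ideal (ex_path_algebra :: ((nat, arrow) path \<Rightarrow> 'k::field) ring)"
  unfolding ex_ideal_def by (rule KQ.genideal_ideal[OF ex_relations_closed])

definition ex_class :: "((nat, arrow) path \<Rightarrow> 'k::field) \<Rightarrow> ((nat, arrow) path \<Rightarrow> 'k) set" where
  "ex_class f = ex_ideal +>\<^bsub>ex_path_algebra\<^esub> f"

lemma ex_class_hom: "ex_class \<in> ring_hom ex_path_algebra ex_algebra"
  unfolding ex_class_def[abs_def] ex_algebra_def by (rule ideal.rcos_ring_hom[OF ex_ideal])

lemmas ex_class_mult = ring_hom_mult[OF ex_class_hom]
lemmas ex_class_add = ring_hom_add[OF ex_class_hom]
lemmas ex_class_one = ring_hom_one[OF ex_class_hom]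

lemma carrier_ex_algebra: "carrier ex_algebra = ex_class ` carrier ex_path_algebra"
  by (auto simp: ex_algebra_def FactRing_def A_RCOSETS_def' ex_class_def)

interpretation EA: ring "ex_algebra :: ((nat, arrow) path \<Rightarrow> 'k::field) set ring"
  unfolding ex_algebra_def by (rule ideal.quotient_is_ring[OF ex_ideal])

lemma ex_class_eq_iff:
  assumes "f \<in> carrier ex_path_algebra" "g \<in> carrier ex_path_algebra"
  shows "ex_class f = ex_class g \<longleftrightarrow> f \<ominus>\<^bsub>ex_path_algebra\<^esub> g \<in> ex_ideal"
  unfolding ex_class_def by (rule KQ.quotient_eq_iff_same_a_r_cos[OF ex_ideal assms, symmetric])

lemma ex_zero_closed: "(\<lambda>_. 0) \<in> carrier ex_path_algebra"
  by (simp add: ex_path_algebra_simps)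

lemma ex_class_eq_zero:
  assumes f: "f \<in> carrier ex_path_algebra"
  shows "ex_class f = ex_class (\<lambda>_. 0) \<longleftrightarrow> f \<in> ex_ideal"
  by (subst ex_class_eq_iff[OF f ex_zero_closed]) (simp add: ex_path_algebra_minus[OF f ex_zero_closed])

abbreviation ex_path_class :: "nat \<Rightarrow> arrow list \<Rightarrow> nat \<Rightarrow> ((nat, arrow) path \<Rightarrow> 'k::field) set" where
  "ex_path_class u p v \<equiv> ex_class (path_delta (u, p, v))"

abbreviation ex_zero_class :: "((nat, arrow) path \<Rightarrow> 'k::field) set" where
  "ex_zero_class \<equiv> ex_class (\<lambda>_. 0)"

lemma ex_path_class_append:
  assumes "pre_digraph.cas ex_quiver u p v" "pre_digraph.cas ex_quiver v q w" "u \<in> {1..9}" "v \<in> {1..9}"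
  shows "ex_path_class u p v \<otimes>\<^bsub>ex_algebra\<^esub> ex_path_class v q w = ex_path_class u (p @ q) w"
  using assms by (simp add: ex_class_mult[symmetric] ex_delta_path_closed ex_mult_delta)

lemma ex_zero_class: "(ex_zero_class :: ((nat, arrow) path \<Rightarrow> 'k::field) set) = \<zero>\<^bsub>ex_algebra\<^esub>"
proof -
  have "ex_zero_class \<oplus>\<^bsub>ex_algebra\<^esub> ex_zero_class = (ex_zero_class :: ((nat, arrow) path \<Rightarrow> 'k) set)"
    by (simp add: ex_class_add[symmetric] ex_zero_closed) (simp add: ex_path_algebra_simps)
  moreover have "(ex_zero_class :: ((nat, arrow) path \<Rightarrow> 'k) set) \<in> carrier ex_algebra"
    by (simp add: carrier_ex_algebra ex_zero_closed)
  ultimately show ?thesis by (metis EA.add.l_cancel_one')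
qed

lemma ex_path_class_closed:
  "pre_digraph.cas ex_quiver u p v \<Longrightarrow> u \<in> {1..9} \<Longrightarrow> ex_path_class u p v \<in> carrier ex_algebra"
  by (simp add: carrier_ex_algebra ex_delta_path_closed)

text \<open>Besides the generators these are the consequences that occur when an arrow is put in
  front of a normal form; \<open>ex_arrow_basis\<close> rewrites with exactly them.\<close>

lemma ex_class_relations:
  defines "c \<equiv> (ex_path_class :: _ \<Rightarrow> _ \<Rightarrow> _ \<Rightarrow> ((nat, arrow) path \<Rightarrow> 'k::field) set)"
  shows "c 1 [arr_a, arr_d, arr_g] 6 = ex_zero_class" "c 4 [arr_f, arr_h] 9 = ex_zero_class"
    "c 1 [arr_a, arr_e] 7 = ex_zero_class"
    "c 2 [arr_c, arr_f] 5 = c 2 [arr_b, arr_d] 5"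
    "c 3 [arr_e, arr_j] 8 = c 3 [arr_d, arr_g, arr_i] 8"
    "c 1 [arr_a, arr_d, arr_g, arr_i] 8 = ex_zero_class"
    "c 2 [arr_b, arr_d, arr_h] 9 = ex_zero_class"
    "c 2 [arr_c, arr_f, arr_g] 6 = c 2 [arr_b, arr_d, arr_g] 6"
    "c 2 [arr_c, arr_f, arr_g, arr_i] 8 = c 2 [arr_b, arr_d, arr_g, arr_i] 8"
proof -
  note cl = ex_delta_path_closed[unfolded One_nat_def] and cas = pre_digraph.cas.simps
  have rel: "ex_relations \<subseteq> (ex_ideal :: ((nat, arrow) path \<Rightarrow> 'k) set)"
    unfolding ex_ideal_def by (rule KQ.genideal_self[OF ex_relations_closed])
  show r1: "c 1 [arr_a, arr_d, arr_g] 6 = ex_zero_class" and r2: "c 4 [arr_f, arr_h] 9 = ex_zero_class"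
    and r3: "c 1 [arr_a, arr_e] 7 = ex_zero_class"
    unfolding c_def by (subst ex_class_eq_zero; use rel in \<open>simp add: cl cas ex_relations_eq\<close>)+
  show r4: "c 2 [arr_c, arr_f] 5 = c 2 [arr_b, arr_d] 5"
    unfolding c_def by (rule sym, subst ex_class_eq_iff; use rel in \<open>simp add: cl cas ex_relations_eq\<close>)
  show r5: "c 3 [arr_e, arr_j] 8 = c 3 [arr_d, arr_g, arr_i] 8"
    unfolding c_def by (subst ex_class_eq_iff; use rel in \<open>simp add: cl cas ex_relations_eq\<close>)
  have app: "c u (p @ q) w = c u p v \<otimes>\<^bsub>ex_algebra\<^esub> c v q w"
    if "pre_digraph.cas ex_quiver u p v" "pre_digraph.cas ex_quiver v q w" "u \<in> {1..9}" "v \<in> {1..9}"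
    for u v w p q unfolding c_def by (rule ex_path_class_append[OF that, symmetric])
  have closed: "c u p v \<in> carrier ex_algebra" if "pre_digraph.cas ex_quiver u p v" "u \<in> {1..9}" for u v p
    using ex_path_class_closed[OF that] by (simp add: c_def)
  show "c 1 [arr_a, arr_d, arr_g, arr_i] 8 = ex_zero_class"
    using app[of 1 "[arr_a, arr_d, arr_g]" 6 "[arr_i]" 8] r1 closed[of 6 "[arr_i]" 8]
    by (simp add: cas ex_zero_class)
  \<comment> \<open>Two relations act together here: bd is replaced by cf, and then fh = 0
    applies.\<close>
  have "c 2 [arr_b, arr_d, arr_h] 9 = c 2 [arr_c, arr_f, arr_h] 9"
    using app[of 2 "[arr_b, arr_d]" 5 "[arr_h]" 9] app[of 2 "[arr_c, arr_f]" 5 "[arr_h]" 9] r4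
    by (simp add: cas)
  also have "\<dots> = ex_zero_class"
    using app[of 2 "[arr_c]" 4 "[arr_f, arr_h]" 9] r2 closed[of 2 "[arr_c]" 4]
    by (simp add: cas ex_zero_class)
  finally show "c 2 [arr_b, arr_d, arr_h] 9 = ex_zero_class" .
  show "c 2 [arr_c, arr_f, arr_g] 6 = c 2 [arr_b, arr_d, arr_g] 6"
    using app[of 2 "[arr_b, arr_d]" 5 "[arr_g]" 6] app[of 2 "[arr_c, arr_f]" 5 "[arr_g]" 6] r4
    by (simp add: cas)
  show "c 2 [arr_c, arr_f, arr_g, arr_i] 8 = c 2 [arr_b, arr_d, arr_g, arr_i] 8"
    using app[of 2 "[arr_b, arr_d]" 5 "[arr_g, arr_i]" 8] app[of 2 "[arr_c, arr_f]" 5 "[arr_g, arr_i]" 8] r4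
    by (simp add: cas)
qed

lemma ex_arrow_basis:
  assumes "(snd (arrow_ends e), v) \<in> ex_pairs"
  shows "ex_path_class (fst (arrow_ends e)) (e # ex_path (snd (arrow_ends e)) v) v =
    (ex_class (ex_basis (fst (arrow_ends e)) v) :: ((nat, arrow) path \<Rightarrow> 'k::field) set)"
  using assms
  by (cases e)
    (auto simp: ex_pairs_def ex_basis_def ex_path.simps ex_class_relations[unfolded One_nat_def])

lemma ex_arrow_unreachable:
  assumes "(snd (arrow_ends e), v) \<in> ex_reachable" "(snd (arrow_ends e), v) \<notin> ex_pairs"
  shows "(fst (arrow_ends e), v) \<notin> ex_pairs"
  using assms by (cases e) (auto simp: ex_pairs_def ex_reachable_def)

text \<open>A path is reduced from its end: the first arrow is put in front of the normal form of
  the rest. If the rest is killed, \<open>ex_arrow_unreachable\<close> shows that the whole path is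
  killed too.\<close>

lemma ex_path_class:
  assumes "pre_digraph.cas ex_quiver u p v" "u \<in> {1..9}"
  shows "ex_path_class u p v = (ex_class (ex_basis u v) :: ((nat, arrow) path \<Rightarrow> 'k::field) set)"
  using assms
proof (induction p arbitrary: u)
  case Nil
  then have "u = v" "v \<in> {1,2,3,4,5,6,7,8,9}"
    by (auto simp: pre_digraph.cas.simps ex_vertices[symmetric])
  then show ?case by (auto simp: ex_basis_def ex_pairs_def ex_path.simps)
next
  case (Cons e p)
  define w where "w = snd (arrow_ends e)"
  have u: "u = fst (arrow_ends e)" and cas: "pre_digraph.cas ex_quiver w p v"
    and w: "w \<in> {1..9}" and cas1: "pre_digraph.cas ex_quiver u [e] w"
    using Cons.prems ex_quiver_head by (auto simp: pre_digraph.cas.simps w_def)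
  have e: "path_delta (u, [e], w) \<in> carrier (ex_path_algebra :: ((nat, arrow) path \<Rightarrow> 'k) ring)"
    by (rule ex_delta_path_closed[OF cas1 Cons.prems(2)])
  have "ex_path_class u (e # p) v =
      ex_path_class u [e] w \<otimes>\<^bsub>ex_algebra\<^esub> (ex_path_class w p v :: ((nat, arrow) path \<Rightarrow> 'k) set)"
    by (simp add: ex_path_class_append[OF cas1 cas Cons.prems(2) w])
  also have "\<dots> = ex_class (path_delta (u, [e], w) \<otimes>\<^bsub>ex_path_algebra\<^esub> ex_basis w v)"
    using e by (simp add: Cons.IH[OF cas w] ex_class_mult ex_basis_closed)
  also have "\<dots> = ex_class (ex_basis u v)"
  proof (cases "(w, v) \<in> ex_pairs")
    case True
    then have b: "ex_basis w v = (path_delta (w, ex_path w v, v) :: _ \<Rightarrow> 'k)" by (simp add: ex_basis_def)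
    show ?thesis
      unfolding b using True by (simp add: ex_mult_delta w_def u ex_arrow_basis)
  next
    case False
    then have "(u, v) \<notin> ex_pairs"
      using ex_cas_reachable[OF cas w] ex_arrow_unreachable[of e v] by (simp add: w_def u)
    with False show ?thesis
      using KQ.r_null[OF e] by (simp add: ex_basis_def ex_path_algebra_simps)
  qed
  finally show ?case .
qed

text \<open>The closedness claims belong to the conclusion because additivity of
  \<open>ex_class\<close> needs them in each step of the induction.\<close>

lemma ex_class_sum_cong:
  fixes g g' :: "(nat, arrow) path \<Rightarrow> (nat, arrow) path \<Rightarrow> 'k::field"
  assumes "finite F" "\<And>x. x \<in> F \<Longrightarrow> g x \<in> carrier ex_path_algebra"
    "\<And>x. x \<in> F \<Longrightarrow> g' x \<in> carrier ex_path_algebra" "\<And>x. x \<in> F \<Longrightarrow> ex_class (g x) = ex_class (g' x)"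
  shows "(\<lambda>z. \<Sum>x\<in>F. c x * g x z) \<in> carrier ex_path_algebra \<and>
     (\<lambda>z. \<Sum>x\<in>F. c x * g' x z) \<in> carrier ex_path_algebra \<and>
     ex_class (\<lambda>z. \<Sum>x\<in>F. c x * g x z) = ex_class (\<lambda>z. \<Sum>x\<in>F. c x * g' x z)"
  using assms
proof (induction F)
  case empty
  then show ?case by (simp add: ex_zero_closed)
next
  case (insert x F)
  have sc: "path_scalar ex_quiver (c x) \<in> carrier (ex_path_algebra :: ((nat, arrow) path \<Rightarrow> 'k) ring)"
    unfolding ex_path_algebra_def by (rule path_scalar_closed) simp
  have sm: "path_scalar ex_quiver (c x) \<otimes>\<^bsub>ex_path_algebra\<^esub> f = (\<lambda>z. c x * f z)"
    if "f \<in> carrier ex_path_algebra" for f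
    using that unfolding ex_path_algebra_def by (intro path_scalar_mult_left) simp_all
  have eq: "(\<lambda>z. \<Sum>x\<in>insert x F. c x * h x z) =
     path_scalar ex_quiver (c x) \<otimes>\<^bsub>ex_path_algebra\<^esub> h x \<oplus>\<^bsub>ex_path_algebra\<^esub> (\<lambda>z. \<Sum>x\<in>F. c x * h x z)"
    if "h x \<in> carrier ex_path_algebra" for h :: "(nat, arrow) path \<Rightarrow> (nat, arrow) path \<Rightarrow> 'k"
    using insert.hyps that by (simp add: sm ex_path_algebra_simps)
  have g: "g x \<in> carrier ex_path_algebra" "g' x \<in> carrier ex_path_algebra" using insert.prems by auto
  show ?case
    unfolding eq[of g, OF g(1)] eq[of g', OF g(2)]
    using insert sc g by (simp add: ex_class_add ex_class_mult)
qed

text \<open>Replacing each path in \<open>f\<close> by the normal form with the same endpoints does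
  not change the class of \<open>f\<close>, and the resulting combination has the numbers
  \<open>ex_coeff f i k\<close> as coefficients.\<close>

lemma ex_coeff_kernel:
  fixes f :: "(nat, arrow) path \<Rightarrow> 'k::field"
  assumes f: "f \<in> carrier ex_path_algebra" and ker: "\<And>i k. ex_coeff f i k = 0"
  shows "f \<in> ex_ideal"
proof -
  let ?F = "{x. f x \<noteq> 0}"
  let ?b = "\<lambda>x. ex_basis (path_source x) (path_target x)"
  have fin: "finite ?F" and sub: "?F \<subseteq> paths ex_quiver" using f by (auto simp: ex_path_algebra_simps)
  have cls: "ex_class (path_delta x) = (ex_class (?b x) :: ((nat, arrow) path \<Rightarrow> 'k) set)" if "x \<in> ?F" for x
  proof -
    obtain u p v where x: "x = (u, p, v)" by (cases x)
    then have "pre_digraph.cas ex_quiver u p v" "u \<in> {1..9}"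
      using that sub by (auto simp: paths_def pre_digraph.awalk_def)
    then show ?thesis by (simp only: x path_source.simps path_target.simps ex_path_class)
  qed
  have "(\<lambda>z. \<Sum>x\<in>?F. f x * path_delta x z) = f"
  proof
    fix z
    have "(\<Sum>x\<in>?F. f x * path_delta x z) = (\<Sum>x\<in>?F. if z = x then f x else 0)"
      by (intro sum.cong refl) (auto simp: path_delta_def)
    then show "(\<Sum>x\<in>?F. f x * path_delta x z) = f z" using fin by (simp add: sum.delta)
  qed
  \<comment> \<open>Terms are collected by their endpoints; the factor in front of
    \<open>ex_basis i k\<close> is \<open>ex_coeff f i k\<close>.\<close>
  moreover have "(\<lambda>z. \<Sum>x\<in>?F. f x * ?b x z) = (\<lambda>_. 0)"
  proof
    fix z :: "(nat, arrow) path"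
    obtain i p k where z: "z = (i, p, k)" by (cases z)
    have "(\<Sum>x\<in>?F. f x * ?b x z) = (\<Sum>x\<in>?F. if path_source x = i \<and> path_target x = k then f x * ex_basis i k z else 0)"
      by (intro sum.cong refl) (auto simp: ex_basis_def path_delta_def z)
    also have "\<dots> = (\<Sum>x\<in>?F. if path_source x = i \<and> path_target x = k then f x else 0) * ex_basis i k z"
      unfolding sum_distrib_right by (intro sum.cong refl) auto
    also have "\<dots> = 0"
      using ker[of i k] by (auto simp: ex_coeff_sum[OF fin order_refl] ex_basis_def split: if_splits)
    finally show "(\<Sum>x\<in>?F. f x * ?b x z) = 0" .
  qed
  moreover have d: "path_delta x \<in> carrier (ex_path_algebra :: ((nat, arrow) path \<Rightarrow> 'k) ring)" if "x \<in> ?F" for x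
    using that sub by (intro ex_delta_closed) auto
  then have "ex_class (\<lambda>z. \<Sum>x\<in>?F. f x * path_delta x z) = ex_class (\<lambda>z. \<Sum>x\<in>?F. f x * ?b x z)"
    by (intro ex_class_sum_cong[OF fin, THEN conjunct2, THEN conjunct2] d ex_basis_closed cls)
  ultimately have "ex_class f = ex_zero_class" by simp
  then show ?thesis using ex_class_eq_zero[OF f] by simp
qed

section \<open>Coordinates of residue classes\<close>

lemma ex_coeff_zero: "ex_coeff (\<lambda>_. 0) i k = 0"
  by (simp add: ex_coeff_def)

lemma ex_coeff_uminus: "ex_coeff (\<lambda>x. - f x) i k = - ex_coeff f i k"
  by (simp add: ex_coeff_def sum_negf)

lemma ex_coeff_minus:
  assumes "f \<in> carrier ex_path_algebra" "g \<in> carrier ex_path_algebra"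
  shows "ex_coeff (f \<ominus>\<^bsub>ex_path_algebra\<^esub> g) i k = ex_coeff f i k - ex_coeff g i k"
proof -
  have n: "(\<lambda>x. - g x) \<in> carrier ex_path_algebra" using assms by (simp add: ex_path_algebra_simps)
  have "f \<ominus>\<^bsub>ex_path_algebra\<^esub> g = f \<oplus>\<^bsub>ex_path_algebra\<^esub> (\<lambda>x. - g x)"
    using assms by (simp add: ex_path_algebra_minus ex_path_algebra_simps)
  then show ?thesis using ex_coeff_add[OF assms(1) n] by (simp add: ex_coeff_uminus)
qed

text \<open>By multiplicativity the functions with vanishing coefficients form an ideal, and the
  five relations belong to it.\<close>

lemma ex_ideal_coeff:
  fixes f :: "(nat, arrow) path \<Rightarrow> 'k::field"
  assumes "f \<in> ex_ideal"
  shows "ex_coeff f i k = 0"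
proof -
  let ?R = "ex_path_algebra :: ((nat, arrow) path \<Rightarrow> 'k) ring"
  let ?K = "{f \<in> carrier ?R. \<forall>i k. ex_coeff f i k = 0}"
  have m: "(i, k) \<notin> ex_pairs \<Longrightarrow> ex_coeff f i k = 0" for f :: "(nat, arrow) path \<Rightarrow> 'k" and i k
    by (simp add: ex_coeff_def)
  have "ideal ?K ?R"
  proof (rule idealI[OF KQ.ring_axioms])
    show "subgroup ?K (add_monoid ?R)"
    proof (rule KQ.add.subgroupI)
      show "?K \<noteq> {}" using ex_zero_closed ex_coeff_zero by blast
      fix a assume a: "a \<in> ?K"
      then have "\<ominus>\<^bsub>?R\<^esub> a = \<zero>\<^bsub>?R\<^esub> \<ominus>\<^bsub>?R\<^esub> a" by (simp add: a_minus_def)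
      then have "ex_coeff (\<ominus>\<^bsub>?R\<^esub> a) i k = 0" for i k
        using a ex_coeff_minus[OF KQ.zero_closed, of a] by (simp add: ex_path_algebra_simps(3) ex_coeff_zero)
      with a show "\<ominus>\<^bsub>?R\<^esub> a \<in> ?K" by simp
    qed (auto simp: ex_coeff_add)
  next
    fix a x assume a: "a \<in> ?K" and x: "x \<in> carrier ?R"
    show "x \<otimes>\<^bsub>?R\<^esub> a \<in> ?K"
    proof (clarsimp simp: a x KQ.m_closed, intro conjI allI)
      show "x \<otimes>\<^bsub>?R\<^esub> a \<in> carrier ?R" using a x by simp
      show "ex_coeff (x \<otimes>\<^bsub>?R\<^esub> a) i k = 0" for i k
        using a x by (cases "(i, k) \<in> ex_pairs") (simp_all add: ex_coeff_mult m)
    qed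
    show "a \<otimes>\<^bsub>?R\<^esub> x \<in> ?K"
    proof (clarsimp simp: a x KQ.m_closed, intro conjI allI)
      show "a \<otimes>\<^bsub>?R\<^esub> x \<in> carrier ?R" using a x by simp
      show "ex_coeff (a \<otimes>\<^bsub>?R\<^esub> x) i k = 0" for i k
        using a x by (cases "(i, k) \<in> ex_pairs") (simp_all add: ex_coeff_mult m)
    qed
  qed
  moreover have "ex_relations \<subseteq> ?K"
    using ex_relations_closed
    by (auto simp: ex_relations_eq ex_coeff_minus ex_delta_path_closed[unfolded One_nat_def] pre_digraph.cas.simps ex_coeff_delta)
      (auto simp: ex_pairs_def)
  ultimately have "ex_ideal \<subseteq> ?K"
    unfolding ex_ideal_def by (rule KQ.genideal_minimal)
  with assms show ?thesis by blast
qed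

definition ex_coord :: "((nat, arrow) path \<Rightarrow> 'k::field) set \<Rightarrow> nat \<Rightarrow> nat \<Rightarrow> 'k" where
  "ex_coord X = ex_coeff (SOME f. f \<in> carrier ex_path_algebra \<and> ex_class f = X)"

lemma ex_coord_class:
  assumes f: "f \<in> carrier ex_path_algebra"
  shows "ex_coord (ex_class f) = ex_coeff f"
proof -
  define g where "g = (SOME g. g \<in> carrier ex_path_algebra \<and> ex_class g = ex_class f)"
  have g: "g \<in> carrier ex_path_algebra" "ex_class g = ex_class f"
    using someI[of "\<lambda>g. g \<in> carrier ex_path_algebra \<and> ex_class g = ex_class f" f] f
    by (auto simp: g_def)
  then have "g \<ominus>\<^bsub>ex_path_algebra\<^esub> f \<in> ex_ideal" using ex_class_eq_iff[OF g(1) f] by simp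
  then have "ex_coeff g = ex_coeff f"
    using ex_ideal_coeff ex_coeff_minus[OF g(1) f] by (metis eq_iff_diff_eq_0 ext)
  then show ?thesis by (simp add: ex_coord_def g_def)
qed

lemma ex_coord_inj:
  assumes "X \<in> carrier ex_algebra" "Y \<in> carrier ex_algebra" "ex_coord X = ex_coord Y"
  shows "X = Y"
proof -
  obtain f g where fg: "f \<in> carrier ex_path_algebra" "X = ex_class f" "g \<in> carrier ex_path_algebra" "Y = ex_class g"
    using assms by (auto simp: carrier_ex_algebra)
  then have "f \<ominus>\<^bsub>ex_path_algebra\<^esub> g \<in> ex_ideal"
    using assms(3) by (intro ex_coeff_kernel) (simp_all add: ex_coord_class ex_coeff_minus)
  then show ?thesis using ex_class_eq_iff fg by blast
qed

text \<open>The preimage is the combination of the normal forms with the entries of \<open>m\<close>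
  as coefficients.\<close>

lemma ex_coord_surj:
  assumes "\<And>i k. (i, k) \<notin> ex_pairs \<Longrightarrow> m i k = 0"
  shows "\<exists>X\<in>carrier ex_algebra. ex_coord X = m"
proof -
  let ?P = "(\<lambda>(i, k). (i, ex_path i k, k)) ` ex_pairs"
  define f where "f = (\<lambda>x. if x \<in> ?P then m (path_source x) (path_target x) else 0)"
  have fin: "finite ?P" by (simp add: ex_pairs_def)
  have sub: "{x. f x \<noteq> 0} \<subseteq> ?P" by (auto simp: f_def split: if_splits)
  then have f: "f \<in> carrier ex_path_algebra"
    using finite_subset[OF sub fin] ex_basis_path by (force simp: ex_path_algebra_simps)
  have "ex_coeff f i k = m i k" for i k
  proof (cases "(i, k) \<in> ex_pairs")
    case True
    have "(\<Sum>x\<in>?P. if path_source x = i \<and> path_target x = k then f x else 0) =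
      (\<Sum>x\<in>?P. if x = (i, ex_path i k, k) then m i k else 0)"
      by (intro sum.cong refl) (auto simp: f_def)
    also have "\<dots> = m i k" using True by (subst sum.delta[OF fin]) (auto intro: rev_image_eqI)
    finally show ?thesis using True by (simp add: ex_coeff_sum[OF fin sub])
  qed (use assms in \<open>simp add: ex_coeff_def\<close>)
  then show ?thesis using f
    by (intro bexI[of _ "ex_class f"]) (auto simp: carrier_ex_algebra ex_coord_class)
qed

lemma ex_unit_map_class: "ex_unit_map c = ex_class (path_scalar ex_quiver c)"
  by (simp add: ex_unit_map_def ex_class_def)

lemma path_scalar_ex_closed: "path_scalar ex_quiver c \<in> carrier ex_path_algebra"
  unfolding ex_path_algebra_def by (rule path_scalar_closed) simp

lemma ex_coord_mult:
  assumes "X \<in> carrier ex_algebra" "Y \<in> carrier ex_algebra" "(i, k) \<in> ex_pairs"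
  shows "ex_coord (X \<otimes>\<^bsub>ex_algebra\<^esub> Y) i k = (\<Sum>j\<in>{1..9}. ex_coord X i j * ex_coord Y j k)"
  using assms
  by (auto simp: carrier_ex_algebra ex_class_mult[symmetric] ex_coord_class ex_coeff_mult KQ.m_closed)

lemma ex_coord_add:
  assumes "X \<in> carrier ex_algebra" "Y \<in> carrier ex_algebra"
  shows "ex_coord (X \<oplus>\<^bsub>ex_algebra\<^esub> Y) i k = ex_coord X i k + ex_coord Y i k"
  using assms
  by (auto simp: carrier_ex_algebra ex_class_add[symmetric] ex_coord_class ex_coeff_add KQ.a_closed)

lemma ex_coord_unit:
  "ex_unit_map c \<in> carrier ex_algebra"
  "ex_coord (ex_unit_map c) i k = (if i = k \<and> i \<in> {1..9} then c else 0)"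
  by (simp_all add: ex_unit_map_class carrier_ex_algebra path_scalar_ex_closed ex_coord_class ex_coeff_scalar)

lemma ex_unit_map_one: "ex_unit_map 1 = \<one>\<^bsub>ex_algebra\<^esub>"
  by (simp add: ex_unit_map_class ex_class_one[symmetric] ex_path_algebra_simps)

lemma ex_coord_supp:
  assumes "X \<in> carrier ex_algebra" "(i, k) \<notin> ex_pairs"
  shows "ex_coord X i k = 0"
  using assms by (auto simp: carrier_ex_algebra ex_coord_class ex_coeff_def)

section \<open>Right modules\<close>

lemma (in right_module) smult_zero_left: "x \<in> carrier M \<Longrightarrow> \<zero>\<^bsub>R\<^esub> \<odot>\<^bsub>M\<^esub> x = \<zero>\<^bsub>M\<^esub>"
  using r_smult_ring_distr[of "\<zero>\<^bsub>R\<^esub>" "\<zero>\<^bsub>R\<^esub>" x] r_smult_closed[of "\<zero>\<^bsub>R\<^esub>" x]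
  by (metis M.add.l_cancel_one' R.l_zero R.zero_closed)

lemma (in right_module) smult_zero_right: "r \<in> carrier R \<Longrightarrow> r \<odot>\<^bsub>M\<^esub> \<zero>\<^bsub>M\<^esub> = \<zero>\<^bsub>M\<^esub>"
  using r_smult_module_distr[of r "\<zero>\<^bsub>M\<^esub>" "\<zero>\<^bsub>M\<^esub>"] r_smult_closed[of r "\<zero>\<^bsub>M\<^esub>"]
  by (metis M.add.l_cancel_one' M.l_zero M.zero_closed)

lemma (in right_module) smult_minus_right:
  assumes "r \<in> carrier R" "x \<in> carrier M"
  shows "r \<odot>\<^bsub>M\<^esub> (\<ominus>\<^bsub>M\<^esub> x) = \<ominus>\<^bsub>M\<^esub> (r \<odot>\<^bsub>M\<^esub> x)"
proof -
  have "r \<odot>\<^bsub>M\<^esub> (\<ominus>\<^bsub>M\<^esub> x) \<oplus>\<^bsub>M\<^esub> r \<odot>\<^bsub>M\<^esub> x = \<zero>\<^bsub>M\<^esub>"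
    using assms by (simp add: r_smult_module_distr[symmetric] M.l_neg smult_zero_right)
  then show ?thesis using assms by (metis M.a_inv_closed M.minus_equality r_smult_closed)
qed

lemma (in abelian_group) minus_eq_zero_iff:
  assumes "x \<in> carrier G" "y \<in> carrier G"
  shows "x \<ominus> y = \<zero> \<longleftrightarrow> x = y"
proof
  assume "x \<ominus> y = \<zero>"
  then have "x \<oplus> \<ominus> y = \<zero>" by (simp add: a_minus_def)
  then have "\<ominus> (\<ominus> y) = x" using assms by (intro minus_equality) auto
  then show "x = y" using assms by simp
qed (use assms in \<open>simp add: a_minus_def r_neg\<close>)

lemma rmod_homI:
  assumes "\<And>x. x \<in> carrier M \<Longrightarrow> f x \<in> carrier N"
    "\<And>x y. x \<in> carrier M \<Longrightarrow> y \<in> carrier M \<Longrightarrow> f (x \<oplus>\<^bsub>M\<^esub> y) = f x \<oplus>\<^bsub>N\<^esub> f y"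
    "\<And>r x. r \<in> carrier R \<Longrightarrow> x \<in> carrier M \<Longrightarrow> f (r \<odot>\<^bsub>M\<^esub> x) = r \<odot>\<^bsub>N\<^esub> f x"
  shows "f \<in> rmod_hom R M N"
  using assms by (auto simp: rmod_hom_def)

lemma rmod_homD:
  assumes "f \<in> rmod_hom R M N"
  shows "x \<in> carrier M \<Longrightarrow> f x \<in> carrier N"
    "x \<in> carrier M \<Longrightarrow> y \<in> carrier M \<Longrightarrow> f (x \<oplus>\<^bsub>M\<^esub> y) = f x \<oplus>\<^bsub>N\<^esub> f y"
    "r \<in> carrier R \<Longrightarrow> x \<in> carrier M \<Longrightarrow> f (r \<odot>\<^bsub>M\<^esub> x) = r \<odot>\<^bsub>N\<^esub> f x"
  using assms by (auto simp: rmod_hom_def)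

lemma right_module_groups:
  assumes "right_module R M"
  shows "ring R" "abelian_group M"
  using assms by (simp_all add: right_module_def)

lemma rmod_hom_zero:
  assumes "right_module R M" "right_module R N" "f \<in> rmod_hom R M N"
  shows "f \<zero>\<^bsub>M\<^esub> = \<zero>\<^bsub>N\<^esub>"
proof -
  interpret M: abelian_group M using assms by (simp add: right_module_groups)
  interpret N: abelian_group N using assms(2) by (simp add: right_module_groups)
  have "f \<zero>\<^bsub>M\<^esub> \<oplus>\<^bsub>N\<^esub> f \<zero>\<^bsub>M\<^esub> = f \<zero>\<^bsub>M\<^esub>"
    using rmod_homD(2)[OF assms(3), of "\<zero>\<^bsub>M\<^esub>" "\<zero>\<^bsub>M\<^esub>"] by simp
  then show ?thesis
    using rmod_homD(1)[OF assms(3), of "\<zero>\<^bsub>M\<^esub>"] by (metis M.zero_closed N.add.l_cancel_one')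
qed

lemma rmod_hom_minus:
  assumes "right_module R M" "right_module R N" "f \<in> rmod_hom R M N" "x \<in> carrier M"
  shows "f (\<ominus>\<^bsub>M\<^esub> x) = \<ominus>\<^bsub>N\<^esub> f x"
proof -
  interpret M: abelian_group M using assms by (simp add: right_module_groups)
  interpret N: abelian_group N using assms(2) by (simp add: right_module_groups)
  have "f (\<ominus>\<^bsub>M\<^esub> x) \<oplus>\<^bsub>N\<^esub> f x = \<zero>\<^bsub>N\<^esub>"
    using rmod_homD(2)[OF assms(3), of "\<ominus>\<^bsub>M\<^esub> x" x] rmod_hom_zero[OF assms(1-3)] assms(4)
    by (simp add: M.l_neg)
  then show ?thesis
    using rmod_homD(1)[OF assms(3)] assms(4) by (metis M.a_inv_closed N.minus_equality)
qed

lemma rmod_hom_diff: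
  assumes "right_module R M" "right_module R N" "f \<in> rmod_hom R M N" "x \<in> carrier M" "y \<in> carrier M"
  shows "f (x \<ominus>\<^bsub>M\<^esub> y) = f x \<ominus>\<^bsub>N\<^esub> f y"
proof -
  interpret M: abelian_group M using assms by (simp add: right_module_groups)
  show ?thesis using assms rmod_homD(2)[OF assms(3), of x "\<ominus>\<^bsub>M\<^esub> y"]
    by (simp add: a_minus_def rmod_hom_minus)
qed

lemma rmod_hom_id: "(\<lambda>x. x) \<in> rmod_hom R M M"
  by (simp add: rmod_hom_def)

lemma rmod_hom_comp:
  assumes "f \<in> rmod_hom R M N" "g \<in> rmod_hom R N L"
  shows "(\<lambda>x. g (f x)) \<in> rmod_hom R M L"
  using rmod_homD[OF assms(1)] rmod_homD[OF assms(2)] by (intro rmod_homI) auto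

lemma rmod_hom_inj_iff:
  assumes "right_module R M" "right_module R N" "f \<in> rmod_hom R M N"
  shows "inj_on f (carrier M) \<longleftrightarrow> (\<forall>x\<in>carrier M. f x = \<zero>\<^bsub>N\<^esub> \<longrightarrow> x = \<zero>\<^bsub>M\<^esub>)"
proof -
  interpret M: abelian_group M using assms by (simp add: right_module_groups)
  interpret N: abelian_group N using assms(2) by (simp add: right_module_groups)
  show ?thesis
  proof
    assume "inj_on f (carrier M)"
    then show "\<forall>x\<in>carrier M. f x = \<zero>\<^bsub>N\<^esub> \<longrightarrow> x = \<zero>\<^bsub>M\<^esub>"
      using rmod_hom_zero[OF assms] by (metis M.zero_closed inj_onD)
  next
    assume *: "\<forall>x\<in>carrier M. f x = \<zero>\<^bsub>N\<^esub> \<longrightarrow> x = \<zero>\<^bsub>M\<^esub>"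
    show "inj_on f (carrier M)"
    proof (rule inj_onI)
      fix x y assume xy: "x \<in> carrier M" "y \<in> carrier M" "f x = f y"
      then have "f (x \<ominus>\<^bsub>M\<^esub> y) = \<zero>\<^bsub>N\<^esub>"
        using rmod_hom_diff[OF assms xy(1,2)] rmod_homD(1)[OF assms(3) xy(2)] by (simp add: N.r_neg a_minus_def)
      with * xy have "x \<ominus>\<^bsub>M\<^esub> y = \<zero>\<^bsub>M\<^esub>" by simp
      with xy show "x = y" by (simp add: M.minus_eq_zero_iff)
    qed
  qed
qed

lemma rmod_hom_eq_zero_iff:
  assumes "right_module R M" "right_module R N" "f \<in> rmod_hom R M N" "inj_on f (carrier M)" "x \<in> carrier M"
  shows "f x = \<zero>\<^bsub>N\<^esub> \<longleftrightarrow> x = \<zero>\<^bsub>M\<^esub>"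
  using rmod_hom_inj_iff[OF assms(1-3)] assms(4,5) rmod_hom_zero[OF assms(1-3)] by auto

lemma rmod_hom_inverse:
  assumes M: "right_module R M" and f: "f \<in> rmod_hom R M N" and b: "bij_betw f (carrier M) (carrier N)"
  shows "inv_into (carrier M) f \<in> rmod_hom R N M"
    "bij_betw (inv_into (carrier M) f) (carrier N) (carrier M)"
proof -
  interpret right_module R M by fact
  let ?g = "inv_into (carrier M) f"
  note fg = bij_betw_inv_into_right[OF b] and gf = bij_betw_inv_into_left[OF b]
  show bg: "bij_betw ?g (carrier N) (carrier M)" by (rule bij_betw_inv_into[OF b])
  have gc: "?g y \<in> carrier M" if "y \<in> carrier N" for y using bg that by (auto dest: bij_betw_apply)
  show "?g \<in> rmod_hom R N M"
  proof (rule rmod_homI)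
    fix x y assume xy: "x \<in> carrier N" "y \<in> carrier N"
    have "?g (f (?g x \<oplus>\<^bsub>M\<^esub> ?g y)) = ?g x \<oplus>\<^bsub>M\<^esub> ?g y" using xy gc by (intro gf) auto
    then show "?g (x \<oplus>\<^bsub>N\<^esub> y) = ?g x \<oplus>\<^bsub>M\<^esub> ?g y"
      using xy gc rmod_homD(2)[OF f] by (simp add: fg)
  next
    fix r x assume rx: "r \<in> carrier R" "x \<in> carrier N"
    have "?g (f (r \<odot>\<^bsub>M\<^esub> ?g x)) = r \<odot>\<^bsub>M\<^esub> ?g x" using rx gc by (intro gf) (auto intro: r_smult_closed)
    then show "?g (r \<odot>\<^bsub>N\<^esub> x) = r \<odot>\<^bsub>M\<^esub> ?g x"
      using rx gc rmod_homD(3)[OF f] by (simp add: fg)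
  qed (rule gc)
qed

lemma submodule_right_module:
  assumes M: "right_module R M" and L: "submodule L R M"
  shows "right_module R (M\<lparr>carrier := L\<rparr>)"
proof -
  interpret right_module R M by fact
  note D = submoduleD'[OF L]
  have neg: "\<exists>y\<in>L. y \<oplus>\<^bsub>M\<^esub> x = \<zero>\<^bsub>M\<^esub>" if "x \<in> L" for x
  proof -
    have x: "x \<in> carrier M" using that D by auto
    \<comment> \<open>Negatives are obtained as the action of -1, since \<open>submoduleD'\<close>
      lists only sums and scalar multiples.\<close>
    have "(\<ominus>\<^bsub>R\<^esub> \<one>\<^bsub>R\<^esub>) \<odot>\<^bsub>M\<^esub> x \<oplus>\<^bsub>M\<^esub> x = \<zero>\<^bsub>M\<^esub>"
      using r_smult_ring_distr[of "\<ominus>\<^bsub>R\<^esub> \<one>\<^bsub>R\<^esub>" "\<one>\<^bsub>R\<^esub>" x] x by (simp add: r_smult_one R.l_neg smult_zero_left)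
    then show ?thesis using D(4)[of "\<ominus>\<^bsub>R\<^esub> \<one>\<^bsub>R\<^esub>" x] that by auto
  qed
  have ag: "abelian_group (M\<lparr>carrier := L\<rparr>)"
    by (rule abelian_groupI) (use D neg in \<open>auto simp: subset_eq M.a_ac\<close>)
  show ?thesis
    using ag R.ring_axioms D
    by (intro right_module.intro right_module_axioms.intro)
      (auto simp: subset_eq r_smult_ring_distr r_smult_module_distr r_smult_assoc r_smult_one)
qed

lemma rmod_ker_submodule:
  assumes "right_module R M" "right_module R N" "f \<in> rmod_hom R M N"
  shows "submodule (rmod_ker M N f) R M"
proof -
  interpret M: right_module R M by fact
  interpret N: right_module R N by fact
  show ?thesis
    by (rule submoduleI'[OF assms(1)])
      (use rmod_homD[OF assms(3)] rmod_hom_zero[OF assms]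
        in \<open>auto simp: rmod_ker_def M.r_smult_closed N.smult_zero_right\<close>)
qed

lemma rmod_image_submodule:
  assumes "right_module R M" "right_module R N" "f \<in> rmod_hom R M N" "submodule L R M"
  shows "submodule (f ` L) R N"
proof -
  interpret M: right_module R M by fact
  note D = submoduleD'[OF assms(4)] and h = rmod_homD[OF assms(3)]
  show ?thesis
  proof (rule submoduleI'[OF assms(2)])
    show "\<zero>\<^bsub>N\<^esub> \<in> f ` L" using D(2) rmod_hom_zero[OF assms(1-3)] by (metis imageI)
    show "x \<oplus>\<^bsub>N\<^esub> y \<in> f ` L" if "x \<in> f ` L" "y \<in> f ` L" for x y
      using that D h(2) by (auto simp: subset_eq) (metis imageI)
    show "r \<odot>\<^bsub>N\<^esub> x \<in> f ` L" if "r \<in> carrier R" "x \<in> f ` L" for r x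
      using that D h(3) by (auto simp: subset_eq) (metis imageI)
  qed (use D h in auto)
qed

lemma carrier_submodule:
  assumes "right_module R M"
  shows "submodule (carrier M) R M"
proof -
  interpret right_module R M by fact
  show ?thesis by (rule submoduleI'[OF assms]) (auto simp: r_smult_closed)
qed

lemma zero_submodule:
  assumes "right_module R M"
  shows "submodule {\<zero>\<^bsub>M\<^esub>} R M"
proof -
  interpret right_module R M by fact
  show ?thesis by (rule submoduleI'[OF assms]) (auto simp: smult_zero_right)
qed

lemma submodule_trans:
  assumes M: "right_module R M" and L: "submodule L R M"
  shows "submodule N R (M\<lparr>carrier := L\<rparr>) \<longleftrightarrow> submodule N R M \<and> N \<subseteq> L"
proof
  assume "submodule N R (M\<lparr>carrier := L\<rparr>)"
  note D = submoduleD'[OF this, simplified] and DL = submoduleD'[OF L]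
  show "submodule N R M \<and> N \<subseteq> L" using D DL by (auto intro!: submoduleI'[OF M])
next
  assume "submodule N R M \<and> N \<subseteq> L"
  then show "submodule N R (M\<lparr>carrier := L\<rparr>)"
    using submoduleD'[of N R M] by (intro submoduleI'[OF submodule_right_module[OF M L]]) auto
qed

lemma fg_right_module_surj:
  assumes fg: "fg_right_module R M" and N: "right_module R N"
    and f: "f \<in> rmod_hom R M N" and surj: "f ` carrier M = carrier N"
  shows "fg_right_module R N"
proof -
  from fg have M: "right_module R M" by (simp add: fg_right_module_def)
  interpret M: right_module R M by fact
  interpret N: right_module R N by fact
  obtain S where S: "finite S" "S \<subseteq> carrier M"
    and gen: "\<And>L. submodule L R M \<Longrightarrow> S \<subseteq> L \<Longrightarrow> L = carrier M"
    using fg by (auto simp: fg_right_module_def)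
  note h = rmod_homD[OF f]
  have "L = carrier N" if L: "submodule L R N" "f ` S \<subseteq> L" for L
  proof -
    note D = submoduleD'[OF L(1)]
    have "submodule {x \<in> carrier M. f x \<in> L} R M"
      using D h rmod_hom_zero[OF M N f] by (intro submoduleI' M) (auto simp: M.r_smult_closed)
    with gen L(2) S(2) have "{x \<in> carrier M. f x \<in> L} = carrier M" by blast
    then have "f ` carrier M \<subseteq> L" by blast
    with D(1) surj show ?thesis by auto
  qed
  with S N surj show ?thesis
    unfolding fg_right_module_def by (intro conjI exI[of _ "f ` S"]) auto
qed

lemma fg_right_moduleD: "fg_right_module R M \<Longrightarrow> right_module R M"
  by (simp add: fg_right_module_def)

lemma projective_rmodD: "projective_rmod R P \<Longrightarrow> fg_right_module R P" "projective_rmod R P \<Longrightarrow> right_module R P"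
  by (simp_all add: projective_rmod_def fg_right_module_def)

lemma injective_rmodD: "injective_rmod R E \<Longrightarrow> fg_right_module R E" "injective_rmod R E \<Longrightarrow> right_module R E"
  by (simp_all add: injective_rmod_def fg_right_module_def)

section \<open>Lifting, extension, retracts and factorization\<close>

lemma projective_rmodI:
  fixes R :: "('a, 'r) ring_scheme"
  assumes "fg_right_module R P"
    and "\<And>(X :: 'a rmod) (Y :: 'a rmod) f g. fg_right_module R X \<Longrightarrow> fg_right_module R Y \<Longrightarrow> f \<in> rmod_hom R X Y \<Longrightarrow>
      f ` carrier X = carrier Y \<Longrightarrow> g \<in> rmod_hom R P Y \<Longrightarrow> \<exists>h\<in>rmod_hom R P X. \<forall>x\<in>carrier P. f (h x) = g x"
  shows "projective_rmod R P"
  unfolding projective_rmod_def by (intro conjI allI impI assms(1); elim conjE; rule assms(2))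

lemma injective_rmodI:
  fixes R :: "('a, 'r) ring_scheme"
  assumes "fg_right_module R E"
    and "\<And>(X :: 'a rmod) (Y :: 'a rmod) f g. fg_right_module R X \<Longrightarrow> fg_right_module R Y \<Longrightarrow> f \<in> rmod_hom R X Y \<Longrightarrow>
      inj_on f (carrier X) \<Longrightarrow> g \<in> rmod_hom R X E \<Longrightarrow> \<exists>h\<in>rmod_hom R Y E. \<forall>x\<in>carrier X. h (f x) = g x"
  shows "injective_rmod R E"
  unfolding injective_rmod_def by (intro conjI allI impI assms(1); elim conjE; rule assms(2))

text \<open>The definition of projectivity tests only modules with one type of elements. Isomorphic
  copies of \<open>X\<close> and \<open>Y\<close> extend the lifting property to all types, in
  particular to that of thin modules.\<close>

lemma projective_rmod_lift:
  fixes R :: "('a, 'r) ring_scheme" and X :: "('a, 'm) module" and Y :: "('a, 'n) module"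
  assumes P: "projective_rmod R P" and X: "fg_right_module R X" and Y: "right_module R Y"
    and f: "f \<in> rmod_hom R X Y" and surj: "f ` carrier X = carrier Y" and g: "g \<in> rmod_hom R P Y"
  obtains h where "h \<in> rmod_hom R P X" "\<And>x. x \<in> carrier P \<Longrightarrow> f (h x) = g x"
proof -
  have fgY: "fg_right_module R Y" by (rule fg_right_module_surj[OF X Y f surj])
  obtain X' :: "'a rmod" and s where X': "fg_right_module R X'" "s \<in> rmod_hom R X X'"
      "bij_betw s (carrier X) (carrier X')"
    using fg_right_module_isomorphic_copy[OF X] by blast
  obtain Y' :: "'a rmod" and t where Y': "fg_right_module R Y'" "t \<in> rmod_hom R Y Y'"
      "bij_betw t (carrier Y) (carrier Y')"
    using fg_right_module_isomorphic_copy[OF fgY] by blast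
  let ?s = "inv_into (carrier X) s"
  note s' = rmod_hom_inverse[OF fg_right_moduleD[OF X] X'(2,3)]
  have "(\<lambda>x. t (f (?s x))) \<in> rmod_hom R X' Y'" "(\<lambda>x. t (g x)) \<in> rmod_hom R P Y'"
    by (intro rmod_hom_comp[OF _ Y'(2)] rmod_hom_comp[OF s'(1) f] g)+
  moreover have "(\<lambda>x. t (f (?s x))) ` carrier X' = carrier Y'"
  proof -
    have "?s ` carrier X' = carrier X" "t ` carrier Y = carrier Y'"
      using s'(2) Y'(3) by (simp_all add: bij_betw_def)
    moreover have "(\<lambda>x. t (f (?s x))) ` carrier X' = t ` f ` ?s ` carrier X'" by (simp only: image_image)
    ultimately show ?thesis using surj by simp
  qed
  ultimately obtain h where h: "h \<in> rmod_hom R P X'" "\<And>x. x \<in> carrier P \<Longrightarrow> t (f (?s (h x))) = t (g x)"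
    using P[unfolded projective_rmod_def, THEN conjunct2, rule_format, of X' Y' "\<lambda>x. t (f (?s x))" "\<lambda>x. t (g x)"]
      X'(1) Y'(1) by blast
  show thesis
  proof
    show "(\<lambda>x. ?s (h x)) \<in> rmod_hom R P X" by (rule rmod_hom_comp[OF h(1) s'(1)])
    fix x assume x: "x \<in> carrier P"
    then have "f (?s (h x)) \<in> carrier Y" "g x \<in> carrier Y"
      using rmod_homD(1)[OF f] rmod_homD(1)[OF s'(1)] rmod_homD(1)[OF h(1)] rmod_homD(1)[OF g] by auto
    with h(2)[OF x] Y'(3) show "f (?s (h x)) = g x" by (auto simp: bij_betw_def dest: inj_onD)
  qed
qed

text \<open>As for projectivity, copies free the extension property from the type fixed in the
  definition.\<close>

lemma injective_rmod_extend:
  fixes R :: "('a, 'r) ring_scheme" and X :: "('a, 'm) module" and Y :: "('a, 'n) module"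
  assumes E: "injective_rmod R E" and X: "fg_right_module R X" and Y: "fg_right_module R Y"
    and f: "f \<in> rmod_hom R X Y" and inj: "inj_on f (carrier X)" and g: "g \<in> rmod_hom R X E"
  obtains h where "h \<in> rmod_hom R Y E" "\<And>x. x \<in> carrier X \<Longrightarrow> h (f x) = g x"
proof -
  obtain X' :: "'a rmod" and s where X': "fg_right_module R X'" "s \<in> rmod_hom R X X'"
      "bij_betw s (carrier X) (carrier X')"
    using fg_right_module_isomorphic_copy[OF X] by blast
  obtain Y' :: "'a rmod" and t where Y': "fg_right_module R Y'" "t \<in> rmod_hom R Y Y'"
      "bij_betw t (carrier Y) (carrier Y')"
    using fg_right_module_isomorphic_copy[OF Y] by blast
  let ?s = "inv_into (carrier X) s"
  note s' = rmod_hom_inverse[OF fg_right_moduleD[OF X] X'(2,3)]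
  have "(\<lambda>x. t (f (?s x))) \<in> rmod_hom R X' Y'" "(\<lambda>x. g (?s x)) \<in> rmod_hom R X' E"
    by (intro rmod_hom_comp[OF _ Y'(2)] rmod_hom_comp[OF s'(1)] f g)+
  moreover have "inj_on (\<lambda>x. t (f (?s x))) (carrier X')"
  proof (rule inj_onI)
    fix x y assume xy: "x \<in> carrier X'" "y \<in> carrier X'" "t (f (?s x)) = t (f (?s y))"
    have c: "?s x \<in> carrier X" "?s y \<in> carrier X" using xy rmod_homD(1)[OF s'(1)] by auto
    with xy have "f (?s x) = f (?s y)"
      using Y'(3) rmod_homD(1)[OF f] by (auto simp: bij_betw_def dest: inj_onD)
    with c inj have "?s x = ?s y" by (auto dest: inj_onD)
    with xy s'(2) show "x = y" by (auto simp: bij_betw_def dest: inj_onD)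
  qed
  ultimately obtain h where h: "h \<in> rmod_hom R Y' E" "\<And>x. x \<in> carrier X' \<Longrightarrow> h (t (f (?s x))) = g (?s x)"
    using E[unfolded injective_rmod_def, THEN conjunct2, rule_format, of X' Y' "\<lambda>x. t (f (?s x))" "\<lambda>x. g (?s x)"]
      X'(1) Y'(1) by blast
  show thesis
  proof
    show "(\<lambda>x. h (t x)) \<in> rmod_hom R Y E" by (rule rmod_hom_comp[OF Y'(2) h(1)])
    fix x assume x: "x \<in> carrier X"
    then have "s x \<in> carrier X'" "?s (s x) = x"
      using X'(3) rmod_homD(1)[OF X'(2)] by (auto simp: bij_betw_def)
    with h(2)[of "s x"] show "h (t (f x)) = g x" by simp
  qed
qed

lemma projective_rmod_retract:
  assumes P: "projective_rmod R P" and Q: "right_module R Q"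
    and i: "i \<in> rmod_hom R Q P" and p: "p \<in> rmod_hom R P Q" and pi: "\<And>x. x \<in> carrier Q \<Longrightarrow> p (i x) = x"
  shows "projective_rmod R Q"
proof -
  have "p ` carrier P = carrier Q"
    using pi rmod_homD(1)[OF i] rmod_homD(1)[OF p] by (force intro: rev_image_eqI)
  then have fg: "fg_right_module R Q"
    by (rule fg_right_module_surj[OF projective_rmodD(1)[OF P] Q p])
  show ?thesis
    unfolding projective_rmod_def
  proof (intro conjI allI impI fg; elim conjE)
    fix X Y :: "'a rmod" and f g
    assume X: "fg_right_module R X" and Y: "fg_right_module R Y" and f: "f \<in> rmod_hom R X Y"
      and s: "f ` carrier X = carrier Y" and g: "g \<in> rmod_hom R Q Y"
    obtain h where h: "h \<in> rmod_hom R P X" "\<And>x. x \<in> carrier P \<Longrightarrow> f (h x) = g (p x)"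
      using projective_rmod_lift[OF P X fg_right_moduleD[OF Y] f s rmod_hom_comp[OF p g]] by blast
    then show "\<exists>h\<in>rmod_hom R Q X. \<forall>x\<in>carrier Q. f (h x) = g x"
      using pi rmod_homD(1)[OF i] by (intro bexI[OF _ rmod_hom_comp[OF i h(1)]]) auto
  qed
qed

lemma injective_rmod_retract:
  assumes P: "injective_rmod R P" and Q: "right_module R Q"
    and i: "i \<in> rmod_hom R Q P" and p: "p \<in> rmod_hom R P Q" and pi: "\<And>x. x \<in> carrier Q \<Longrightarrow> p (i x) = x"
  shows "injective_rmod R Q"
proof -
  have "p ` carrier P = carrier Q"
    using pi rmod_homD(1)[OF i] rmod_homD(1)[OF p] by (force intro: rev_image_eqI)
  then have fg: "fg_right_module R Q"
    by (rule fg_right_module_surj[OF injective_rmodD(1)[OF P] Q p])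
  show ?thesis
    unfolding injective_rmod_def
  proof (intro conjI allI impI fg; elim conjE)
    fix X Y :: "'a rmod" and f g
    assume X: "fg_right_module R X" and Y: "fg_right_module R Y" and f: "f \<in> rmod_hom R X Y"
      and s: "inj_on f (carrier X)" and g: "g \<in> rmod_hom R X Q"
    obtain h where h: "h \<in> rmod_hom R Y P" "\<And>x. x \<in> carrier X \<Longrightarrow> h (f x) = i (g x)"
      using injective_rmod_extend[OF P X Y f s rmod_hom_comp[OF g i]] by blast
    then show "\<exists>h\<in>rmod_hom R Y Q. \<forall>x\<in>carrier X. h (f x) = g x"
      using pi rmod_homD(1)[OF g] by (intro bexI[OF _ rmod_hom_comp[OF h(1) p]]) auto
  qed
qed

lemma projective_rmod_iso:
  assumes "projective_rmod R P" "right_module R Q" "f \<in> rmod_hom R P Q" "bij_betw f (carrier P) (carrier Q)"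
  shows "projective_rmod R Q"
  using assms(1,2) rmod_hom_inverse(1)[OF projective_rmodD(2)[OF assms(1)] assms(3,4)] assms(3)
  by (rule projective_rmod_retract) (rule bij_betw_inv_into_right[OF assms(4)])

lemma injective_rmod_iso:
  assumes "injective_rmod R P" "right_module R Q" "f \<in> rmod_hom R P Q" "bij_betw f (carrier P) (carrier Q)"
  shows "injective_rmod R Q"
  using assms(1,2) rmod_hom_inverse(1)[OF injective_rmodD(2)[OF assms(1)] assms(3,4)] assms(3)
  by (rule injective_rmod_retract) (rule bij_betw_inv_into_right[OF assms(4)])

lemma rmod_hom_descend:
  assumes P: "right_module R P" and M: "right_module R M" and N: "right_module R N"
    and e: "e \<in> rmod_hom R P M" and surj: "e ` carrier P = carrier M"
    and f: "f \<in> rmod_hom R P N" and ker: "\<And>x. x \<in> carrier P \<Longrightarrow> e x = \<zero>\<^bsub>M\<^esub> \<Longrightarrow> f x = \<zero>\<^bsub>N\<^esub>"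
  obtains g where "g \<in> rmod_hom R M N" "\<And>x. x \<in> carrier P \<Longrightarrow> g (e x) = f x"
proof -
  interpret P: right_module R P by fact
  interpret M: right_module R M by fact
  interpret N: right_module R N by fact
  define g where "g y = f (inv_into (carrier P) e y)" for y
  have eq: "f x = f y" if "x \<in> carrier P" "y \<in> carrier P" "e x = e y" for x y
  proof -
    have "e (x \<ominus>\<^bsub>P\<^esub> y) = \<zero>\<^bsub>M\<^esub>"
      using rmod_hom_diff[OF P M e that(1,2)] that rmod_homD(1)[OF e that(2)] by (simp add: M.r_neg a_minus_def)
    then have "f x \<ominus>\<^bsub>N\<^esub> f y = \<zero>\<^bsub>N\<^esub>" using that ker by (simp add: rmod_hom_diff[OF P N f, symmetric])
    then show ?thesis using that rmod_homD(1)[OF f] by (simp add: N.minus_eq_zero_iff)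
  qed
  have ge: "g (e x) = f x" if "x \<in> carrier P" for x
    unfolding g_def using that surj
    by (intro eq) (auto intro: inv_into_into f_inv_into_f)
  have gsur: "\<exists>x\<in>carrier P. y = e x" if "y \<in> carrier M" for y using that surj by auto
  show thesis
  proof
    show "g \<in> rmod_hom R M N"
    proof (rule rmod_homI)
      fix x assume "x \<in> carrier M"
      then show "g x \<in> carrier N" using gsur ge rmod_homD(1)[OF f] by force
    next
      fix x y assume "x \<in> carrier M" "y \<in> carrier M"
      then obtain u v where uv: "u \<in> carrier P" "x = e u" "v \<in> carrier P" "y = e v" using gsur by meson
      then have "g (x \<oplus>\<^bsub>M\<^esub> y) = f (u \<oplus>\<^bsub>P\<^esub> v)"
        using ge[of "u \<oplus>\<^bsub>P\<^esub> v"] by (simp add: rmod_homD(2)[OF e])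
      with uv show "g (x \<oplus>\<^bsub>M\<^esub> y) = g x \<oplus>\<^bsub>N\<^esub> g y" by (simp add: ge rmod_homD(2)[OF f])
    next
      fix r x assume r: "r \<in> carrier R" and "x \<in> carrier M"
      then obtain u where u: "u \<in> carrier P" "x = e u" using gsur by meson
      then have "g (r \<odot>\<^bsub>M\<^esub> x) = f (r \<odot>\<^bsub>P\<^esub> u)"
        using ge[of "r \<odot>\<^bsub>P\<^esub> u"] r by (simp add: rmod_homD(3)[OF e] P.r_smult_closed)
      with u r show "g (r \<odot>\<^bsub>M\<^esub> x) = r \<odot>\<^bsub>N\<^esub> g x" by (simp add: ge rmod_homD(3)[OF f])
    qed
  qed (rule ge)
qed

lemma rmod_hom_sub:
  assumes M: "right_module R M" and N: "right_module R N" and f: "f \<in> rmod_hom R M N" and g: "g \<in> rmod_hom R M N"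
  shows "(\<lambda>x. f x \<ominus>\<^bsub>N\<^esub> g x) \<in> rmod_hom R M N"
proof -
  interpret M: right_module R M by fact
  interpret N: right_module R N by fact
  show ?thesis
    using rmod_homD[OF f] rmod_homD[OF g]
    by (intro rmod_homI)
      (auto simp: a_minus_def N.minus_add N.a_ac N.r_smult_module_distr N.smult_minus_right)
qed

section \<open>Projective dimension\<close>

text \<open>Existence of a short resolution is easier to transport and to shift than the infimum
  \<open>projdim\<close>; \<open>projdim_eqI\<close> returns to the latter.\<close>

definition projdim_le :: "('a, 'r) ring_scheme \<Rightarrow> nat \<Rightarrow> ('a, 'm) module \<Rightarrow> bool" where
  "projdim_le R n M \<longleftrightarrow> (\<exists>P d e. projective_resolution R M P d e \<and> (\<forall>i>n. carrier (P i) = {\<zero>\<^bsub>P i\<^esub>}))"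

lemma projdim_le_mono: "projdim_le R m M \<Longrightarrow> m \<le> n \<Longrightarrow> projdim_le R n M"
  unfolding projdim_le_def by (meson le_less_trans)

lemma projdim_leI: "projdim_le R n M \<Longrightarrow> projdim R M \<le> enat n"
  unfolding projdim_def projdim_le_def by (rule Inf_lower) auto

lemma projdim_eqI:
  assumes "projdim_le R n M" "\<And>m. n = Suc m \<Longrightarrow> \<not> projdim_le R m M"
  shows "projdim R M = enat n"
proof (rule antisym[OF projdim_leI[OF assms(1)]])
  have "enat n \<le> enat m" if "projdim_le R m M" for m
  proof (rule ccontr)
    assume "\<not> enat n \<le> enat m"
    then obtain k where "n = Suc k" "m \<le> k" by (cases n) auto
    with that assms(2) show False using projdim_le_mono by blast
  qed
  then show "enat n \<le> projdim R M"
    unfolding projdim_def projdim_le_def by (intro Inf_greatest) blast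
qed

lemma projdim_le_iso:
  assumes M: "right_module R M" and N: "right_module R N" and g: "g \<in> rmod_hom R M N"
    and b: "bij_betw g (carrier M) (carrier N)" and pd: "projdim_le R n M"
  shows "projdim_le R n N"
proof -
  obtain P d e where P: "projective_resolution R M P d e" "\<forall>i>n. carrier (P i) = {\<zero>\<^bsub>P i\<^esub>}"
    using pd by (auto simp: projdim_le_def)
  then have e: "e \<in> rmod_hom R (P 0) M" "e ` carrier (P 0) = carrier M"
    by (auto simp: projective_resolution_def)
  have "g x = \<zero>\<^bsub>N\<^esub> \<longleftrightarrow> x = \<zero>\<^bsub>M\<^esub>" if "x \<in> carrier M" for x
    using rmod_hom_eq_zero_iff[OF M N g _ that] b by (simp add: bij_betw_def)
  then have ker: "rmod_ker (P 0) N (\<lambda>x. g (e x)) = rmod_ker (P 0) M e"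
    using rmod_homD(1)[OF e(1)] by (auto simp: rmod_ker_def)
  have "(\<lambda>x. g (e x)) ` carrier (P 0) = carrier N"
    unfolding image_image[symmetric] e(2) using b by (rule bij_betw_imp_surj_on)
  with P e ker rmod_hom_comp[OF e(1) g] have "projective_resolution R N P d (\<lambda>x. g (e x))"
    by (simp add: projective_resolution_def)
  with P(2) show ?thesis unfolding projdim_le_def by blast
qed

text \<open>Resolutions by thin modules do not have the type required by
  \<open>projective_resolution\<close>. Each term is replaced by an isomorphic copy, and the
  differentials are conjugated accordingly.\<close>

lemma projdim_le_resolution:
  fixes R :: "('a, 'r) ring_scheme" and Q :: "nat \<Rightarrow> ('a, 'm) module"
  assumes M: "right_module R M"
    and Q: "\<And>i. projective_rmod R (Q i)" and e: "e \<in> rmod_hom R (Q 0) M" "e ` carrier (Q 0) = carrier M"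
    and d: "\<And>i. d i \<in> rmod_hom R (Q (Suc i)) (Q i)"
    and ex0: "d 0 ` carrier (Q 1) = rmod_ker (Q 0) M e"
    and ex: "\<And>i. d (Suc i) ` carrier (Q (Suc (Suc i))) = rmod_ker (Q (Suc i)) (Q i) (d i)"
    and z: "\<And>i. i > n \<Longrightarrow> carrier (Q i) = {\<zero>\<^bsub>Q i\<^esub>}"
  shows "projdim_le R n M"
proof -
  have Qr: "right_module R (Q i)" for i using Q by (rule projective_rmodD)
  have "\<exists>(N :: 'a rmod) f. fg_right_module R N \<and> f \<in> rmod_hom R (Q i) N \<and> bij_betw f (carrier (Q i)) (carrier N)" for i
    by (rule fg_right_module_isomorphic_copy) (rule projective_rmodD[OF Q])
  then obtain P :: "nat \<Rightarrow> 'a rmod" and f where P: "\<And>i. fg_right_module R (P i)"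
    and f: "\<And>i. f i \<in> rmod_hom R (Q i) (P i)" and b: "\<And>i. bij_betw (f i) (carrier (Q i)) (carrier (P i))"
    by metis
  define g where "g i = inv_into (carrier (Q i)) (f i)" for i
  have g: "g i \<in> rmod_hom R (P i) (Q i)" "bij_betw (g i) (carrier (P i)) (carrier (Q i))" for i
    unfolding g_def using rmod_hom_inverse[OF Qr f b] by auto
  have Pr: "right_module R (P i)" for i using P by (rule fg_right_moduleD)
  have gf: "g i (f i x) = x" if "x \<in> carrier (Q i)" for i x
    unfolding g_def using that by (rule bij_betw_inv_into_left[OF b])
  have fg: "f i (g i x) = x" if "x \<in> carrier (P i)" for i x
    unfolding g_def using that by (rule bij_betw_inv_into_right[OF b])
  have gim: "g i ` carrier (P i) = carrier (Q i)" for i using g(2) by (simp add: bij_betw_def)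
  have fz: "f i x = \<zero>\<^bsub>P i\<^esub> \<longleftrightarrow> x = \<zero>\<^bsub>Q i\<^esub>" if "x \<in> carrier (Q i)" for i x
    using rmod_hom_eq_zero_iff[OF Qr Pr f _ that] b by (simp add: bij_betw_def)
  have proj: "projective_rmod R (P i)" for i by (rule projective_rmod_iso[OF Q Pr f b])
  have ker: "f i ` rmod_ker (Q i) L h = rmod_ker (P i) L (\<lambda>x. h (g i x))"
    for i h and L :: "('a, 'l) module"
    using rmod_homD(1)[OF f] rmod_homD(1)[OF g(1)] gf fg
    by (auto simp: rmod_ker_def) (metis (mono_tags, lifting) image_eqI mem_Collect_eq)
  have ker2: "rmod_ker (P (Suc i)) (P i) (\<lambda>x. f i (d i (g (Suc i) x))) = rmod_ker (P (Suc i)) (Q i) (\<lambda>x. d i (g (Suc i) x))" for i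
    unfolding rmod_ker_def
    by (intro Collect_cong conj_cong refl fz rmod_homD(1)[OF d] rmod_homD(1)[OF g(1)])
  have im: "(\<lambda>x. f i (d i (g (Suc i) x))) ` carrier (P (Suc i)) = f i ` d i ` carrier (Q (Suc i))" for i
    by (simp add: gim[symmetric] image_image)
  have "projective_resolution R M P (\<lambda>i x. f i (d i (g (Suc i) x))) (\<lambda>x. e (g 0 x))"
    unfolding projective_resolution_def
  proof (intro conjI allI proj)
    show "(\<lambda>x. e (g 0 x)) \<in> rmod_hom R (P 0) M" by (rule rmod_hom_comp[OF g(1) e(1)])
    show "(\<lambda>x. f i (d i (g (Suc i) x))) \<in> rmod_hom R (P (Suc i)) (P i)" for i
      by (rule rmod_hom_comp[OF rmod_hom_comp[OF g(1) d] f])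
    show "(\<lambda>x. e (g 0 x)) ` carrier (P 0) = carrier M"
      unfolding image_image[of e "g 0", symmetric] gim by (rule e(2))
    show "(\<lambda>x. f 0 (d 0 (g (Suc 0) x))) ` carrier (P 1) = rmod_ker (P 0) M (\<lambda>x. e (g 0 x))"
      using im[of 0] ex0 ker[of 0 M e] by simp
    show "(\<lambda>x. f (Suc i) (d (Suc i) (g (Suc (Suc i)) x))) ` carrier (P (Suc (Suc i))) =
        rmod_ker (P (Suc i)) (P i) (\<lambda>x. f i (d i (g (Suc i) x)))" for i
      using im[of "Suc i"] ex[of i] ker[of "Suc i" "Q i" "d i"] ker2 by simp
  qed
  moreover have "carrier (P i) = {\<zero>\<^bsub>P i\<^esub>}" if "i > n" for i
  proof -
    have "f i ` carrier (Q i) = carrier (P i)" using b by (simp add: bij_betw_def)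
    then show ?thesis using z[OF that] rmod_hom_zero[OF Qr Pr f] by simp
  qed
  ultimately show ?thesis unfolding projdim_le_def by blast
qed

lemma projective_rmod_trivial:
  assumes "right_module R M" "carrier M = {\<zero>\<^bsub>M\<^esub>}"
  shows "projective_rmod R M"
proof -
  interpret M: right_module R M by fact
  have fg: "fg_right_module R M"
    using assms submoduleD'[of _ R M] by (auto simp: fg_right_module_def intro!: exI[of _ "{}"])
  have "\<exists>h\<in>rmod_hom R M X. \<forall>x\<in>carrier M. f (h x) = g x"
    if "fg_right_module R X" "fg_right_module R Y" "f \<in> rmod_hom R X Y" "g \<in> rmod_hom R M Y"
    for X Y :: "'a rmod" and f g
  proof -
    note r = fg_right_moduleD[OF that(1)] fg_right_moduleD[OF that(2)]
    interpret X: right_module R X by (rule r)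
    show ?thesis
      using assms rmod_hom_zero[OF r that(3)] rmod_hom_zero[OF assms(1) r(2) that(4)]
      by (intro bexI[of _ "\<lambda>_. \<zero>\<^bsub>X\<^esub>"] rmod_homI) (auto simp: X.smult_zero_right)
  qed
  with fg show ?thesis
    unfolding projective_rmod_def by (intro conjI allI impI) (assumption, elim conjE, assumption)
qed

lemma projdim_le_0:
  assumes P: "projective_rmod R P"
  shows "projdim_le R 0 P"
proof -
  note r = projective_rmodD(2)[OF P]
  interpret P: right_module R P by (rule r)
  let ?Z = "P\<lparr>carrier := {\<zero>\<^bsub>P\<^esub>}\<rparr>"
  have Z: "right_module R ?Z" by (rule submodule_right_module[OF r zero_submodule[OF r]])
  have "projective_rmod R ?Z" by (rule projective_rmod_trivial[OF Z]) simp
  then show ?thesis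
    using P by (intro projdim_le_resolution[where Q = "\<lambda>i. if i = 0 then P else ?Z" and e = "\<lambda>x. x" and d = "\<lambda>_ x. x"] r)
      (auto simp: rmod_hom_def rmod_ker_def)
qed

text \<open>\<open>P\<close> has type \<open>'a rmod\<close> because it becomes the term 0 of the
  new resolution.\<close>

lemma projdim_le_step:
  fixes P :: "'a rmod"
  assumes M: "right_module R M" and P: "projective_rmod R P" and e: "e \<in> rmod_hom R P M" "e ` carrier P = carrier M"
    and pd: "projdim_le R n (P\<lparr>carrier := rmod_ker P M e\<rparr>)"
  shows "projdim_le R (Suc n) M"
proof -
  obtain Q d c where Q: "projective_resolution R (P\<lparr>carrier := rmod_ker P M e\<rparr>) Q d c" "\<forall>i>n. carrier (Q i) = {\<zero>\<^bsub>Q i\<^esub>}"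
    using pd by (auto simp: projdim_le_def)
  have c: "c \<in> rmod_hom R (Q 0) P" "c ` carrier (Q 0) = rmod_ker P M e"
    using Q(1) by (auto simp: projective_resolution_def rmod_hom_def rmod_ker_def)
  have "projective_resolution R M (case_nat P Q) (case_nat c d) e"
    using Q(1) P e c
    by (auto simp: projective_resolution_def split: nat.split) (auto simp: rmod_ker_def)
  moreover have "\<forall>i>Suc n. carrier (case_nat P Q i) = {\<zero>\<^bsub>case_nat P Q i\<^esub>}"
    using Q(2) by (auto split: nat.split)
  ultimately show ?thesis unfolding projdim_le_def by blast
qed

lemma projdim_le_SucE:
  fixes M :: "('a, 'm) module"
  assumes "projdim_le R (Suc n) M"
  obtains P :: "'a rmod" and e where "projective_rmod R P" "e \<in> rmod_hom R P M" "e ` carrier P = carrier M"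
    "projdim_le R n (P\<lparr>carrier := rmod_ker P M e\<rparr>)" "fg_right_module R P"
    "right_module R M \<Longrightarrow> fg_right_module R (P\<lparr>carrier := rmod_ker P M e\<rparr>)"
proof -
  obtain P d e where P: "projective_resolution R M P d e" "\<forall>i>Suc n. carrier (P i) = {\<zero>\<^bsub>P i\<^esub>}"
    using assms by (auto simp: projdim_le_def)
  then have c: "d 0 \<in> rmod_hom R (P (Suc 0)) (P 0)" "d 0 ` carrier (P (Suc 0)) = rmod_ker (P 0) M e"
    and p: "projective_rmod R (P i)" and e: "e \<in> rmod_hom R (P 0) M" "e ` carrier (P 0) = carrier M" for i
    by (auto simp: projective_resolution_def)
  have c': "d 0 \<in> rmod_hom R (P (Suc 0)) (P 0\<lparr>carrier := rmod_ker (P 0) M e\<rparr>)"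
    using c by (auto simp: rmod_hom_def)
  have "projective_resolution R (P 0\<lparr>carrier := rmod_ker (P 0) M e\<rparr>) (\<lambda>i. P (Suc i)) (\<lambda>i. d (Suc i)) (d 0)"
    using P(1) c c' by (auto simp: projective_resolution_def) (auto simp: rmod_ker_def)
  then have "projdim_le R n (P 0\<lparr>carrier := rmod_ker (P 0) M e\<rparr>)"
    using P(2) unfolding projdim_le_def by (intro exI conjI) auto
  \<comment> \<open>The kernel is the image of the term 1 of the resolution, hence finitely
    generated.\<close>
  moreover have "fg_right_module R (P 0\<lparr>carrier := rmod_ker (P 0) M e\<rparr>)" if M: "right_module R M"
    by (rule fg_right_module_surj[OF projective_rmodD(1)[OF p] _ c'])
      (use c in \<open>auto intro: submodule_right_module[OF projective_rmodD(2)[OF p] rmod_ker_submodule[OF projective_rmodD(2)[OF p] M e(1)]]\<close>)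
  ultimately show thesis using p e by (intro that[of "P 0" e] projective_rmodD(1)[OF p]) auto
qed

lemma projdim_le_0D:
  assumes M: "right_module R M" and "projdim_le R 0 M"
  shows "projective_rmod R M"
proof -
  obtain P d e where P: "projective_resolution R M P d e" "\<forall>i>0. carrier (P i) = {\<zero>\<^bsub>P i\<^esub>}"
    using assms by (auto simp: projdim_le_def)
  then have c: "d 0 \<in> rmod_hom R (P (Suc 0)) (P 0)" "d 0 ` carrier (P (Suc 0)) = rmod_ker (P 0) M e"
    and p: "projective_rmod R (P i)" and e: "e \<in> rmod_hom R (P 0) M" "e ` carrier (P 0) = carrier M" for i
    by (auto simp: projective_resolution_def)
  note r = projective_rmodD(2)[OF p]
  have "rmod_ker (P 0) M e = {\<zero>\<^bsub>P 0\<^esub>}"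
    using c P(2) rmod_hom_zero[OF r r c(1)] by auto
  then have "inj_on e (carrier (P 0))"
    using rmod_hom_inj_iff[OF r M e(1)] by (auto simp: rmod_ker_def)
  then show ?thesis using projective_rmod_iso[OF p M e(1)] e(2) by (auto simp: bij_betw_def)
qed

text \<open>Dimension shifting: \<open>Ext\<^sup>n\<^sup>+\<^sup>1(X, -)\<close> vanishes on the kernel of \<open>d 0\<close>.\<close>

lemma projdim_le_lift:
  fixes E :: "nat \<Rightarrow> ('a, 'n) module" and X :: "('a, 'm) module"
  assumes E: "\<And>i. injective_rmod R (E i)" and d: "\<And>i. d i \<in> rmod_hom R (E i) (E (Suc i))"
    and ex: "\<And>i. d i ` carrier (E i) = rmod_ker (E (Suc i)) (E (Suc (Suc i))) (d (Suc i))"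
    and X: "right_module R X" and pd: "projdim_le R n X"
    and f: "f \<in> rmod_hom R X (E (Suc n))" "\<And>x. x \<in> carrier X \<Longrightarrow> d (Suc n) (f x) = \<zero>\<^bsub>E (Suc (Suc n))\<^esub>"
  obtains g where "g \<in> rmod_hom R X (E n)" "\<And>x. x \<in> carrier X \<Longrightarrow> d n (g x) = f x"
proof -
  note r = injective_rmodD(2)[OF E]
  \<comment> \<open>Over a projective module it suffices to lift through the surjection of
    \<open>E n\<close> onto the kernel of the next differential.\<close>
  have lift: "\<exists>g\<in>rmod_hom R P (E n). \<forall>x\<in>carrier P. d n (g x) = f x"
    if P: "projective_rmod R P" and f: "f \<in> rmod_hom R P (E (Suc n))"
      "\<And>x. x \<in> carrier P \<Longrightarrow> d (Suc n) (f x) = \<zero>\<^bsub>E (Suc (Suc n))\<^esub>"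
    for n f and P :: "('a, 'p) module"
  proof -
    let ?Z = "E (Suc n)\<lparr>carrier := rmod_ker (E (Suc n)) (E (Suc (Suc n))) (d (Suc n))\<rparr>"
    have Z: "right_module R ?Z" by (rule submodule_right_module[OF r rmod_ker_submodule[OF r r d]])
    have "d n \<in> rmod_hom R (E n) ?Z" using d[of n] ex[of n] by (auto simp: rmod_hom_def)
    moreover have "f \<in> rmod_hom R P ?Z" using f by (auto simp: rmod_hom_def rmod_ker_def)
    ultimately obtain h where "h \<in> rmod_hom R P (E n)" "\<And>x. x \<in> carrier P \<Longrightarrow> d n (h x) = f x"
      using ex[of n] by (elim projective_rmod_lift[OF P injective_rmodD(1)[OF E] Z, rotated 2]) auto
    then show ?thesis by blast
  qed
  \<comment> \<open>The elements of \<open>X\<close> have an arbitrary type, those of the kernel of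
    its cover the type of \<open>'a rmod\<close>. So the induction step is isolated:
    \<open>main\<close> iterates it within \<open>'a rmod\<close>, and it is used once more for
    \<open>X\<close>.\<close>
  have step: "\<exists>g\<in>rmod_hom R X (E (Suc n)). \<forall>x\<in>carrier X. d (Suc n) (g x) = f x"
    if IH: "\<And>f (K :: 'a rmod). projdim_le R n K \<Longrightarrow> right_module R K \<Longrightarrow> f \<in> rmod_hom R K (E (Suc n)) \<Longrightarrow>
        (\<And>x. x \<in> carrier K \<Longrightarrow> d (Suc n) (f x) = \<zero>\<^bsub>E (Suc (Suc n))\<^esub>) \<Longrightarrow>
        \<exists>g\<in>rmod_hom R K (E n). \<forall>x\<in>carrier K. d n (g x) = f x"
      and X: "right_module R X" "projdim_le R (Suc n) X" and f: "f \<in> rmod_hom R X (E (Suc (Suc n)))"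
        "\<And>x. x \<in> carrier X \<Longrightarrow> d (Suc (Suc n)) (f x) = \<zero>\<^bsub>E (Suc (Suc (Suc n)))\<^esub>"
    for X :: "('a, 'p) module" and f n
  proof -
    obtain P :: "'a rmod" and e where P: "projective_rmod R P" "e \<in> rmod_hom R P X" "e ` carrier P = carrier X"
      and pd: "projdim_le R n (P\<lparr>carrier := rmod_ker P X e\<rparr>)" and fg: "fg_right_module R P"
      "fg_right_module R (P\<lparr>carrier := rmod_ker P X e\<rparr>)"
      using projdim_le_SucE[OF X(2)] X(1) by metis
    let ?K = "P\<lparr>carrier := rmod_ker P X e\<rparr>"
    note Pr = projective_rmodD(2)[OF P(1)]
    have z: "d (Suc (Suc n)) (f (e x)) = \<zero>\<^bsub>E (Suc (Suc (Suc n)))\<^esub>" if "x \<in> carrier P" for x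
      using that f(2) rmod_homD(1)[OF P(2)] by simp
    obtain g where g: "g \<in> rmod_hom R P (E (Suc n))" "\<And>x. x \<in> carrier P \<Longrightarrow> d (Suc n) (g x) = f (e x)"
      using lift[OF P(1) rmod_hom_comp[OF P(2) f(1)] z] by auto
    have gK: "g \<in> rmod_hom R ?K (E (Suc n))" using g(1) by (auto simp: rmod_hom_def rmod_ker_def)
    have "d (Suc n) (g x) = \<zero>\<^bsub>E (Suc (Suc n))\<^esub>" if "x \<in> carrier ?K" for x
      using that g(2) rmod_hom_zero[OF X(1) r f(1)] by (simp add: rmod_ker_def)
    \<comment> \<open>On the kernel of the cover the map \<open>f \<circ> e\<close> vanishes, so
      \<open>g\<close> takes it to cycles, and the induction hypothesis lifts this restriction along
      \<open>d n\<close>.\<close>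
    then obtain h where h: "h \<in> rmod_hom R ?K (E n)" "\<And>x. x \<in> carrier ?K \<Longrightarrow> d n (h x) = g x"
      using IH[OF pd fg_right_moduleD[OF fg(2)] gK] by auto
    have "(\<lambda>x. x) \<in> rmod_hom R ?K P" by (auto simp: rmod_hom_def rmod_ker_def)
    then obtain k where k: "k \<in> rmod_hom R P (E n)" "\<And>x. x \<in> carrier ?K \<Longrightarrow> k x = h x"
      using injective_rmod_extend[OF E fg(2,1) _ _ h(1), of "\<lambda>x. x"] by auto
    \<comment> \<open>Subtracting \<open>d n (k x)\<close> does not change the image under
      \<open>d (Suc n)\<close>, but makes the lift vanish on the kernel of \<open>e\<close>, so that
      it descends to \<open>X\<close>.\<close>
    let ?g = "\<lambda>x. g x \<ominus>\<^bsub>E (Suc n)\<^esub> d n (k x)"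
    interpret E1: right_module R "E (Suc n)" by (rule r)
    interpret E2: right_module R "E (Suc (Suc n))" by (rule r)
    have g': "?g \<in> rmod_hom R P (E (Suc n))" by (intro rmod_hom_sub[OF Pr r] g(1) rmod_hom_comp[OF k(1) d])
    have "?g x = \<zero>\<^bsub>E (Suc n)\<^esub>" if "x \<in> carrier P" "e x = \<zero>\<^bsub>X\<^esub>" for x
      using that k(2)[of x] h(2)[of x] rmod_homD(1)[OF g(1)] by (simp add: rmod_ker_def a_minus_def E1.r_neg)
    then obtain g0 where g0: "g0 \<in> rmod_hom R X (E (Suc n))" "\<And>x. x \<in> carrier P \<Longrightarrow> g0 (e x) = ?g x"
      using rmod_hom_descend[OF Pr X(1) r P(2,3) g'] by auto
    have "d (Suc n) (d n (k x)) = \<zero>\<^bsub>E (Suc (Suc n))\<^esub>" if "x \<in> carrier P" for x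
    proof -
      have "d n (k x) \<in> d n ` carrier (E n)" using that rmod_homD(1)[OF k(1)] by simp
      then show ?thesis by (simp add: ex rmod_ker_def)
    qed
    moreover have "d (Suc n) (?g x) = d (Suc n) (g x) \<ominus>\<^bsub>E (Suc (Suc n))\<^esub> d (Suc n) (d n (k x))" if "x \<in> carrier P" for x
      using that rmod_homD(1)[OF g(1)] rmod_homD(1)[OF k(1)] rmod_homD(1)[OF d]
      by (intro rmod_hom_diff[OF r r d]) auto
    ultimately have "d (Suc n) (g0 (e x)) = f (e x)" if "x \<in> carrier P" for x
      using that g0(2) g(2) rmod_homD(1)[OF f(1)] rmod_homD(1)[OF P(2)] by (simp add: a_minus_def)
    then show ?thesis using g0(1) P(3) by (metis imageE)
  qed
  have main: "\<exists>g\<in>rmod_hom R K (E n). \<forall>x\<in>carrier K. d n (g x) = f x"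
    if "projdim_le R n K" "right_module R K" "f \<in> rmod_hom R K (E (Suc n))"
       "\<And>x. x \<in> carrier K \<Longrightarrow> d (Suc n) (f x) = \<zero>\<^bsub>E (Suc (Suc n))\<^esub>" for n f and K :: "'a rmod"
    using that
  proof (induction n arbitrary: K f)
    case 0
    then show ?case using lift[OF projdim_le_0D] by blast
  next
    case (Suc n)
    show ?case by (rule step[OF Suc.IH Suc.prems(2,1,3,4)])
  qed
  have "\<exists>g\<in>rmod_hom R X (E n). \<forall>x\<in>carrier X. d n (g x) = f x"
  proof (cases n)
    case 0
    show ?thesis
      unfolding 0 by (rule lift) (use projdim_le_0D[OF X] pd f in \<open>simp_all add: 0\<close>)
  next
    case (Suc m)
    show ?thesis
      unfolding Suc by (rule step[OF main X]) (use pd f in \<open>simp_all add: Suc\<close>)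
  qed
  then show thesis using that by blast
qed

section \<open>Algebras of matrices with a prescribed support\<close>

text \<open>Coordinates embed finitely generated modules into this function space; bases and linear
  extension are taken there.\<close>

interpretation fun_vs: vector_space "\<lambda>(c :: 'k::field) (f :: 'i \<Rightarrow> 'k) i. c * f i"
  by standard (auto simp: fun_eq_iff algebra_simps)

interpretation field_vs: vector_space "(*) :: 'k::field \<Rightarrow> 'k \<Rightarrow> 'k"
  by standard (auto simp: algebra_simps)

interpretation fun_field_vs: vector_space_pair "\<lambda>(c :: 'k::field) (f :: 'i \<Rightarrow> 'k) i. c * f i"
   "(*) :: 'k \<Rightarrow> 'k \<Rightarrow> 'k" ..

text \<open>
  The axiom \<open>co_mult\<close> restricts the matrix product to \<open>S\<close>; the compatibility \<open>S_assoc\<close> makes the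
  restricted product associative.
\<close>

locale coord_algebra = ring B for B :: "('a, 'r) ring_scheme" (structure) +
  fixes \<eta> :: "'k::field \<Rightarrow> 'a" and V :: "nat set" and S :: "(nat \<times> nat) set" and co :: "'a \<Rightarrow> nat \<Rightarrow> nat \<Rightarrow> 'k"
  assumes finite_V: "finite V" and S_subset: "S \<subseteq> V \<times> V" and S_refl: "v \<in> V \<Longrightarrow> (v, v) \<in> S"
    and S_assoc: "(i, j) \<in> S \<Longrightarrow> (j, k) \<in> S \<Longrightarrow> (k, l) \<in> S \<Longrightarrow> (i, l) \<in> S \<Longrightarrow> (i, k) \<in> S \<longleftrightarrow> (j, l) \<in> S"
    and S_antisym: "(i, k) \<in> S \<Longrightarrow> (k, i) \<in> S \<Longrightarrow> i = k"
    and co_inj: "r \<in> carrier B \<Longrightarrow> s \<in> carrier B \<Longrightarrow> co r = co s \<Longrightarrow> r = s"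
    and co_surj: "(\<And>i k. (i, k) \<notin> S \<Longrightarrow> m i k = 0) \<Longrightarrow> \<exists>r\<in>carrier B. co r = m"
    and co_supp: "r \<in> carrier B \<Longrightarrow> (i, k) \<notin> S \<Longrightarrow> co r i k = 0"
    and co_add: "r \<in> carrier B \<Longrightarrow> s \<in> carrier B \<Longrightarrow> co (r \<oplus> s) i k = co r i k + co s i k"
    and co_mult: "r \<in> carrier B \<Longrightarrow> s \<in> carrier B \<Longrightarrow> (i, k) \<in> S \<Longrightarrow>
      co (r \<otimes> s) i k = (\<Sum>j\<in>V. co r i j * co s j k)"
    and eta_closed: "\<eta> c \<in> carrier B"
    and eta_one: "\<eta> 1 = \<one>"
    and co_eta: "co (\<eta> c) i k = (if i = k \<and> i \<in> V then c else 0)"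
begin

lemma S_vertices: "(i, k) \<in> S \<Longrightarrow> i \<in> V" "(i, k) \<in> S \<Longrightarrow> k \<in> V"
  using S_subset by auto

lemma finite_S: "finite S"
  using S_subset finite_V by (meson finite_SigmaI finite_subset)

lemma co_eqI:
  assumes "r \<in> carrier B" "s \<in> carrier B" "\<And>i k. (i, k) \<in> S \<Longrightarrow> co r i k = co s i k"
  shows "r = s"
proof -
  have "co r i k = co s i k" for i k
    using assms co_supp[of r i k] co_supp[of s i k] by (cases "(i, k) \<in> S") auto
  then show ?thesis using assms(1,2) co_inj by blast
qed

lemma co_one: "co \<one> i k = (if i = k \<and> i \<in> V then 1 else 0)"
  using co_eta[of 1] eta_one by simp

lemma co_zero: "co \<zero> i k = 0"
proof -
  have "co \<zero> i k + 0 = co \<zero> i k + co \<zero> i k" using co_add[of \<zero> \<zero> i k] by (simp only: add_0_right zero_closed r_zero)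
  then show ?thesis by (simp only: add_left_cancel)
qed

lemma eta_mult_left: "r \<in> carrier B \<Longrightarrow> co (\<eta> c \<otimes> r) i k = c * co r i k"
proof (cases "(i, k) \<in> S")
  case True
  assume r: "r \<in> carrier B"
  have "co (\<eta> c \<otimes> r) i k = (\<Sum>j\<in>V. if i = j then c * co r i k else 0)"
    unfolding co_mult[OF eta_closed r True] by (intro sum.cong refl) (auto simp: co_eta)
  also have "\<dots> = c * co r i k" using finite_V S_vertices[OF True] by (simp add: sum.delta')
  finally show ?thesis .
qed (simp add: co_supp eta_closed)

lemma eta_mult_right: "r \<in> carrier B \<Longrightarrow> co (r \<otimes> \<eta> c) i k = c * co r i k"
proof (cases "(i, k) \<in> S")
  case True
  assume r: "r \<in> carrier B"
  have "co (r \<otimes> \<eta> c) i k = (\<Sum>j\<in>V. if j = k then c * co r i k else 0)"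
    unfolding co_mult[OF r eta_closed True] by (intro sum.cong refl) (auto simp: co_eta)
  also have "\<dots> = c * co r i k" using finite_V S_vertices[OF True] by (simp add: sum.delta)
  finally show ?thesis .
qed (simp add: co_supp eta_closed)

lemma eta_central: "r \<in> carrier B \<Longrightarrow> \<eta> c \<otimes> r = r \<otimes> \<eta> c"
  by (rule co_eqI) (auto simp: eta_closed eta_mult_left eta_mult_right)

lemma eta_add: "\<eta> (c + d) = \<eta> c \<oplus> \<eta> d"
  by (rule co_eqI) (auto simp: eta_closed co_add co_eta)

lemma eta_mult: "\<eta> (c * d) = \<eta> c \<otimes> \<eta> d"
  by (rule co_eqI) (auto simp: eta_closed eta_mult_left co_eta)

definition mk :: "(nat \<Rightarrow> nat \<Rightarrow> 'k) \<Rightarrow> 'a" where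
  "mk m = (SOME r. r \<in> carrier B \<and> co r = (\<lambda>i k. if (i, k) \<in> S then m i k else 0))"

lemma mk: "mk m \<in> carrier B" "co (mk m) i k = (if (i, k) \<in> S then m i k else 0)"
proof -
  have "\<exists>r. r \<in> carrier B \<and> co r = (\<lambda>i k. if (i, k) \<in> S then m i k else 0)"
    using co_surj[of "\<lambda>i k. if (i, k) \<in> S then m i k else 0"] by auto
  from someI_ex[OF this] show "mk m \<in> carrier B" "co (mk m) i k = (if (i, k) \<in> S then m i k else 0)"
    by (simp_all add: mk_def[symmetric])
qed

text \<open>Matrix units. As products are cut off, the product of \<open>bs i j\<close> and
  \<open>bs j k\<close> is zero whenever (i,k) is not in \<open>S\<close>.\<close>

definition bs :: "nat \<Rightarrow> nat \<Rightarrow> 'a" where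
  "bs i k = mk (\<lambda>i' k'. if i' = i \<and> k' = k then 1 else 0)"

lemma bs_closed [simp]: "bs i k \<in> carrier B"
  by (simp add: bs_def mk)

lemma co_bs: "co (bs i k) i' k' = (if i' = i \<and> k' = k \<and> (i, k) \<in> S then 1 else 0)"
  by (auto simp: bs_def mk)

lemma co_bs_mult:
  assumes "r \<in> carrier B"
  shows "co (bs i j \<otimes> r) i' k = (if i' = i \<and> (i, j) \<in> S \<and> (i, k) \<in> S then co r j k else 0)"
proof (cases "(i', k) \<in> S")
  case True
  have "co (bs i j \<otimes> r) i' k = (\<Sum>l\<in>V. if l = j then (if i' = i \<and> (i, j) \<in> S then co r j k else 0) else 0)"
    unfolding co_mult[OF bs_closed assms True] by (intro sum.cong refl) (auto simp: co_bs)
  then show ?thesis using True finite_V S_vertices(2)[of i j] by (auto simp: sum.delta)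
qed (auto simp: co_supp assms)

lemma co_mult_bs:
  assumes "r \<in> carrier B"
  shows "co (r \<otimes> bs j k) i k' = (if k' = k \<and> (j, k) \<in> S \<and> (i, k) \<in> S then co r i j else 0)"
proof (cases "(i, k') \<in> S")
  case True
  have "co (r \<otimes> bs j k) i k' = (\<Sum>l\<in>V. if l = j then (if k' = k \<and> (j, k) \<in> S then co r i j else 0) else 0)"
    unfolding co_mult[OF assms bs_closed True] by (intro sum.cong refl) (auto simp: co_bs)
  then show ?thesis using True finite_V S_vertices(1)[of j k] by (auto simp: sum.delta)
qed (auto simp: co_supp assms)

lemma bs_idem_right: "bs i k \<otimes> bs k k = bs i k"
  by (rule co_eqI) (auto simp: co_bs_mult co_bs S_refl S_vertices)

text \<open>Adjoining the matrix units of \<open>S\<close> one by one raises the dimension by one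
  each time, up to \<open>card S\<close>.\<close>

lemma finite_dim: "finite_dimension (range \<eta>) (carrier B)"
proof -
  have "dimension (card U) (range \<eta>) {r \<in> carrier B. \<forall>i k. (i, k) \<notin> U \<longrightarrow> co r i k = 0}"
    if "finite U" "U \<subseteq> S" for U
    using that
  proof (induction U)
    case empty
    have "{r \<in> carrier B. \<forall>i k. (i, k) \<notin> {} \<longrightarrow> co r i k = 0} = {\<zero>}"
      using co_eqI[of _ \<zero>] by (auto simp: co_zero)
    then show ?case by (simp add: zero_dim)
  next
    case (insert p U)
    obtain a b where p: "p = (a, b)" "(a, b) \<in> S" using insert.prems by (cases p) auto
    let ?E = "{r \<in> carrier B. \<forall>i k. (i, k) \<notin> U \<longrightarrow> co r i k = 0}"
    have "bs a b \<notin> ?E" using insert.hyps p by (auto simp: co_bs intro!: exI[of _ a] exI[of _ b])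
    then have "dimension (Suc (card U)) (range \<eta>) (line_extension (range \<eta>) (bs a b) ?E)"
      using insert by (intro Suc_dim) auto
    also have "line_extension (range \<eta>) (bs a b) ?E =
        {r \<in> carrier B. \<forall>i k. (i, k) \<notin> insert p U \<longrightarrow> co r i k = 0}"
    proof (intro equalityI subsetI)
      fix r assume "r \<in> line_extension (range \<eta>) (bs a b) ?E"
      then obtain c u where "u \<in> ?E" "r = \<eta> c \<otimes> bs a b \<oplus> u"
        by (auto simp: line_extension_mem_iff)
      then show "r \<in> {r \<in> carrier B. \<forall>i k. (i, k) \<notin> insert p U \<longrightarrow> co r i k = 0}"
        by (auto simp: eta_closed co_add eta_mult_left co_bs p)
    next
      fix r assume r: "r \<in> {r \<in> carrier B. \<forall>i k. (i, k) \<notin> insert p U \<longrightarrow> co r i k = 0}"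
      let ?u = "mk (\<lambda>i k. if (i, k) \<in> U then co r i k else 0)"
      have "r = \<eta> (co r a b) \<otimes> bs a b \<oplus> ?u"
        by (rule co_eqI) (use r insert.hyps in \<open>auto simp: eta_closed co_add eta_mult_left co_bs p mk\<close>)
      moreover have "?u \<in> ?E" by (auto simp: mk)
      ultimately show "r \<in> line_extension (range \<eta>) (bs a b) ?E"
        unfolding line_extension_mem_iff by blast
    qed
    finally show ?case using insert.hyps by simp
  qed
  from this[OF finite_S] have "dimension (card S) (range \<eta>) (carrier B)"
    using co_supp by (simp add: Collect_conj_eq Int_absorb2 subset_eq)
  then show ?thesis unfolding finite_dimension_def by blast
qed

lemma fd_algebra: "fd_algebra \<eta> B"
  unfolding fd_algebra_def
  using finite_dim eta_closed by (intro conjI allI ballI ring_axioms eta_one eta_add eta_mult eta_central) auto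

end

section \<open>Linear algebra in modules: spans, homogeneous bases, coordinates\<close>

locale coord_module = coord_algebra B \<eta> V S co + right_module B M
  for B :: "('a, 'r) ring_scheme" (structure) and \<eta> :: "'k::field \<Rightarrow> 'a" and V S co
    and M :: "('a, 'm) module"
begin

abbreviation sc :: "'k \<Rightarrow> 'm \<Rightarrow> 'm" where "sc c x \<equiv> \<eta> c \<odot>\<^bsub>M\<^esub> x"

lemma sc_closed: "x \<in> carrier M \<Longrightarrow> sc c x \<in> carrier M"
  by (simp add: r_smult_closed eta_closed)

lemma sc_add_left: "x \<in> carrier M \<Longrightarrow> sc (c + d) x = sc c x \<oplus>\<^bsub>M\<^esub> sc d x"
  by (simp add: eta_add r_smult_ring_distr eta_closed)

lemma sc_add_right: "x \<in> carrier M \<Longrightarrow> y \<in> carrier M \<Longrightarrow> sc c (x \<oplus>\<^bsub>M\<^esub> y) = sc c x \<oplus>\<^bsub>M\<^esub> sc c y"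
  by (simp add: r_smult_module_distr eta_closed)

lemma sc_sc: "x \<in> carrier M \<Longrightarrow> sc c (sc d x) = sc (c * d) x"
  by (simp add: r_smult_assoc[symmetric] eta_closed eta_mult[symmetric] mult.commute)

lemma sc_one: "x \<in> carrier M \<Longrightarrow> sc 1 x = x"
  by (simp add: eta_one r_smult_one)

lemma sc_zero: "x \<in> carrier M \<Longrightarrow> sc 0 x = \<zero>\<^bsub>M\<^esub>"
  using sc_add_left[of x 0 0] sc_closed[of x 0] by (simp add: M.add.l_cancel_one')

lemma smult_sc: "r \<in> carrier B \<Longrightarrow> x \<in> carrier M \<Longrightarrow> r \<odot>\<^bsub>M\<^esub> sc c x = sc c (r \<odot>\<^bsub>M\<^esub> x)"
  by (simp add: r_smult_assoc[symmetric] eta_closed eta_central)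

text \<open>\<open>L\<close> need only be closed under sums and scalars: it is the zero set where
  vanishing is proved, and a span where generation is proved. The support of \<open>r\<close> is
  split off one matrix unit at a time.\<close>

lemma smult_eq_zero_sub:
  assumes "finite U" "U \<subseteq> S" "r \<in> carrier B" "\<And>i k. (i, k) \<notin> U \<Longrightarrow> co r i k = 0" "x \<in> carrier M"
    and "\<zero>\<^bsub>M\<^esub> \<in> L" "\<And>y z. y \<in> L \<Longrightarrow> z \<in> L \<Longrightarrow> y \<oplus>\<^bsub>M\<^esub> z \<in> L" "\<And>c y. y \<in> L \<Longrightarrow> sc c y \<in> L"
      "\<And>i k. (i, k) \<in> U \<Longrightarrow> bs i k \<odot>\<^bsub>M\<^esub> x \<in> L"
  shows "r \<odot>\<^bsub>M\<^esub> x \<in> L"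
  using assms(1-4,9)
proof (induction U arbitrary: r)
  case empty
  then have "r = \<zero>" by (intro co_eqI) (auto simp: co_zero)
  then show ?case using assms by (simp add: smult_zero_left)
next
  case (insert p U)
  obtain a b where p: "p = (a, b)" "(a, b) \<in> S" using insert.prems by (cases p) auto
  let ?u = "mk (\<lambda>i k. if (i, k) \<in> U then co r i k else 0)"
  have r: "r = bs a b \<otimes> \<eta> (co r a b) \<oplus> ?u"
    by (rule co_eqI) (use insert.hyps insert.prems in \<open>auto simp: eta_closed co_add eta_mult_right co_bs p mk\<close>)
  have "?u \<odot>\<^bsub>M\<^esub> x \<in> L"
    by (rule insert.IH) (use insert.prems in \<open>auto simp: mk\<close>)
  moreover have "sc (co r a b) (bs a b \<odot>\<^bsub>M\<^esub> x) \<in> L" using insert.prems p assms(8) by auto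
  moreover have "r \<odot>\<^bsub>M\<^esub> x = sc (co r a b) (bs a b \<odot>\<^bsub>M\<^esub> x) \<oplus>\<^bsub>M\<^esub> ?u \<odot>\<^bsub>M\<^esub> x"
    using assms(5) by (subst r) (simp add: r_smult_ring_distr eta_closed mk r_smult_assoc)
  ultimately show ?case using assms(7) by simp
qed

lemma smult_eq_sum:
  assumes "r \<in> carrier B" "x \<in> carrier M"
    and "\<zero>\<^bsub>M\<^esub> \<in> L" "\<And>y z. y \<in> L \<Longrightarrow> z \<in> L \<Longrightarrow> y \<oplus>\<^bsub>M\<^esub> z \<in> L" "\<And>c y. y \<in> L \<Longrightarrow> sc c y \<in> L"
      "\<And>i k. (i, k) \<in> S \<Longrightarrow> co r i k \<noteq> 0 \<Longrightarrow> bs i k \<odot>\<^bsub>M\<^esub> x \<in> L"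
  shows "r \<odot>\<^bsub>M\<^esub> x \<in> L"
  by (rule smult_eq_zero_sub[of "{(i, k). (i, k) \<in> S \<and> co r i k \<noteq> 0}"])
    (use assms co_supp finite_S in \<open>auto intro: finite_subset[of _ S]\<close>)

inductive_set kspan :: "'m set \<Rightarrow> 'm set" for T where
  kspan_zero: "\<zero>\<^bsub>M\<^esub> \<in> kspan T"
| kspan_base: "t \<in> T \<Longrightarrow> t \<in> kspan T"
| kspan_add: "x \<in> kspan T \<Longrightarrow> y \<in> kspan T \<Longrightarrow> x \<oplus>\<^bsub>M\<^esub> y \<in> kspan T"
| kspan_sc: "x \<in> kspan T \<Longrightarrow> sc c x \<in> kspan T"

lemma kspan_closed:
  assumes "T \<subseteq> carrier M" "x \<in> kspan T"
  shows "x \<in> carrier M"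
  using assms(2,1) by (induction rule: kspan.induct) (auto simp: sc_closed)

lemma kspan_trans: "x \<in> kspan T \<Longrightarrow> T \<subseteq> kspan U \<Longrightarrow> x \<in> kspan U"
  by (induction rule: kspan.induct) (auto intro: kspan.intros)

definition lincomb :: "'m set \<Rightarrow> ('m \<Rightarrow> 'k) \<Rightarrow> 'm" where
  "lincomb T c = (\<Oplus>\<^bsub>M\<^esub>t\<in>T. sc (c t) t)"

lemma lincomb_closed: "T \<subseteq> carrier M \<Longrightarrow> lincomb T c \<in> carrier M"
  unfolding lincomb_def by (rule M.finsum_closed) (auto simp: sc_closed)

lemma lincomb_insert:
  assumes "finite T" "insert t T \<subseteq> carrier M" "t \<notin> T"
  shows "lincomb (insert t T) c = sc (c t) t \<oplus>\<^bsub>M\<^esub> lincomb T c"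
  unfolding lincomb_def using assms by (intro M.finsum_insert) (auto simp: sc_closed)

lemma lincomb_add:
  assumes "T \<subseteq> carrier M"
  shows "lincomb T (\<lambda>t. c t + d t) = lincomb T c \<oplus>\<^bsub>M\<^esub> lincomb T d"
proof -
  have "lincomb T (\<lambda>t. c t + d t) = (\<Oplus>\<^bsub>M\<^esub>t\<in>T. sc (c t) t \<oplus>\<^bsub>M\<^esub> sc (d t) t)"
    unfolding lincomb_def using assms by (intro M.finsum_cong') (auto simp: sc_closed sc_add_left)
  then show ?thesis unfolding lincomb_def using assms by (simp add: M.finsum_addf sc_closed Pi_def subset_eq)
qed

lemma lincomb_smult:
  assumes "finite T" "T \<subseteq> carrier M" "r \<in> carrier B"
  shows "r \<odot>\<^bsub>M\<^esub> lincomb T c = (\<Oplus>\<^bsub>M\<^esub>t\<in>T. sc (c t) (r \<odot>\<^bsub>M\<^esub> t))"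
  using assms(1,2)
proof (induction T)
  case empty
  then show ?case using assms by (simp add: lincomb_def smult_zero_right)
next
  case (insert t T)
  have "(\<Oplus>\<^bsub>M\<^esub>t\<in>insert t T. sc (c t) (r \<odot>\<^bsub>M\<^esub> t)) = sc (c t) (r \<odot>\<^bsub>M\<^esub> t) \<oplus>\<^bsub>M\<^esub> (\<Oplus>\<^bsub>M\<^esub>t\<in>T. sc (c t) (r \<odot>\<^bsub>M\<^esub> t))"
    using insert assms by (intro M.finsum_insert) (auto intro!: sc_closed r_smult_closed)
  with insert assms show ?case
    by (simp add: lincomb_insert r_smult_module_distr sc_closed lincomb_closed smult_sc)
qed

lemma lincomb_sc:
  assumes "finite T" "T \<subseteq> carrier M"
  shows "lincomb T (\<lambda>t. a * c t) = sc a (lincomb T c)"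
proof -
  have "sc a (lincomb T c) = (\<Oplus>\<^bsub>M\<^esub>t\<in>T. sc (c t) (sc a t))" by (rule lincomb_smult[OF assms eta_closed])
  also have "\<dots> = lincomb T (\<lambda>t. a * c t)"
    unfolding lincomb_def using assms by (intro M.finsum_cong') (auto simp: sc_closed sc_sc mult.commute)
  finally show ?thesis by simp
qed

lemma lincomb_delta:
  assumes "finite T" "T \<subseteq> carrier M" "t \<in> T"
  shows "lincomb T (\<lambda>s. if s = t then 1 else 0) = t"
proof -
  have "lincomb T (\<lambda>s. if s = t then 1 else 0) = (\<Oplus>\<^bsub>M\<^esub>s\<in>T. if t = s then s else \<zero>\<^bsub>M\<^esub>)"
    unfolding lincomb_def using assms by (intro M.finsum_cong') (auto simp: sc_one sc_zero subset_eq)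
  also have "\<dots> = t" using M.finsum_singleton[OF assms(3,1), of "\<lambda>s. s"] assms(2) by auto
  finally show ?thesis .
qed

lemma kspan_eq_lincomb:
  assumes "finite T" "T \<subseteq> carrier M"
  shows "x \<in> kspan T \<longleftrightarrow> (\<exists>c. x = lincomb T c)"
proof
  assume "x \<in> kspan T"
  then show "\<exists>c. x = lincomb T c"
  proof (induction rule: kspan.induct)
    case kspan_zero
    have "lincomb T (\<lambda>_. 0) = \<zero>\<^bsub>M\<^esub>"
    proof -
      have "lincomb T (\<lambda>_. 0) = (\<Oplus>\<^bsub>M\<^esub>t\<in>T. \<zero>\<^bsub>M\<^esub>)"
        unfolding lincomb_def using assms by (intro M.finsum_cong') (auto simp: sc_zero)
      then show ?thesis by simp
    qed
    then show ?case by metis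
  next
    case (kspan_base t)
    then show ?case using lincomb_delta[OF assms] by metis
  next
    case (kspan_add x y)
    then show ?case using lincomb_add[OF assms(2)] by metis
  next
    case (kspan_sc x c)
    then show ?case using lincomb_sc[OF assms] by metis
  qed
next
  assume "\<exists>c. x = lincomb T c"
  then obtain c where "x = lincomb T c" by blast
  moreover have "lincomb U c \<in> kspan T" if "finite U" "U \<subseteq> T" for U
    using that
  proof (induction U)
    case empty
    then show ?case by (simp add: lincomb_def kspan_zero)
  next
    case (insert u U)
    then show ?case using assms by (subst lincomb_insert) (auto intro: kspan.intros)
  qed
  ultimately show "x \<in> kspan T" using assms by blast
qed

text \<open>The matrix units applied to generators span the module, and the result of applying
  \<open>bs i k\<close> is fixed by the idempotent at \<open>k\<close>.\<close>

lemma homogeneous_spanning_set: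
  assumes "fg_right_module B M"
  obtains T where "finite T" "T \<subseteq> carrier M" "\<And>t. t \<in> T \<Longrightarrow> \<exists>v\<in>V. bs v v \<odot>\<^bsub>M\<^esub> t = t" "kspan T = carrier M"
proof -
  obtain G where G: "finite G" "G \<subseteq> carrier M" and gen: "\<And>N. submodule N B M \<Longrightarrow> G \<subseteq> N \<Longrightarrow> N = carrier M"
    using assms by (auto simp: fg_right_module_def)
  define T where "T = (\<lambda>((i, k), s). bs i k \<odot>\<^bsub>M\<^esub> s) ` (S \<times> G)"
  have fin: "finite T" using G finite_S by (simp add: T_def)
  have sub: "T \<subseteq> carrier M" using G by (auto simp: T_def intro: r_smult_closed)
  have "\<exists>v\<in>V. bs v v \<odot>\<^bsub>M\<^esub> t = t" if "t \<in> T" for t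
  proof -
    from \<open>t \<in> T\<close> obtain i k s where t: "(i, k) \<in> S" "s \<in> G" "t = bs i k \<odot>\<^bsub>M\<^esub> s"
      unfolding T_def by auto
    then have "bs k k \<odot>\<^bsub>M\<^esub> t = t" using G by (auto simp: r_smult_assoc[symmetric] bs_idem_right)
    then show ?thesis using S_vertices(2)[OF t(1)] by blast
  qed
  moreover have "kspan T = carrier M"
  proof (rule gen)
    have 1: "r \<odot>\<^bsub>M\<^esub> s \<in> kspan T" if "r \<in> carrier B" "s \<in> G" for r s
    proof (rule smult_eq_sum[OF that(1) _ kspan_zero kspan_add kspan_sc])
      show "s \<in> carrier M" using G that by blast
      fix i k assume "(i, k) \<in> S"
      then have "bs i k \<odot>\<^bsub>M\<^esub> s \<in> T" using that unfolding T_def by (intro image_eqI[of _ _ "((i, k), s)"]) auto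
      then show "bs i k \<odot>\<^bsub>M\<^esub> s \<in> kspan T" by (rule kspan_base)
    qed
    have 2: "r \<odot>\<^bsub>M\<^esub> x \<in> kspan T" if "x \<in> kspan T" "r \<in> carrier B" for r x
      using that
    proof (induction rule: kspan.induct)
      case kspan_zero
      then show ?case by (simp add: smult_zero_right kspan.kspan_zero)
    next
      case (kspan_base t)
      then obtain i k s where t: "s \<in> G" "t = bs i k \<odot>\<^bsub>M\<^esub> s" by (auto simp: T_def)
      then have "r \<odot>\<^bsub>M\<^esub> t = (bs i k \<otimes> r) \<odot>\<^bsub>M\<^esub> s" using G kspan_base by (auto simp: r_smult_assoc)
      then show ?case using 1 t kspan_base by simp
    next
      case (kspan_add x y)
      then show ?case using kspan_closed[OF sub] by (simp add: r_smult_module_distr kspan.kspan_add)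
    next
      case (kspan_sc x c)
      then show ?case using kspan_closed[OF sub] by (simp add: smult_sc kspan.kspan_sc)
    qed
    show "submodule (kspan T) B M"
      by (rule submoduleI'[OF right_module_axioms]) (use kspan_closed[OF sub] 2 in \<open>auto intro: kspan.intros\<close>)
    show "G \<subseteq> kspan T" using 1[OF one_closed] G by (auto simp: r_smult_one subset_eq)
  qed
  ultimately show thesis using that fin sub by blast
qed

text \<open>A homogeneous spanning set of least cardinality is independent, because a relation would
  allow one element to be dropped.\<close>

lemma homogeneous_basis:
  assumes "fg_right_module B M"
  obtains T where "finite T" "T \<subseteq> carrier M" "\<And>t. t \<in> T \<Longrightarrow> \<exists>v\<in>V. bs v v \<odot>\<^bsub>M\<^esub> t = t" "kspan T = carrier M"
    "\<And>c t. lincomb T c = \<zero>\<^bsub>M\<^esub> \<Longrightarrow> t \<in> T \<Longrightarrow> c t = 0"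
proof -
  define P where "P T \<longleftrightarrow> finite T \<and> T \<subseteq> carrier M \<and> (\<forall>t\<in>T. \<exists>v\<in>V. bs v v \<odot>\<^bsub>M\<^esub> t = t) \<and> kspan T = carrier M" for T
  have ex: "\<exists>T. P T" using homogeneous_spanning_set[OF assms] unfolding P_def by metis
  define T where "T = (ARG_MIN card T. P T)"
  have T: "P T" unfolding T_def using ex by (metis arg_min_natI)
  have min: "card T \<le> card U" if "P U" for U unfolding T_def using that by (rule arg_min_nat_le)
  have fin: "finite T" and sub: "T \<subseteq> carrier M" and hom: "\<forall>t\<in>T. \<exists>v\<in>V. bs v v \<odot>\<^bsub>M\<^esub> t = t"
    and span: "kspan T = carrier M" using T by (auto simp: P_def)
  have indep: "c t = 0" if c: "lincomb T c = \<zero>\<^bsub>M\<^esub>" and t: "t \<in> T" for c t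
  proof (rule ccontr)
    assume nz: "c t \<noteq> 0"
    let ?U = "T - {t}"
    have U: "finite ?U" "?U \<subseteq> carrier M" "insert t ?U = T" using fin sub t by auto
    have tc: "t \<in> carrier M" using sub t by auto
    let ?l = "lincomb ?U c"
    have l: "?l \<in> carrier M" by (rule lincomb_closed[OF U(2)])
    have "sc (c t) t \<oplus>\<^bsub>M\<^esub> ?l = \<zero>\<^bsub>M\<^esub>"
      using c lincomb_insert[OF U(1), of t c] U(3) sub tc by simp
    \<comment> \<open>Multiplication by -1/\<open>c t\<close> solves the relation for
      \<open>t\<close>.\<close>
    then have "sc (- inverse (c t)) (sc (c t) t \<oplus>\<^bsub>M\<^esub> ?l) = \<zero>\<^bsub>M\<^esub>" by (simp add: smult_zero_right eta_closed)
    then have "sc (- 1) t \<oplus>\<^bsub>M\<^esub> sc (- inverse (c t)) ?l = \<zero>\<^bsub>M\<^esub>"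
      using tc l nz by (simp add: sc_add_right sc_closed sc_sc)
    then have "t \<oplus>\<^bsub>M\<^esub> (sc (- 1) t \<oplus>\<^bsub>M\<^esub> sc (- inverse (c t)) ?l) = t" using tc by simp
    moreover have "t \<oplus>\<^bsub>M\<^esub> sc (- 1) t = \<zero>\<^bsub>M\<^esub>"
      using sc_add_left[OF tc, of 1 "- 1"] tc by (simp add: sc_one sc_zero)
    ultimately have "t = sc (- inverse (c t)) ?l"
      using tc l by (metis M.add.m_assoc M.l_zero sc_closed)
    moreover have "?l \<in> kspan ?U" using kspan_eq_lincomb[OF U(1,2)] by blast
    ultimately have "t \<in> kspan ?U" by (metis kspan_sc)
    then have "T \<subseteq> kspan ?U" using U(3) by (auto intro: kspan_base)
    then have "kspan ?U = carrier M" using kspan_trans span kspan_closed[OF U(2)] by blast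
    then have "P ?U" using U hom by (auto simp: P_def)
    then show False using min[of ?U] fin t by (metis card_Diff1_less leD)
  qed
  show thesis
  proof (rule that[of T])
    show "\<exists>v\<in>V. bs v v \<odot>\<^bsub>M\<^esub> t = t" if "t \<in> T" for t using hom that by blast
  qed (fact fin sub span indep)+
qed

text \<open>The basis is enumerated by natural numbers, and coordinates vanish from \<open>N\<close>
  on, so that coordinate vectors live in the function space \<open>nat \<Rightarrow> 'k\<close> for
  every module.\<close>

lemma coordinates:
  assumes "fg_right_module B M"
  obtains N :: nat and t :: "nat \<Rightarrow> 'm" and v :: "nat \<Rightarrow> nat" and \<kappa> :: "'m \<Rightarrow> nat \<Rightarrow> 'k"
  where "\<And>n. n < N \<Longrightarrow> t n \<in> carrier M" "\<And>n. n < N \<Longrightarrow> v n \<in> V" "\<And>n. n < N \<Longrightarrow> bs (v n) (v n) \<odot>\<^bsub>M\<^esub> t n = t n"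
    "\<And>x y n. x \<in> carrier M \<Longrightarrow> y \<in> carrier M \<Longrightarrow> \<kappa> (x \<oplus>\<^bsub>M\<^esub> y) n = \<kappa> x n + \<kappa> y n"
    "\<And>c x n. x \<in> carrier M \<Longrightarrow> \<kappa> (sc c x) n = c * \<kappa> x n"
    "\<And>x n. n \<ge> N \<Longrightarrow> \<kappa> x n = 0"
    "\<And>x. x \<in> carrier M \<Longrightarrow> (\<And>n. n < N \<Longrightarrow> \<kappa> x n = 0) \<Longrightarrow> x = \<zero>\<^bsub>M\<^esub>"
    "\<And>n m. n < N \<Longrightarrow> \<kappa> (t n) m = (if m = n then 1 else 0)"
    "\<And>x. x \<in> carrier M \<Longrightarrow> x = (\<Oplus>\<^bsub>M\<^esub>n\<in>{..<N}. sc (\<kappa> x n) (t n))"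
proof -
  obtain T where fin: "finite T" and sub: "T \<subseteq> carrier M" and hom: "\<And>t. t \<in> T \<Longrightarrow> \<exists>v\<in>V. bs v v \<odot>\<^bsub>M\<^esub> t = t"
    and span: "kspan T = carrier M" and indep: "\<And>c t. lincomb T c = \<zero>\<^bsub>M\<^esub> \<Longrightarrow> t \<in> T \<Longrightarrow> c t = 0"
    using homogeneous_basis[OF assms] by metis
  obtain h where h: "bij_betw h {0..<card T} T" using fin ex_bij_betw_nat_finite by blast
  then have hinj: "inj_on h {..<card T}" and him: "h ` {..<card T} = T" by (auto simp: bij_betw_def atLeast0LessThan)
  have hT: "h n \<in> T" if "n < card T" for n using him that by auto
  define coef where "coef x = (SOME c. x = lincomb T c)" for x
  have coef: "x = lincomb T (coef x)" if "x \<in> carrier M" for x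
  proof -
    have "\<exists>c. x = lincomb T c" using that span kspan_eq_lincomb[OF fin sub, of x] by blast
    then show ?thesis unfolding coef_def by (rule someI_ex)
  qed
  have uniq: "c s = d s" if "lincomb T c = lincomb T d" "s \<in> T" for c d s
  proof -
    have "lincomb T (\<lambda>s. c s + (- 1) * d s) = lincomb T (\<lambda>s. d s + (- 1) * d s)"
      using that sub by (simp only: lincomb_add lincomb_sc[OF fin sub])
    also have "\<dots> = lincomb T (\<lambda>s. 0 * d s)" by simp
    also have "\<dots> = \<zero>\<^bsub>M\<^esub>" unfolding lincomb_sc[OF fin sub] by (rule sc_zero[OF lincomb_closed[OF sub]])
    finally have "c s + (- 1) * d s = 0" using indep[OF _ that(2), of "\<lambda>s. c s + (- 1) * d s"] by blast
    then show ?thesis by simp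
  qed
  define v where "v n = (SOME v. v \<in> V \<and> bs v v \<odot>\<^bsub>M\<^esub> h n = h n)" for n
  have v: "v n \<in> V \<and> bs (v n) (v n) \<odot>\<^bsub>M\<^esub> h n = h n" if "n < card T" for n
    unfolding v_def by (rule someI_ex) (use hom[OF hT[OF that]] in blast)
  define \<kappa> where "\<kappa> x n = (if n < card T then coef x (h n) else 0)" for x n
  show thesis
  proof (rule that[of "card T" h v \<kappa>])
    show "h n \<in> carrier M" if "n < card T" for n using hT[OF that] sub by auto
    show "\<kappa> (x \<oplus>\<^bsub>M\<^esub> y) n = \<kappa> x n + \<kappa> y n" if "x \<in> carrier M" "y \<in> carrier M" for x y n
    proof -
      have "lincomb T (coef (x \<oplus>\<^bsub>M\<^esub> y)) = lincomb T (\<lambda>s. coef x s + coef y s)"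
        using that by (simp add: coef[symmetric] lincomb_add[OF sub])
      from uniq[OF this] show ?thesis using hT by (simp add: \<kappa>_def)
    qed
    show "\<kappa> (sc c x) n = c * \<kappa> x n" if "x \<in> carrier M" for c x n
    proof -
      have "lincomb T (coef (sc c x)) = lincomb T (\<lambda>s. c * coef x s)"
        using that by (simp add: coef[symmetric] lincomb_sc[OF fin sub] sc_closed)
      from uniq[OF this] show ?thesis using hT by (simp add: \<kappa>_def)
    qed
    show eq: "x = (\<Oplus>\<^bsub>M\<^esub>n\<in>{..<card T}. sc (\<kappa> x n) (h n))" if x: "x \<in> carrier M" for x
    proof -
      have "(\<Oplus>\<^bsub>M\<^esub>t\<in>h ` {..<card T}. sc (coef x t) t) = (\<Oplus>\<^bsub>M\<^esub>n\<in>{..<card T}. sc (coef x (h n)) (h n))"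
        by (rule M.finsum_reindex[OF _ hinj]) (use hT sub in \<open>auto intro!: sc_closed\<close>)
      also have "\<dots> = (\<Oplus>\<^bsub>M\<^esub>n\<in>{..<card T}. sc (\<kappa> x n) (h n))"
        by (rule M.finsum_cong') (use hT sub in \<open>auto simp: \<kappa>_def intro!: sc_closed\<close>)
      finally show ?thesis using coef[OF x] by (simp add: lincomb_def him)
    qed
    show "x = \<zero>\<^bsub>M\<^esub>" if x: "x \<in> carrier M" and z: "\<And>n. n < card T \<Longrightarrow> \<kappa> x n = 0" for x
    proof -
      have "(\<Oplus>\<^bsub>M\<^esub>n\<in>{..<card T}. sc (\<kappa> x n) (h n)) = (\<Oplus>\<^bsub>M\<^esub>n\<in>{..<card T}. \<zero>\<^bsub>M\<^esub>)"
        by (rule M.finsum_cong') (use z hT sub in \<open>auto intro!: sc_zero\<close>)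
      with eq[OF x] show ?thesis by simp
    qed
    show "\<kappa> (h n) m = (if m = n then 1 else 0)" if n: "n < card T" for n m
    proof -
      have "lincomb T (coef (h n)) = lincomb T (\<lambda>s. if s = h n then 1 else 0)"
        using hT[OF n] sub by (subst coef[symmetric]) (auto simp: lincomb_delta[OF fin sub])
      from uniq[OF this] show ?thesis using hT n hinj by (auto simp: \<kappa>_def inj_on_def)
    qed
  qed (use v in \<open>auto simp: \<kappa>_def\<close>)
qed

lemma linear_coordinates:
  assumes "fg_right_module B M"
  obtains N :: nat and \<kappa> :: "'m \<Rightarrow> nat \<Rightarrow> 'k"
  where "\<And>x y n. x \<in> carrier M \<Longrightarrow> y \<in> carrier M \<Longrightarrow> \<kappa> (x \<oplus>\<^bsub>M\<^esub> y) n = \<kappa> x n + \<kappa> y n"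
    "\<And>c x n. x \<in> carrier M \<Longrightarrow> \<kappa> (sc c x) n = c * \<kappa> x n"
    "\<And>x n. n \<ge> N \<Longrightarrow> \<kappa> x n = 0"
    "\<And>x y. x \<in> carrier M \<Longrightarrow> y \<in> carrier M \<Longrightarrow> \<kappa> x = \<kappa> y \<Longrightarrow> x = y"
proof (rule coordinates[OF assms])
  fix N and \<kappa> :: "'m \<Rightarrow> nat \<Rightarrow> 'k"
  assume kadd: "\<And>x y n. x \<in> carrier M \<Longrightarrow> y \<in> carrier M \<Longrightarrow> \<kappa> (x \<oplus>\<^bsub>M\<^esub> y) n = \<kappa> x n + \<kappa> y n"
    and ksc: "\<And>c x n. x \<in> carrier M \<Longrightarrow> \<kappa> (sc c x) n = c * \<kappa> x n"
    and kN: "\<And>x n. n \<ge> N \<Longrightarrow> \<kappa> x n = 0"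
    and kz: "\<And>x. x \<in> carrier M \<Longrightarrow> (\<And>n. n < N \<Longrightarrow> \<kappa> x n = 0) \<Longrightarrow> x = \<zero>\<^bsub>M\<^esub>"
  have kinj: "x = y" if "x \<in> carrier M" "y \<in> carrier M" "\<kappa> x = \<kappa> y" for x y
  proof -
    have "\<kappa> (x \<oplus>\<^bsub>M\<^esub> sc (- 1) y) n = 0" for n using that by (simp add: kadd ksc sc_closed)
    then have "x \<oplus>\<^bsub>M\<^esub> sc (- 1) y = \<zero>\<^bsub>M\<^esub>" using that by (intro kz) (auto simp: sc_closed)
    moreover have "y \<oplus>\<^bsub>M\<^esub> sc (- 1) y = \<zero>\<^bsub>M\<^esub>"
      using sc_add_left[OF that(2), of 1 "- 1"] that by (simp add: sc_one sc_zero)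
    ultimately show ?thesis using that by (metis M.minus_equality sc_closed)
  qed
  show thesis by (rule that[OF kadd ksc kN kinj])
qed

end

lemma (in right_module) smult_finsum:
  assumes "finite A" "\<And>a. a \<in> A \<Longrightarrow> f a \<in> carrier M" "r \<in> carrier R"
  shows "r \<odot>\<^bsub>M\<^esub> (\<Oplus>\<^bsub>M\<^esub>a\<in>A. f a) = (\<Oplus>\<^bsub>M\<^esub>a\<in>A. r \<odot>\<^bsub>M\<^esub> f a)"
  using assms(1,2)
proof (induction A)
  case empty
  then show ?case using assms by (simp add: smult_zero_right)
next
  case (insert a A)
  then have "f \<in> A \<rightarrow> carrier M" "(\<lambda>a. r \<odot>\<^bsub>M\<^esub> f a) \<in> A \<rightarrow> carrier M"
    using assms(3) by (auto intro: r_smult_closed)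
  with insert assms(3) show ?case by (simp add: r_smult_module_distr r_smult_closed)
qed

lemma rmod_hom_finsum:
  assumes M: "right_module R M" and N: "right_module R N" and g: "g \<in> rmod_hom R M N"
    and "finite A" "\<And>a. a \<in> A \<Longrightarrow> f a \<in> carrier M"
  shows "g (\<Oplus>\<^bsub>M\<^esub>a\<in>A. f a) = (\<Oplus>\<^bsub>N\<^esub>a\<in>A. g (f a))"
proof -
  interpret M: right_module R M by fact
  interpret N: right_module R N by fact
  show ?thesis
    using assms(4,5)
  proof (induction A)
    case empty
    then show ?case using rmod_hom_zero[OF M N g] by simp
  next
    case (insert a A)
    then have "f \<in> A \<rightarrow> carrier M" "(\<lambda>a. g (f a)) \<in> A \<rightarrow> carrier N"
      using rmod_homD(1)[OF g] by auto
    with insert show ?case by (simp add: rmod_homD[OF g])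
  qed
qed

lemma (in coord_algebra) coord_moduleI: "right_module B M \<Longrightarrow> coord_module B \<eta> V S co M"
  by (simp add: coord_module_def coord_algebra_axioms)

section \<open>Thin modules\<close>

context coord_algebra
begin

text \<open>
  A thin module is a direct sum, indexed by \<open>n\<close>, of modules with a one-dimensional component at each
  vertex \<open>k\<close> such that \<open>(n, k) \<in> W\<close>. For \<open>W = psum vs\<close> and \<open>W = isum vs\<close> the summands
  are the indecomposable projectives \<open>P(v) = e\<^sub>v B\<close> and the indecomposable injectives \<open>I(v)\<close>, the duals of
  \<open>B e\<^sub>v\<close>, for the entries \<open>v\<close> of \<open>vs\<close>.
\<close>

definition thin :: "(nat \<times> nat) set \<Rightarrow> ('a, nat \<Rightarrow> nat \<Rightarrow> 'k) module" where
  "thin W = \<lparr>carrier = {f. \<forall>n k. (n, k) \<notin> W \<longrightarrow> f n k = 0}, monoid.mult = (\<lambda>f g. f),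
     monoid.one = (\<lambda>_ _. 0), ring.zero = (\<lambda>_ _. 0), ring.add = (\<lambda>f g n k. f n k + g n k),
     smult = (\<lambda>r f n k. if (n, k) \<in> W then \<Sum>i\<in>V. f n i * co r i k else 0)\<rparr>"

lemma thin_simps:
  "f \<in> carrier (thin W) \<longleftrightarrow> (\<forall>n k. (n, k) \<notin> W \<longrightarrow> f n k = 0)"
  "\<zero>\<^bsub>thin W\<^esub> = (\<lambda>_ _. 0)" "f \<oplus>\<^bsub>thin W\<^esub> g = (\<lambda>n k. f n k + g n k)"
  "r \<odot>\<^bsub>thin W\<^esub> f = (\<lambda>n k. if (n, k) \<in> W then \<Sum>i\<in>V. f n i * co r i k else 0)"
  by (simp_all add: thin_def)

text \<open>The last condition makes the action associative: from component i to component k, the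
  product of \<open>bs i j\<close> and \<open>bs j k\<close> acts nontrivially iff (i,k) is in
  \<open>S\<close>, while its factors act nontrivially one after the other iff the component j is
  present.\<close>

definition thin_ok :: "(nat \<times> nat) set \<Rightarrow> bool" where
  "thin_ok W \<longleftrightarrow> finite W \<and> (\<forall>n k. (n, k) \<in> W \<longrightarrow> k \<in> V) \<and>
     (\<forall>n i j k. (n, i) \<in> W \<longrightarrow> (n, k) \<in> W \<longrightarrow> (i, j) \<in> S \<longrightarrow> (j, k) \<in> S \<longrightarrow> ((n, j) \<in> W \<longleftrightarrow> (i, k) \<in> S))"

lemma thin_okD:
  assumes "thin_ok W"
  shows "finite W" "(n, k) \<in> W \<Longrightarrow> k \<in> V"
    "(n, i) \<in> W \<Longrightarrow> (n, k) \<in> W \<Longrightarrow> (i, j) \<in> S \<Longrightarrow> (j, k) \<in> S \<Longrightarrow> (n, j) \<in> W \<longleftrightarrow> (i, k) \<in> S"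
proof -
  note * = assms[unfolded thin_ok_def]
  show "finite W" using * by (rule conjunct1)
  show "(n, k) \<in> W \<Longrightarrow> k \<in> V" by (rule *[THEN conjunct2, THEN conjunct1, rule_format])
  show "(n, i) \<in> W \<Longrightarrow> (n, k) \<in> W \<Longrightarrow> (i, j) \<in> S \<Longrightarrow> (j, k) \<in> S \<Longrightarrow> (n, j) \<in> W \<longleftrightarrow> (i, k) \<in> S"
    by (rule *[THEN conjunct2, THEN conjunct2, rule_format])
qed

lemma thin_right_module:
  assumes "thin_ok W"
  shows "right_module B (thin W)"
proof -
  note fin = thin_okD(1)[OF assms] and WV = thin_okD(2)[OF assms] and ok = thin_okD(3)[OF assms]
  have ag: "abelian_group (thin W)"
  proof (rule abelian_groupI)
    fix f assume "f \<in> carrier (thin W)"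
    then show "\<exists>g\<in>carrier (thin W). g \<oplus>\<^bsub>thin W\<^esub> f = \<zero>\<^bsub>thin W\<^esub>"
      by (intro bexI[of _ "\<lambda>n k. - f n k"]) (auto simp: thin_simps)
  qed (auto simp: thin_simps add_ac)
  have assoc: "(r \<otimes> s) \<odot>\<^bsub>thin W\<^esub> f = s \<odot>\<^bsub>thin W\<^esub> (r \<odot>\<^bsub>thin W\<^esub> f)"
    if r: "r \<in> carrier B" and s: "s \<in> carrier B" and f: "f \<in> carrier (thin W)" for r s f
  proof (intro ext)
    fix n k
    show "((r \<otimes> s) \<odot>\<^bsub>thin W\<^esub> f) n k = (s \<odot>\<^bsub>thin W\<^esub> (r \<odot>\<^bsub>thin W\<^esub> f)) n k"
    proof (cases "(n, k) \<in> W")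
      case True
      have t: "f n i * (if (i, k) \<in> S then co r i j * co s j k else 0) =
         (if (n, j) \<in> W then f n i * co r i j else 0) * co s j k" for i j
      proof (cases "f n i = 0 \<or> co r i j = 0 \<or> co s j k = 0")
        case False
        then have "(n, i) \<in> W" "(i, j) \<in> S" "(j, k) \<in> S"
          using f co_supp[OF r, of i j] co_supp[OF s, of j k] by (auto simp: thin_simps)
        then show ?thesis using ok[of n i k j] True by simp
      qed auto
      have "((r \<otimes> s) \<odot>\<^bsub>thin W\<^esub> f) n k = (\<Sum>i\<in>V. f n i * (\<Sum>j\<in>V. if (i, k) \<in> S then co r i j * co s j k else 0))"
      proof -
        have "co (r \<otimes> s) i k = (\<Sum>j\<in>V. if (i, k) \<in> S then co r i j * co s j k else 0)" for i
          using r s by (cases "(i, k) \<in> S") (simp_all add: co_mult co_supp)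
        then show ?thesis using True by (simp only: thin_simps(4) if_True)
      qed
      also have "\<dots> = (\<Sum>i\<in>V. \<Sum>j\<in>V. (if (n, j) \<in> W then f n i * co r i j else 0) * co s j k)"
        by (simp add: sum_distrib_left t)
      also have "\<dots> = (\<Sum>j\<in>V. (\<Sum>i\<in>V. if (n, j) \<in> W then f n i * co r i j else 0) * co s j k)"
        by (subst sum.swap) (simp add: sum_distrib_right)
      also have "\<dots> = (s \<odot>\<^bsub>thin W\<^esub> (r \<odot>\<^bsub>thin W\<^esub> f)) n k"
        using True by (auto simp: thin_simps intro!: sum.cong)
      finally show ?thesis .
    qed (simp add: thin_simps)
  qed
  have one: "\<one> \<odot>\<^bsub>thin W\<^esub> f = f" if f: "f \<in> carrier (thin W)" for f
  proof (intro ext)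
    fix n k
    have "(\<Sum>i\<in>V. f n i * co \<one> i k) = (\<Sum>i\<in>V. if i = k then f n k else 0)"
      by (intro sum.cong refl) (auto simp: co_one)
    then show "(\<one> \<odot>\<^bsub>thin W\<^esub> f) n k = f n k"
      using f finite_V WV[of n k] by (auto simp: thin_simps sum.delta)
  qed
  show ?thesis
    by (intro right_module.intro right_module_axioms.intro ring_axioms ag assoc one)
      (auto simp: thin_simps co_add algebra_simps sum.distrib intro!: ext)
qed

definition unit_fun :: "nat \<Rightarrow> nat \<Rightarrow> nat \<Rightarrow> nat \<Rightarrow> 'k" where
  "unit_fun n k = (\<lambda>n' k'. if n' = n \<and> k' = k then 1 else 0)"

lemma unit_fun_closed: "(n, k) \<in> W \<Longrightarrow> unit_fun n k \<in> carrier (thin W)"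
  by (auto simp: thin_simps unit_fun_def)

lemma smult_unit_fun:
  assumes "thin_ok W" "(n, i) \<in> W"
  shows "r \<odot>\<^bsub>thin W\<^esub> unit_fun n i = (\<lambda>m k. if m = n \<and> (n, k) \<in> W then co r i k else 0)"
proof (intro ext)
  fix m k
  have "(\<Sum>j\<in>V. unit_fun n i m j * co r j k) = (\<Sum>j\<in>V. if j = i then (if m = n then co r i k else 0) else 0)"
    by (intro sum.cong refl) (auto simp: unit_fun_def)
  moreover have "i \<in> V" using thin_okD(2)[OF assms] .
  ultimately show "(r \<odot>\<^bsub>thin W\<^esub> unit_fun n i) m k = (if m = n \<and> (n, k) \<in> W then co r i k else 0)"
    using finite_V by (auto simp: thin_simps sum.delta)
qed

lemma smult_bs_thin:
  assumes "f \<in> carrier (thin W)"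
  shows "(bs i k \<odot>\<^bsub>thin W\<^esub> f) n j = (if (n, j) \<in> W \<and> j = k \<and> (i, k) \<in> S then f n i else 0)"
proof -
  have "(\<Sum>l\<in>V. f n l * co (bs i k) l j) = (\<Sum>l\<in>V. if l = i then (if j = k \<and> (i, k) \<in> S then f n i else 0) else 0)"
    by (intro sum.cong refl) (auto simp: co_bs)
  then show ?thesis using S_vertices(1)[of i k] finite_V by (auto simp: thin_simps sum.delta)
qed

lemma thin_finsum:
  assumes "thin_ok W" "finite A" "\<And>a. a \<in> A \<Longrightarrow> F a \<in> carrier (thin W)"
  shows "(\<Oplus>\<^bsub>thin W\<^esub>a\<in>A. F a) = (\<lambda>n k. \<Sum>a\<in>A. F a n k)"
proof -
  interpret W: right_module B "thin W" by (rule thin_right_module[OF assms(1)])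
  show ?thesis
    using assms(2,3)
  proof (induction A)
    case empty
    then show ?case by (simp add: thin_simps)
  next
    case (insert a A)
    then have "F \<in> A \<rightarrow> carrier (thin W)" by auto
    with insert show ?case by (simp add: thin_simps(3))
  qed
qed

lemma thin_fg:
  assumes ok: "thin_ok W"
  shows "fg_right_module B (thin W)"
proof -
  interpret W: right_module B "thin W" by (rule thin_right_module[OF ok])
  note fin = thin_okD(1)[OF ok] and WV = thin_okD(2)[OF ok]
  let ?S = "(\<lambda>(n, k). unit_fun n k) ` W"
  have "N = carrier (thin W)" if N: "submodule N B (thin W)" "?S \<subseteq> N" for N
  proof
    note D = submoduleD'[OF N(1)]
    show "N \<subseteq> carrier (thin W)" by (rule D)
    have "f \<in> N" if "finite U" "U \<subseteq> W" "\<And>n k. (n, k) \<notin> U \<Longrightarrow> f n k = 0" for U f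
      using that
    proof (induction U arbitrary: f)
      case empty
      then have "f = \<zero>\<^bsub>thin W\<^esub>" by (auto simp: thin_simps)
      then show ?case using D(2) by simp
    next
      case (insert p U)
      obtain n k where p: "p = (n, k)" "(n, k) \<in> W" using insert.prems by (cases p) auto
      let ?g = "\<lambda>m j. if (m, j) \<in> U then f m j else 0"
      have "?g \<in> N" using insert by (intro insert.IH) auto
      moreover have "\<eta> (f n k) \<odot>\<^bsub>thin W\<^esub> unit_fun n k \<in> N"
        using D(4)[OF eta_closed] N(2) p by auto
      ultimately have "\<eta> (f n k) \<odot>\<^bsub>thin W\<^esub> unit_fun n k \<oplus>\<^bsub>thin W\<^esub> ?g \<in> N" by (intro D(3))
      moreover have "\<eta> (f n k) \<odot>\<^bsub>thin W\<^esub> unit_fun n k \<oplus>\<^bsub>thin W\<^esub> ?g = f"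
        using insert.hyps insert.prems WV[OF p(2)] p
        by (auto simp: smult_unit_fun[OF ok p(2)] thin_simps(3) co_eta fun_eq_iff)
      ultimately show ?case by simp
    qed
    from this[OF fin order_refl] show "carrier (thin W) \<subseteq> N" by (auto simp: thin_simps)
  qed
  then show ?thesis
    unfolding fg_right_module_def using fin
    by (intro conjI W.right_module_axioms exI[of _ ?S]) (auto intro: unit_fun_closed)
qed

section \<open>Projective and injective thin modules\<close>

definition psum :: "nat list \<Rightarrow> (nat \<times> nat) set" where
  "psum vs = {(n, k). n < length vs \<and> (vs ! n, k) \<in> S}"

definition isum :: "nat list \<Rightarrow> (nat \<times> nat) set" where
  "isum vs = {(n, k). n < length vs \<and> (k, vs ! n) \<in> S}"

text \<open>On the row of a vertex w the condition is \<open>S_assoc\<close> with w as first vertex;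
  for \<open>isum\<close> it is the same axiom with w as last vertex.\<close>

lemma thin_ok_psum: "thin_ok (psum vs)"
proof -
  have "finite (psum vs)"
    by (rule finite_subset[of _ "{..<length vs} \<times> V"]) (use finite_V S_vertices in \<open>auto simp: psum_def\<close>)
  then show ?thesis
    unfolding thin_ok_def
  proof (intro conjI allI impI)
    fix n i j k
    assume "(n, i) \<in> psum vs" "(n, k) \<in> psum vs" "(i, j) \<in> S" "(j, k) \<in> S"
    then show "(n, j) \<in> psum vs \<longleftrightarrow> (i, k) \<in> S" using S_assoc[of "vs ! n" i j k] by (simp add: psum_def)
  qed (auto simp: psum_def S_vertices)
qed

lemma thin_ok_isum: "thin_ok (isum vs)"
proof -
  have "finite (isum vs)"
    by (rule finite_subset[of _ "{..<length vs} \<times> V"]) (use finite_V S_vertices in \<open>auto simp: isum_def\<close>)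
  then show ?thesis
    unfolding thin_ok_def
  proof (intro conjI allI impI)
    fix n i j k
    assume "(n, i) \<in> isum vs" "(n, k) \<in> isum vs" "(i, j) \<in> S" "(j, k) \<in> S"
    then show "(n, j) \<in> isum vs \<longleftrightarrow> (i, k) \<in> S" using S_assoc[of i j k "vs ! n"] by (simp add: isum_def)
  qed (auto simp: isum_def S_vertices)
qed

definition row_elt :: "nat \<Rightarrow> (nat \<Rightarrow> 'k) \<Rightarrow> 'a" where
  "row_elt v g = mk (\<lambda>i k. if i = v then g k else 0)"

lemma row_elt: "row_elt v g \<in> carrier B" "co (row_elt v g) i k = (if i = v \<and> (i, k) \<in> S then g k else 0)"
  by (auto simp: row_elt_def mk)

text \<open>P(w) is generated by its idempotent, so the images of the generators can be prescribed;
  only the component of \<open>x n\<close> at \<open>vs ! n\<close> matters. The row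
  \<open>c n\<close> is turned into an algebra element and acts on \<open>x n\<close>.\<close>

lemma psum_hom:
  fixes X :: "('a, 'm) module"
  assumes X: "right_module B X" and x: "\<And>n. n < length vs \<Longrightarrow> x n \<in> carrier X"
  shows "(\<lambda>c. \<Oplus>\<^bsub>X\<^esub>n\<in>{..<length vs}. row_elt (vs ! n) (c n) \<odot>\<^bsub>X\<^esub> x n) \<in> rmod_hom B (thin (psum vs)) X"
    (is "?h \<in> _")
proof -
  let ?W = "psum vs" and ?N = "length vs"
  interpret X: right_module B X by fact
  have cl: "row_elt w g \<odot>\<^bsub>X\<^esub> x n \<in> carrier X" if "n < ?N" for w g n
    using that x row_elt by (simp add: X.r_smult_closed)
  show ?thesis
  proof (rule rmod_homI)
    show "?h c \<in> carrier X" for c using cl by (auto intro!: X.M.finsum_closed)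
    show "?h (c \<oplus>\<^bsub>thin ?W\<^esub> d) = ?h c \<oplus>\<^bsub>X\<^esub> ?h d" for c d
    proof -
      have "row_elt w ((c \<oplus>\<^bsub>thin ?W\<^esub> d) n) = row_elt w (c n) \<oplus> row_elt w (d n)" for w n
        by (rule co_eqI) (auto simp: row_elt co_add thin_simps)
      then have "?h (c \<oplus>\<^bsub>thin ?W\<^esub> d) =
          (\<Oplus>\<^bsub>X\<^esub>n\<in>{..<?N}. row_elt (vs ! n) (c n) \<odot>\<^bsub>X\<^esub> x n \<oplus>\<^bsub>X\<^esub> row_elt (vs ! n) (d n) \<odot>\<^bsub>X\<^esub> x n)"
        using cl x by (intro X.M.finsum_cong') (auto simp: X.r_smult_ring_distr row_elt)
      then show ?thesis using cl by (simp add: X.M.finsum_addf Pi_def)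
    qed
    show "?h (r \<odot>\<^bsub>thin ?W\<^esub> c) = r \<odot>\<^bsub>X\<^esub> ?h c" if r: "r \<in> carrier B" and c: "c \<in> carrier (thin ?W)" for r c
    proof -
      have eq: "row_elt (vs ! n) ((r \<odot>\<^bsub>thin ?W\<^esub> c) n) = row_elt (vs ! n) (c n) \<otimes> r" if n: "n < ?N" for n
      proof (rule co_eqI)
        fix i k assume ik: "(i, k) \<in> S"
        have "(\<Sum>j\<in>V. co (row_elt (vs ! n) (c n)) i j * co r j k) = (if i = vs ! n then \<Sum>j\<in>V. c n j * co r j k else 0)"
          using c n by (auto simp: row_elt thin_simps(1) psum_def intro!: sum.cong)
        then have "co (row_elt (vs ! n) (c n) \<otimes> r) i k = (if i = vs ! n then \<Sum>j\<in>V. c n j * co r j k else 0)"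
          using co_mult[OF row_elt(1) r ik] by simp
        moreover have "co (row_elt (vs ! n) ((r \<odot>\<^bsub>thin ?W\<^esub> c) n)) i k = (if i = vs ! n then \<Sum>j\<in>V. c n j * co r j k else 0)"
          using n ik by (auto simp: row_elt thin_simps(4) psum_def)
        ultimately show "co (row_elt (vs ! n) ((r \<odot>\<^bsub>thin ?W\<^esub> c) n)) i k = co (row_elt (vs ! n) (c n) \<otimes> r) i k" by simp
      qed (auto simp: row_elt r)
      have "?h (r \<odot>\<^bsub>thin ?W\<^esub> c) = (\<Oplus>\<^bsub>X\<^esub>n\<in>{..<?N}. r \<odot>\<^bsub>X\<^esub> (row_elt (vs ! n) (c n) \<odot>\<^bsub>X\<^esub> x n))"
        using cl x r
        by (intro X.M.finsum_cong') (auto simp: X.r_smult_assoc row_elt eq intro!: X.r_smult_closed)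
      then show ?thesis using cl r by (subst X.smult_finsum) auto
    qed
  qed
qed

lemma thin_projective: "projective_rmod B (thin (psum vs))"
proof -
  let ?W = "psum vs" and ?N = "length vs"
  note ok = thin_ok_psum[of vs]
  interpret W: right_module B "thin ?W" by (rule thin_right_module[OF ok])
  define rr where "rr c n = row_elt (vs ! n) (c n)" for c :: "nat \<Rightarrow> nat \<Rightarrow> 'k" and n
  \<comment> \<open>A list entry outside \<open>V\<close> gives a zero summand, whose generator has
    to be 0.\<close>
  define u where "u n = (if vs ! n \<in> V then unit_fun n (vs ! n) else \<zero>\<^bsub>thin ?W\<^esub>)" for n
  have rr: "rr c n \<in> carrier B" for c n by (simp add: rr_def row_elt)
  have co_rr: "co (rr c n) i k = (if i = vs ! n \<and> (i, k) \<in> S then c n k else 0)" for c n i k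
    by (auto simp: rr_def row_elt)
  have u: "u n \<in> carrier (thin ?W)" if "n < ?N" for n
  proof (cases "vs ! n \<in> V")
    case True
    then show ?thesis using that S_refl by (auto simp: u_def psum_def intro!: unit_fun_closed)
  qed (simp add: u_def)
  have dec: "(\<Oplus>\<^bsub>thin ?W\<^esub>n\<in>{..<?N}. rr c n \<odot>\<^bsub>thin ?W\<^esub> u n) = c" if c: "c \<in> carrier (thin ?W)" for c
  proof -
    have t: "(rr c n \<odot>\<^bsub>thin ?W\<^esub> u n) m k = (if m = n then c m k else 0)" if n: "n < ?N" for n m k
    proof (cases "vs ! n \<in> V")
      case True
      then have "(n, vs ! n) \<in> ?W" using n S_refl by (simp add: psum_def)
      from smult_unit_fun[OF ok this] show ?thesis
        using c n True by (auto simp: u_def co_rr psum_def thin_simps(1))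
    next
      case False
      then have "c n k = 0" using c S_vertices(1) by (auto simp: thin_simps(1) psum_def)
      moreover have "rr c n \<odot>\<^bsub>thin ?W\<^esub> u n = \<zero>\<^bsub>thin ?W\<^esub>" using False by (simp add: u_def W.smult_zero_right rr)
      ultimately show ?thesis by (simp add: thin_simps(2))
    qed
    have z: "c m k = 0" if "\<not> m < ?N" for m k using that c by (simp add: thin_simps psum_def)
    show ?thesis
      by (subst thin_finsum[OF ok]) (auto simp: t z W.r_smult_closed rr u fun_eq_iff sum.delta')
  qed
  have "\<exists>h\<in>rmod_hom B (thin ?W) X. \<forall>x\<in>carrier (thin ?W). f (h x) = g x"
    if X: "fg_right_module B X" and Y: "fg_right_module B Y" and f: "f \<in> rmod_hom B X Y"
      and surj: "f ` carrier X = carrier Y" and g: "g \<in> rmod_hom B (thin ?W) Y"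
    for X Y :: "'a rmod" and f g
  proof -
    interpret X: right_module B X by (rule fg_right_moduleD[OF X])
    interpret Y: right_module B Y by (rule fg_right_moduleD[OF Y])
    have "\<forall>n\<in>{..<?N}. \<exists>x. x \<in> carrier X \<and> f x = g (u n)"
    proof
      fix n assume "n \<in> {..<?N}"
      then have "g (u n) \<in> f ` carrier X" using u rmod_homD(1)[OF g] surj by auto
      then show "\<exists>x. x \<in> carrier X \<and> f x = g (u n)" by auto
    qed
    then obtain x where x: "\<And>n. n < ?N \<Longrightarrow> x n \<in> carrier X" "\<And>n. n < ?N \<Longrightarrow> f (x n) = g (u n)"
      by (metis lessThan_iff)
    define h where "h c = (\<Oplus>\<^bsub>X\<^esub>n\<in>{..<?N}. rr c n \<odot>\<^bsub>X\<^esub> x n)" for c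
    have cl: "rr c n \<odot>\<^bsub>X\<^esub> x n \<in> carrier X" if "n < ?N" for c n
      using that x rr by (simp add: X.r_smult_closed)
    have "h \<in> rmod_hom B (thin ?W) X"
      unfolding h_def rr_def by (rule psum_hom[OF X.right_module_axioms x(1)])
    moreover have "f (h c) = g c" if c: "c \<in> carrier (thin ?W)" for c
    proof -
      have "f (h c) = (\<Oplus>\<^bsub>Y\<^esub>n\<in>{..<?N}. f (rr c n \<odot>\<^bsub>X\<^esub> x n))"
        unfolding h_def using cl
        by (intro rmod_hom_finsum[OF X.right_module_axioms Y.right_module_axioms f]) auto
      also have "\<dots> = (\<Oplus>\<^bsub>Y\<^esub>n\<in>{..<?N}. g (rr c n \<odot>\<^bsub>thin ?W\<^esub> u n))"
        using x u rr rmod_homD[OF f] rmod_homD[OF g]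
        by (intro Y.M.finsum_cong') (auto intro!: Y.r_smult_closed)
      also have "\<dots> = g (\<Oplus>\<^bsub>thin ?W\<^esub>n\<in>{..<?N}. rr c n \<odot>\<^bsub>thin ?W\<^esub> u n)"
        using u rr
        by (intro rmod_hom_finsum[OF W.right_module_axioms Y.right_module_axioms g, symmetric]) (auto intro: W.r_smult_closed)
      finally show ?thesis by (simp add: dec[OF c])
    qed
    ultimately show ?thesis by (intro bexI ballI)
  qed
  then show ?thesis by (rule projective_rmodI[OF thin_fg[OF ok]])
qed

text \<open>Coordinates of \<open>Y\<close> identify \<open>X\<close> with a subspace
  \<open>Z\<close> of the function space. The linear map constructed from a basis of
  \<open>Z\<close> is defined on the whole space and hence on the coordinates of
  \<open>Y\<close>.\<close>

lemma functional_extension: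
  fixes X :: "('a, 'm) module" and Y :: "('a, 'n) module"
  assumes X: "right_module B X" and Y: "fg_right_module B Y" and f: "f \<in> rmod_hom B X Y" and inj: "inj_on f (carrier X)"
    and add: "\<And>x y. x \<in> carrier X \<Longrightarrow> y \<in> carrier X \<Longrightarrow> \<phi> (x \<oplus>\<^bsub>X\<^esub> y) = \<phi> x + \<phi> y"
    and scale: "\<And>c x. x \<in> carrier X \<Longrightarrow> \<phi> (\<eta> c \<odot>\<^bsub>X\<^esub> x) = c * \<phi> x"
  obtains \<psi> :: "'n \<Rightarrow> 'k" where "\<And>x y. x \<in> carrier Y \<Longrightarrow> y \<in> carrier Y \<Longrightarrow> \<psi> (x \<oplus>\<^bsub>Y\<^esub> y) = \<psi> x + \<psi> y"
    "\<And>c x. x \<in> carrier Y \<Longrightarrow> \<psi> (\<eta> c \<odot>\<^bsub>Y\<^esub> x) = c * \<psi> x" "\<And>x. x \<in> carrier X \<Longrightarrow> \<psi> (f x) = \<phi> x"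
proof -
  have Yr: "right_module B Y" by (rule fg_right_moduleD[OF Y])
  interpret X: coord_module B \<eta> V S co X by (rule coord_moduleI[OF X])
  interpret Y: coord_module B \<eta> V S co Y by (rule coord_moduleI[OF Yr])
  show thesis
  proof (rule Y.linear_coordinates[OF Y])
  fix N and \<kappa> :: "'n \<Rightarrow> nat \<Rightarrow> 'k"
  assume kadd: "\<And>x y n. x \<in> carrier Y \<Longrightarrow> y \<in> carrier Y \<Longrightarrow> \<kappa> (x \<oplus>\<^bsub>Y\<^esub> y) n = \<kappa> x n + \<kappa> y n"
    and ksc: "\<And>c x n. x \<in> carrier Y \<Longrightarrow> \<kappa> (\<eta> c \<odot>\<^bsub>Y\<^esub> x) n = c * \<kappa> x n"
    and kN: "\<And>x n. n \<ge> N \<Longrightarrow> \<kappa> x n = 0"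
    and kinjY: "\<And>x y. x \<in> carrier Y \<Longrightarrow> y \<in> carrier Y \<Longrightarrow> \<kappa> x = \<kappa> y \<Longrightarrow> x = y"
  define Z where "Z = (\<lambda>x. \<kappa> (f x)) ` carrier X"
  \<comment> \<open>The chosen preimage is unique since coordinates and \<open>f\<close> are
    injective.\<close>
  define p where "p z = \<phi> (SOME x. x \<in> carrier X \<and> \<kappa> (f x) = z)" for z
  have kinj: "x = y" if "x \<in> carrier X" "y \<in> carrier X" "\<kappa> (f x) = \<kappa> (f y)" for x y
    using that inj kinjY rmod_homD(1)[OF f] by (meson inj_onD)
  have p: "p (\<kappa> (f x)) = \<phi> x" if "x \<in> carrier X" for x
  proof -
    have "(SOME y. y \<in> carrier X \<and> \<kappa> (f y) = \<kappa> (f x)) = x"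
      by (rule some_equality) (use that kinj in auto)
    then show ?thesis by (simp add: p_def)
  qed
  have addZ: "x + y \<in> Z \<and> p (x + y) = p x + p y" if xy: "x \<in> Z" "y \<in> Z" for x y
  proof -
    obtain a b where ab: "a \<in> carrier X" "x = \<kappa> (f a)" "b \<in> carrier X" "y = \<kappa> (f b)"
      using xy by (auto simp: Z_def)
    then have "x + y = \<kappa> (f (a \<oplus>\<^bsub>X\<^esub> b))"
      using rmod_homD(1,2)[OF f] by (auto simp: kadd fun_eq_iff)
    then show ?thesis using ab p add by (auto simp: Z_def)
  qed
  have scZ: "(\<lambda>n. c * x n) \<in> Z \<and> p (\<lambda>n. c * x n) = c * p x" if x: "x \<in> Z" for c x
  proof -
    obtain a where a: "a \<in> carrier X" "x = \<kappa> (f a)" using x by (auto simp: Z_def)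
    then have "(\<lambda>n. c * x n) = \<kappa> (f (\<eta> c \<odot>\<^bsub>X\<^esub> a))"
      using rmod_homD(1,3)[OF f] by (auto simp: ksc fun_eq_iff eta_closed)
    then show ?thesis using a p scale X.sc_closed by (auto simp: Z_def)
  qed
  have "0 = \<kappa> (f \<zero>\<^bsub>X\<^esub>)"
    using rmod_hom_zero[OF X Yr f] ksc[of "\<zero>\<^bsub>Y\<^esub>" 0] by (simp add: fun_eq_iff Y.smult_zero_right eta_closed)
  then have zeroZ: "0 \<in> Z" unfolding Z_def by (metis X.M.zero_closed imageI)
  then have sub: "fun_vs.subspace Z" using addZ scZ by (auto simp: fun_vs.subspace_def)
  obtain Bz where Bz: "Bz \<subseteq> Z" "\<not> fun_vs.dependent Bz" "Z \<subseteq> fun_vs.span Bz"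
    using fun_vs.maximal_independent_subset[of Z] by blast
  define g where "g = fun_field_vs.construct Bz p"
  interpret g: Vector_Spaces.linear "\<lambda>c f i. c * f i" "(*)" g
    unfolding g_def by (rule fun_field_vs.linear_construct[OF Bz(2)])
  have "z \<in> Z \<and> g z = p z" if "z \<in> fun_vs.span Bz" for z
    using that
  proof (induction rule: fun_vs.span_induct_alt)
    case base
    show ?case using zeroZ scZ[OF zeroZ, of 0] g.zero by (simp add: zero_fun_def)
  next
    case (step c x y)
    have x: "x \<in> Z" "g x = p x" using step.hyps(1) Bz(1) fun_field_vs.construct_basis[OF Bz(2), of x p] by (auto simp: g_def)
    have "g ((\<lambda>i. c * x i) + y) = p (\<lambda>i. c * x i) + p y"
      using step x scZ[OF x(1), of c] by (simp only: g.add g.scale)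
    moreover have "(\<lambda>i. c * x i) + y \<in> Z \<and> p ((\<lambda>i. c * x i) + y) = p (\<lambda>i. c * x i) + p y"
      using step scZ[OF x(1), of c] by (intro addZ) blast+
    ultimately show ?case by (simp only: simp_thms)
  qed
  then have gp: "g z = p z" if "z \<in> Z" for z using Bz(3) that by auto
  show thesis
  proof (rule that[of "\<lambda>y. g (\<kappa> y)"])
    show "g (\<kappa> (x \<oplus>\<^bsub>Y\<^esub> y)) = g (\<kappa> x) + g (\<kappa> y)" if "x \<in> carrier Y" "y \<in> carrier Y" for x y
    proof -
      have "\<kappa> (x \<oplus>\<^bsub>Y\<^esub> y) = \<kappa> x + \<kappa> y" using kadd that by auto
      then show ?thesis by (simp add: g.add)
    qed
    show "g (\<kappa> (\<eta> c \<odot>\<^bsub>Y\<^esub> x)) = c * g (\<kappa> x)" if "x \<in> carrier Y" for c x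
    proof -
      have "\<kappa> (\<eta> c \<odot>\<^bsub>Y\<^esub> x) = (\<lambda>n. c * \<kappa> x n)" using ksc that by auto
      then show ?thesis by (simp add: g.scale)
    qed
    show "g (\<kappa> (f x)) = \<phi> x" if "x \<in> carrier X" for x
      using gp[of "\<kappa> (f x)"] p that by (simp add: Z_def)
  qed
qed
qed

text \<open>\<open>Hom(Y, I(v))\<close> is the dual of the vector space \<open>Y e\<^sub>v\<close>, so maps into \<open>I(v)\<close> extend because functionals do.\<close>

lemma functional_hom:
  fixes Y :: "('a, 'n) module"
  assumes Y: "right_module B Y"
    and add: "\<And>n x y. n < length vs \<Longrightarrow> x \<in> carrier Y \<Longrightarrow> y \<in> carrier Y \<Longrightarrow> \<psi> n (x \<oplus>\<^bsub>Y\<^esub> y) = \<psi> n x + \<psi> n y"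
    and scale: "\<And>n c x. n < length vs \<Longrightarrow> x \<in> carrier Y \<Longrightarrow> \<psi> n (\<eta> c \<odot>\<^bsub>Y\<^esub> x) = c * \<psi> n x"
  shows "(\<lambda>y n k. if (n, k) \<in> isum vs then \<psi> n (bs k (vs ! n) \<odot>\<^bsub>Y\<^esub> y) else 0) \<in> rmod_hom B Y (thin (isum vs))"
    (is "?h \<in> _")
proof -
  interpret Y: coord_module B \<eta> V S co Y by (rule coord_moduleI[OF Y])
  show ?thesis
  proof (rule rmod_homI)
    show "?h y \<in> carrier (thin (isum vs))" for y by (simp add: thin_simps)
    show "?h (x \<oplus>\<^bsub>Y\<^esub> y) = ?h x \<oplus>\<^bsub>thin (isum vs)\<^esub> ?h y" if "x \<in> carrier Y" "y \<in> carrier Y" for x y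
      using that by (auto simp: thin_simps fun_eq_iff Y.r_smult_module_distr add Y.r_smult_closed isum_def)
    show "?h (r \<odot>\<^bsub>Y\<^esub> y) = r \<odot>\<^bsub>thin (isum vs)\<^esub> ?h y" if r: "r \<in> carrier B" and y: "y \<in> carrier Y" for r y
    proof (intro ext)
      fix n k
      show "?h (r \<odot>\<^bsub>Y\<^esub> y) n k = (r \<odot>\<^bsub>thin (isum vs)\<^esub> ?h y) n k"
      proof (cases "(n, k) \<in> isum vs")
        case True
        then have n: "n < length vs" and kv: "(k, vs ! n) \<in> S" by (auto simp: isum_def)
        let ?s = "r \<otimes> bs k (vs ! n)"
        have co_s: "co ?s i j = (if j = vs ! n \<and> (i, vs ! n) \<in> S then co r i k else 0)" for i j
          using co_mult_bs[OF r, of k "vs ! n" i j] kv by simp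
        \<comment> \<open>An element supported in the column \<open>vs ! n\<close> is a combination
          of the units \<open>bs i (vs ! n)\<close>. The induction runs over the rows that carry its
          support.\<close>
        have expand: "\<psi> n (s \<odot>\<^bsub>Y\<^esub> y) = (\<Sum>i\<in>V. co s i (vs ! n) * \<psi> n (bs i (vs ! n) \<odot>\<^bsub>Y\<^esub> y))"
          if "finite U" "U \<subseteq> V" "s \<in> carrier B" "\<And>i j. co s i j \<noteq> 0 \<Longrightarrow> j = vs ! n \<and> i \<in> U" for U s
          using that
        proof (induction U arbitrary: s)
          case empty
          \<comment> \<open>Zero is written as a multiple by \<open>\<eta> 0\<close> so that
            \<open>scale\<close> gives the value 0.\<close>
          then have "s = \<eta> 0 \<otimes> \<zero>" by (intro co_eqI) (auto simp: co_zero eta_closed)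
          moreover have "\<psi> n (\<eta> 0 \<odot>\<^bsub>Y\<^esub> \<zero>\<^bsub>Y\<^esub>) = 0" using scale[OF n, of "\<zero>\<^bsub>Y\<^esub>" 0] by simp
          ultimately show ?case using y by (simp add: eta_closed Y.smult_zero_left Y.smult_zero_right co_zero)
        next
          case (insert a U)
          let ?u = "mk (\<lambda>i j. if i \<in> U then co s i j else 0)"
          have s: "s = bs a (vs ! n) \<otimes> \<eta> (co s a (vs ! n)) \<oplus> ?u"
            by (rule co_eqI) (use insert in \<open>auto simp: eta_closed co_add eta_mult_right co_bs mk\<close>)
          have u: "?u \<in> carrier B" by (rule mk)
          have "\<psi> n (?u \<odot>\<^bsub>Y\<^esub> y) = (\<Sum>i\<in>V. co ?u i (vs ! n) * \<psi> n (bs i (vs ! n) \<odot>\<^bsub>Y\<^esub> y))"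
            using insert.prems by (intro insert.IH) (auto simp: mk split: if_splits)
          moreover have "\<psi> n (s \<odot>\<^bsub>Y\<^esub> y) = co s a (vs ! n) * \<psi> n (bs a (vs ! n) \<odot>\<^bsub>Y\<^esub> y) + \<psi> n (?u \<odot>\<^bsub>Y\<^esub> y)"
            using y u by (subst s) (simp add: Y.r_smult_ring_distr eta_closed Y.r_smult_assoc add[OF n] scale[OF n] Y.r_smult_closed)
          moreover have eq: "co s i (vs ! n) * x = (if i = a then co s a (vs ! n) * x else 0) + co ?u i (vs ! n) * x" for i x
            using insert.hyps insert.prems(3)[of i "vs ! n"] co_supp[OF insert.prems(2), of i "vs ! n"] by (auto simp: mk)
          then have "(\<Sum>i\<in>V. co s i (vs ! n) * \<psi> n (bs i (vs ! n) \<odot>\<^bsub>Y\<^esub> y)) =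
            (\<Sum>i\<in>V. (if i = a then co s a (vs ! n) * \<psi> n (bs i (vs ! n) \<odot>\<^bsub>Y\<^esub> y) else 0) +
               co ?u i (vs ! n) * \<psi> n (bs i (vs ! n) \<odot>\<^bsub>Y\<^esub> y))"
            by (intro sum.cong refl) (rule eq)
          ultimately show ?case
            using insert.prems(1) finite_V by (simp only: sum.distrib sum.delta if_True insert_subset)
        qed
        have "\<psi> n (?s \<odot>\<^bsub>Y\<^esub> y) = (\<Sum>i\<in>V. co ?s i (vs ! n) * \<psi> n (bs i (vs ! n) \<odot>\<^bsub>Y\<^esub> y))"
          by (rule expand[OF finite_V order_refl]) (use r in \<open>simp_all add: co_s S_vertices split: if_splits\<close>)
        also have "\<dots> = (\<Sum>i\<in>V. ?h y n i * co r i k)"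
          using n by (intro sum.cong refl) (auto simp: co_s isum_def)
        finally show ?thesis using True r y by (simp add: Y.r_smult_assoc[symmetric] thin_simps(4))
      qed (simp add: thin_simps)
    qed
  qed
qed

lemma thin_injective: "injective_rmod B (thin (isum vs))"
proof -
  let ?W = "isum vs" and ?N = "length vs"
  note ok = thin_ok_isum[of vs]
  have "\<exists>h\<in>rmod_hom B Y (thin ?W). \<forall>x\<in>carrier X. h (f x) = g x"
    if X: "fg_right_module B X" and Y: "fg_right_module B Y" and f: "f \<in> rmod_hom B X Y"
      and inj: "inj_on f (carrier X)" and g: "g \<in> rmod_hom B X (thin ?W)"
    for X Y :: "'a rmod" and f g
  proof -
    note Xr = fg_right_moduleD[OF X] and Yr = fg_right_moduleD[OF Y]
    interpret X: right_module B X by (rule Xr)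
    interpret Y: right_module B Y by (rule Yr)
    \<comment> \<open>The functional to be extended is the component of \<open>g\<close> at the
      socle vertex of the summand \<open>n\<close>.\<close>
    have ex: "\<exists>\<psi>. (\<forall>x\<in>carrier Y. \<forall>y\<in>carrier Y. \<psi> (x \<oplus>\<^bsub>Y\<^esub> y) = \<psi> x + \<psi> y) \<and>
       (\<forall>c. \<forall>x\<in>carrier Y. \<psi> (\<eta> c \<odot>\<^bsub>Y\<^esub> x) = c * \<psi> x) \<and> (\<forall>x\<in>carrier X. \<psi> (f x) = g x n (vs ! n))" for n
    proof -
      have a1: "g (x \<oplus>\<^bsub>X\<^esub> y) n (vs ! n) = g x n (vs ! n) + g y n (vs ! n)" if "x \<in> carrier X" "y \<in> carrier X" for x y
        using that by (simp add: rmod_homD(2)[OF g] thin_simps)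
      have a2: "g (\<eta> c \<odot>\<^bsub>X\<^esub> x) n (vs ! n) = c * g x n (vs ! n)" if x: "x \<in> carrier X" for c x
      proof -
        have "g x \<in> carrier (thin ?W)" using x rmod_homD(1)[OF g] by simp
        moreover have "(\<Sum>i\<in>V. g x n i * co (\<eta> c) i (vs ! n)) = (\<Sum>i\<in>V. if i = vs ! n then c * g x n (vs ! n) else 0)"
          by (intro sum.cong refl) (auto simp: co_eta)
        ultimately show ?thesis
          using x finite_V S_vertices by (auto simp: rmod_homD(3)[OF g eta_closed] thin_simps isum_def sum.delta)
      qed
      show ?thesis
      proof (rule functional_extension[OF Xr Y f inj a1 a2])
        fix \<psi> :: "(nat \<Rightarrow> 'a) set \<Rightarrow> 'k"
        assume "\<And>x y. x \<in> carrier Y \<Longrightarrow> y \<in> carrier Y \<Longrightarrow> \<psi> (x \<oplus>\<^bsub>Y\<^esub> y) = \<psi> x + \<psi> y"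
          "\<And>c x. x \<in> carrier Y \<Longrightarrow> \<psi> (\<eta> c \<odot>\<^bsub>Y\<^esub> x) = c * \<psi> x" "\<And>x. x \<in> carrier X \<Longrightarrow> \<psi> (f x) = g x n (vs ! n)"
        then show ?thesis by (intro exI[of _ \<psi>] conjI ballI allI)
      qed
    qed
    from choice[OF allI[OF ex]] obtain \<psi> where psi': "\<forall>n. (\<forall>x\<in>carrier Y. \<forall>y\<in>carrier Y. \<psi> n (x \<oplus>\<^bsub>Y\<^esub> y) = \<psi> n x + \<psi> n y) \<and>
       (\<forall>c. \<forall>x\<in>carrier Y. \<psi> n (\<eta> c \<odot>\<^bsub>Y\<^esub> x) = c * \<psi> n x) \<and> (\<forall>x\<in>carrier X. \<psi> n (f x) = g x n (vs ! n))" ..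
    have psi: "\<psi> n (x \<oplus>\<^bsub>Y\<^esub> y) = \<psi> n x + \<psi> n y" if "x \<in> carrier Y" "y \<in> carrier Y" for n x y
      using psi' that by blast
    have psi2: "\<psi> n (\<eta> c \<odot>\<^bsub>Y\<^esub> x) = c * \<psi> n x" if "x \<in> carrier Y" for n c x
      using psi' that by blast
    have psi3: "\<psi> n (f x) = g x n (vs ! n)" if "x \<in> carrier X" for n x
      using psi' that by blast
    let ?h = "\<lambda>y n k. if (n, k) \<in> ?W then \<psi> n (bs k (vs ! n) \<odot>\<^bsub>Y\<^esub> y) else 0"
    have h: "?h \<in> rmod_hom B Y (thin ?W)" by (rule functional_hom[OF Yr psi psi2])
    have "?h (f x) = g x" if x: "x \<in> carrier X" for x
    proof (intro ext)
      fix n k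
      have gx: "g x \<in> carrier (thin ?W)" using x rmod_homD(1)[OF g] by simp
      show "?h (f x) n k = g x n k"
      proof (cases "(n, k) \<in> ?W")
        case True
        then have W: "(n, vs ! n) \<in> ?W" "(k, vs ! n) \<in> S" using S_refl S_vertices(2) by (auto simp: isum_def)
        \<comment> \<open>The unit \<open>bs k (vs ! n)\<close> moves the component at
          \<open>k\<close> to the socle vertex, where the extended functional agrees with
          \<open>g\<close>.\<close>
        have "\<psi> n (bs k (vs ! n) \<odot>\<^bsub>Y\<^esub> f x) = g (bs k (vs ! n) \<odot>\<^bsub>X\<^esub> x) n (vs ! n)"
          using x by (simp add: rmod_homD(3)[OF f, symmetric] psi3 X.r_smult_closed)
        also have "\<dots> = g x n k"
          using x W by (simp add: rmod_homD(3)[OF g] smult_bs_thin[OF gx])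
        finally show ?thesis using True by simp
      next
        case False
        then show ?thesis using gx by (auto simp: thin_simps)
      qed
    qed
    then show ?thesis by (intro bexI[OF _ h] ballI)
  qed
  then show ?thesis by (rule injective_rmodI[OF thin_fg[OF ok]])
qed

text \<open>Coordinate vectors of \<open>L\<close> lie in a space of dimension \<open>N\<close>, so
  a maximal independent set of them is finite, and its preimages in \<open>L\<close> generate
  \<open>L\<close>.\<close>

lemma submodule_fg:
  fixes Y :: "('a, 'n) module"
  assumes Y: "fg_right_module B Y" and L: "submodule L B Y"
  shows "fg_right_module B (Y\<lparr>carrier := L\<rparr>)"
proof -
  have Yr: "right_module B Y" by (rule fg_right_moduleD[OF Y])
  interpret Y: coord_module B \<eta> V S co Y by (rule coord_moduleI[OF Yr])
  note D = submoduleD'[OF L]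
  show ?thesis
  proof (rule Y.linear_coordinates[OF Y])
  fix N and \<kappa> :: "'n \<Rightarrow> nat \<Rightarrow> 'k"
  assume kadd: "\<And>x y n. x \<in> carrier Y \<Longrightarrow> y \<in> carrier Y \<Longrightarrow> \<kappa> (x \<oplus>\<^bsub>Y\<^esub> y) n = \<kappa> x n + \<kappa> y n"
    and ksc: "\<And>c x n. x \<in> carrier Y \<Longrightarrow> \<kappa> (\<eta> c \<odot>\<^bsub>Y\<^esub> x) n = c * \<kappa> x n"
    and kN: "\<And>x n. n \<ge> N \<Longrightarrow> \<kappa> x n = 0"
    and kinj: "\<And>x y. x \<in> carrier Y \<Longrightarrow> y \<in> carrier Y \<Longrightarrow> \<kappa> x = \<kappa> y \<Longrightarrow> x = y"
  obtain Bz where Bz: "Bz \<subseteq> \<kappa> ` L" "\<not> fun_vs.dependent Bz" "\<kappa> ` L \<subseteq> fun_vs.span Bz"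
    using fun_vs.maximal_independent_subset[of "\<kappa> ` L"] by blast
  let ?U = "(\<lambda>n i. if i = n then 1 else 0 :: 'k) ` {..<N}"
  have "z \<in> fun_vs.span ?U" if z: "\<And>n. n \<ge> N \<Longrightarrow> z n = 0" for z :: "nat \<Rightarrow> 'k"
  proof -
    have "z = (\<Sum>n<N. (\<lambda>i. z n * (if i = n then 1 else 0)))"
    proof
      fix i
      have "(\<Sum>n<N. (\<lambda>i. z n * (if i = n then 1 else 0))) i = (\<Sum>n<N. z n * (if i = n then 1 else 0))"
        by (induction N) auto
      also have "\<dots> = (\<Sum>n<N. if i = n then z n else 0)" by (intro sum.cong refl) auto
      also have "\<dots> = z i" using z[of i] by (simp add: sum.delta')
      finally show "z i = (\<Sum>n<N. (\<lambda>i. z n * (if i = n then 1 else 0))) i" ..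
    qed
    also have "\<dots> \<in> fun_vs.span ?U"
      by (intro fun_vs.span_sum fun_vs.span_scale fun_vs.span_base) auto
    finally show ?thesis .
  qed
  then have "Bz \<subseteq> fun_vs.span ?U" using Bz(1) kN by (auto simp: subset_eq)
  then have fin: "finite Bz" using fun_vs.independent_span_bound[of ?U Bz] Bz(2) by auto
  obtain G where G: "G \<subseteq> L" "finite G" "Bz = \<kappa> ` G"
    using finite_subset_image[OF fin Bz(1)] by metis
  have "K = L" if K: "submodule K B Y" "K \<subseteq> L" "G \<subseteq> K" for K
  proof (rule antisym[OF K(2)])
    note DK = submoduleD'[OF K(1)]
    have "z \<in> \<kappa> ` K" if "z \<in> fun_vs.span Bz" for z
      using that
    proof (induction rule: fun_vs.span_induct_alt)
      case base
      have "\<kappa> \<zero>\<^bsub>Y\<^esub> = 0"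
        using ksc[of "\<zero>\<^bsub>Y\<^esub>" 0] by (simp add: fun_eq_iff Y.smult_zero_right eta_closed)
      then show ?case using DK(2) by (metis imageI)
    next
      case (step c x y)
      then obtain a b where ab: "a \<in> K" "x = \<kappa> a" "b \<in> K" "y = \<kappa> b" using G(3) K(3) by auto
      then have "(\<lambda>i. c * x i) + y = \<kappa> (\<eta> c \<odot>\<^bsub>Y\<^esub> a \<oplus>\<^bsub>Y\<^esub> b)"
        using DK(1) by (auto simp: fun_eq_iff kadd ksc Y.sc_closed subset_eq)
      then show ?case using ab DK(3,4) eta_closed by auto
    qed
    then have "\<kappa> ` L \<subseteq> \<kappa> ` K" using Bz(3) by blast
    show "L \<subseteq> K"
    proof
      fix x assume x: "x \<in> L"
      with \<open>\<kappa> ` L \<subseteq> \<kappa> ` K\<close> obtain y where "y \<in> K" "\<kappa> x = \<kappa> y" by blast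
      with x kinj[of x y] D(1) DK(1) show "x \<in> K" by (simp add: subset_eq)
    qed
  qed
  then show ?thesis
    unfolding fg_right_module_def using submodule_right_module[OF Yr L] G
    by (intro conjI exI[of _ G]) (auto simp: submodule_trans[OF Yr L])
qed
qed

section \<open>Global dimension\<close>

definition supported_from :: "nat \<Rightarrow> ('a, 'm) module \<Rightarrow> bool" where
  "supported_from k M \<longleftrightarrow> (\<forall>v\<in>V. v < k \<longrightarrow> (\<forall>x\<in>carrier M. bs v v \<odot>\<^bsub>M\<^esub> x = \<zero>\<^bsub>M\<^esub>))"

text \<open>The unit is the sum of the idempotents.\<close>

lemma eq_zero_if_idempotents_vanish:
  assumes M: "right_module B M" and x: "x \<in> carrier M" and z: "\<And>v. v \<in> V \<Longrightarrow> bs v v \<odot>\<^bsub>M\<^esub> x = \<zero>\<^bsub>M\<^esub>"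
  shows "x = \<zero>\<^bsub>M\<^esub>"
proof -
  interpret coord_module B \<eta> V S co M by (rule coord_moduleI[OF M])
  have "\<one> \<odot>\<^bsub>M\<^esub> x \<in> {\<zero>\<^bsub>M\<^esub>}"
    by (rule smult_eq_sum[OF one_closed x]) (auto simp: co_one smult_zero_right eta_closed z S_vertices split: if_splits)
  then show ?thesis using x by (simp add: r_smult_one)
qed

lemma rmod_hom_supported_from:
  assumes M: "right_module B M" and N: "right_module B N" and f: "f \<in> rmod_hom B M N" and surj: "f ` carrier M = carrier N"
    and s: "supported_from k M"
  shows "supported_from k N"
  unfolding supported_from_def
proof (intro ballI impI)
  fix v x assume "v \<in> V" "v < k" "x \<in> carrier N"
  moreover from this surj obtain y where "y \<in> carrier M" "x = f y" by auto
  ultimately show "bs v v \<odot>\<^bsub>N\<^esub> x = \<zero>\<^bsub>N\<^esub>"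
    using s rmod_homD(3)[OF f bs_closed, of y v v] rmod_hom_zero[OF M N f] by (simp add: supported_from_def)
qed

text \<open>Covering a basis of homogeneous elements kills the lowest vertex in the kernel.\<close>

lemma minimal_cover:
  fixes M :: "('a, 'm) module"
  assumes fg: "fg_right_module B M" and s: "supported_from k M" and tri: "\<And>i k. (i, k) \<in> S \<Longrightarrow> i \<le> k"
  obtains vs F where "F \<in> rmod_hom B (thin (psum vs)) M" "F ` carrier (thin (psum vs)) = carrier M"
    "supported_from (Suc k) ((thin (psum vs))\<lparr>carrier := rmod_ker (thin (psum vs)) M F\<rparr>)"
proof -
  note M = fg_right_moduleD[OF fg]
  interpret coord_module B \<eta> V S co M by (rule coord_moduleI[OF M])
  show thesis
  proof (rule coordinates[OF fg])
    fix N t and v :: "nat \<Rightarrow> nat" and \<kappa> :: "'m \<Rightarrow> nat \<Rightarrow> 'k"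
    assume t: "\<And>n. n < N \<Longrightarrow> t n \<in> carrier M" and v: "\<And>n. n < N \<Longrightarrow> v n \<in> V"
      and tv: "\<And>n. n < N \<Longrightarrow> bs (v n) (v n) \<odot>\<^bsub>M\<^esub> t n = t n"
      and kadd: "\<And>x y n. x \<in> carrier M \<Longrightarrow> y \<in> carrier M \<Longrightarrow> \<kappa> (x \<oplus>\<^bsub>M\<^esub> y) n = \<kappa> x n + \<kappa> y n"
      and ksc: "\<And>c x n. x \<in> carrier M \<Longrightarrow> \<kappa> (sc c x) n = c * \<kappa> x n"
      and kt: "\<And>n m. n < N \<Longrightarrow> \<kappa> (t n) m = (if m = n then 1 else 0)"
      and dec: "\<And>x. x \<in> carrier M \<Longrightarrow> x = (\<Oplus>\<^bsub>M\<^esub>n\<in>{..<N}. sc (\<kappa> x n) (t n))"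
    define vs where "vs = map v [0..<N]"
    have vs: "length vs = N" "\<And>n. n < N \<Longrightarrow> vs ! n = v n" by (simp_all add: vs_def)
    let ?P = "thin (psum vs)"
    note P = thin_right_module[OF thin_ok_psum, of vs]
    interpret P: right_module B ?P by (rule P)
    define F where "F = (\<lambda>c. \<Oplus>\<^bsub>M\<^esub>n\<in>{..<length vs}. row_elt (vs ! n) (c n) \<odot>\<^bsub>M\<^esub> t n)"
    have F: "F \<in> rmod_hom B ?P M" unfolding F_def by (rule psum_hom[OF M]) (simp add: vs t)
    have kz: "\<kappa> \<zero>\<^bsub>M\<^esub> m = 0" for m
      using ksc[of "\<zero>\<^bsub>M\<^esub>" 0] by (simp add: smult_zero_right eta_closed)
    have F_diag: "F c = (\<Oplus>\<^bsub>M\<^esub>n\<in>{..<N}. sc (c n (v n)) (t n))"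
      if c: "\<And>n j. n < N \<Longrightarrow> j \<noteq> v n \<Longrightarrow> c n j = 0" for c
      unfolding F_def vs
    proof (rule M.finsum_cong')
      fix n assume n: "n \<in> {..<N}"
      have "row_elt (v n) (c n) = bs (v n) (v n) \<otimes> \<eta> (c n (v n))"
        by (rule co_eqI) (use n c[of n] v[of n] S_refl in \<open>auto simp: row_elt eta_closed eta_mult_right co_bs\<close>)
      then show "row_elt (vs ! n) (c n) \<odot>\<^bsub>M\<^esub> t n = sc (c n (v n)) (t n)"
        using n t tv by (simp add: vs r_smult_assoc eta_closed)
    qed (auto simp: t sc_closed)
    have kF: "\<kappa> (\<Oplus>\<^bsub>M\<^esub>n\<in>A. sc (c n) (t n)) m = (if m \<in> A then c m else 0)" if "finite A" "A \<subseteq> {..<N}" for A c m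
      using that
    proof (induction A)
      case empty
      then show ?case by (simp add: kz)
    next
      case (insert a A)
      then have "(\<lambda>n. sc (c n) (t n)) \<in> A \<rightarrow> carrier M" "sc (c a) (t a) \<in> carrier M" using t by (auto intro!: sc_closed)
      with insert show ?case by (simp add: kadd ksc kt t)
    qed
    \<comment> \<open>A basis element below \<open>k\<close> would be fixed by an idempotent that
      annihilates the module.\<close>
    have vk: "k \<le> v n" if n: "n < N" for n
    proof (rule ccontr)
      assume "\<not> k \<le> v n"
      then have "t n = \<zero>\<^bsub>M\<^esub>" using s n v t tv[OF n] by (simp add: supported_from_def)
      then show False using kt[OF n, of n] kz by simp
    qed
    show thesis
    proof (rule that[of F vs])
      show "F \<in> rmod_hom B ?P M" by (rule F)
      show "F ` carrier ?P = carrier M"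
      proof
        show "F ` carrier ?P \<subseteq> carrier M" using rmod_homD(1)[OF F] by auto
        show "carrier M \<subseteq> F ` carrier ?P"
        proof
          fix x assume x: "x \<in> carrier M"
          let ?c = "\<lambda>n j. if n < N \<and> j = v n then \<kappa> x n else 0"
          have "F ?c = (\<Oplus>\<^bsub>M\<^esub>n\<in>{..<N}. sc (?c n (v n)) (t n))" by (rule F_diag) auto
          also have "\<dots> = (\<Oplus>\<^bsub>M\<^esub>n\<in>{..<N}. sc (\<kappa> x n) (t n))"
            by (rule M.finsum_cong') (auto simp: t sc_closed)
          also have "\<dots> = x" using dec[OF x] by simp
          finally have "x = F ?c" ..
          moreover have "?c \<in> carrier ?P" using v S_refl by (auto simp: thin_simps psum_def vs)
          ultimately show "x \<in> F ` carrier ?P" by blast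
        qed
      qed
      show "supported_from (Suc k) (?P\<lparr>carrier := rmod_ker ?P M F\<rparr>)"
        unfolding supported_from_def
      proof (intro ballI impI)
        fix w f assume w: "w \<in> V" "w < Suc k" and "f \<in> carrier (?P\<lparr>carrier := rmod_ker ?P M F\<rparr>)"
        then have f: "f \<in> carrier ?P" "F f = \<zero>\<^bsub>M\<^esub>" by (auto simp: rmod_ker_def)
        define g where "g = bs w w \<odot>\<^bsub>?P\<^esub> f"
        have g: "g \<in> carrier ?P" using f by (simp add: g_def P.r_smult_closed)
        have gv: "g n j = (if (n, j) \<in> psum vs \<and> j = w then f n w else 0)" for n j
          using smult_bs_thin[OF f(1), of w w n j] S_refl[OF w(1)] by (simp add: g_def)
        \<comment> \<open>Where the summand n has a component at w, triangularity gives v n \<le> w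
          \<le> k \<le> v n. So at w only generators of summands occur, and \<open>F\<close> maps
          these to independent elements.\<close>
        have gs: "g n j = 0" if "n < N" "j \<noteq> v n" for n j
          using that gv[of n j] vk[of n] w(2) tri[of "v n" j] by (auto simp: psum_def vs)
        have "F g = bs w w \<odot>\<^bsub>M\<^esub> F f" unfolding g_def by (rule rmod_homD(3)[OF F bs_closed f(1)])
        then have "F g = \<zero>\<^bsub>M\<^esub>" by (simp add: f smult_zero_right)
        then have "(\<Oplus>\<^bsub>M\<^esub>n\<in>{..<N}. sc (g n (v n)) (t n)) = \<zero>\<^bsub>M\<^esub>" using F_diag[of g] gs by simp
        then have "g n (v n) = 0" if "n < N" for n
          using kF[of "{..<N}" "\<lambda>n. g n (v n)" n] that by (simp add: kz)
        then have "g n j = 0" for n j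
          using gs[of n j] g by (cases "n < N"; cases "j = v n") (auto simp: thin_simps psum_def vs)
        then show "bs w w \<odot>\<^bsub>?P\<lparr>carrier := rmod_ker ?P M F\<rparr>\<^esub> f = \<zero>\<^bsub>?P\<lparr>carrier := rmod_ker ?P M F\<rparr>\<^esub>"
          by (simp add: g_def[symmetric] thin_simps(2) fun_eq_iff)
      qed
    qed
  qed
qed

text \<open>Each passage to the kernel of a cover pushes the support up by one vertex; after
  \<open>n\<close> steps no vertex is left.\<close>

lemma projdim_le_supported:
  fixes M :: "'a rmod"
  assumes "fg_right_module B M" "supported_from k M" and tri: "\<And>i k. (i, k) \<in> S \<Longrightarrow> i \<le> k" and V: "V \<subseteq> {..<k + n}"
  shows "projdim_le B n M"
  using assms(1,2,4)
proof (induction n arbitrary: k M)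
  case 0
  note M = fg_right_moduleD[OF 0(1)]
  interpret right_module B M by (rule M)
  have "carrier M = {\<zero>\<^bsub>M\<^esub>}"
    using eq_zero_if_idempotents_vanish[OF M] 0(2,3) by (auto simp: supported_from_def subset_eq)
  then show ?case by (intro projdim_le_0 projective_rmod_trivial M)
next
  case (Suc n)
  note M = fg_right_moduleD[OF Suc.prems(1)]
  show ?case
  proof (rule minimal_cover[OF Suc.prems(1,2) tri])
    fix vs F
    let ?P = "thin (psum vs)"
    assume F: "F \<in> rmod_hom B ?P M" "F ` carrier ?P = carrier M"
      and sF: "supported_from (Suc k) (?P\<lparr>carrier := rmod_ker ?P M F\<rparr>)"
    note P = thin_right_module[OF thin_ok_psum, of vs]
    \<comment> \<open>\<open>projdim_le_step\<close> requires a cover of type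
      \<open>'a rmod\<close>, so the thin one is replaced by a copy.\<close>
    obtain Q :: "'a rmod" and f where Q: "fg_right_module B Q" "f \<in> rmod_hom B ?P Q" "bij_betw f (carrier ?P) (carrier Q)"
      using fg_right_module_isomorphic_copy[OF thin_fg[OF thin_ok_psum]] by blast
    note Qr = fg_right_moduleD[OF Q(1)]
    let ?g = "inv_into (carrier ?P) f"
    note g = rmod_hom_inverse[OF P Q(2,3)]
    let ?e = "\<lambda>x. F (?g x)"
    have e: "?e \<in> rmod_hom B Q M" by (rule rmod_hom_comp[OF g(1) F(1)])
    have es: "?e ` carrier Q = carrier M"
      unfolding image_image[of F ?g, symmetric] bij_betw_imp_surj_on[OF g(2)] by (rule F(2))
    let ?K = "rmod_ker Q M ?e" and ?L = "rmod_ker ?P M F"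
    have K: "submodule ?K B Q" by (rule rmod_ker_submodule[OF Qr M e])
    have L: "submodule ?L B ?P" by (rule rmod_ker_submodule[OF P M F(1)])
    have "f x \<in> ?K" if "x \<in> ?L" for x
      using that rmod_homD(1)[OF Q(2)] bij_betw_inv_into_left[OF Q(3)] by (auto simp: rmod_ker_def)
    moreover have "x \<in> f ` ?L" if "x \<in> ?K" for x
      using that rmod_homD(1)[OF g(1)] bij_betw_inv_into_right[OF Q(3)]
      by (intro image_eqI[of _ _ "?g x"]) (auto simp: rmod_ker_def)
    ultimately have im: "f ` ?L = ?K" by auto
    have fL: "f \<in> rmod_hom B (?P\<lparr>carrier := ?L\<rparr>) (Q\<lparr>carrier := ?K\<rparr>)"
      using im rmod_homD[OF Q(2)] by (intro rmod_homI) (auto simp: rmod_ker_def)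
    have "supported_from (Suc k) (Q\<lparr>carrier := ?K\<rparr>)"
      by (rule rmod_hom_supported_from[OF submodule_right_module[OF P L] submodule_right_module[OF Qr K] fL _ sF])
        (simp add: im)
    moreover have "fg_right_module B (Q\<lparr>carrier := ?K\<rparr>)" by (rule submodule_fg[OF Q(1) K])
    ultimately have "projdim_le B n (Q\<lparr>carrier := ?K\<rparr>)" using Suc.prems(3) by (intro Suc.IH) auto
    then show ?case
      by (rule projdim_le_step[OF M projective_rmod_iso[OF thin_projective Qr Q(2,3)] e es])
  qed
qed

lemma gldim_finite:
  assumes tri: "\<And>i k. (i, k) \<in> S \<Longrightarrow> i \<le> k"
  shows "gldim B < \<infinity>"
proof -
  obtain n where n: "V \<subseteq> {..<n}" using finite_V finite_nat_iff_bounded by auto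
  have "projdim B M \<le> enat n" if "fg_right_module B M" for M :: "'a rmod"
    by (rule projdim_leI, rule projdim_le_supported[OF that _ tri, of 0]) (use n in \<open>auto simp: supported_from_def\<close>)
  then have "gldim B \<le> enat n" unfolding gldim_def by (intro Sup_least) auto
  then show ?thesis by (rule order_le_less_trans) simp
qed

section \<open>Socles and injective envelopes\<close>

text \<open>The condition describes a generator of a simple submodule concentrated at
  \<open>v\<close>.\<close>

definition socle_at :: "('a, 'm) module \<Rightarrow> nat \<Rightarrow> 'm \<Rightarrow> bool" where
  "socle_at M v x \<longleftrightarrow> x \<in> carrier M \<and> x \<noteq> \<zero>\<^bsub>M\<^esub> \<and> v \<in> V \<and> (\<forall>r\<in>carrier B. r \<odot>\<^bsub>M\<^esub> x = \<eta> (co r v v) \<odot>\<^bsub>M\<^esub> x)"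

lemma socle_at_hom:
  assumes "right_module B M" "right_module B N" "f \<in> rmod_hom B M N" "inj_on f (carrier M)" "socle_at M v x"
  shows "socle_at N v (f x)"
proof -
  from assms(5) have x: "x \<in> carrier M" "x \<noteq> \<zero>\<^bsub>M\<^esub>" "v \<in> V"
    and act: "\<And>r. r \<in> carrier B \<Longrightarrow> r \<odot>\<^bsub>M\<^esub> x = \<eta> (co r v v) \<odot>\<^bsub>M\<^esub> x"
    by (auto simp: socle_at_def)
  have "r \<odot>\<^bsub>N\<^esub> f x = \<eta> (co r v v) \<odot>\<^bsub>N\<^esub> f x" if "r \<in> carrier B" for r
    using rmod_homD(3)[OF assms(3) that x(1)] rmod_homD(3)[OF assms(3) eta_closed x(1), of "co r v v"] act[OF that]
    by simp
  then show ?thesis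
    unfolding socle_at_def
    using x rmod_hom_eq_zero_iff[OF assms(1-4) x(1)] rmod_homD(1)[OF assms(3) x(1)] by blast
qed

text \<open>Off-diagonal matrix units lead to larger vertices, so they annihilate every element at
  the largest vertex occurring in the module.\<close>

lemma socle_exists:
  assumes M: "right_module B M" and nz: "carrier M \<noteq> {\<zero>\<^bsub>M\<^esub>}" and tri: "\<And>i k. (i, k) \<in> S \<Longrightarrow> i \<le> k"
  obtains v x where "socle_at M v x"
proof -
  interpret coord_module B \<eta> V S co M by (rule coord_moduleI[OF M])
  let ?A = "{v \<in> V. \<exists>x\<in>carrier M. bs v v \<odot>\<^bsub>M\<^esub> x \<noteq> \<zero>\<^bsub>M\<^esub>}"
  have fin: "finite ?A" using finite_V by simp
  have "?A \<noteq> {}" using nz eq_zero_if_idempotents_vanish[OF M] by blast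
  define v where "v = Max ?A"
  have "v \<in> ?A" unfolding v_def using fin \<open>?A \<noteq> {}\<close> by (rule Max_in)
  then obtain x where x: "v \<in> V" "x \<in> carrier M" "bs v v \<odot>\<^bsub>M\<^esub> x \<noteq> \<zero>\<^bsub>M\<^esub>" by auto
  have max: "bs k k \<odot>\<^bsub>M\<^esub> y = \<zero>\<^bsub>M\<^esub>" if "v < k" "k \<in> V" "y \<in> carrier M" for k y
    using Max_ge[OF fin, of k] that unfolding v_def[symmetric] by (metis (mono_tags, lifting) leD mem_Collect_eq)
  have "r \<odot>\<^bsub>M\<^esub> (bs v v \<odot>\<^bsub>M\<^esub> x) = sc (co r v v) (bs v v \<odot>\<^bsub>M\<^esub> x)" if r: "r \<in> carrier B" for r
  proof -
    \<comment> \<open>The part of row v of \<open>r\<close> off the diagonal, which acts as zero by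
      the choice of v.\<close>
    let ?q = "row_elt v (\<lambda>k. if k = v then 0 else co r v k)"
    have "?q \<odot>\<^bsub>M\<^esub> x \<in> {\<zero>\<^bsub>M\<^esub>}"
    proof (rule smult_eq_sum[OF row_elt(1) x(2)])
      fix i k assume ik: "(i, k) \<in> S" "co ?q i k \<noteq> 0"
      then have "v < k" using tri[OF ik(1)] by (auto simp: row_elt split: if_splits)
      then have "bs k k \<odot>\<^bsub>M\<^esub> (bs i k \<odot>\<^bsub>M\<^esub> x) = \<zero>\<^bsub>M\<^esub>"
        using x S_vertices(2)[OF ik(1)] by (intro max) (auto intro: r_smult_closed)
      then show "bs i k \<odot>\<^bsub>M\<^esub> x \<in> {\<zero>\<^bsub>M\<^esub>}"
        using x by (simp add: r_smult_assoc[symmetric] bs_idem_right)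
    qed (auto simp: smult_zero_right eta_closed)
    moreover have "bs v v \<otimes> r = bs v v \<otimes> \<eta> (co r v v) \<oplus> ?q"
      by (rule co_eqI) (use r x in \<open>auto simp: co_bs_mult eta_closed co_add row_elt co_eta S_refl\<close>)
    ultimately show ?thesis
      using r x by (simp add: r_smult_assoc[symmetric] r_smult_ring_distr eta_closed row_elt r_smult_closed)
  qed
  then have "socle_at M v (bs v v \<odot>\<^bsub>M\<^esub> x)" using x by (auto simp: socle_at_def r_smult_closed)
  then show thesis by (rule that)
qed

text \<open>A nonzero entry of a summand I(w) at a vertex other than w could be moved to w by an
  off-diagonal matrix unit, but these annihilate socle elements.\<close>

lemma socle_at_isum:
  assumes "socle_at (thin (isum vs)) v x"
  shows "x \<in> carrier (thin (isum vs))" "x n k \<noteq> 0 \<Longrightarrow> k = v \<and> n < length vs \<and> vs ! n = v"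
proof -
  note ok = thin_ok_isum[of vs]
  interpret right_module B "thin (isum vs)" by (rule thin_right_module[OF ok])
  from assms have x: "x \<in> carrier (thin (isum vs))" and v: "v \<in> V"
    and act: "\<And>r. r \<in> carrier B \<Longrightarrow> r \<odot>\<^bsub>thin (isum vs)\<^esub> x = \<eta> (co r v v) \<odot>\<^bsub>thin (isum vs)\<^esub> x"
    by (auto simp: socle_at_def)
  show "x \<in> carrier (thin (isum vs))" by (rule x)
  assume nz: "x n k \<noteq> 0"
  then have nk: "(n, k) \<in> isum vs" using x by (auto simp: thin_simps)
  have "bs v v \<odot>\<^bsub>thin (isum vs)\<^esub> x = x"
    using act[OF bs_closed, of v v] S_refl[OF v] x by (simp add: co_bs eta_one r_smult_one)
  then have k: "k = v" using nz smult_bs_thin[OF x, of v v n k] by (auto split: if_splits)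
  have n: "n < length vs" "(v, vs ! n) \<in> S" using nk k by (auto simp: isum_def)
  have "vs ! n = v"
  proof (rule ccontr)
    assume ne: "vs ! n \<noteq> v"
    have "bs v (vs ! n) \<odot>\<^bsub>thin (isum vs)\<^esub> x = \<zero>\<^bsub>thin (isum vs)\<^esub>"
    proof -
      have "\<eta> 0 = \<zero>" by (rule co_eqI) (auto simp: co_eta co_zero eta_closed)
      then show ?thesis using act[OF bs_closed, of v "vs ! n"] ne x by (simp add: co_bs smult_zero_left)
    qed
    moreover have "(bs v (vs ! n) \<odot>\<^bsub>thin (isum vs)\<^esub> x) n (vs ! n) = x n v"
      using smult_bs_thin[OF x, of v "vs ! n" n "vs ! n"] n S_refl S_vertices(2)[OF n(2)] by (simp add: isum_def)
    ultimately show False using nz k by (simp add: thin_simps)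
  qed
  with k n show "k = v \<and> n < length vs \<and> vs ! n = v" by simp
qed

text \<open>If (0,v) is in \<open>W\<close>, then \<open>thin W\<close> is the quotient of P(v) by
  the coordinates outside \<open>W\<close>. By \<open>ann\<close> these annihilate \<open>y\<close>,
  so the map from P(v) given by acting on \<open>y\<close> factors through the quotient.\<close>

lemma hom_from_row:
  fixes X :: "('a, 'm) module"
  assumes X: "right_module B X" and y: "y \<in> carrier X"
    and ok: "thin_ok W" and W: "W \<subseteq> {0} \<times> {k. (v, k) \<in> S}"
    and ann: "\<And>r. r \<in> carrier B \<Longrightarrow> (\<And>k. (0, k) \<in> W \<Longrightarrow> co r v k = 0) \<Longrightarrow> row_elt v (co r v) \<odot>\<^bsub>X\<^esub> y = \<zero>\<^bsub>X\<^esub>"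
  shows "(\<lambda>f. row_elt v (f 0) \<odot>\<^bsub>X\<^esub> y) \<in> rmod_hom B (thin W) X"
proof -
  interpret X: right_module B X by fact
  show ?thesis
  proof (rule rmod_homI)
    show "row_elt v (f 0) \<odot>\<^bsub>X\<^esub> y \<in> carrier X" for f by (simp add: X.r_smult_closed row_elt y)
    show "row_elt v ((f \<oplus>\<^bsub>thin W\<^esub> g) 0) \<odot>\<^bsub>X\<^esub> y = row_elt v (f 0) \<odot>\<^bsub>X\<^esub> y \<oplus>\<^bsub>X\<^esub> row_elt v (g 0) \<odot>\<^bsub>X\<^esub> y" for f g
    proof -
      have "row_elt v ((f \<oplus>\<^bsub>thin W\<^esub> g) 0) = row_elt v (f 0) \<oplus> row_elt v (g 0)"
        by (rule co_eqI) (auto simp: row_elt co_add thin_simps)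
      then show ?thesis by (simp add: X.r_smult_ring_distr row_elt y)
    qed
    fix r f assume r: "r \<in> carrier B" and f: "f \<in> carrier (thin W)"
    let ?s = "row_elt v (f 0) \<otimes> r"
    let ?t = "row_elt v ((r \<odot>\<^bsub>thin W\<^esub> f) 0)"
    \<comment> \<open>The entries of the product that the action on \<open>thin W\<close> cuts
      off.\<close>
    let ?q = "row_elt v (\<lambda>k. if (0, k) \<in> W then 0 else co ?s v k)"
    have "row_elt v (co ?q v) = ?q" by (rule co_eqI) (auto simp: row_elt)
    then have q: "?q \<odot>\<^bsub>X\<^esub> y = \<zero>\<^bsub>X\<^esub>" using ann[of ?q] by (simp add: row_elt)
    have eq: "?s = ?t \<oplus> ?q"
    proof (rule co_eqI)
      fix i k assume ik: "(i, k) \<in> S"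
      have "(\<Sum>j\<in>V. co (row_elt v (f 0)) i j * co r j k) = (if i = v then \<Sum>j\<in>V. f 0 j * co r j k else 0)"
      proof -
        have "f 0 j = 0" if "(v, j) \<notin> S" for j using f W that unfolding thin_simps by blast
        then show ?thesis by (auto simp: row_elt intro!: sum.cong)
      qed
      then have s: "co ?s i k = (if i = v then \<Sum>j\<in>V. f 0 j * co r j k else 0)"
        using co_mult[OF row_elt(1) r ik] by simp
      show "co ?s i k = co (?t \<oplus> ?q) i k"
        using ik s by (auto simp: co_add row_elt thin_simps(4))
    qed (auto simp: row_elt r)
    have "?s \<odot>\<^bsub>X\<^esub> y = (?t \<oplus> ?q) \<odot>\<^bsub>X\<^esub> y" by (rule arg_cong[OF eq])
    also have "\<dots> = ?t \<odot>\<^bsub>X\<^esub> y \<oplus>\<^bsub>X\<^esub> ?q \<odot>\<^bsub>X\<^esub> y" by (rule X.r_smult_ring_distr) (simp_all add: row_elt y)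
    also have "\<dots> = ?t \<odot>\<^bsub>X\<^esub> y" unfolding q by (simp add: X.r_smult_closed row_elt y)
    finally have "?s \<odot>\<^bsub>X\<^esub> y = ?t \<odot>\<^bsub>X\<^esub> y" .
    then show "row_elt v ((r \<odot>\<^bsub>thin W\<^esub> f) 0) \<odot>\<^bsub>X\<^esub> y = r \<odot>\<^bsub>X\<^esub> (row_elt v (f 0) \<odot>\<^bsub>X\<^esub> y)"
      by (simp add: X.r_smult_assoc row_elt y r)
  qed
qed

lemma row_elt_unit: "(v, k) \<in> S \<Longrightarrow> row_elt v (unit_fun n k n) = bs v k"
  by (rule co_eqI) (auto simp: row_elt co_bs unit_fun_def)

lemma thin_inclusion:
  assumes "W \<subseteq> U" "\<And>n i k. (n, i) \<in> W \<Longrightarrow> (i, k) \<in> S \<Longrightarrow> (n, k) \<in> U \<Longrightarrow> (n, k) \<in> W"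
  shows "(\<lambda>f. f) \<in> rmod_hom B (thin W) (thin U)"
proof (rule rmod_homI)
  fix r f assume r: "r \<in> carrier B" and f: "f \<in> carrier (thin W)"
  show "r \<odot>\<^bsub>thin W\<^esub> f = r \<odot>\<^bsub>thin U\<^esub> f"
  proof (intro ext)
    fix n k
    have "f n i * co r i k = 0" if "(n, k) \<in> U" "(n, k) \<notin> W" for i
      using that f assms(2)[of n i k] co_supp[OF r, of i k] by (auto simp: thin_simps)
    then show "(r \<odot>\<^bsub>thin W\<^esub> f) n k = (r \<odot>\<^bsub>thin U\<^esub> f) n k"
      using assms(1) by (auto simp: thin_simps intro!: sum.neutral)
  qed
qed (use assms(1) in \<open>auto simp: thin_simps\<close>)

lemma thin_ok_singleton:
  assumes "v \<in> V"
  shows "thin_ok {(0, v)}"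
  using assms S_refl S_antisym by (auto simp: thin_ok_def)

lemma direct_decomposition_retract:
  assumes M: "right_module B M" and N: "right_module B N" and j: "j \<in> rmod_hom B N M" and p: "p \<in> rmod_hom B M N"
    and pj: "\<And>x. x \<in> carrier N \<Longrightarrow> p (j x) = x"
  shows "direct_decomposition B M (j ` carrier N) (rmod_ker M N p)"
proof -
  interpret M: right_module B M by fact
  interpret N: right_module B N by fact
  have s1: "submodule (j ` carrier N) B M" by (rule rmod_image_submodule[OF N M j carrier_submodule[OF N]])
  have s2: "submodule (rmod_ker M N p) B M" by (rule rmod_ker_submodule[OF M N p])
  have "x = \<zero>\<^bsub>M\<^esub>" if "x \<in> j ` carrier N" "x \<in> rmod_ker M N p" for x
    using that pj rmod_hom_zero[OF N M j] by (auto simp: rmod_ker_def)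
  then have "j ` carrier N \<inter> rmod_ker M N p = {\<zero>\<^bsub>M\<^esub>}"
    using submoduleD'(2)[OF s1] submoduleD'(2)[OF s2] by blast
  moreover have "j ` carrier N <+>\<^bsub>M\<^esub> rmod_ker M N p = carrier M"
  proof
    show "j ` carrier N <+>\<^bsub>M\<^esub> rmod_ker M N p \<subseteq> carrier M"
      using submoduleD'(1)[OF s1] submoduleD'(1)[OF s2] by (auto simp: set_add_def' subset_eq)
    show "carrier M \<subseteq> j ` carrier N <+>\<^bsub>M\<^esub> rmod_ker M N p"
    proof
      fix x assume x: "x \<in> carrier M"
      have px: "p x \<in> carrier N" "j (p x) \<in> carrier M" using x rmod_homD(1)[OF p] rmod_homD(1)[OF j] by auto
      have "p (x \<ominus>\<^bsub>M\<^esub> j (p x)) = p x \<ominus>\<^bsub>N\<^esub> p (j (p x))" by (rule rmod_hom_diff[OF M N p x px(2)])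
      then have "x \<ominus>\<^bsub>M\<^esub> j (p x) \<in> rmod_ker M N p"
        using x px by (simp add: rmod_ker_def pj N.minus_eq_zero_iff)
      moreover have "x = j (p x) \<oplus>\<^bsub>M\<^esub> (x \<ominus>\<^bsub>M\<^esub> j (p x))"
        using x px by (simp add: a_minus_def M.a_lcomm M.r_neg)
      ultimately show "x \<in> j ` carrier N <+>\<^bsub>M\<^esub> rmod_ker M N p"
        using px(1) unfolding set_add_def' by blast
    qed
  qed
  ultimately show ?thesis using s1 s2 by (simp add: direct_decomposition_def)
qed

lemma isum_singleton: "isum [v] = {0} \<times> {k. (k, v) \<in> S}"
  by (auto simp: isum_def)

text \<open>The map from the simple module at v extends to I(v) because \<open>X\<close> is
  injective. The extension is injective since every nonzero element of I(v) can be moved to a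
  nonzero socle element, and it splits because I(v) is injective.\<close>

lemma socle_splits:
  fixes X :: "('a, 'm) module"
  assumes X: "injective_rmod B X" and s: "socle_at X v s"
  obtains j Y where "j \<in> rmod_hom B (thin (isum [v])) X" "inj_on j (carrier (thin (isum [v])))"
    "direct_decomposition B X (j ` carrier (thin (isum [v]))) Y" "j (unit_fun 0 v) = s"
proof -
  note Xr = injective_rmodD(2)[OF X]
  interpret X: coord_module B \<eta> V S co X by (rule coord_moduleI[OF Xr])
  from s have sc: "s \<in> carrier X" "s \<noteq> \<zero>\<^bsub>X\<^esub>" "v \<in> V"
    and act: "\<And>r. r \<in> carrier B \<Longrightarrow> r \<odot>\<^bsub>X\<^esub> s = \<eta> (co r v v) \<odot>\<^bsub>X\<^esub> s"
    by (auto simp: socle_at_def)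
  let ?I = "thin (isum [v])" and ?T = "thin {(0, v)}"
  note ok = thin_ok_singleton[OF sc(3)]
  note I = thin_right_module[OF thin_ok_isum, of "[v]"] and T = thin_right_module[OF ok]
  interpret I: right_module B ?I by (rule I)
  have vv: "(v, v) \<in> S" using S_refl sc by simp
  have g: "(\<lambda>f. row_elt v (f 0) \<odot>\<^bsub>X\<^esub> s) \<in> rmod_hom B ?T X"
  proof (rule hom_from_row[OF Xr sc(1) ok])
    show "{(0, v)} \<subseteq> {0} \<times> {k. (v, k) \<in> S}" using vv by simp
    fix r assume "r \<in> carrier B" "\<And>k. (0, k) \<in> {(0, v)} \<Longrightarrow> co r v k = 0"
    then have "co (row_elt v (co r v)) v v = 0" by (simp add: row_elt)
    then show "row_elt v (co r v) \<odot>\<^bsub>X\<^esub> s = \<zero>\<^bsub>X\<^esub>" using act[OF row_elt(1)] sc by (simp add: X.sc_zero)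
  qed
  have inc: "(\<lambda>f. f) \<in> rmod_hom B ?T ?I"
    by (rule thin_inclusion) (use vv S_antisym in \<open>auto simp: isum_def\<close>)
  obtain j where j: "j \<in> rmod_hom B ?I X" "\<And>x. x \<in> carrier ?T \<Longrightarrow> j x = row_elt v (x 0) \<odot>\<^bsub>X\<^esub> s"
    using injective_rmod_extend[OF X thin_fg[OF ok] thin_fg[OF thin_ok_isum] inc _ g] by (metis inj_on_id2)
  have ju: "j (unit_fun 0 v) = s"
    using j(2)[OF unit_fun_closed, of 0 v] row_elt_unit[OF vv] act[OF bs_closed, of v v] vv sc
    by (simp add: co_bs X.sc_one)
  have "inj_on j (carrier ?I)"
    unfolding rmod_hom_inj_iff[OF I Xr j(1)]
  proof (intro ballI impI)
    fix f assume f: "f \<in> carrier ?I" and jf: "j f = \<zero>\<^bsub>X\<^esub>"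
    have "f n k = 0" for n k
    proof (rule ccontr)
      assume nz: "f n k \<noteq> 0"
      then have nk: "n = 0" "(k, v) \<in> S" using f unfolding thin_simps isum_singleton by blast+
      have "bs k v \<odot>\<^bsub>?I\<^esub> f = \<eta> (f 0 k) \<odot>\<^bsub>?I\<^esub> unit_fun 0 v"
      proof (intro ext)
        fix m l
        have "(0, v) \<in> isum [v]" using vv by (simp add: isum_def)
        from smult_unit_fun[OF thin_ok_isum this] nk f
        show "(bs k v \<odot>\<^bsub>?I\<^esub> f) m l = (\<eta> (f 0 k) \<odot>\<^bsub>?I\<^esub> unit_fun 0 v) m l"
          using smult_bs_thin[OF f, of k v m l] sc(3) by (auto simp: co_eta isum_def thin_simps(1))
      qed
      then have "j (\<eta> (f 0 k) \<odot>\<^bsub>?I\<^esub> unit_fun 0 v) = bs k v \<odot>\<^bsub>X\<^esub> j f"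
        using rmod_homD(3)[OF j(1) bs_closed f] by metis
      then have "\<eta> (f 0 k) \<odot>\<^bsub>X\<^esub> s = \<zero>\<^bsub>X\<^esub>"
        using jf ju rmod_homD(3)[OF j(1) eta_closed unit_fun_closed, of 0 v "f 0 k"] vv
        by (simp add: X.smult_zero_right isum_def)
      then have "\<eta> (inverse (f 0 k)) \<odot>\<^bsub>X\<^esub> (\<eta> (f 0 k) \<odot>\<^bsub>X\<^esub> s) = \<zero>\<^bsub>X\<^esub>"
        by (simp add: X.smult_zero_right eta_closed)
      then show False using nz nk sc by (simp add: X.sc_sc X.sc_one)
    qed
    then show "f = \<zero>\<^bsub>?I\<^esub>" by (simp add: thin_simps fun_eq_iff)
  qed
  moreover from this obtain p where p: "p \<in> rmod_hom B X ?I" "\<And>x. x \<in> carrier ?I \<Longrightarrow> p (j x) = x"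
    using injective_rmod_extend[OF thin_injective thin_fg[OF thin_ok_isum] injective_rmodD(1)[OF X] j(1) _ rmod_hom_id] by metis
  ultimately show thesis
    using that[OF j(1) _ direct_decomposition_retract[OF Xr I j(1) p] ju] by blast
qed

text \<open>The socle generator lies in every nonzero submodule, so no two of these intersect in
  zero.\<close>

lemma isum_indecomposable:
  assumes v: "v \<in> V" and X: "right_module B X" and j: "j \<in> rmod_hom B (thin (isum [v])) X" "inj_on j (carrier (thin (isum [v])))"
    "j ` carrier (thin (isum [v])) = carrier X"
  shows "indecomposable B X"
proof -
  let ?I = "thin (isum [v])"
  note I = thin_right_module[OF thin_ok_isum, of "[v]"]
  interpret I: right_module B ?I by (rule I)
  interpret X: coord_module B \<eta> V S co X by (rule coord_moduleI[OF X])
  have vv: "(v, v) \<in> S" using S_refl v by simp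
  let ?s = "unit_fun 0 v :: nat \<Rightarrow> nat \<Rightarrow> 'k"
  have s: "?s \<in> carrier ?I" using vv by (intro unit_fun_closed) (simp add: isum_def)
  have js: "j ?s \<in> carrier X" using rmod_homD(1)[OF j(1) s] .
  have "?s \<noteq> \<zero>\<^bsub>?I\<^esub>" by (auto simp: unit_fun_def thin_simps fun_eq_iff)
  then have jsnz: "j ?s \<noteq> \<zero>\<^bsub>X\<^esub>" using rmod_hom_eq_zero_iff[OF I X j(1,2) s] by simp
  have L: "j ?s \<in> L" if L: "submodule L B X" "L \<noteq> {\<zero>\<^bsub>X\<^esub>}" for L
  proof -
    note D = submoduleD'[OF L(1)]
    obtain y where "y \<in> L" "y \<noteq> \<zero>\<^bsub>X\<^esub>" using L(2) D(2) by auto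
    moreover from this have "y \<in> j ` carrier ?I" using D(1) j(3) by blast
    ultimately obtain f where f: "f \<in> carrier ?I" "j f \<in> L" "j f \<noteq> \<zero>\<^bsub>X\<^esub>" by blast
    then have "f \<noteq> \<zero>\<^bsub>?I\<^esub>" using rmod_hom_zero[OF I X j(1)] by auto
    then obtain n k where nz: "f n k \<noteq> 0" by (auto simp: thin_simps fun_eq_iff)
    then have nk: "n = 0" "(k, v) \<in> S" using f unfolding thin_simps isum_singleton by blast+
    let ?r = "bs k v \<otimes> \<eta> (inverse (f 0 k))"
    have "?r \<odot>\<^bsub>?I\<^esub> f = ?s"
    proof (intro ext)
      fix m l
      have "\<eta> (inverse (f 0 k)) \<odot>\<^bsub>?I\<^esub> (bs k v \<odot>\<^bsub>?I\<^esub> f) = ?r \<odot>\<^bsub>?I\<^esub> f"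
        using f by (simp add: I.r_smult_assoc eta_closed)
      moreover have "(\<eta> c \<odot>\<^bsub>?I\<^esub> g) m l = c * g m l" if "g \<in> carrier ?I" for c g
      proof -
        have "(\<Sum>i\<in>V. g m i * co (\<eta> c) i l) = (\<Sum>i\<in>V. if i = l then c * g m l else 0)"
          by (intro sum.cong refl) (auto simp: co_eta)
        then show ?thesis using that finite_V S_vertices(1) by (auto simp: thin_simps isum_def sum.delta)
      qed
      moreover have "bs k v \<odot>\<^bsub>?I\<^esub> f \<in> carrier ?I" using f by (simp add: I.r_smult_closed)
      ultimately have "(?r \<odot>\<^bsub>?I\<^esub> f) m l = inverse (f 0 k) * (bs k v \<odot>\<^bsub>?I\<^esub> f) m l" by metis
      then show "(?r \<odot>\<^bsub>?I\<^esub> f) m l = ?s m l"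
        using smult_bs_thin[OF f(1), of k v m l] nz nk vv by (auto simp: isum_singleton unit_fun_def)
    qed
    then have "j ?s = ?r \<odot>\<^bsub>X\<^esub> j f" using rmod_homD(3)[OF j(1) _ f(1), of ?r] eta_closed by simp
    then show ?thesis using D(4)[of ?r] f eta_closed by simp
  qed
  show ?thesis
    unfolding indecomposable_def
  proof (intro conjI allI impI)
    show "carrier X \<noteq> {\<zero>\<^bsub>X\<^esub>}" using js jsnz by auto
    fix L N assume "direct_decomposition B X L N"
    then have d: "submodule L B X" "submodule N B X" "L \<inter> N = {\<zero>\<^bsub>X\<^esub>}" by (auto simp: direct_decomposition_def)
    show "L = {\<zero>\<^bsub>X\<^esub>} \<or> N = {\<zero>\<^bsub>X\<^esub>}" using L[OF d(1)] L[OF d(2)] d(3) jsnz by blast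
  qed
qed

text \<open>The projection along \<open>Y\<close> makes the summand a retract; it is well defined
  because \<open>X\<close> and \<open>Y\<close> intersect in zero.\<close>

lemma direct_summand_injective:
  fixes M :: "('a, 'm) module"
  assumes M: "injective_rmod B M" and d: "direct_decomposition B M X Y"
  shows "injective_rmod B (M\<lparr>carrier := X\<rparr>)"
proof -
  note Mr = injective_rmodD(2)[OF M]
  interpret M: right_module B M by (rule Mr)
  from d have X: "submodule X B M" and Y: "submodule Y B M" and XY: "X \<inter> Y = {\<zero>\<^bsub>M\<^esub>}" "X <+>\<^bsub>M\<^esub> Y = carrier M"
    by (auto simp: direct_decomposition_def)
  note DX = submoduleD'[OF X] and DY = submoduleD'[OF Y]
  define p where "p m = (THE x. x \<in> X \<and> (\<exists>y\<in>Y. m = x \<oplus>\<^bsub>M\<^esub> y))" for m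
  have negY: "\<ominus>\<^bsub>M\<^esub> y \<in> Y" if "y \<in> Y" for y
    using Y that by (auto simp: submodule_def subgroup_def a_inv_def)
  have negX: "\<ominus>\<^bsub>M\<^esub> y \<in> X" if "y \<in> X" for y
    using X that by (auto simp: submodule_def subgroup_def a_inv_def)
  have p: "p (x \<oplus>\<^bsub>M\<^esub> y) = x" if xy: "x \<in> X" "y \<in> Y" for x y
    unfolding p_def
  proof (rule the_equality)
    show "x \<in> X \<and> (\<exists>y'\<in>Y. x \<oplus>\<^bsub>M\<^esub> y = x \<oplus>\<^bsub>M\<^esub> y')" using xy by blast
    fix x' assume "x' \<in> X \<and> (\<exists>y'\<in>Y. x \<oplus>\<^bsub>M\<^esub> y = x' \<oplus>\<^bsub>M\<^esub> y')"
    then obtain y' where y': "x' \<in> X" "y' \<in> Y" "x \<oplus>\<^bsub>M\<^esub> y = x' \<oplus>\<^bsub>M\<^esub> y'" by blast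
    have c: "x \<in> carrier M" "y \<in> carrier M" "x' \<in> carrier M" "y' \<in> carrier M" using xy y' DX DY by auto
    have "x' \<ominus>\<^bsub>M\<^esub> x = y \<ominus>\<^bsub>M\<^esub> y'"
    proof -
      have "x' \<ominus>\<^bsub>M\<^esub> x = (x' \<oplus>\<^bsub>M\<^esub> y') \<ominus>\<^bsub>M\<^esub> (x \<oplus>\<^bsub>M\<^esub> y')"
        using c by (simp add: a_minus_def M.minus_add M.a_ac M.r_neg M.l_neg)
      also have "\<dots> = (x \<oplus>\<^bsub>M\<^esub> y) \<ominus>\<^bsub>M\<^esub> (x \<oplus>\<^bsub>M\<^esub> y')" by (simp add: y'(3))
      also have "\<dots> = (\<ominus>\<^bsub>M\<^esub> x \<oplus>\<^bsub>M\<^esub> (x \<oplus>\<^bsub>M\<^esub> y)) \<ominus>\<^bsub>M\<^esub> y'"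
        using c by (simp add: a_minus_def M.minus_add M.a_ac)
      also have "\<dots> = y \<ominus>\<^bsub>M\<^esub> y'" using c by (simp add: M.r_neg1)
      finally show ?thesis .
    qed
    moreover have "x' \<ominus>\<^bsub>M\<^esub> x \<in> X" using y' xy negX DX by (simp add: a_minus_def)
    moreover have "y \<ominus>\<^bsub>M\<^esub> y' \<in> Y" using y' xy negY DY by (simp add: a_minus_def)
    ultimately have "x' \<ominus>\<^bsub>M\<^esub> x = \<zero>\<^bsub>M\<^esub>" using XY(1) by auto
    then show "x' = x" using c by (simp add: M.minus_eq_zero_iff)
  qed
  have dec: "\<exists>x\<in>X. \<exists>y\<in>Y. m = x \<oplus>\<^bsub>M\<^esub> y" if "m \<in> carrier M" for m
    using that XY(2) unfolding set_add_def' by blast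
  show ?thesis
  proof (rule injective_rmod_retract[OF M submodule_right_module[OF Mr X]])
    show "(\<lambda>x. x) \<in> rmod_hom B (M\<lparr>carrier := X\<rparr>) M" using DX by (auto simp: rmod_hom_def)
    show "p \<in> rmod_hom B M (M\<lparr>carrier := X\<rparr>)"
    proof (rule rmod_homI)
      fix m assume "m \<in> carrier M"
      then show "p m \<in> carrier (M\<lparr>carrier := X\<rparr>)" using dec p by fastforce
    next
      fix m m' assume m: "m \<in> carrier M" "m' \<in> carrier M"
      obtain x y where xy: "x \<in> X" "y \<in> Y" "m = x \<oplus>\<^bsub>M\<^esub> y" using dec[OF m(1)] by blast
      obtain x' y' where xy': "x' \<in> X" "y' \<in> Y" "m' = x' \<oplus>\<^bsub>M\<^esub> y'" using dec[OF m(2)] by blast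
      have "m \<oplus>\<^bsub>M\<^esub> m' = (x \<oplus>\<^bsub>M\<^esub> x') \<oplus>\<^bsub>M\<^esub> (y \<oplus>\<^bsub>M\<^esub> y')"
        using xy xy' DX DY by (simp add: M.a_ac subset_eq)
      then show "p (m \<oplus>\<^bsub>M\<^esub> m') = p m \<oplus>\<^bsub>M\<lparr>carrier := X\<rparr>\<^esub> p m'"
        using xy xy' DX(3) DY(3) by (simp add: p)
    next
      fix r m assume r: "r \<in> carrier B" and m: "m \<in> carrier M"
      obtain x y where xy: "x \<in> X" "y \<in> Y" "m = x \<oplus>\<^bsub>M\<^esub> y" using dec[OF m] by blast
      have "r \<odot>\<^bsub>M\<^esub> m = r \<odot>\<^bsub>M\<^esub> x \<oplus>\<^bsub>M\<^esub> r \<odot>\<^bsub>M\<^esub> y"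
        using xy DX(1) DY(1) r by (simp add: M.r_smult_module_distr subset_eq)
      then show "p (r \<odot>\<^bsub>M\<^esub> m) = r \<odot>\<^bsub>M\<lparr>carrier := X\<rparr>\<^esub> p m"
        using xy DX(4) DY(4) r by (simp add: p)
    qed
    show "p x = x" if "x \<in> carrier (M\<lparr>carrier := X\<rparr>)" for x
      using p[of x "\<zero>\<^bsub>M\<^esub>"] that DX(1) DY(2) by (auto simp: subset_eq)
  qed
qed

end

section \<open>Complexes given by integer matrices\<close>

text \<open>The default lets finite lists describe infinite complexes: beyond the list all terms and
  maps are zero.\<close>

definition nth_or_Nil :: "'a list list \<Rightarrow> nat \<Rightarrow> 'a list" where
  "nth_or_Nil xs i = (if i < length xs then xs ! i else [])"

text \<open>Supports are stored by vertex, because exactness is checked vertex by vertex.\<close>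

definition col_set :: "nat list list \<Rightarrow> (nat \<times> nat) set" where
  "col_set c = {(n, k). n \<in> set (nth_or_Nil c k)}"

text \<open>Integer matrices are given by the list of the nonzero entries of each row.\<close>

definition entry :: "(nat \<times> int) list list \<Rightarrow> nat \<Rightarrow> nat \<Rightarrow> int" where
  "entry C n m = (case map_of (nth_or_Nil C n) m of None \<Rightarrow> 0 | Some c \<Rightarrow> c)"

definition psum_cols :: "nat list list \<Rightarrow> nat list \<Rightarrow> nat list list" where
  "psum_cols rows vs = map (\<lambda>k. filter (\<lambda>n. k \<in> set (rows ! (vs ! n))) [0..<length vs]) [0..<length rows]"

definition isum_cols :: "nat list list \<Rightarrow> nat list \<Rightarrow> nat list list" where
  "isum_cols rows vs = map (\<lambda>k. filter (\<lambda>n. vs ! n \<in> set (rows ! k)) [0..<length vs]) [0..<length rows]"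

definition hom_check :: "nat list list \<Rightarrow> nat list list \<Rightarrow> nat list list \<Rightarrow> (nat \<times> int) list list \<Rightarrow> bool" where
  "hom_check rows c c' C \<longleftrightarrow> list_all (\<lambda>i. list_all (\<lambda>k. list_all (\<lambda>n. list_all (\<lambda>m.
     entry C n m = 0 \<or> (n \<in> set (nth_or_Nil c k) \<longleftrightarrow> m \<in> set (nth_or_Nil c' i)))
       (nth_or_Nil c' k)) (nth_or_Nil c i)) (rows ! i)) [0..<length rows]"

text \<open>
  \<open>H0\<close> and \<open>H1\<close> describe a contracting homotopy at \<open>c1\<close>; it consists of linear maps only, so that
  its matrices depend on the vertex.
\<close>

definition exact_check :: "nat list list \<Rightarrow> nat list list \<Rightarrow> nat list list \<Rightarrow>
    (nat \<times> int) list list \<Rightarrow> (nat \<times> int) list list \<Rightarrow>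
    (nat \<times> int) list list list \<Rightarrow> (nat \<times> int) list list list \<Rightarrow> bool" where
  "exact_check c0 c1 c2 C0 C1 H0 H1 \<longleftrightarrow> list_all (\<lambda>k.
     distinct (nth_or_Nil c0 k) \<and> distinct (nth_or_Nil c1 k) \<and> distinct (nth_or_Nil c2 k) \<and>
     list_all (\<lambda>n. list_all (\<lambda>q. sum_list (map (\<lambda>m. entry C0 n m * entry C1 m q) (nth_or_Nil c1 k)) = 0)
       (nth_or_Nil c2 k)) (nth_or_Nil c0 k) \<and>
     list_all (\<lambda>n. list_all (\<lambda>m.
       sum_list (map (\<lambda>p. entry (nth_or_Nil H0 k) n p * entry C0 p m) (nth_or_Nil c0 k)) +
       sum_list (map (\<lambda>q. entry C1 n q * entry (nth_or_Nil H1 k) q m) (nth_or_Nil c2 k)) =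
       (if n = m then 1 else 0)) (nth_or_Nil c1 k)) (nth_or_Nil c1 k)) [0..<length c1]"

definition minimal_check :: "nat list \<Rightarrow> nat list list \<Rightarrow> (nat \<times> int) list list \<Rightarrow> bool" where
  "minimal_check vs c C \<longleftrightarrow>
     list_all (\<lambda>n. list_all (\<lambda>m. entry C n m = 0) (nth_or_Nil c (vs ! n))) [0..<length vs]"

text \<open>Position 0 of \<open>c\<close> is I(v) and position i + 1 is the projective term i, so
  matrix i leads from position i + 1 to position i. At i = 0 the truncated i - 1 is harmless, as the
  third module is zero there. The range ends with i = \<open>length ps\<close>, which checks
  injectivity at the left end.\<close>

definition resolution_check :: "nat list list \<Rightarrow> nat \<Rightarrow> nat list list \<Rightarrow> (nat \<times> int) list list list \<Rightarrow>
    (nat \<times> int) list list list list \<Rightarrow> bool" where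
  "resolution_check rows v ps Cs Hs \<longleftrightarrow> v < length rows \<and> list_all (list_all (\<lambda>p. p < length rows)) ps \<and>
    (let c = nth_or_Nil (isum_cols rows [v] # map (psum_cols rows) ps) in
     list_all (\<lambda>i. hom_check rows (c (Suc i)) (c i) (nth_or_Nil Cs i) \<and>
       exact_check (c (Suc i)) (c i) (if i = 0 then [] else c (i - 1)) (nth_or_Nil Cs i) (nth_or_Nil Cs (i - 1))
        (nth_or_Nil Hs i) (nth_or_Nil Hs (i - 1))) [0..<Suc (length ps)])"

text \<open>Position 0 of \<open>c\<close> is the regular module and the term i is at position i +
  1; hence the shift in \<open>minimal_check\<close>, which concerns the terms only.\<close>

definition coresolution_check :: "nat list list \<Rightarrow> nat list list \<Rightarrow> (nat \<times> int) list list list \<Rightarrow>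
    (nat \<times> int) list list list list \<Rightarrow> bool" where
  "coresolution_check rows vss Cs Hs \<longleftrightarrow> list_all (list_all (\<lambda>p. p < length rows)) vss \<and>
    (let c = nth_or_Nil (psum_cols rows [0..<length rows] # map (isum_cols rows) vss) in
     list_all (\<lambda>i. hom_check rows (c i) (c (Suc i)) (nth_or_Nil Cs i) \<and>
       exact_check (if i = 0 then [] else c (i - 1)) (c i) (c (Suc i)) (nth_or_Nil Cs (i - 1)) (nth_or_Nil Cs i)
        (nth_or_Nil Hs (i - 1)) (nth_or_Nil Hs i) \<and>
       (i = 0 \<or> minimal_check (nth_or_Nil vss (i - 1)) (c (Suc i)) (nth_or_Nil Cs i))) [0..<Suc (length vss)])"

lemma nth_or_Nil_Nil [simp]: "nth_or_Nil [] i = []"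
  by (simp add: nth_or_Nil_def)

lemma col_set_Nil [simp]: "col_set [] = {}"
  by (simp add: col_set_def)

lemma hom_check_Nil [simp]: "hom_check rows [] c' C" "hom_check rows c [] C"
  by (simp_all add: hom_check_def list_all_iff)

lemma exact_check_Nil [simp]: "exact_check c0 [] c2 C0 C1 H0 H1"
  by (simp add: exact_check_def)

lemma minimal_check_Nil [simp]: "minimal_check [] c C"
  by (simp add: minimal_check_def)

section \<open>Soundness of the checks\<close>

context coord_algebra
begin

definition thin_map :: "(nat \<times> nat) set \<Rightarrow> (nat \<times> nat) set \<Rightarrow> (nat \<Rightarrow> nat \<Rightarrow> int) \<Rightarrow>
    (nat \<Rightarrow> nat \<Rightarrow> 'k) \<Rightarrow> nat \<Rightarrow> nat \<Rightarrow> 'k" where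
  "thin_map W W' C f = (\<lambda>m k. if (m, k) \<in> W' then \<Sum>n | (n, k) \<in> W. of_int (C n m) * f n k else 0)"

lemma finite_column: "thin_ok W \<Longrightarrow> finite {n. (n, k) \<in> W}"
  by (rule finite_subset[of _ "fst ` W"]) (auto dest: thin_okD(1) intro: rev_image_eqI)

text \<open>From (n,i) to (m,k), acting first passes through (n,k), and mapping first passes through
  (m,i). A nonzero coefficient is admissible iff both positions are present or both absent.\<close>

lemma thin_map_hom:
  assumes W: "thin_ok W"
    and ok: "\<And>n m i k. (n, i) \<in> W \<Longrightarrow> (m, k) \<in> W' \<Longrightarrow> (i, k) \<in> S \<Longrightarrow> C n m \<noteq> 0 \<Longrightarrow> (n, k) \<in> W \<longleftrightarrow> (m, i) \<in> W'"
  shows "thin_map W W' C \<in> rmod_hom B (thin W) (thin W')"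
proof (rule rmod_homI)
  show "thin_map W W' C f \<in> carrier (thin W')" for f by (simp add: thin_map_def thin_simps)
  show "thin_map W W' C (f \<oplus>\<^bsub>thin W\<^esub> g) = thin_map W W' C f \<oplus>\<^bsub>thin W'\<^esub> thin_map W W' C g" for f g
    by (auto simp: thin_map_def thin_simps fun_eq_iff algebra_simps sum.distrib)
  fix r f assume r: "r \<in> carrier B" and f: "f \<in> carrier (thin W)"
  show "thin_map W W' C (r \<odot>\<^bsub>thin W\<^esub> f) = r \<odot>\<^bsub>thin W'\<^esub> thin_map W W' C f"
  proof (intro ext)
    fix m k
    let ?A = "fst ` W"
    have fin: "finite ?A" using thin_okD(1)[OF W] by simp
    have expand: "(\<Sum>n | (n, l) \<in> W. x n) = (\<Sum>n\<in>?A. if (n, l) \<in> W then x n else 0)" for l and x :: "nat \<Rightarrow> 'k"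
      by (rule sum.mono_neutral_cong_left) (use fin in \<open>auto intro: rev_image_eqI\<close>)
    show "thin_map W W' C (r \<odot>\<^bsub>thin W\<^esub> f) m k = (r \<odot>\<^bsub>thin W'\<^esub> thin_map W W' C f) m k"
    proof (cases "(m, k) \<in> W'")
      case True
      have t: "(if (n, k) \<in> W then of_int (C n m) * (f n i * co r i k) else 0) =
         (if (m, i) \<in> W' then (if (n, i) \<in> W then of_int (C n m) * f n i else 0) else 0) * co r i k" for n i
      proof (cases "f n i = 0 \<or> co r i k = 0 \<or> C n m = 0")
        case False
        then have "(n, i) \<in> W" "(i, k) \<in> S"
          using f co_supp[OF r, of i k] by (auto simp: thin_simps)
        then show ?thesis using ok[of n i m k] True False by simp
      qed auto
      have "thin_map W W' C (r \<odot>\<^bsub>thin W\<^esub> f) m k =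
          (\<Sum>n\<in>?A. \<Sum>i\<in>V. if (n, k) \<in> W then of_int (C n m) * (f n i * co r i k) else 0)"
        unfolding thin_map_def expand using True by (auto simp: thin_simps sum_distrib_left intro!: sum.cong)
      also have "\<dots> = (\<Sum>i\<in>V. \<Sum>n\<in>?A. if (n, k) \<in> W then of_int (C n m) * (f n i * co r i k) else 0)"
        by (rule sum.swap)
      also have "\<dots> = (\<Sum>i\<in>V. thin_map W W' C f m i * co r i k)"
        unfolding t thin_map_def expand by (intro sum.cong refl) (auto simp: sum_distrib_right)
      finally show ?thesis using True by (simp add: thin_simps(4))
    qed (simp add: thin_map_def thin_simps(4))
  qed
qed

text \<open>The homotopy identity writes each cycle as the boundary of its image under
  \<open>H0\<close>. All identities are between integers and enter the field through
  \<open>of_int\<close>.\<close>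

lemma thin_map_exact:
  fixes C0 C1 :: "nat \<Rightarrow> nat \<Rightarrow> int"
  assumes W: "thin_ok W0" "thin_ok W1" "thin_ok W2"
    and complex: "\<And>n q k. (n, k) \<in> W0 \<Longrightarrow> (q, k) \<in> W2 \<Longrightarrow> (\<Sum>m | (m, k) \<in> W1. C0 n m * C1 m q) = 0"
    and homotopy: "\<And>n m k. (n, k) \<in> W1 \<Longrightarrow> (m, k) \<in> W1 \<Longrightarrow>
      (\<Sum>p | (p, k) \<in> W0. H0 k n p * C0 p m) + (\<Sum>q | (q, k) \<in> W2. C1 n q * H1 k q m) = (if n = m then 1 else 0)"
  shows "thin_map W0 W1 C0 ` carrier (thin W0) = rmod_ker (thin W1) (thin W2) (thin_map W1 W2 C1)"
proof
  note fin = finite_column[OF W(1)] finite_column[OF W(2)] finite_column[OF W(3)]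
  show "thin_map W0 W1 C0 ` carrier (thin W0) \<subseteq> rmod_ker (thin W1) (thin W2) (thin_map W1 W2 C1)"
  proof
    fix g assume "g \<in> thin_map W0 W1 C0 ` carrier (thin W0)"
    then obtain f where g: "g = thin_map W0 W1 C0 f" by auto
    have "thin_map W1 W2 C1 g q k = 0" for q k
    proof (cases "(q, k) \<in> W2")
      case True
      have "thin_map W1 W2 C1 g q k = (\<Sum>m | (m, k) \<in> W1. \<Sum>n | (n, k) \<in> W0. of_int (C0 n m * C1 m q) * f n k)"
      proof -
        have A: "thin_map W1 W2 C1 g q k = (\<Sum>m | (m, k) \<in> W1. of_int (C1 m q) * g m k)"
          using True by (simp add: thin_map_def)
        have C: "of_int (C1 m q) * g m k = (\<Sum>n | (n, k) \<in> W0. of_int (C0 n m * C1 m q) * f n k)"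
          if "m \<in> {m. (m, k) \<in> W1}" for m
        proof -
          have *: "g m k = (\<Sum>n | (n, k) \<in> W0. of_int (C0 n m) * f n k)" using that by (simp add: g thin_map_def)
          have "of_int (C1 m q) * (of_int (C0 n m) * f n k) = of_int (C0 n m * C1 m q) * f n k" for n
            unfolding of_int_mult by (metis mult.assoc mult.commute)
          then show ?thesis unfolding * sum_distrib_left by (intro sum.cong refl)
        qed
        show ?thesis unfolding A by (rule sum.cong[OF refl C])
      qed
      also have "\<dots> = (\<Sum>n | (n, k) \<in> W0. of_int (\<Sum>m | (m, k) \<in> W1. C0 n m * C1 m q) * f n k)"
        by (subst sum.swap) (simp add: sum_distrib_right)
      also have "\<dots> = 0" using complex[OF _ True] by (intro sum.neutral) auto
      finally show ?thesis .
    qed (simp add: thin_map_def)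
    then show "g \<in> rmod_ker (thin W1) (thin W2) (thin_map W1 W2 C1)"
      by (auto simp: rmod_ker_def thin_simps g thin_map_def fun_eq_iff)
  qed
  show "rmod_ker (thin W1) (thin W2) (thin_map W1 W2 C1) \<subseteq> thin_map W0 W1 C0 ` carrier (thin W0)"
  proof
    fix f assume "f \<in> rmod_ker (thin W1) (thin W2) (thin_map W1 W2 C1)"
    then have f: "\<And>n k. (n, k) \<notin> W1 \<Longrightarrow> f n k = 0" and z: "\<And>q k. thin_map W1 W2 C1 f q k = 0"
      by (auto simp: rmod_ker_def thin_simps fun_eq_iff)
    \<comment> \<open>The preimage of the cycle \<open>f\<close> is its image under the
      homotopy.\<close>
    define h where "h = (\<lambda>p k. if (p, k) \<in> W0 then \<Sum>n | (n, k) \<in> W1. of_int (H0 k n p) * f n k else 0)"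
    have "thin_map W0 W1 C0 h m k = f m k" for m k
    proof (cases "(m, k) \<in> W1")
      case True
      have "thin_map W0 W1 C0 h m k = (\<Sum>p | (p, k) \<in> W0. \<Sum>n | (n, k) \<in> W1. of_int (H0 k n p * C0 p m) * f n k)"
      proof -
        have A: "thin_map W0 W1 C0 h m k = (\<Sum>p | (p, k) \<in> W0. of_int (C0 p m) * h p k)"
          using True by (simp add: thin_map_def)
        have C: "of_int (C0 p m) * h p k = (\<Sum>n | (n, k) \<in> W1. of_int (H0 k n p * C0 p m) * f n k)"
          if "p \<in> {p. (p, k) \<in> W0}" for p
        proof -
          have *: "h p k = (\<Sum>n | (n, k) \<in> W1. of_int (H0 k n p) * f n k)" using that by (simp add: h_def)
          have "of_int (C0 p m) * (of_int (H0 k n p) * f n k) = of_int (H0 k n p * C0 p m) * f n k" for n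
            unfolding of_int_mult by (metis mult.assoc mult.commute)
          then show ?thesis unfolding * sum_distrib_left by (intro sum.cong refl)
        qed
        show ?thesis unfolding A by (rule sum.cong[OF refl C])
      qed
      also have "\<dots> = (\<Sum>n | (n, k) \<in> W1. of_int (\<Sum>p | (p, k) \<in> W0. H0 k n p * C0 p m) * f n k)"
        by (subst sum.swap) (simp add: sum_distrib_right)
      also have "\<dots> = (\<Sum>n | (n, k) \<in> W1. (if n = m then f n k else 0) -
          (\<Sum>q | (q, k) \<in> W2. of_int (H1 k q m) * (of_int (C1 n q) * f n k)))"
      proof (intro sum.cong refl)
        fix n assume "n \<in> {n. (n, k) \<in> W1}"
        then have eq: "(\<Sum>p | (p, k) \<in> W0. H0 k n p * C0 p m) = (if n = m then 1 else 0) - (\<Sum>q | (q, k) \<in> W2. C1 n q * H1 k q m)"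
          using homotopy[of n k m] True by simp
        show "of_int (\<Sum>p | (p, k) \<in> W0. H0 k n p * C0 p m) * f n k = (if n = m then f n k else 0) -
          (\<Sum>q | (q, k) \<in> W2. of_int (H1 k q m) * (of_int (C1 n q) * f n k))"
        proof -
          have "of_int (\<Sum>q | (q, k) \<in> W2. C1 n q * H1 k q m) * f n k =
              (\<Sum>q | (q, k) \<in> W2. of_int (H1 k q m) * (of_int (C1 n q) * f n k))"
            unfolding of_int_sum sum_distrib_right
            by (intro sum.cong refl) (metis mult.assoc mult.commute of_int_mult)
          then show ?thesis unfolding eq by (simp add: left_diff_distrib)
        qed
      qed
      also have "\<dots> = f m k - (\<Sum>n | (n, k) \<in> W1. \<Sum>q | (q, k) \<in> W2. of_int (H1 k q m) * (of_int (C1 n q) * f n k))"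
        using True fin by (simp add: sum_subtractf sum.delta)
      also have "\<dots> = f m k - (\<Sum>q | (q, k) \<in> W2. of_int (H1 k q m) * (\<Sum>n | (n, k) \<in> W1. of_int (C1 n q) * f n k))"
        by (subst sum.swap) (simp add: sum_distrib_left)
      also have "\<dots> = f m k - (\<Sum>q | (q, k) \<in> W2. of_int (H1 k q m) * thin_map W1 W2 C1 f q k)"
        by (auto simp: thin_map_def intro!: sum.cong)
      finally show ?thesis by (simp add: z)
    qed (simp add: thin_map_def f)
    then have "f = thin_map W0 W1 C0 h" by (simp add: fun_eq_iff)
    moreover have "h \<in> carrier (thin W0)" by (simp add: thin_simps h_def)
    ultimately show "f \<in> thin_map W0 W1 C0 ` carrier (thin W0)" by blast
  qed
qed

lemma thin_ok_empty: "thin_ok {}"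
  by (simp add: thin_ok_def)

lemma psum_Nil: "psum [] = {}" and isum_Nil: "isum [] = {}"
  by (simp_all add: psum_def isum_def)

lemma thin_empty: "carrier (thin {}) = {\<zero>\<^bsub>thin {}\<^esub>}"
  by (auto simp: thin_simps fun_eq_iff)

text \<open>The minimality condition says that the differential vanishes on the socle.\<close>

lemma thin_kernel_essential:
  assumes tri: "\<And>i k. (i, k) \<in> S \<Longrightarrow> i \<le> k" and W': "thin_ok W'"
    and F: "thin_map (isum vs) W' C \<in> rmod_hom B (thin (isum vs)) (thin W')"
    and min: "\<And>n m. n < length vs \<Longrightarrow> (m, vs ! n) \<in> W' \<Longrightarrow> C n m = 0"
  shows "essential_in B (thin (isum vs)) (rmod_ker (thin (isum vs)) (thin W') (thin_map (isum vs) W' C))"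
proof -
  let ?I = "thin (isum vs)" and ?F = "thin_map (isum vs) W' C"
  note I = thin_right_module[OF thin_ok_isum, of vs]
  interpret I: right_module B ?I by (rule I)
  have K: "submodule (rmod_ker ?I (thin W') ?F) B ?I"
    by (rule rmod_ker_submodule[OF I thin_right_module[OF W'] F])
  show ?thesis
    unfolding essential_in_def
  proof (intro conjI allI impI K, elim conjE)
    fix L assume L: "submodule L B ?I" "L \<noteq> {\<zero>\<^bsub>?I\<^esub>}"
    note D = submoduleD'[OF L(1)] and Lr = submodule_right_module[OF I L(1)]
    obtain v x where "socle_at (?I\<lparr>carrier := L\<rparr>) v x"
      using socle_exists[OF Lr _ tri] L(2) by auto
    then have x: "x \<in> L" "x \<noteq> \<zero>\<^bsub>?I\<^esub>" and "socle_at ?I v x"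
      using D(1) by (auto simp: socle_at_def)
    note soc = socle_at_isum[OF \<open>socle_at ?I v x\<close>]
    have "?F x m k = 0" for m k
    proof (cases "(m, k) \<in> W'")
      case True
      have "of_int (C n m) * x n k = 0" for n
        using soc(2)[of n k] min[of n m] True by (cases "x n k = 0") auto
      then show ?thesis unfolding thin_map_def by (simp only: sum.neutral_const if_cancel)
    qed (simp add: thin_map_def)
    then have "x \<in> rmod_ker ?I (thin W') ?F" using soc(1) by (simp add: rmod_ker_def thin_simps(2) fun_eq_iff)
    with x show "rmod_ker ?I (thin W') ?F \<inter> L \<noteq> {\<zero>\<^bsub>?I\<^esub>}" by blast
  qed
qed

text \<open>An element of the algebra already is a family of rows. For the list
  \<open>[0..<l]\<close> the index of a summand is the row number, so \<open>psum\<close> is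
  \<open>S\<close> itself.\<close>

lemma regular_iso:
  assumes L: "S \<subseteq> {..<l} \<times> UNIV"
  shows "co \<in> rmod_hom B (regular_right_module B) (thin (psum [0..<l]))"
    "bij_betw co (carrier (regular_right_module B)) (carrier (thin (psum [0..<l])))"
    "right_module B (regular_right_module B)"
proof -
  have ps: "psum [0..<l] = S" using L by (auto simp: psum_def)
  have car: "carrier (regular_right_module B) = carrier B" by (simp add: regular_right_module_def)
  show "co \<in> rmod_hom B (regular_right_module B) (thin (psum [0..<l]))"
    unfolding ps
    by (rule rmod_homI)
      (auto simp: regular_right_module_def thin_simps co_supp co_add co_mult fun_eq_iff)
  show "bij_betw co (carrier (regular_right_module B)) (carrier (thin (psum [0..<l])))"
    unfolding ps car bij_betw_def
  proof
    show "inj_on co (carrier B)" using co_inj by (auto intro: inj_onI)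
    show "co ` carrier B = carrier (thin S)"
    proof
      show "co ` carrier B \<subseteq> carrier (thin S)" using co_supp by (auto simp: thin_simps)
      show "carrier (thin S) \<subseteq> co ` carrier B"
      proof
        fix m assume "m \<in> carrier (thin S)"
        then have "\<exists>r\<in>carrier B. co r = m" by (intro co_surj) (simp add: thin_simps)
        then show "m \<in> co ` carrier B" by blast
      qed
    qed
  qed
  show "right_module B (regular_right_module B)"
  proof -
    have "abelian_group (regular_right_module B)"
      by (rule abelian_groupI) (auto simp: regular_right_module_def a_ac intro: l_neg)
    then show ?thesis
      by (intro right_module.intro right_module_axioms.intro ring_axioms)
        (auto simp: regular_right_module_def l_distr r_distr m_assoc)
  qed
qed

context
  fixes rows :: "nat list list"
  assumes rows: "S = {(i, k). i < length rows \<and> k \<in> set (rows ! i)}" and rows_V: "V \<subseteq> {..<length rows}"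
begin

lemma mem_S_iff: "(i, k) \<in> S \<longleftrightarrow> i < length rows \<and> k \<in> set (rows ! i)"
  by (simp add: rows)

lemma col_set_psum_cols: "list_all (\<lambda>p. p < length rows) vs \<Longrightarrow> col_set (psum_cols rows vs) = psum vs"
  using S_vertices(2) rows_V
  by (fastforce simp: col_set_def psum_cols_def psum_def nth_or_Nil_def mem_S_iff list_all_length split: if_splits)

lemma col_set_isum_cols: "col_set (isum_cols rows vs) = isum vs"
  by (auto simp: col_set_def isum_cols_def isum_def nth_or_Nil_def mem_S_iff split: if_splits)

lemma hom_check_sound:
  assumes "hom_check rows c c' C" "thin_ok (col_set c)"
  shows "thin_map (col_set c) (col_set c') (entry C) \<in> rmod_hom B (thin (col_set c)) (thin (col_set c'))"
proof (rule thin_map_hom[OF assms(2)])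
  fix n m i k
  assume "(n, i) \<in> col_set c" "(m, k) \<in> col_set c'" "(i, k) \<in> S" "entry C n m \<noteq> 0"
  then show "(n, k) \<in> col_set c \<longleftrightarrow> (m, i) \<in> col_set c'"
    using assms(1)[unfolded hom_check_def list_all_iff, rule_format, of i k n m]
    by (simp add: col_set_def mem_S_iff)
qed

lemma exact_check_sound:
  assumes "exact_check c0 c1 c2 C0 C1 H0 H1" "thin_ok (col_set c0)" "thin_ok (col_set c1)" "thin_ok (col_set c2)"
  shows "thin_map (col_set c0) (col_set c1) (entry C0) ` carrier (thin (col_set c0)) =
    rmod_ker (thin (col_set c1)) (thin (col_set c2)) (thin_map (col_set c1) (col_set c2) (entry C1))"
proof (rule thin_map_exact[OF assms(2-4), where ?H0.0 = "\<lambda>k. entry (nth_or_Nil H0 k)" and ?H1.0 = "\<lambda>k. entry (nth_or_Nil H1 k)"])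
  have col: "{n. (n, k) \<in> col_set c} = set (nth_or_Nil c k)" for c k by (simp add: col_set_def)
  have sum: "sum f (set xs) = sum_list (map f xs)" if "distinct xs" for f :: "nat \<Rightarrow> int" and xs
    using that by (simp add: sum.distinct_set_conv_list)
  show "(\<Sum>m | (m, k) \<in> col_set c1. entry C0 n m * entry C1 m q) = 0"
    if "(n, k) \<in> col_set c0" "(q, k) \<in> col_set c2" for n q k
  proof (cases "k < length c1")
    case True
    then show ?thesis using assms(1) that unfolding col
      by (simp add: exact_check_def list_all_iff sum col_set_def)
  qed (simp add: col_set_def nth_or_Nil_def)
  show "(\<Sum>p | (p, k) \<in> col_set c0. entry (nth_or_Nil H0 k) n p * entry C0 p m) +
     (\<Sum>q | (q, k) \<in> col_set c2. entry C1 n q * entry (nth_or_Nil H1 k) q m) = (if n = m then 1 else 0)"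
    if "(n, k) \<in> col_set c1" "(m, k) \<in> col_set c1" for n m k
  proof -
    have "k < length c1" using that by (auto simp: col_set_def nth_or_Nil_def split: if_splits)
    then show ?thesis using assms(1) that unfolding col
      by (simp add: exact_check_def list_all_iff sum col_set_def)
  qed
qed

lemma resolution_check_sound:
  assumes chk: "resolution_check rows v ps Cs Hs"
  shows "projdim_le B (length ps - 1) (thin (isum [v]))"
proof -
  define c where "c = nth_or_Nil (isum_cols rows [v] # map (psum_cols rows) ps)"
  have ps: "list_all (\<lambda>p. p < length rows) (nth_or_Nil ps i)" for i
    using chk by (auto simp: resolution_check_def list_all_length nth_or_Nil_def)
  have c0: "col_set (c 0) = isum [v]" by (simp add: c_def nth_or_Nil_def col_set_isum_cols)
  have cS: "col_set (c (Suc i)) = psum (nth_or_Nil ps i)" for i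
    using ps[of i] col_set_psum_cols[of "nth_or_Nil ps i"]
    by (cases "i < length ps") (auto simp: c_def nth_or_Nil_def psum_Nil)
  have ok: "thin_ok (col_set (c i))" for i
    by (cases i) (simp_all add: c0 cS thin_ok_isum thin_ok_psum)
  have chk': "hom_check rows (c (Suc i)) (c i) (nth_or_Nil Cs i) \<and>
       exact_check (c (Suc i)) (c i) (if i = 0 then [] else c (i - 1)) (nth_or_Nil Cs i) (nth_or_Nil Cs (i - 1))
        (nth_or_Nil Hs i) (nth_or_Nil Hs (i - 1))" for i
  \<comment> \<open>Beyond the listed terms the middle module is zero and the checks hold trivially,
    so they are available for all i.\<close>
  proof (cases "i < Suc (length ps)")
    case True
    then have "i \<in> set [0..<Suc (length ps)]" by (simp del: upt_Suc)
    then show ?thesis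
      using chk unfolding resolution_check_def Let_def c_def[symmetric] list_all_iff by blast
  next
    case False
    then have "c i = []" by (simp add: c_def nth_or_Nil_def)
    then show ?thesis by simp
  qed
  let ?d = "\<lambda>i. thin_map (col_set (c (Suc i))) (col_set (c i)) (entry (nth_or_Nil Cs i))"
  have hom: "?d i \<in> rmod_hom B (thin (col_set (c (Suc i)))) (thin (col_set (c i)))" for i
    using hom_check_sound[OF _ ok] chk' by blast
  have exact: "?d (Suc i) ` carrier (thin (col_set (c (Suc (Suc i))))) =
      rmod_ker (thin (col_set (c (Suc i)))) (thin (col_set (c i))) (?d i)" for i
    by (rule exact_check_sound[OF _ ok ok ok]) (use chk'[of "Suc i"] in auto)
  have surj: "?d 0 ` carrier (thin (col_set (c (Suc 0)))) = carrier (thin (col_set (c 0)))"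
  proof -
    have e: "exact_check (c (Suc 0)) (c 0) [] (nth_or_Nil Cs 0) (nth_or_Nil Cs 0) (nth_or_Nil Hs 0) (nth_or_Nil Hs 0)"
      using chk'[of 0] by simp
    show ?thesis
      using exact_check_sound[OF e ok ok] thin_ok_empty
      by (simp add: rmod_ker_def thin_map_def thin_simps(2))
  qed
  have "projdim_le B (length ps - 1) (thin (col_set (c 0)))"
  proof (rule projdim_le_resolution[where Q = "\<lambda>i. thin (col_set (c (Suc i)))" and e = "?d 0" and d = "\<lambda>i. ?d (Suc i)"])
    show "right_module B (thin (col_set (c 0)))" by (rule thin_right_module[OF ok])
    show "projective_rmod B (thin (col_set (c (Suc i))))" for i unfolding cS by (rule thin_projective)
    show "carrier (thin (col_set (c (Suc i)))) = {\<zero>\<^bsub>thin (col_set (c (Suc i)))\<^esub>}" if "i > length ps - 1" for i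
    proof -
      have "\<not> i < length ps" using that by linarith
      then have "nth_or_Nil ps i = []" unfolding nth_or_Nil_def by (rule if_not_P)
      then show ?thesis unfolding cS by (simp add: psum_Nil thin_empty)
    qed
    show "?d (Suc 0) ` carrier (thin (col_set (c (Suc 1)))) = rmod_ker (thin (col_set (c (Suc 0)))) (thin (col_set (c 0))) (?d 0)"
      using exact[of 0] by simp
  qed (fact hom surj exact)+
  then show ?thesis by (simp add: c0)
qed

lemma coresolution_check_sound:
  assumes tri: "\<And>i k. (i, k) \<in> S \<Longrightarrow> i \<le> k" and chk: "coresolution_check rows vss Cs Hs"
  defines "W \<equiv> \<lambda>i. isum (nth_or_Nil vss i)"
  defines "d \<equiv> \<lambda>i. thin_map (W i) (W (Suc i)) (entry (nth_or_Nil Cs (Suc i)))"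
  defines "u \<equiv> \<lambda>x. thin_map (psum [0..<length rows]) (W 0) (entry (nth_or_Nil Cs 0)) (co x)"
  shows "u \<in> rmod_hom B (regular_right_module B) (thin (W 0))" "inj_on u (carrier (regular_right_module B))"
    "d i \<in> rmod_hom B (thin (W i)) (thin (W (Suc i)))"
    "u ` carrier (regular_right_module B) = rmod_ker (thin (W 0)) (thin (W 1)) (d 0)"
    "d i ` carrier (thin (W i)) = rmod_ker (thin (W (Suc i))) (thin (W (Suc (Suc i)))) (d (Suc i))"
    "essential_in B (thin (W i)) (rmod_ker (thin (W i)) (thin (W (Suc i))) (d i))"
proof -
  define c where "c = nth_or_Nil (psum_cols rows [0..<length rows] # map (isum_cols rows) vss)"
  have c0: "col_set (c 0) = psum [0..<length rows]"
    using col_set_psum_cols[of "[0..<length rows]"] by (simp add: c_def nth_or_Nil_def list_all_iff)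
  have cS: "col_set (c (Suc i)) = W i" for i
    by (cases "i < length vss") (auto simp: W_def c_def nth_or_Nil_def isum_Nil col_set_isum_cols)
  have ok: "thin_ok (col_set (c i))" for i
    by (cases i) (simp_all add: c0 cS W_def thin_ok_isum thin_ok_psum)
  have chk': "hom_check rows (c i) (c (Suc i)) (nth_or_Nil Cs i) \<and>
       exact_check (if i = 0 then [] else c (i - 1)) (c i) (c (Suc i)) (nth_or_Nil Cs (i - 1)) (nth_or_Nil Cs i)
        (nth_or_Nil Hs (i - 1)) (nth_or_Nil Hs i) \<and>
       (i = 0 \<or> minimal_check (nth_or_Nil vss (i - 1)) (c (Suc i)) (nth_or_Nil Cs i))" for i
  proof (cases "i < Suc (length vss)")
    case True
    then have "i \<in> set [0..<Suc (length vss)]" by (simp del: upt_Suc)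
    then show ?thesis
      using chk unfolding coresolution_check_def Let_def c_def[symmetric] list_all_iff by blast
  next
    case False
    then have "\<not> i - 1 < length vss" by linarith
    then have "nth_or_Nil vss (i - 1) = []" unfolding nth_or_Nil_def by (rule if_not_P)
    moreover from False have "c i = []" by (simp add: c_def nth_or_Nil_def)
    ultimately show ?thesis by simp
  qed
  have hom: "thin_map (col_set (c i)) (col_set (c (Suc i))) (entry (nth_or_Nil Cs i)) \<in>
      rmod_hom B (thin (col_set (c i))) (thin (col_set (c (Suc i))))" for i
    using hom_check_sound[OF _ ok] chk' by blast
  have exact: "thin_map (col_set (c i)) (col_set (c (Suc i))) (entry (nth_or_Nil Cs i)) ` carrier (thin (col_set (c i))) =
      rmod_ker (thin (col_set (c (Suc i)))) (thin (col_set (c (Suc (Suc i)))))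
        (thin_map (col_set (c (Suc i))) (col_set (c (Suc (Suc i)))) (entry (nth_or_Nil Cs (Suc i))))" for i
    by (rule exact_check_sound[OF _ ok ok ok]) (use chk'[of "Suc i"] in auto)
  have inj: "inj_on (thin_map (col_set (c 0)) (col_set (c (Suc 0))) (entry (nth_or_Nil Cs 0))) (carrier (thin (col_set (c 0))))"
  proof -
    have e: "exact_check [] (c 0) (c (Suc 0)) (nth_or_Nil Cs 0) (nth_or_Nil Cs 0) (nth_or_Nil Hs 0) (nth_or_Nil Hs 0)"
      using chk'[of 0] by simp
    have "rmod_ker (thin (col_set (c 0))) (thin (col_set (c (Suc 0))))
        (thin_map (col_set (c 0)) (col_set (c (Suc 0))) (entry (nth_or_Nil Cs 0))) \<subseteq> {\<zero>\<^bsub>thin (col_set (c 0))\<^esub>}"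
      by (subst exact_check_sound[OF e _ ok ok, symmetric])
        (auto simp: thin_map_def thin_simps fun_eq_iff thin_ok_empty)
    then show ?thesis
      unfolding rmod_hom_inj_iff[OF thin_right_module[OF ok] thin_right_module[OF ok] hom]
      by (auto simp: rmod_ker_def)
  qed
  have S_rows: "S \<subseteq> {..<length rows} \<times> UNIV" by (auto simp: mem_S_iff)
  note reg = regular_iso[OF S_rows, folded c0]
  have u: "u = (\<lambda>x. thin_map (col_set (c 0)) (col_set (c (Suc 0))) (entry (nth_or_Nil Cs 0)) (co x))"
    by (simp add: u_def c0 cS)
  have d: "d = (\<lambda>i. thin_map (col_set (c (Suc i))) (col_set (c (Suc (Suc i)))) (entry (nth_or_Nil Cs (Suc i))))"
    by (simp add: d_def cS)
  show "u \<in> rmod_hom B (regular_right_module B) (thin (W 0))"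
    unfolding u cS[symmetric] by (rule rmod_hom_comp[OF reg(1) hom])
  show "inj_on u (carrier (regular_right_module B))"
    unfolding u
  proof (rule inj_onI)
    fix x y
    assume x: "x \<in> carrier (regular_right_module B)" and y: "y \<in> carrier (regular_right_module B)"
      and eq: "thin_map (col_set (c 0)) (col_set (c (Suc 0))) (entry (nth_or_Nil Cs 0)) (co x) =
        thin_map (col_set (c 0)) (col_set (c (Suc 0))) (entry (nth_or_Nil Cs 0)) (co y)"
    have "co x \<in> carrier (thin (col_set (c 0)))" "co y \<in> carrier (thin (col_set (c 0)))"
      by (intro bij_betw_apply[OF reg(2)] x y)+
    then have "co x = co y" using inj eq unfolding inj_on_def by blast
    then show "x = y" by (rule inj_onD[OF bij_betw_imp_inj_on[OF reg(2)]]) (fact x y)+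
  qed
  show dh: "d i \<in> rmod_hom B (thin (W i)) (thin (W (Suc i)))"
    unfolding d cS[symmetric] by (rule hom)
  have "u ` carrier (regular_right_module B) =
      thin_map (col_set (c 0)) (col_set (c (Suc 0))) (entry (nth_or_Nil Cs 0)) ` carrier (thin (col_set (c 0)))"
    unfolding u using reg(2) by (simp add: bij_betw_def image_image[symmetric])
  then show "u ` carrier (regular_right_module B) = rmod_ker (thin (W 0)) (thin (W 1)) (d 0)"
    using exact[of 0] by (simp add: d cS)
  show "d i ` carrier (thin (W i)) = rmod_ker (thin (W (Suc i))) (thin (W (Suc (Suc i)))) (d (Suc i))"
    using exact[of "Suc i"] by (simp add: d cS)
  have min: "entry (nth_or_Nil Cs (Suc i)) n m = 0"
    if "n < length (nth_or_Nil vss i)" "(m, nth_or_Nil vss i ! n) \<in> isum (nth_or_Nil vss (Suc i))" for n m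
    using chk'[of "Suc i"] that cS[of "Suc i", unfolded W_def, symmetric]
    by (simp add: minimal_check_def list_all_iff col_set_def)
  show "essential_in B (thin (W i)) (rmod_ker (thin (W i)) (thin (W (Suc i))) (d i))"
    using thin_kernel_essential[OF tri thin_ok_isum dh[unfolded d_def W_def] min]
    by (simp add: d_def W_def)
qed

end

end

section \<open>Transport of coresolutions along isomorphisms\<close>

lemma iso_ker:
  assumes M: "right_module R M" and f: "f \<in> rmod_hom R M N" and b: "bij_betw f (carrier M) (carrier N)"
  shows "f ` rmod_ker M L h = rmod_ker N L (\<lambda>x. h (inv_into (carrier M) f x))"
proof -
  let ?g = "inv_into (carrier M) f"
  note g = rmod_hom_inverse[OF M f b]
  have "f x \<in> rmod_ker N L (\<lambda>x. h (?g x))" if "x \<in> rmod_ker M L h" for x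
    using that rmod_homD(1)[OF f] bij_betw_inv_into_left[OF b] by (auto simp: rmod_ker_def)
  moreover have "x \<in> f ` rmod_ker M L h" if "x \<in> rmod_ker N L (\<lambda>x. h (?g x))" for x
    using that rmod_homD(1)[OF g(1)] bij_betw_inv_into_right[OF b]
    by (intro image_eqI[of _ _ "?g x"]) (auto simp: rmod_ker_def)
  ultimately show ?thesis by auto
qed

lemma essential_in_iso:
  assumes M: "right_module R M" and N: "right_module R N" and f: "f \<in> rmod_hom R M N"
    and b: "bij_betw f (carrier M) (carrier N)" and e: "essential_in R M K"
  shows "essential_in R N (f ` K)"
proof -
  interpret M: right_module R M by fact
  have K: "submodule K R M" using e by (simp add: essential_in_def)
  have inj: "inj_on f (carrier M)" using b by (simp add: bij_betw_def)
  show ?thesis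
    unfolding essential_in_def
  proof (intro conjI allI impI; (elim conjE)?)
    show "submodule (f ` K) R N" by (rule rmod_image_submodule[OF M N f K])
    fix L assume L: "submodule L R N" "L \<noteq> {\<zero>\<^bsub>N\<^esub>}"
    note D = submoduleD'[OF L(1)]
    let ?L = "{x \<in> carrier M. f x \<in> L}"
    have "submodule ?L R M"
      using D rmod_homD[OF f] rmod_hom_zero[OF M N f] by (intro submoduleI' M) (auto simp: M.r_smult_closed)
    moreover have "?L \<noteq> {\<zero>\<^bsub>M\<^esub>}"
    proof
      assume z: "?L = {\<zero>\<^bsub>M\<^esub>}"
      obtain y where y: "y \<in> L" "y \<noteq> \<zero>\<^bsub>N\<^esub>" using L(2) D(2) by blast
      then obtain x where "x \<in> carrier M" "y = f x" using D(1) b by (auto simp: bij_betw_def)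
      then have "x = \<zero>\<^bsub>M\<^esub>" using y z by blast
      with y \<open>y = f x\<close> rmod_hom_zero[OF M N f] show False by simp
    qed
    ultimately have "K \<inter> ?L \<noteq> {\<zero>\<^bsub>M\<^esub>}" using e by (simp add: essential_in_def)
    moreover have "\<zero>\<^bsub>M\<^esub> \<in> K \<inter> ?L"
      using submoduleD'(2)[OF K] D(2) rmod_hom_zero[OF M N f] by simp
    ultimately obtain x where x: "x \<in> K" "x \<in> ?L" "x \<noteq> \<zero>\<^bsub>M\<^esub>" by blast
    then have "f x \<noteq> \<zero>\<^bsub>N\<^esub>" using rmod_hom_eq_zero_iff[OF M N f inj, of x] by simp
    with x show "f ` K \<inter> L \<noteq> {\<zero>\<^bsub>N\<^esub>}" by blast
  qed
qed

text \<open>Minimality is assumed for kernels, the form delivered by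
  \<open>thin_kernel_essential\<close>; by exactness these are the images required in the
  definition.\<close>

lemma minimal_coresolution_copy:
  fixes R :: "('a, 'r) ring_scheme" and Q :: "nat \<Rightarrow> ('a, 'm) module"
  assumes M: "right_module R M" and Q: "\<And>i. injective_rmod R (Q i)"
    and u: "u \<in> rmod_hom R M (Q 0)" "inj_on u (carrier M)" "u ` carrier M = rmod_ker (Q 0) (Q 1) (d 0)"
    and d: "\<And>i. d i \<in> rmod_hom R (Q i) (Q (Suc i))"
    and ex: "\<And>i. d i ` carrier (Q i) = rmod_ker (Q (Suc i)) (Q (Suc (Suc i))) (d (Suc i))"
    and ess: "\<And>i. essential_in R (Q i) (rmod_ker (Q i) (Q (Suc i)) (d i))"
  obtains E :: "nat \<Rightarrow> 'a rmod" and d' u' f where "minimal_injective_coresolution R M E d' u'"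
    "\<And>i. f i \<in> rmod_hom R (Q i) (E i)" "\<And>i. bij_betw (f i) (carrier (Q i)) (carrier (E i))"
proof -
  have Qr: "right_module R (Q i)" for i using Q by (rule injective_rmodD)
  have "\<exists>(N :: 'a rmod) f. fg_right_module R N \<and> f \<in> rmod_hom R (Q i) N \<and> bij_betw f (carrier (Q i)) (carrier N)" for i
    by (rule fg_right_module_isomorphic_copy) (rule injective_rmodD[OF Q])
  then obtain E :: "nat \<Rightarrow> 'a rmod" and f where E: "\<And>i. fg_right_module R (E i)"
    and f: "\<And>i. f i \<in> rmod_hom R (Q i) (E i)" and b: "\<And>i. bij_betw (f i) (carrier (Q i)) (carrier (E i))"
    by metis
  define g where "g i = inv_into (carrier (Q i)) (f i)" for i
  have g: "g i \<in> rmod_hom R (E i) (Q i)" "bij_betw (g i) (carrier (E i)) (carrier (Q i))" for i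
    unfolding g_def using rmod_hom_inverse[OF Qr f b] by auto
  have Er: "right_module R (E i)" for i using E by (rule fg_right_moduleD)
  have inj: "injective_rmod R (E i)" for i by (rule injective_rmod_iso[OF Q Er f b])
  have gim: "g i ` carrier (E i) = carrier (Q i)" for i using g(2) by (simp add: bij_betw_def)
  have finj: "inj_on (f i) (carrier (Q i))" for i using b by (simp add: bij_betw_def)
  have fz: "f i x = \<zero>\<^bsub>E i\<^esub> \<longleftrightarrow> x = \<zero>\<^bsub>Q i\<^esub>" if "x \<in> carrier (Q i)" for i x
    by (rule rmod_hom_eq_zero_iff[OF Qr Er f finj that])
  let ?d = "\<lambda>i x. f (Suc i) (d i (g i x))"
  have ker: "rmod_ker (E i) (E (Suc i)) (?d i) = f i ` rmod_ker (Q i) (Q (Suc i)) (d i)" for i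
  proof -
    have "rmod_ker (E i) (E (Suc i)) (?d i) = rmod_ker (E i) (Q (Suc i)) (\<lambda>x. d i (g i x))"
      unfolding rmod_ker_def
      by (intro Collect_cong conj_cong refl fz rmod_homD(1)[OF d] rmod_homD(1)[OF g(1)])
    then show ?thesis unfolding iso_ker[OF Qr f b] g_def .
  qed
  have im: "?d i ` carrier (E i) = f (Suc i) ` d i ` carrier (Q i)" for i
    by (simp add: gim[symmetric] image_image)
  have "minimal_injective_coresolution R M E ?d (\<lambda>x. f 0 (u x))"
    unfolding minimal_injective_coresolution_def
  proof (intro conjI allI inj)
    show "(\<lambda>x. f 0 (u x)) \<in> rmod_hom R M (E 0)" by (rule rmod_hom_comp[OF u(1) f])
    show "?d i \<in> rmod_hom R (E i) (E (Suc i))" for i by (rule rmod_hom_comp[OF rmod_hom_comp[OF g(1) d] f])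
    show "inj_on (\<lambda>x. f 0 (u x)) (carrier M)"
    proof (rule inj_onI)
      fix x y assume xy: "x \<in> carrier M" "y \<in> carrier M" "f 0 (u x) = f 0 (u y)"
      have "u x = u y" by (rule inj_onD[OF finj xy(3)]) (intro rmod_homD(1)[OF u(1)] xy)+
      then show "x = y" by (rule inj_onD[OF u(2)]) (fact xy)+
    qed
    have im0: "(\<lambda>x. f 0 (u x)) ` carrier M = f 0 ` rmod_ker (Q 0) (Q 1) (d 0)"
      by (simp add: image_image[of "f 0" u, symmetric] u(3))
    then show "(\<lambda>x. f 0 (u x)) ` carrier M = rmod_ker (E 0) (E 1) (?d 0)" using ker[of 0] by simp
    show "essential_in R (E 0) ((\<lambda>x. f 0 (u x)) ` carrier M)"
      unfolding im0 using essential_in_iso[OF Qr Er f b ess, of 0] by simp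
    show "?d i ` carrier (E i) = rmod_ker (E (Suc i)) (E (Suc (Suc i))) (?d (Suc i))" for i
      using im[of i] ex[of i] ker[of "Suc i"] by simp
    show "essential_in R (E (Suc i)) (?d i ` carrier (E i))" for i
      unfolding im ex by (rule essential_in_iso[OF Qr Er f b ess])
  qed
  then show thesis using that f b by blast
qed

section \<open>The coresolution and the resolutions of the example\<close>

text \<open>
  Lists are indexed from 0, so the vertices \<open>1, \<dots>, 9\<close> are preceded by a dummy entry. Likewise the first
  matrix in \<open>ex_maps\<close> describes the map from the regular module, which is the direct sum of the \<open>P(v)\<close>
  with a zero summand at index 0.
\<close>

definition ex_rows :: "nat list list" where
  "ex_rows = [[], [1,3,5,9], [2,3,4,5,6,7,8], [3,5,6,7,8,9], [4,5,6,8], [5,6,8,9], [6,8], [7,8], [8], [9]]"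

definition ex_cols :: "nat list list" where
  "ex_cols = [[], [1], [2], [1,2,3], [2,4], [1,2,3,4,5], [2,3,4,5,6], [2,3,7], [2,3,4,5,6,7,8], [1,3,5,9]]"

definition ex_terms :: "nat list list" where
  "ex_terms = [[9,8,8,9,8,8,9,8,8,8,9], [5,7,5,7,5,7,6,6,7,5], [2,3,3,4], [1]]"

text \<open>The minimal coresolutions of P(1), ..., P(9) stand side by side in this order: term 0
  begins with I(9) for P(1), I(8) for P(2), and I(8) and I(9) for P(3).\<close>

definition ex_maps :: "(nat \<times> int) list list list" where
  "ex_maps = [[[], [(0,1)], [(1,1)], [(2,1), (3,1)], [(4,1)], [(5,1), (6,1)], [(7,1)], [(8,1)], [(9,1)], [(10,1)]],
    [[], [], [(0,1)], [(0,-1)], [(1,1)], [(2,1), (3,1)], [(2,-1)], [(4,1), (5,1)], [(6,1)], [(7,1), (8,1)], [(9,1)]],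
    [[], [], [(0,1)], [(0,-1)], [(1,1)], [(1,-1)], [], [(2,1)], [(2,-1)], [(3,1)]],
    [[], [], [(0,1)]]]"

text \<open>Position i holds, for each vertex, a matrix leading backwards against the matrix i of
  \<open>ex_maps\<close>.\<close>

definition ex_homotopies :: "(nat \<times> int) list list list list" where
  "ex_homotopies = [[[],
     [[(1,1)]],
     [[], [(2,1)]],
     [[(1,1)], [(2,1)], [(3,1)]],
     [[], [(2,1)], [], [], [(4,1)]],
     [[(1,1)], [(2,1)], [(3,1)], [], [(4,1)], [(5,1)]],
     [[], [(2,1)], [(3,1)], [], [(4,1)], [(5,1)], [], [(6,1)]],
     [[], [(2,1)], [(3,1)], [], [], [], [], [], [(7,1)]],
     [[], [(2,1)], [(3,1)], [], [(4,1)], [(5,1)], [], [(6,1)], [(7,1)], [(8,1)]],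
     [[(1,1)], [], [], [(3,1)], [], [], [(5,1)], [], [], [], [(9,1)]]],
    [[],
     [[(3,-1)], [], [(6,-1)], [], [], [], [], [], [], [(10,1)]],
     [[(2,1)], [(4,1)], [(5,1)], [], [(7,1)], [], [(8,1)], [(9,1)]],
     [[(3,-1)], [(4,1)], [(6,-1)], [(5,1), (6,1)], [(7,1)], [], [(8,1)], [(9,1)], [], [(10,1)]],
     [[(2,1)], [], [(5,1)], [], [(7,1)], [], [(8,1)], [(9,1)]],
     [[(3,-1)], [], [(6,-1)], [], [(7,1)], [], [(8,1)], [(9,1)], [], [(10,1)]],
     [[], [], [], [], [], [], [(8,1)], [(9,1)]],
     [[], [(4,1)], [], [(5,1)], [], [(7,1)], [], [], [(9,1)]]],
    [[],
     [[], [(4,1)]],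
     [[(3,-1)], [(5,-1)], [(8,-1)], [(9,1)]],
     [[], [(5,-1)], [(8,-1)]],
     [[], [], [], [(9,1)]]],
    [[],
     [[(2,1)]]]]"

text \<open>Row 2 and column 8 of the support both consist of 2, ..., 8: I(8) is P(2).\<close>

lemma resolution_8: "resolution_check ex_rows 8 [[2]]
    [[[(0,1)]]]
    [[[],
     [],
     [[(0,1)]],
     [[(0,1)]],
     [[(0,1)]],
     [[(0,1)]],
     [[(0,1)]],
     [[(0,1)]],
     [[(0,1)]]]]"
  by code_simp

text \<open>Likewise I(9) is P(1), with vertices 1, 3, 5, 9.\<close>

lemma resolution_9: "resolution_check ex_rows 9 [[1]]
    [[[(0,1)]]]
    [[[],
     [[(0,1)]],
     [],
     [[(0,1)]],
     [],
     [[(0,1)]],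
     [],
     [],
     [],
     [[(0,1)]]]]"
  by code_simp

text \<open>P(3) maps diagonally to P(2) and P(1), by left multiplication with b and a; the opposite
  signs in the augmentation kill the diagonal.\<close>

lemma resolution_5: "resolution_check ex_rows 5 [[2,1], [3]]
    [[[(0,1)], [(0,-1)]], [[(0,1), (1,1)]]]
    [[[],
     [[(1,-1)]],
     [[(0,1)]],
     [[(1,-1)]],
     [[(0,1)]],
     [[(1,-1)]]],
    [[],
     [],
     [],
     [[(0,1)]],
     [],
     [[(0,1)]],
     [[(0,1)]],
     [[(0,1)]],
     [[(0,1)]],
     [[], [(0,1)]]]]"
  by code_simp

text \<open>The kernel of P(2) over I(6) has the vertices 7 and 8 and is P(7).\<close>

lemma resolution_6: "resolution_check ex_rows 6 [[2], [7]]
    [[[(0,1)]], [[(0,1)]]]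
    [[[],
     [],
     [[(0,1)]],
     [[(0,1)]],
     [[(0,1)]],
     [[(0,1)]],
     [[(0,1)]]],
    [[],
     [],
     [],
     [],
     [],
     [],
     [],
     [[(0,1)]],
     [[(0,1)]]]]"
  by code_simp

text \<open>The kernel of P(2) over I(7) has the vertices 4, 5, 6, 8 and is P(4).\<close>

lemma resolution_7: "resolution_check ex_rows 7 [[2], [4]]
    [[[(0,1)]], [[(0,1)]]]
    [[[],
     [],
     [[(0,1)]],
     [[(0,1)]],
     [],
     [],
     [],
     [[(0,1)]]],
    [[],
     [],
     [],
     [],
     [[(0,1)]],
     [[(0,1)]],
     [[(0,1)]],
     [],
     [[(0,1)]]]]"
  by code_simp

text \<open>I(2) is simple. The radical of P(2) is covered by P(3) and P(4), which overlap in P(5)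
  because bd = cf.\<close>

lemma resolution_2: "resolution_check ex_rows 2 [[2], [3,4], [5]]
    [[[(0,1)]], [[(0,1)], [(0,-1)]], [[(0,1), (1,1)]]]
    [[[],
     [],
     [[(0,1)]]],
    [[],
     [],
     [],
     [[(0,1)]],
     [[(1,-1)]],
     [[(1,-1)]],
     [[(1,-1)]],
     [[(0,1)]],
     [[(1,-1)]]],
    [[],
     [],
     [],
     [],
     [],
     [[(0,1)]],
     [[(0,1)]],
     [],
     [[(0,1)]],
     [[(0,1)]]]]"
  by code_simp

text \<open>P(6) is embedded by dg and fg: adg = 0 removes the component in P(1), and bdg = cfg
  cancels the one in P(2).\<close>

lemma resolution_3: "resolution_check ex_rows 3 [[1,2], [3,4], [6]]
    [[[(0,1)], [(0,-1)]], [[(0,1), (1,1)], [(1,-1)]], [[(0,1), (1,1)]]]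
    [[[],
     [[(0,1)]],
     [[(1,-1)]],
     [[(1,-1)]]],
    [[],
     [],
     [],
     [[(0,1)]],
     [[], [(1,-1)]],
     [[(0,1), (1,1)], [(1,-1)]],
     [[], [(1,-1)]],
     [[], [(0,1)]],
     [[], [(1,-1)]],
     [[(0,1)]]],
    [[],
     [],
     [],
     [],
     [],
     [],
     [[(0,1)]],
     [],
     [[(0,1)]]]]"
  by code_simp

text \<open>Left multiplication by b is not injective on P(3): since bdh = 0, its kernel is
  P(9).\<close>

lemma resolution_4: "resolution_check ex_rows 4 [[2], [3], [9]]
    [[[(0,1)]], [[(0,1)]], [[(0,1)]]]
    [[[],
     [],
     [[(0,1)]],
     [],
     [[(0,1)]]],
    [[],
     [],
     [],
     [[(0,1)]],
     [],
     [[(0,1)]],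
     [[(0,1)]],
     [[(0,1)]],
     [[(0,1)]]],
    [[],
     [],
     [],
     [],
     [],
     [],
     [],
     [],
     [],
     [[(0,1)]]]]"
  by code_simp

text \<open>Since adg = 0 and ae = 0, the kernel of left multiplication by a on P(3) is covered by
  P(6) and P(7), which overlap in P(8) because ej = dgi.\<close>

lemma resolution_1: "resolution_check ex_rows 1 [[1], [3], [6,7], [8]]
    [[[(0,1)]], [[(0,1)]], [[(0,1)], [(0,-1)]], [[(0,1), (1,1)]]]
    [[[],
     [[(0,1)]]],
    [[],
     [],
     [],
     [[(0,1)]],
     [],
     [[(0,1)]],
     [],
     [],
     [],
     [[(0,1)]]],
    [[],
     [],
     [],
     [],
     [],
     [],
     [[(0,1)]],
     [[(1,-1)]],
     [[(1,-1)]]],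
    [[],
     [],
     [],
     [],
     [],
     [],
     [],
     [],
     [[(0,1)]]]]"
  by code_simp

lemma ex_coresolution: "coresolution_check ex_rows ex_terms ex_maps ex_homotopies"
  by code_simp

text \<open>Rows and columns are exchanged. I(7) now has the vertices 7 and 8, and the kernel of its
  cover P(8) has the vertices 2, ..., 6 and is P(6).\<close>

lemma opposite_resolution_7: "resolution_check ex_cols 7 [[8], [6]]
    [[[(0,1)]], [[(0,1)]]]
    [[[],
     [],
     [],
     [],
     [],
     [],
     [],
     [[(0,1)]],
     [[(0,1)]]],
    [[],
     [],
     [[(0,1)]],
     [[(0,1)]],
     [[(0,1)]],
     [[(0,1)]],
     [[(0,1)]]]]"
  by code_simp

section \<open>Lower bounds for projective dimensions; indecomposable injectives\<close>

context coord_algebra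
begin

text \<open>
  If \<open>I(v)\<close> is a direct summand of the term \<open>m + 1\<close> killed by the differential, and \<open>Hom(I(v), -)\<close> vanishes
  on the term \<open>m\<close>, then \<open>Ext\<^sup>m\<^sup>+\<^sup>1(I(v), B)\<close> is nonzero.
\<close>

lemma not_projdim_le_isum:
  fixes vss :: "nat list list" and D :: "nat \<Rightarrow> nat \<Rightarrow> nat \<Rightarrow> int"
  defines "W \<equiv> \<lambda>i. isum (nth_or_Nil vss i)"
  assumes hom: "\<And>i. thin_map (W i) (W (Suc i)) (D i) \<in> rmod_hom B (thin (W i)) (thin (W (Suc i)))"
    and exact: "\<And>i. thin_map (W i) (W (Suc i)) (D i) ` carrier (thin (W i)) =
      rmod_ker (thin (W (Suc i))) (thin (W (Suc (Suc i)))) (thin_map (W (Suc i)) (W (Suc (Suc i))) (D (Suc i)))"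
    and v: "v \<in> V" and n0: "n0 < length (nth_or_Nil vss (Suc m))" "nth_or_Nil vss (Suc m) ! n0 = v"
    and row: "\<And>k. D (Suc m) n0 k = 0" and sep: "\<And>w. w \<in> set (nth_or_Nil vss m) \<Longrightarrow> (w, v) \<notin> S"
  shows "\<not> projdim_le B m (thin (isum [v]))"
proof
  let ?I = "thin (isum [v])" and ?d = "\<lambda>i. thin_map (W i) (W (Suc i)) (D i)"
  assume pd: "projdim_le B m ?I"
  have I: "right_module B ?I" by (rule thin_right_module[OF thin_ok_isum])
  have vv: "(v, v) \<in> S" by (rule S_refl[OF v])
  \<comment> \<open>The inclusion of I(v) as the summand \<open>n0\<close>; by \<open>row\<close>
    its image consists of cycles.\<close>
  define f where "f = thin_map (isum [v]) (W (Suc m)) (\<lambda>n m. if n = 0 \<and> m = n0 then 1 else 0)"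
  have f: "f \<in> rmod_hom B ?I (thin (W (Suc m)))"
    unfolding f_def
    by (rule thin_map_hom[OF thin_ok_isum]) (use n0 in \<open>auto simp: isum_def W_def split: if_splits\<close>)
  have fx: "f x n k = 0" if "n \<noteq> n0" for x n k
    using that by (simp add: f_def thin_map_def)
  have "?d (Suc m) (f x) = \<zero>\<^bsub>thin (W (Suc (Suc m)))\<^esub>" for x
  proof -
    have "of_int (D (Suc m) n q) * f x n k = 0" for n q k
      using row fx[of n x k] by (cases "n = n0") auto
    then show ?thesis by (simp only: thin_map_def thin_simps(2) sum.neutral_const if_cancel)
  qed
  then obtain g where g: "g \<in> rmod_hom B ?I (thin (W m))" "\<And>x. x \<in> carrier ?I \<Longrightarrow> ?d m (g x) = f x"
    using projdim_le_lift[of B "\<lambda>i. thin (W i)" ?d, OF _ hom exact I pd f] thin_injective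
    unfolding W_def by blast
  let ?x = "unit_fun 0 v :: nat \<Rightarrow> nat \<Rightarrow> 'k"
  have x: "?x \<in> carrier ?I" using vv by (intro unit_fun_closed) (simp add: isum_def)
  have gx: "g ?x \<in> carrier (thin (W m))" by (rule rmod_homD(1)[OF g(1) x])
  have "g ?x n k = 0" for n k
  proof (cases "(n, k) \<in> W m")
    case True
    let ?w = "nth_or_Nil vss m ! n"
    have n: "n < length (nth_or_Nil vss m)" "(k, ?w) \<in> S" using True by (auto simp: W_def isum_def)
    \<comment> \<open>By \<open>sep\<close> this unit annihilates the socle generator of I(v),
      whereas it would move a nonzero component of the image to the socle vertex of its
      summand.\<close>
    have "bs k ?w \<odot>\<^bsub>?I\<^esub> ?x = \<zero>\<^bsub>?I\<^esub>"
      using smult_bs_thin[OF x, of k ?w] sep[of ?w] n(1) by (auto simp: fun_eq_iff isum_singleton thin_simps(2))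
    then have "bs k ?w \<odot>\<^bsub>thin (W m)\<^esub> g ?x = \<zero>\<^bsub>thin (W m)\<^esub>"
      using rmod_homD(3)[OF g(1) bs_closed x, of k ?w] rmod_hom_zero[OF I _ g(1)] thin_right_module[OF thin_ok_isum]
      by (simp add: W_def)
    moreover have "(n, ?w) \<in> W m" using n S_refl S_vertices(2) by (auto simp: W_def isum_def)
    ultimately show ?thesis using smult_bs_thin[OF gx, of k ?w n ?w] n(2) by (simp add: thin_simps(2))
  next
    case False
    then show ?thesis using gx by (simp add: thin_simps(1))
  qed
  then have "?d m (g ?x) = (\<lambda>_ _. 0)" by (simp add: thin_map_def fun_eq_iff)
  then have "f ?x = (\<lambda>_ _. 0)" using g(2)[OF x] by simp
  moreover have "f ?x n0 v = 1"
  proof -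
    have "{n. (n, v) \<in> isum [v]} = {0}" using vv by (auto simp: isum_singleton)
    moreover have "(n0, v) \<in> W (Suc m)" using n0 vv by (simp add: W_def isum_def)
    ultimately show ?thesis by (simp add: f_def thin_map_def unit_fun_def)
  qed
  ultimately show False by simp
qed

text \<open>The injective envelope I(v) of a simple submodule splits off, and indecomposability
  leaves no room for a complement.\<close>

lemma indecomposable_injective:
  fixes X :: "('a, 'm) module"
  assumes X: "injective_rmod B X" "indecomposable B X" and tri: "\<And>i k. (i, k) \<in> S \<Longrightarrow> i \<le> k"
  obtains v j s where "socle_at X v s" "j \<in> rmod_hom B (thin (isum [v])) X"
    "bij_betw j (carrier (thin (isum [v]))) (carrier X)"
proof -
  note Xr = injective_rmodD(2)[OF X(1)]
  obtain v s where s: "socle_at X v s"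
    using socle_exists[OF Xr _ tri] X(2) by (auto simp: indecomposable_def)
  then have s': "s \<noteq> \<zero>\<^bsub>X\<^esub>" "v \<in> V" by (auto simp: socle_at_def)
  show thesis
  proof (rule socle_splits[OF X(1) s])
    fix j Y
    let ?I = "carrier (thin (isum [v]))"
    assume j: "j \<in> rmod_hom B (thin (isum [v])) X" "inj_on j ?I"
      and d: "direct_decomposition B X (j ` ?I) Y" and js: "j (unit_fun 0 v) = s"
    have "unit_fun 0 v \<in> ?I" using S_refl[OF s'(2)] by (intro unit_fun_closed) (simp add: isum_singleton)
    then have "j ` ?I \<noteq> {\<zero>\<^bsub>X\<^esub>}" using js s'(1) by blast
    then have Y: "Y = {\<zero>\<^bsub>X\<^esub>}" using X(2) d unfolding indecomposable_def by blast
    interpret X: right_module B X by (rule Xr)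
    have "j ` ?I = carrier X"
    proof
      show "j ` ?I \<subseteq> carrier X" using rmod_homD(1)[OF j(1)] by auto
      show "carrier X \<subseteq> j ` ?I"
      proof
        fix x assume "x \<in> carrier X"
        then have "x \<in> j ` ?I <+>\<^bsub>X\<^esub> Y" using d by (simp add: direct_decomposition_def)
        then obtain y where "y \<in> j ` ?I" "x = y \<oplus>\<^bsub>X\<^esub> \<zero>\<^bsub>X\<^esub>" unfolding set_add_def' Y by blast
        then show "x \<in> j ` ?I" using rmod_homD(1)[OF j(1)] by auto
      qed
    qed
    then show thesis using that[OF s j(1)] j(2) by (simp add: bij_betw_def)
  qed
qed

end

section \<open>The algebra A\<close>

locale ex_coord_algebra = coord_algebra B \<eta> "{1..9}" "{(i, k). i < length ex_rows \<and> k \<in> set (ex_rows ! i)}" co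
  for B :: "('a, 'r) ring_scheme" (structure) and \<eta> :: "'k::field \<Rightarrow> 'a" and co
begin

abbreviation "SA \<equiv> {(i, k). i < length ex_rows \<and> k \<in> set (ex_rows ! i)}"

lemma rows_bound: "{1..9} \<subseteq> {..<length ex_rows}"
  by (auto simp: ex_rows_def)

lemma tri: "(i, k) \<in> SA \<Longrightarrow> i \<le> k"
proof -
  have "\<forall>i\<in>set [0..<length ex_rows]. \<forall>k\<in>set (ex_rows ! i). i \<le> k" by code_simp
  then show "(i, k) \<in> SA \<Longrightarrow> i \<le> k" by auto
qed

lemma projdim_le_level:
  assumes "v \<in> set (nth_or_Nil ex_terms i)"
  shows "projdim_le B i (thin (isum [v]))"
proof -
  \<comment> \<open>The support of the locale is spelled out through \<open>ex_rows\<close>, so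
    \<open>refl\<close> proves the premise on rows.\<close>
  note r = resolution_check_sound[OF refl rows_bound]
  have "i < 4" using assms by (auto simp: nth_or_Nil_def ex_terms_def split: if_splits)
  then consider "i = 0" | "i = 1" | "i = 2" | "i = 3" by linarith
  then show ?thesis
  proof cases
    case 1
    then have "v = 8 \<or> v = 9" using assms by (auto simp: nth_or_Nil_def ex_terms_def)
    then show ?thesis using r[OF resolution_8] r[OF resolution_9] 1 by auto
  next
    case 2
    then have "v = 5 \<or> v = 6 \<or> v = 7" using assms by (auto simp: nth_or_Nil_def ex_terms_def)
    then show ?thesis using r[OF resolution_5] r[OF resolution_6] r[OF resolution_7] 2 by auto
  next
    case 3
    then have "v = 2 \<or> v = 3 \<or> v = 4" using assms by (auto simp: nth_or_Nil_def ex_terms_def)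
    then show ?thesis using r[OF resolution_2] r[OF resolution_3] r[OF resolution_4] 3 by (auto simp: numeral_2_eq_2)
  next
    case 4
    then have "v = 1" using assms by (auto simp: nth_or_Nil_def ex_terms_def)
    then show ?thesis using r[OF resolution_1] 4 by (auto simp: numeral_3_eq_3)
  qed
qed

lemmas coresolution = coresolution_check_sound[OF refl rows_bound tri ex_coresolution]

lemma not_projdim_le_level:
  assumes "v \<in> set (nth_or_Nil ex_terms (Suc m))"
  shows "\<not> projdim_le B m (thin (isum [v]))"
proof -
  have row: "entry (nth_or_Nil ex_maps (Suc (Suc m))) n k = 0" if "nth_or_Nil (nth_or_Nil ex_maps (Suc (Suc m))) n = []" for n k
    using that by (simp add: entry_def)
  have lb: "\<not> projdim_le B m (thin (isum [v]))"
    if "n0 < length (nth_or_Nil ex_terms (Suc m))" "nth_or_Nil ex_terms (Suc m) ! n0 = v"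
      "nth_or_Nil (nth_or_Nil ex_maps (Suc (Suc m))) n0 = []"
      "\<forall>w\<in>set (nth_or_Nil ex_terms m). v \<notin> set (ex_rows ! w)" "v \<in> {1..9}" for n0
    by (rule not_projdim_le_isum[where vss = ex_terms and D = "\<lambda>i. entry (nth_or_Nil ex_maps (Suc i))" and ?n0.0 = n0])
      (use that coresolution(3,5) row in auto)
  have "Suc m < 4" using assms by (auto simp: nth_or_Nil_def ex_terms_def split: if_splits)
  then consider "m = 0" | "m = 1" | "m = 2" by linarith
  then show ?thesis
  proof cases
    case 1
    then have "v = 5 \<or> v = 6 \<or> v = 7" using assms by (auto simp: nth_or_Nil_def ex_terms_def)
    \<comment> \<open>The summands 0, 1, 6 of the term 1 end the coresolutions of P(3), P(4), P(7),
      so their rows in the next matrix are empty.\<close>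
    then show ?thesis using lb[of 0] lb[of 1] lb[of 6] 1
      by (auto simp: nth_or_Nil_def ex_terms_def ex_maps_def ex_rows_def)
  next
    case 2
    then have "v = 2 \<or> v = 3 \<or> v = 4" using assms by (auto simp: nth_or_Nil_def ex_terms_def)
    \<comment> \<open>These summands of the term 2 end the coresolutions of P(5), P(6),
      P(9).\<close>
    then show ?thesis using lb[of 0] lb[of 1] lb[of 3] 2
      by (auto simp: nth_or_Nil_def ex_terms_def ex_maps_def ex_rows_def)
  next
    case 3
    then have "v = 1" using assms by (auto simp: nth_or_Nil_def ex_terms_def)
    \<comment> \<open>The only summand of the term 3 comes from P(8).\<close>
    then show ?thesis using lb[of 0] 3
      by (auto simp: nth_or_Nil_def ex_terms_def ex_maps_def ex_rows_def)
  qed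
qed

text \<open>The summand is some I(v). Its socle is part of the socle of the whole term, so
  \<open>socle_at_isum\<close> places v among the listed vertices, for which both bounds are
  known.\<close>

lemma projdim_summand:
  fixes E :: "('a, 'm) module"
  assumes E: "right_module B E" and f: "f \<in> rmod_hom B (thin (isum (nth_or_Nil ex_terms i))) E"
    and b: "bij_betw f (carrier (thin (isum (nth_or_Nil ex_terms i)))) (carrier E)"
    and X: "indecomposable_summand B E X"
  shows "projdim B (E\<lparr>carrier := X\<rparr>) = enat i"
proof -
  let ?Q = "thin (isum (nth_or_Nil ex_terms i))" and ?X = "E\<lparr>carrier := X\<rparr>"
  have Q: "right_module B ?Q" by (rule thin_right_module[OF thin_ok_isum])
  note g = rmod_hom_inverse[OF Q f b]
  have injE: "injective_rmod B E" by (rule injective_rmod_iso[OF thin_injective E f b])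
  obtain Y where d: "direct_decomposition B E X Y" and ind: "indecomposable B ?X"
    using X by (auto simp: indecomposable_summand_def)
  have sub: "submodule X B E" using d by (simp add: direct_decomposition_def)
  have inj: "injective_rmod B ?X" by (rule direct_summand_injective[OF injE d])
  note Xr = injective_rmodD(2)[OF inj]
  show ?thesis
  proof (rule indecomposable_injective[OF inj ind tri])
    fix v s j
    assume s: "socle_at ?X v s" and j: "j \<in> rmod_hom B (thin (isum [v])) ?X"
      and bj: "bij_betw j (carrier (thin (isum [v]))) (carrier ?X)"
    have I: "right_module B (thin (isum [v]))" by (rule thin_right_module[OF thin_ok_isum])
    have "(\<lambda>x. x) \<in> rmod_hom B ?X E" using submoduleD'(1)[OF sub] by (auto simp: rmod_hom_def)
    then have "socle_at E v s" using socle_at_hom[OF Xr E _ inj_on_id2 s] by simp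
    then have soc: "socle_at ?Q v (inv_into (carrier ?Q) f s)"
      by (rule socle_at_hom[OF E Q g(1) bij_betw_imp_inj_on[OF g(2)]])
    then have "inv_into (carrier ?Q) f s \<noteq> (\<lambda>_ _. 0)" unfolding socle_at_def thin_simps(2) by (elim conjE)
    then obtain n k where "inv_into (carrier ?Q) f s n k \<noteq> 0" by (meson ext)
    from socle_at_isum(2)[OF soc this] have v: "v \<in> set (nth_or_Nil ex_terms i)"
      unfolding in_set_conv_nth by (intro exI[of _ n]) (elim conjE, intro conjI)
    note h = rmod_hom_inverse[OF I j bj]
    show ?thesis
    proof (rule projdim_eqI)
      show "projdim_le B i ?X" by (rule projdim_le_iso[OF I Xr j bj projdim_le_level[OF v]])
      fix m assume "i = Suc m"
      then show "\<not> projdim_le B m ?X"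
        using projdim_le_iso[OF Xr I h] not_projdim_le_level v by blast
    qed
  qed
qed

theorem diagonal_Auslander_regular: "diagonal_Auslander_regular \<eta> B"
proof -
  let ?M = "regular_right_module B"
  define Q where "Q i = thin (isum (nth_or_Nil ex_terms i))" for i
  have "\<exists>E d u. minimal_injective_coresolution B ?M E d u \<and>
      (\<forall>i X. indecomposable_summand B (E i) X \<longrightarrow> projdim B ((E i)\<lparr>carrier := X\<rparr>) = enat i)"
  proof (rule minimal_coresolution_copy[where M = ?M and Q = Q])
    show "right_module B ?M" by (rule regular_iso(3)[of "length ex_rows"]) auto
    show "injective_rmod B (Q i)" for i unfolding Q_def by (rule thin_injective)
    show "(\<lambda>x. thin_map (psum [0..<length ex_rows]) (isum (nth_or_Nil ex_terms 0)) (entry (nth_or_Nil ex_maps 0)) (co x))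
      \<in> rmod_hom B ?M (Q 0)" unfolding Q_def by (rule coresolution(1))
    show "inj_on (\<lambda>x. thin_map (psum [0..<length ex_rows]) (isum (nth_or_Nil ex_terms 0)) (entry (nth_or_Nil ex_maps 0)) (co x)) (carrier ?M)"
      by (rule coresolution(2))
    show "(\<lambda>x. thin_map (psum [0..<length ex_rows]) (isum (nth_or_Nil ex_terms 0)) (entry (nth_or_Nil ex_maps 0)) (co x)) ` carrier ?M =
      rmod_ker (Q 0) (Q 1) (thin_map (isum (nth_or_Nil ex_terms 0)) (isum (nth_or_Nil ex_terms (Suc 0))) (entry (nth_or_Nil ex_maps (Suc 0))))"
      unfolding Q_def by (rule coresolution(4))
    show "thin_map (isum (nth_or_Nil ex_terms i)) (isum (nth_or_Nil ex_terms (Suc i))) (entry (nth_or_Nil ex_maps (Suc i)))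
      \<in> rmod_hom B (Q i) (Q (Suc i))" for i unfolding Q_def by (rule coresolution(3))
    show "thin_map (isum (nth_or_Nil ex_terms i)) (isum (nth_or_Nil ex_terms (Suc i))) (entry (nth_or_Nil ex_maps (Suc i))) ` carrier (Q i) =
      rmod_ker (Q (Suc i)) (Q (Suc (Suc i)))
       (thin_map (isum (nth_or_Nil ex_terms (Suc i))) (isum (nth_or_Nil ex_terms (Suc (Suc i)))) (entry (nth_or_Nil ex_maps (Suc (Suc i)))))" for i
      unfolding Q_def by (rule coresolution(5))
    show "essential_in B (Q i) (rmod_ker (Q i) (Q (Suc i))
       (thin_map (isum (nth_or_Nil ex_terms i)) (isum (nth_or_Nil ex_terms (Suc i))) (entry (nth_or_Nil ex_maps (Suc i)))))" for i
      unfolding Q_def by (rule coresolution(6))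
    fix E :: "nat \<Rightarrow> 'a rmod" and d u f
    assume E: "minimal_injective_coresolution B ?M E d u"
      and f: "\<And>i. f i \<in> rmod_hom B (Q i) (E i)" "\<And>i. bij_betw (f i) (carrier (Q i)) (carrier (E i))"
    have "right_module B (E i)" for i
      using E unfolding minimal_injective_coresolution_def by (intro injective_rmodD(2)) (elim conjE allE, assumption)
    then have "projdim B ((E i)\<lparr>carrier := X\<rparr>) = enat i" if "indecomposable_summand B (E i) X" for i X
      using f[unfolded Q_def] that by (rule projdim_summand)
    then show ?thesis using E by blast
  qed
  then show ?thesis
    using fd_algebra gldim_finite[OF tri] unfolding diagonal_Auslander_regular_def by blast
qed

end

text \<open>Here \<open>y\<close> is divided by \<open>bs p v\<close>. The module
  \<open>thin W\<close> is a quotient of P(v) and a submodule of P(p); the map sending its generator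
  to \<open>y\<close> extends to P(p), and \<open>z\<close> is the image of the generator
  there.\<close>

lemma (in coord_algebra) extend_from_row:
  fixes X :: "('a, 'm) module"
  assumes X: "injective_rmod B X" and y: "y \<in> carrier X" "bs v v \<odot>\<^bsub>X\<^esub> y = y"
    and ok: "thin_ok W" "(0, v) \<in> W" and W: "W \<subseteq> {0} \<times> {k. (v, k) \<in> S}"
    and ann: "\<And>r. r \<in> carrier B \<Longrightarrow> (\<And>k. (0, k) \<in> W \<Longrightarrow> co r v k = 0) \<Longrightarrow> row_elt v (co r v) \<odot>\<^bsub>X\<^esub> y = \<zero>\<^bsub>X\<^esub>"
    and p: "p \<in> V" "W \<subseteq> psum [p]" "\<And>i k. (0, i) \<in> W \<Longrightarrow> (i, k) \<in> S \<Longrightarrow> (p, k) \<in> S \<Longrightarrow> (0, k) \<in> W"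
  obtains z where "z \<in> carrier X" "bs p v \<odot>\<^bsub>X\<^esub> z = y" "bs p p \<odot>\<^bsub>X\<^esub> z = z"
proof -
  note Xr = injective_rmodD(2)[OF X]
  let ?P = "thin (psum [p])"
  note g = hom_from_row[OF Xr y(1) ok(1) W ann]
  have inc: "(\<lambda>f. f) \<in> rmod_hom B (thin W) ?P"
    by (rule thin_inclusion[OF p(2)]) (use W p(3) in \<open>auto simp: psum_def\<close>)
  obtain h where h: "h \<in> rmod_hom B ?P X" "\<And>x. x \<in> carrier (thin W) \<Longrightarrow> h x = row_elt v (x 0) \<odot>\<^bsub>X\<^esub> y"
    using injective_rmod_extend[OF X thin_fg[OF ok(1)] thin_fg[OF thin_ok_psum] inc inj_on_id2 g] by blast
  have pp: "(0, p) \<in> psum [p]" using S_refl[OF p(1)] by (simp add: psum_def)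
  have vv: "(v, v) \<in> S" using W ok(2) by auto
  let ?u = "unit_fun 0 p :: nat \<Rightarrow> nat \<Rightarrow> 'k"
  note u = unit_fun_closed[OF pp]
  have eq: "bs p k \<odot>\<^bsub>?P\<^esub> ?u = unit_fun 0 k" if "(0, k) \<in> psum [p]" for k
  proof (intro ext)
    fix m j
    show "(bs p k \<odot>\<^bsub>?P\<^esub> ?u) m j = unit_fun 0 k m j"
      unfolding smult_bs_thin[OF u] using that by (auto simp: unit_fun_def psum_def)
  qed
  show thesis
  proof (rule that[of "h ?u"])
    show "h ?u \<in> carrier X" by (rule rmod_homD(1)[OF h(1) u])
    have "(0, v) \<in> psum [p]" using ok(2) p(2) by auto
    from eq[OF this] have "bs p v \<odot>\<^bsub>X\<^esub> h ?u = h (unit_fun 0 v)"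
      using rmod_homD(3)[OF h(1) bs_closed u, of p v] by simp
    also have "\<dots> = y" using h(2)[OF unit_fun_closed[OF ok(2)]] row_elt_unit[OF vv] y(2) by simp
    finally show "bs p v \<odot>\<^bsub>X\<^esub> h ?u = y" .
    show "bs p p \<odot>\<^bsub>X\<^esub> h ?u = h ?u"
      using rmod_homD(3)[OF h(1) bs_closed u, of p p] eq[OF pp] by simp
  qed
qed

section \<open>The opposite algebra\<close>

locale ex_op_coord_algebra = coord_algebra B \<eta> "{1..9}" "{(i, k). i < length ex_cols \<and> k \<in> set (ex_cols ! i)}" co
  for B :: "('a, 'r) ring_scheme" (structure) and \<eta> :: "'k::field \<Rightarrow> 'a" and co
begin

abbreviation "SB \<equiv> {(i, k). i < length ex_cols \<and> k \<in> set (ex_cols ! i)}"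

lemma cols_bound: "{1..9} \<subseteq> {..<length ex_cols}"
  by (auto simp: ex_cols_def)

lemma mem_SB:
  "(1, k) \<in> SB \<longleftrightarrow> k = 1" "(2, k) \<in> SB \<longleftrightarrow> k = 2" "(3, k) \<in> SB \<longleftrightarrow> k = 1 \<or> k = 2 \<or> k = 3"
  "(7, k) \<in> SB \<longleftrightarrow> k = 2 \<or> k = 3 \<or> k = 7"
  by (auto simp: ex_cols_def)

text \<open>
  The coresolution of the summand \<open>e\<^sub>1 B\<close> starts \<open>I(1) \<rightarrow> I(3) \<rightarrow> I(6) \<oplus> I(7)\<close>. The socle element of \<open>I(7)\<close>
  in the term 2 represents the class of \<open>0 \<rightarrow> P(1) \<rightarrow> P(3) \<rightarrow> P(7) \<rightarrow> S(7) \<rightarrow> 0\<close> in \<open>Ext\<^sup>2(S(7), B)\<close>.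
\<close>

lemma socle_in_second_term:
  fixes E :: "nat \<Rightarrow> 'a rmod"
  assumes E: "minimal_injective_coresolution B (regular_right_module B) E d u"
  obtains s where "socle_at (E 2) 7 s"
proof -
  let ?M = "regular_right_module B"
  have inj: "injective_rmod B (E i)" and u: "u \<in> rmod_hom B ?M (E 0)" "inj_on u (carrier ?M)"
    and d: "d i \<in> rmod_hom B (E i) (E (Suc i))"
    and ex0: "u ` carrier ?M = rmod_ker (E 0) (E 1) (d 0)"
    and ex: "d i ` carrier (E i) = rmod_ker (E (Suc i)) (E (Suc (Suc i))) (d (Suc i))" for i
    using E unfolding minimal_injective_coresolution_def by blast+
  note r = injective_rmodD(2)[OF inj]
  interpret E0: coord_module B \<eta> "{1..9}" SB co "E 0" by (rule coord_moduleI[OF r])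
  interpret E1: coord_module B \<eta> "{1..9}" SB co "E 1" by (rule coord_moduleI[OF r])
  interpret E2: coord_module B \<eta> "{1..9}" SB co "E 2" by (rule coord_moduleI[OF r])
  have M: "x \<in> carrier ?M \<longleftrightarrow> x \<in> carrier B" "t \<odot>\<^bsub>?M\<^esub> x = x \<otimes> t" for x t
    by (simp_all add: regular_right_module_def)
  have V: "v \<in> {1..9::nat}" if "v = 1 \<or> v = 3 \<or> v = 7" for v using that by auto
  have act_u: "t \<odot>\<^bsub>E 0\<^esub> u x = u (x \<otimes> t)" if "t \<in> carrier B" "x \<in> carrier B" for t x
    using rmod_homD(3)[OF u(1), of t x] that by (simp add: M)
  have act_d0: "t \<odot>\<^bsub>E 1\<^esub> d 0 x = d 0 (t \<odot>\<^bsub>E 0\<^esub> x)" if "t \<in> carrier B" "x \<in> carrier (E 0)" for t x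
    using rmod_homD(3)[OF d[of 0], of t x] that by simp
  have act_d1: "t \<odot>\<^bsub>E 2\<^esub> d 1 x = d 1 (t \<odot>\<^bsub>E 1\<^esub> x)" if "t \<in> carrier B" "x \<in> carrier (E 1)" for t x
    using rmod_homD(3)[OF d[of 1], of t x] that by (simp add: numeral_2_eq_2)
  have d0: "d 0 x \<in> carrier (E 1)" if "x \<in> carrier (E 0)" for x using rmod_homD(1)[OF d[of 0] that] by simp
  have d1: "d 1 x \<in> carrier (E 2)" if "x \<in> carrier (E 1)" for x
    using rmod_homD(1)[OF d[of 1]] that by (simp add: numeral_2_eq_2)
  \<comment> \<open>The generator of the summand P(1) of the algebra, which is simple because row 1
    is [1].\<close>
  define w where "w = u (bs 1 1)"
  have w: "w \<in> carrier (E 0)" using rmod_homD(1)[OF u(1), of "bs 1 1"] by (simp add: w_def M)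
  have w1: "bs 1 1 \<odot>\<^bsub>E 0\<^esub> w = w" unfolding w_def act_u[OF bs_closed bs_closed] bs_idem_right ..
  have dw: "d 0 w = \<zero>\<^bsub>E 1\<^esub>"
  proof -
    have "w \<in> u ` carrier ?M" unfolding w_def by (rule imageI) (simp add: M)
    then show ?thesis unfolding ex0 by (simp add: rmod_ker_def)
  qed
  \<comment> \<open>P(1) is a submodule of P(3), so \<open>w\<close> can be divided by
    \<open>bs 3 1\<close>.\<close>
  obtain z where z: "z \<in> carrier (E 0)" "bs 3 1 \<odot>\<^bsub>E 0\<^esub> z = w" "bs 3 3 \<odot>\<^bsub>E 0\<^esub> z = z"
  proof (rule extend_from_row[OF inj w w1 thin_ok_singleton[of 1], of 3])
    fix t assume t: "t \<in> carrier B" "\<And>k. (0, k) \<in> {(0, 1)} \<Longrightarrow> co t 1 k = 0"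
    have "row_elt 1 (co t 1) = \<zero>"
    proof (rule co_eqI)
      fix i k assume "(i, k) \<in> SB"
      then show "co (row_elt 1 (co t 1)) i k = co \<zero> i k"
        using t(2)[of 1] mem_SB(1)[of k] by (auto simp: row_elt co_zero)
    qed (simp_all add: row_elt)
    then show "row_elt 1 (co t 1) \<odot>\<^bsub>E 0\<^esub> w = \<zero>\<^bsub>E 0\<^esub>" using w by (simp add: E0.smult_zero_left)
  qed (use V mem_SB in \<open>auto simp: psum_def\<close>)
  define y where "y = d 0 z"
  have y: "y \<in> carrier (E 1)" "bs 3 3 \<odot>\<^bsub>E 1\<^esub> y = y" "bs 3 1 \<odot>\<^bsub>E 1\<^esub> y = \<zero>\<^bsub>E 1\<^esub>"
    unfolding y_def act_d0[OF bs_closed z(1)] z(2,3) by (fact d0[OF z(1)] refl dw)+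
  \<comment> \<open>Since \<open>bs 3 1\<close> annihilates \<open>y\<close>, the map from P(3)
    factors through P(3)/P(1), which has the vertices 2 and 3 and is a submodule of P(7).\<close>
  let ?W = "{(0::nat, 2::nat), (0, 3)}"
  have W: "thin_ok ?W"
    unfolding thin_ok_def
  proof (intro conjI allI impI)
    fix n i j k
    assume a: "(n, i) \<in> ?W" "(n, k) \<in> ?W" and ij: "(i, j) \<in> SB" and jk: "(j, k) \<in> SB"
    from a have n: "n = 0" and ik: "i = 2 \<or> i = 3" "k = 2 \<or> k = 3" by auto
    have j: "j = 2 \<or> j = 3" and "(i, k) \<in> SB"
    proof -
      note m = mem_SB(2)[of j] mem_SB(2)[of k] mem_SB(3)[of j] mem_SB(3)[of k] mem_SB(1)[of k]
      have "j = 1 \<or> j = 2 \<or> j = 3" using ij ik(1) m(1,3) by meson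
      moreover have "j \<noteq> 1" using jk ik(2) m(5) by fastforce
      ultimately show "j = 2 \<or> j = 3" by blast
      show "(i, k) \<in> SB"
      proof (cases "i = 2")
        case True
        then have "j = 2" using ij m(1) by meson
        then have "k = 2" using jk m(2) by meson
        with True show ?thesis using m(2) by meson
      next
        case False
        then have "i = 3" using ik(1) by meson
        then show ?thesis using ik(2) m(4) by meson
      qed
    qed
    with j n show "(n, j) \<in> ?W \<longleftrightarrow> (i, k) \<in> SB" by blast
  qed auto
  obtain y1 where y1: "y1 \<in> carrier (E 1)" "bs 7 3 \<odot>\<^bsub>E 1\<^esub> y1 = y" "bs 7 7 \<odot>\<^bsub>E 1\<^esub> y1 = y1"
  proof (rule extend_from_row[OF inj y(1,2) W, of 7])
    fix t assume t: "t \<in> carrier B" "\<And>k. (0, k) \<in> ?W \<Longrightarrow> co t 3 k = 0"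
    have "row_elt 3 (co t 3) = bs 3 1 \<otimes> \<eta> (co t 3 1)"
    proof (rule co_eqI)
      fix i k assume ik: "(i, k) \<in> SB"
      have "co t 3 k = 0" if "i = 3" "k \<noteq> 1"
        using ik that mem_SB(3)[of k] t(2)[of k] by blast
      moreover have "(3, 1) \<in> SB" using mem_SB(3)[of 1] by blast
      ultimately show "co (row_elt 3 (co t 3)) i k = co (bs 3 1 \<otimes> \<eta> (co t 3 1)) i k"
        using ik by (auto simp: row_elt eta_closed eta_mult_right co_bs)
    qed (simp_all add: row_elt eta_closed)
    then show "row_elt 3 (co t 3) \<odot>\<^bsub>E 1\<^esub> y = \<zero>\<^bsub>E 1\<^esub>"
      by (simp only: E1.r_smult_assoc[OF bs_closed eta_closed y(1)] y(3) E1.smult_zero_right[OF eta_closed])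
  qed (use V mem_SB in \<open>auto simp: psum_def\<close>)
  \<comment> \<open>\<open>d 1\<close> kills \<open>y\<close>, and with it everything that
    \<open>y1\<close> generates away from the vertex 7.\<close>
  define s where "s = d 1 y1"
  have s: "s \<in> carrier (E 2)" using d1 y1 by (simp add: s_def)
  have s7: "bs 7 7 \<odot>\<^bsub>E 2\<^esub> s = s" unfolding s_def act_d1[OF bs_closed y1(1)] y1(3) ..
  have s3: "bs 7 3 \<odot>\<^bsub>E 2\<^esub> s = \<zero>\<^bsub>E 2\<^esub>"
  proof -
    have "y \<in> d 0 ` carrier (E 0)" unfolding y_def using z(1) by (rule imageI)
    then have "d 1 y = \<zero>\<^bsub>E 2\<^esub>" unfolding ex by (simp add: rmod_ker_def numeral_2_eq_2)
    then show ?thesis unfolding s_def act_d1[OF bs_closed y1(1)] y1(2) .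
  qed
  have s0: "s \<noteq> \<zero>\<^bsub>E 2\<^esub>"
  proof
    \<comment> \<open>If \<open>y1\<close> were a boundary of some \<open>k\<close>, subtracting the
      action of \<open>bs 7 3\<close> on \<open>k\<close> from \<open>z\<close> would give an
      element \<open>u t\<close>. It still yields \<open>w\<close> under \<open>bs 3 1\<close>, as
      (7,1) is not in the support. Then \<open>bs 1 1\<close> would be a left multiple of
      \<open>bs 3 1\<close>, which fails because (1,3) is not in the support.\<close>
    assume "s = \<zero>\<^bsub>E 2\<^esub>"
    then have "y1 \<in> d 0 ` carrier (E 0)" unfolding ex using y1(1) by (simp add: rmod_ker_def s_def numeral_2_eq_2)
    then obtain k where k: "k \<in> carrier (E 0)" "y1 = d 0 k" by auto
    have bk: "bs 7 3 \<odot>\<^bsub>E 0\<^esub> k \<in> carrier (E 0)" using k by (simp add: E0.r_smult_closed)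
    let ?t0 = "z \<ominus>\<^bsub>E 0\<^esub> bs 7 3 \<odot>\<^bsub>E 0\<^esub> k"
    have t0: "?t0 \<in> carrier (E 0)" using z bk by simp
    have "d 0 ?t0 = d 0 z \<ominus>\<^bsub>E (Suc 0)\<^esub> d 0 (bs 7 3 \<odot>\<^bsub>E 0\<^esub> k)" by (rule rmod_hom_diff[OF r r d z(1) bk])
    also have "d 0 (bs 7 3 \<odot>\<^bsub>E 0\<^esub> k) = y"
      using y1(2) unfolding k(2) act_d0[OF bs_closed k(1)] .
    also have "d 0 z \<ominus>\<^bsub>E (Suc 0)\<^esub> y = y \<ominus>\<^bsub>E 1\<^esub> y" by (simp add: y_def)
    also have "\<dots> = \<zero>\<^bsub>E 1\<^esub>" unfolding a_minus_def by (rule E1.M.r_neg[OF y(1)])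
    finally have "?t0 \<in> u ` carrier ?M" unfolding ex0 using t0 by (simp add: rmod_ker_def)
    then obtain t where t: "t \<in> carrier B" "?t0 = u t" by (auto simp: M)
    have b0: "bs 7 3 \<otimes> bs 3 1 = \<zero>"
      by (rule co_eqI) (use mem_SB(4)[of 1] in \<open>auto simp: co_bs_mult co_bs co_zero\<close>)
    have "bs 3 1 \<odot>\<^bsub>E 0\<^esub> ?t0 = bs 3 1 \<odot>\<^bsub>E 0\<^esub> z \<ominus>\<^bsub>E 0\<^esub> bs 3 1 \<odot>\<^bsub>E 0\<^esub> (bs 7 3 \<odot>\<^bsub>E 0\<^esub> k)"
      using z(1) bk by (simp add: a_minus_def E0.r_smult_module_distr E0.smult_minus_right)
    also have "\<dots> = w"
      using k b0 w z(2) by (simp add: E0.r_smult_assoc[symmetric] E0.smult_zero_left a_minus_def)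
    finally have "u (t \<otimes> bs 3 1) = u (bs 1 1)" using t by (simp add: act_u w_def)
    then have eq: "t \<otimes> bs 3 1 = bs 1 1" using u(2) t by (auto simp: M inj_on_def)
    have "co (t \<otimes> bs 3 1) 1 1 = 0"
      using co_mult_bs[OF t(1), of 3 1 1 1] co_supp[OF t(1), of 1 3] mem_SB(1)[of 3] by simp
    then show False unfolding eq using mem_SB(1)[of 1] by (simp add: co_bs)
  qed
  have sc: "t \<odot>\<^bsub>E 2\<^esub> s = \<eta> (co t 7 7) \<odot>\<^bsub>E 2\<^esub> s" if t: "t \<in> carrier B" for t
  proof -
    \<comment> \<open>As (3,2) is in the support, row 7 off the diagonal factors through
      \<open>bs 7 3\<close>, which annihilates \<open>s\<close>.\<close>
    let ?q = "row_elt 3 (co t 7)"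
    have "bs 7 7 \<otimes> t = bs 7 7 \<otimes> \<eta> (co t 7 7) \<oplus> bs 7 3 \<otimes> ?q"
    proof (rule co_eqI)
      fix i k assume ik: "(i, k) \<in> SB"
      have "(3, k) \<in> SB" if "i = 7" "k \<noteq> 7"
        using ik that mem_SB(4)[of k] mem_SB(3)[of k] by blast
      moreover have "(7, 7) \<in> SB" "(7, 3) \<in> SB" "(3, 7) \<notin> SB"
        using mem_SB(4)[of 7] mem_SB(4)[of 3] mem_SB(3)[of 7] by (blast, blast, simp)
      ultimately show "co (bs 7 7 \<otimes> t) i k = co (bs 7 7 \<otimes> \<eta> (co t 7 7) \<oplus> bs 7 3 \<otimes> ?q) i k"
        using ik t by (auto simp: co_add co_bs_mult eta_closed eta_mult_right co_bs row_elt)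
    qed (use t in \<open>simp_all add: eta_closed row_elt\<close>)
    then have "(bs 7 7 \<otimes> t) \<odot>\<^bsub>E 2\<^esub> s = \<eta> (co t 7 7) \<odot>\<^bsub>E 2\<^esub> s"
      using s s3 s7 E2.sc_closed by (simp add: E2.r_smult_ring_distr eta_closed row_elt E2.r_smult_assoc E2.smult_zero_right)
    then show ?thesis using s s7 t by (simp add: E2.r_smult_assoc)
  qed
  show thesis
    by (rule that[of s]) (unfold socle_at_def, intro conjI ballI s s0 sc V, simp_all)
qed

theorem not_diagonal_Auslander_regular: "\<not> diagonal_Auslander_regular \<eta> B"
proof
  assume "diagonal_Auslander_regular \<eta> B"
  then obtain E d u where E: "minimal_injective_coresolution B (regular_right_module B) E d u"
    and pd: "\<And>i X. indecomposable_summand B (E i) X \<Longrightarrow> projdim B ((E i)\<lparr>carrier := X\<rparr>) = enat i"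
    unfolding diagonal_Auslander_regular_def by blast
  have inj: "injective_rmod B (E 2)" using E unfolding minimal_injective_coresolution_def by (elim conjE allE)
  note r = injective_rmodD(2)[OF inj]
  obtain s where s: "socle_at (E 2) 7 s" using socle_in_second_term[OF E] by blast
  show False
  proof (rule socle_splits[OF inj s])
    fix j :: "(nat \<Rightarrow> nat \<Rightarrow> 'k) \<Rightarrow> (nat \<Rightarrow> 'a) set" and Y
    let ?I = "thin (isum [7])"
    let ?X = "j ` carrier ?I"
    let ?E = "(E 2)\<lparr>carrier := ?X\<rparr>"
    assume j: "j \<in> rmod_hom B ?I (E 2)" "inj_on j (carrier ?I)" and dec: "direct_decomposition B (E 2) ?X Y"
    have I: "right_module B ?I" by (rule thin_right_module[OF thin_ok_isum])
    have X: "right_module B ?E"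
      using dec by (intro submodule_right_module[OF r]) (simp add: direct_decomposition_def)
    have jX: "j \<in> rmod_hom B ?I ?E" using j(1) by (auto simp: rmod_hom_def)
    have "indecomposable B ?E" by (rule isum_indecomposable[OF _ X jX j(2)]) simp_all
    then have "indecomposable_summand B (E 2) ?X" using dec unfolding indecomposable_summand_def by blast
    then have "projdim B ?E = enat 2" by (rule pd)
    moreover have "projdim B ?E \<le> enat 1"
    proof (rule projdim_leI, rule projdim_le_iso[OF I X jX])
      show "bij_betw j (carrier ?I) (carrier ?E)" using j(2) by (simp add: bij_betw_def)
      show "projdim_le B 1 ?I" using resolution_check_sound[OF refl cols_bound opposite_resolution_7] by simp
    qed
    ultimately show False by simp
  qed
qed

end

section \<open>The example\<close>

text \<open>The list on the right makes the relation a finite set that \<open>code_simp\<close> can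
  compare with \<open>ex_pairs\<close>.\<close>

lemma relation_of_lists:
  "i < length xs \<and> k \<in> set (xs ! i) \<longleftrightarrow> (i, k) \<in> set (concat (map (\<lambda>i. map (Pair i) (xs ! i)) [0..<length xs]))"
  by auto

lemma ex_rows_iff: "i < length ex_rows \<and> k \<in> set (ex_rows ! i) \<longleftrightarrow> (i, k) \<in> ex_pairs"
proof -
  have "set (concat (map (\<lambda>i. map (Pair i) (ex_rows ! i)) [0..<length ex_rows])) = ex_pairs" by code_simp
  then show ?thesis unfolding relation_of_lists by simp
qed

lemma ex_cols_iff: "i < length ex_cols \<and> k \<in> set (ex_cols ! i) \<longleftrightarrow> (k, i) \<in> ex_pairs"
proof -
  have "set (concat (map (\<lambda>i. map (Pair i) (ex_cols ! i)) [0..<length ex_cols])) = prod.swap ` ex_pairs" by code_simp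
  then show ?thesis unfolding relation_of_lists by force
qed

lemma ex_pairs_order:
  "ex_pairs \<subseteq> {1..9} \<times> {1..9}" "v \<in> {1..9} \<Longrightarrow> (v, v) \<in> ex_pairs" "(i, k) \<in> ex_pairs \<Longrightarrow> i \<le> k"
proof -
  have "\<forall>x\<in>ex_pairs. 1 \<le> fst x \<and> fst x \<le> snd x \<and> snd x \<le> 9" by code_simp
  then show "ex_pairs \<subseteq> {1..9} \<times> {1..9}" "(i, k) \<in> ex_pairs \<Longrightarrow> i \<le> k" by fastforce+
  have "\<forall>v\<in>{1,2,3,4,5,6,7,8,9}. (v, v) \<in> ex_pairs" by code_simp
  then show "v \<in> {1..9} \<Longrightarrow> (v, v) \<in> ex_pairs" unfolding ex_vertices by blast
qed

text \<open>If (i,l) survives, convexity applies to the paths through j and k, so both sides of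
  \<open>S_assoc\<close> are true. The composites are first shown to be reachable, as convexity asks
  for no more.\<close>

lemma ex_pairs_assoc:
  assumes "(i, j) \<in> ex_pairs" "(j, k) \<in> ex_pairs" "(k, l) \<in> ex_pairs" "(i, l) \<in> ex_pairs"
  shows "(i, k) \<in> ex_pairs \<and> (j, l) \<in> ex_pairs"
proof -
  have "\<forall>x\<in>ex_pairs. \<forall>y\<in>ex_pairs. snd x = fst y \<longrightarrow> (fst x, snd y) \<in> ex_reachable" by code_simp
  then have reach: "(x, z) \<in> ex_reachable" if "(x, y) \<in> ex_pairs" "(y, z) \<in> ex_pairs" for x y z
    using that by fastforce
  have sub: "(x, y) \<in> ex_reachable" if "(x, y) \<in> ex_pairs" for x y using that by (simp add: ex_reachable_def)
  show ?thesis
    using ex_pairs_convex[OF assms(4) reach[OF assms(1,2)] sub[OF assms(3)]]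
      ex_pairs_convex[OF assms(4) sub[OF assms(1)] reach[OF assms(2,3)]] by blast
qed

lemma coord_algebra_ex: "coord_algebra ex_algebra ex_unit_map {1..9} ex_pairs ex_coord"
proof (intro coord_algebra.intro coord_algebra_axioms.intro EA.ring_axioms)
  fix i k :: nat
  assume "(i, k) \<in> ex_pairs" "(k, i) \<in> ex_pairs"
  from ex_pairs_order(3)[OF this(1)] ex_pairs_order(3)[OF this(2)] show "i = k" by simp
next
  fix i j k l :: nat
  assume "(i, j) \<in> ex_pairs" "(j, k) \<in> ex_pairs" "(k, l) \<in> ex_pairs" "(i, l) \<in> ex_pairs"
  from ex_pairs_assoc[OF this] show "(i, k) \<in> ex_pairs \<longleftrightarrow> (j, l) \<in> ex_pairs" by simp
qed (fact finite_atLeastAtMost ex_pairs_order ex_coord_inj ex_coord_surj ex_coord_supp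
  ex_coord_add ex_coord_mult ex_coord_unit ex_unit_map_one)+

lemma (in ring) opposite_ring: "ring (opposite_ring R)"
proof (rule ringI)
  have add: "add_monoid (opposite_ring R) = add_monoid R" by (simp add: opposite_ring_def)
  show "abelian_group (opposite_ring R)"
    using abelian_group_axioms unfolding abelian_group_def abelian_monoid_def abelian_group_axioms_def add .
  show "monoid (opposite_ring R)"
    by (rule monoidI) (auto simp: opposite_ring_def m_assoc)
qed (auto simp: opposite_ring_def l_distr r_distr)

text \<open>Transposing the coordinates reverses products, and \<open>S_assoc\<close> is invariant
  under reversal.\<close>

lemma (in coord_algebra) opposite: "coord_algebra (opposite_ring B) \<eta> V (S\<inverse>) (\<lambda>r i k. co r k i)"
proof (intro coord_algebra.intro coord_algebra_axioms.intro opposite_ring)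
  have op: "carrier (opposite_ring B) = carrier B" "ring.add (opposite_ring B) = ring.add B"
    "monoid.one (opposite_ring B) = monoid.one B" "\<And>x y. x \<otimes>\<^bsub>opposite_ring B\<^esub> y = y \<otimes> x"
    by (simp_all add: opposite_ring_def)
  {
    fix m :: "nat \<Rightarrow> nat \<Rightarrow> 'k"
    assume "\<And>i k. (i, k) \<notin> S\<inverse> \<Longrightarrow> m i k = 0"
    then obtain r where r: "r \<in> carrier B" "co r = (\<lambda>i k. m k i)" using co_surj[of "\<lambda>i k. m k i"] by auto
    then show "\<exists>r\<in>carrier (opposite_ring B). (\<lambda>i k. co r k i) = m" by (intro bexI[of _ r]) (simp_all add: op)
  next
    fix r s assume "r \<in> carrier (opposite_ring B)" "s \<in> carrier (opposite_ring B)"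
      and eq: "(\<lambda>i k. co r k i) = (\<lambda>i k. co s k i)"
    then show "r = s" using fun_cong[OF fun_cong[OF eq]] by (intro co_inj) (auto simp: op)
  next
    fix r s i k assume "r \<in> carrier (opposite_ring B)" "s \<in> carrier (opposite_ring B)" "(i, k) \<in> S\<inverse>"
    then show "co (r \<otimes>\<^bsub>opposite_ring B\<^esub> s) k i = (\<Sum>j\<in>V. co r j i * co s k j)"
      using co_mult[of s r k i] by (simp add: op mult.commute)
  next
    fix i j k l assume "(i, j) \<in> S\<inverse>" "(j, k) \<in> S\<inverse>" "(k, l) \<in> S\<inverse>" "(i, l) \<in> S\<inverse>"
    then show "(i, k) \<in> S\<inverse> \<longleftrightarrow> (j, l) \<in> S\<inverse>" using S_assoc[of l k j i] by auto
  next
    fix i k assume "(i, k) \<in> S\<inverse>" "(k, i) \<in> S\<inverse>"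
    then show "i = k" using S_antisym by auto
  }
  show "S\<inverse> \<subseteq> V \<times> V" using S_subset by auto
qed (auto simp: opposite_ring_def finite_V S_refl co_supp co_add eta_closed eta_one co_eta)

text \<open>The middle conjunct excludes that regularity of the opposite algebra fails merely
  because of the first clause of its definition.\<close>

theorem proposition3p8:
  shows "diagonal_Auslander_regular (ex_unit_map :: 'k::field_char_0 \<Rightarrow> _) ex_algebra \<and>
    fd_algebra (ex_unit_map :: 'k \<Rightarrow> _) (opposite_ring ex_algebra) \<and>
    \<not> diagonal_Auslander_regular (ex_unit_map :: 'k \<Rightarrow> _) (opposite_ring ex_algebra)"
proof -
  interpret A: ex_coord_algebra ex_algebra "ex_unit_map :: 'k \<Rightarrow> _" ex_coord
    using coord_algebra_ex unfolding ex_coord_algebra_def ex_rows_iff by simp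
  interpret O: ex_op_coord_algebra "opposite_ring ex_algebra" "ex_unit_map :: 'k \<Rightarrow> _" "\<lambda>r i k. ex_coord r k i"
    using coord_algebra.opposite[OF coord_algebra_ex]
    unfolding ex_op_coord_algebra_def ex_cols_iff converse_unfold .
  show ?thesis using A.diagonal_Auslander_regular O.fd_algebra O.not_diagonal_Auslander_regular by blast
qed

end
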